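(* Let $f:[0,\infty)\to[0,\infty)$ be non-decreasing and continuous, $q\in(1,\infty)$, $\alpha\in(1,2]$. Then the problem $u_t=\Delta^{\alpha/2}u+f(u)$ in $B_R$, $u(0)=u_0$, with Dirichlet boundary condition, has the local existence property in $L^q(B_R)$ if and only if $$\limsup_{s\to\infty}s^{-(1+\alpha q/d)}f(s)<\infty.$$
   Context: $B_R=B_R(0)\subset\mathbb{R}^d$ is the open ball of radius $R$. $\Delta^{\alpha/2}=-(-\Delta)^{\alpha/2}$ is the fractional Laplacian. $S_\alpha(t)$ is the Dirichlet fractional heat semigroup on $B_R$: $(S_\alpha(t)u_0)(x)=\int_{B_R}p_D(t,x,y)u_0(y)dy$, with $p_D$ the Dirichlet heat kernel of $\Delta^{\alpha/2}$ on $B_R$. A local integral solution on $[0,T)$ is a measurable, a.e. finite $u:B_R\times[0,T)\to[0,\infty)$ with $u(t)=S_\alpha(t)u_0+\int_0^tS_\alpha(t-s)f(u(s))ds$ a.e. A local $L^q$ solution is a local integral solution on $[0,T)$ for some $T>0$ with $u\in L^\infty((0,T);L^q(B_R))$. The problem has the local existence property in $L^q(B_R)$ if for every non-negative $u_0\in L^q(B_R)$ there is a local $L^q$ solution. *)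

theory Defs
  imports "HOL-Analysis.Analysis"
begin

definition fourier :: "(real^'n \<Rightarrow> real) \<Rightarrow> real^'n \<Rightarrow> complex" where
  "fourier u \<xi> = (\<integral>x. cis (- (x \<bullet> \<xi>)) * complex_of_real (u x) \<partial>lborel)"

text \<open>Form domain of the Dirichlet fractional Laplacian on B_R: functions in L^2(R^d)
  vanishing outside B_R with finite energy int |xi|^alpha |hat u|^2.
  (For alpha = 2 this is H^1_0(B_R).)\<close>
definition frac_domain :: "real \<Rightarrow> real \<Rightarrow> (real^'n \<Rightarrow> real) \<Rightarrow> bool" where
  "frac_domain \<alpha> R u \<longleftrightarrow>
     u \<in> borel_measurable lborel \<and>
     (\<forall>x. x \<notin> ball 0 R \<longrightarrow> u x = 0) \<and>
     integrable lborel (\<lambda>x. (u x)\<^sup>2) \<and>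
     integrable lborel (\<lambda>\<xi>. norm \<xi> powr \<alpha> * (cmod (fourier u \<xi>))\<^sup>2)"

definition frac_form :: "real \<Rightarrow> (real^'n \<Rightarrow> real) \<Rightarrow> (real^'n \<Rightarrow> real) \<Rightarrow> real" where
  "frac_form \<alpha> u v = (2 * pi) powr (- real CARD('n)) *
     (\<integral>\<xi>. norm \<xi> powr \<alpha> * Re (fourier u \<xi> * cnj (fourier v \<xi>)) \<partial>lborel)"

definition dirichlet_eigensystem ::
  "real \<Rightarrow> real \<Rightarrow> (nat \<Rightarrow> real) \<Rightarrow> (nat \<Rightarrow> real^'n \<Rightarrow> real) \<Rightarrow> bool" where
  "dirichlet_eigensystem \<alpha> R lam \<phi> \<longleftrightarrow>
     (\<forall>k. frac_domain \<alpha> R (\<phi> k)) \<and>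
     (\<forall>k j. (\<integral>x. \<phi> k x * \<phi> j x \<partial>lborel) = (if k = j then 1 else 0)) \<and>
     (\<forall>k v. frac_domain \<alpha> R v \<longrightarrow>
        frac_form \<alpha> (\<phi> k) v = lam k * (\<integral>x. \<phi> k x * v x \<partial>lborel)) \<and>
     (\<forall>g. g \<in> borel_measurable lborel \<longrightarrow> (\<forall>x. x \<notin> ball 0 R \<longrightarrow> g x = 0) \<longrightarrow>
        integrable lborel (\<lambda>x. (g x)\<^sup>2) \<longrightarrow>
        (\<lambda>k. (\<integral>x. g x * \<phi> k x \<partial>lborel)\<^sup>2) sums (\<integral>x. (g x)\<^sup>2 \<partial>lborel))"

definition dirichlet_heat_kernel ::
  "(nat \<Rightarrow> real) \<Rightarrow> (nat \<Rightarrow> real^'n \<Rightarrow> real) \<Rightarrow> real \<Rightarrow> real^'n \<Rightarrow> real^'n \<Rightarrow> real" where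
  "dirichlet_heat_kernel lam \<phi> t x y = (\<Sum>k. exp (- lam k * t) * \<phi> k x * \<phi> k y)"

text \<open>(S(t) v)(x) = int_{B_R} p_D(t,x,y) v(y) dy, for non-negative v (value in [0,\<infinity>]).\<close>
definition dirichlet_semigroup ::
  "real \<Rightarrow> (nat \<Rightarrow> real) \<Rightarrow> (nat \<Rightarrow> real^'n \<Rightarrow> real) \<Rightarrow> real \<Rightarrow> (real^'n \<Rightarrow> real) \<Rightarrow> real^'n \<Rightarrow> ennreal" where
  "dirichlet_semigroup R lam \<phi> t v x =
     (\<integral>\<^sup>+ y \<in> ball 0 R. ennreal (dirichlet_heat_kernel lam \<phi> t x y) * ennreal (v y) \<partial>lborel)"

definition local_integral_solution ::
  "real \<Rightarrow> (nat \<Rightarrow> real) \<Rightarrow> (nat \<Rightarrow> real^'n \<Rightarrow> real) \<Rightarrow> (real \<Rightarrow> real) \<Rightarrow>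
   (real^'n \<Rightarrow> real) \<Rightarrow> real \<Rightarrow> (real^'n \<Rightarrow> real \<Rightarrow> real) \<Rightarrow> bool" where
  "local_integral_solution R lam \<phi> f u0 T u \<longleftrightarrow>
     (\<lambda>z. u (fst z) (snd z)) \<in> borel_measurable (lborel \<Otimes>\<^sub>M lborel) \<and>
     (\<forall>x t. 0 \<le> u x t) \<and>
     (AE z in lborel \<Otimes>\<^sub>M lborel. fst z \<in> ball 0 R \<and> 0 < snd z \<and> snd z < T \<longrightarrow>
        ennreal (u (fst z) (snd z)) =
          dirichlet_semigroup R lam \<phi> (snd z) u0 (fst z) +
          (\<integral>\<^sup>+ s \<in> {0<..<snd z}.
             dirichlet_semigroup R lam \<phi> (snd z - s) (\<lambda>y. f (u y s)) (fst z) \<partial>lborel))"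

definition Linf_Lq :: "real \<Rightarrow> real \<Rightarrow> real \<Rightarrow> (real^'n \<Rightarrow> real \<Rightarrow> real) \<Rightarrow> bool" where
  "Linf_Lq R q T u \<longleftrightarrow>
     (\<exists>C::real. AE t in lborel. 0 < t \<and> t < T \<longrightarrow>
        (\<integral>\<^sup>+ x \<in> ball 0 R. ennreal (\<bar>u x t\<bar> powr q) \<partial>lborel) \<le> ennreal C)"

definition local_existence_Lq ::
  "real \<Rightarrow> (nat \<Rightarrow> real) \<Rightarrow> (nat \<Rightarrow> real^'n \<Rightarrow> real) \<Rightarrow> (real \<Rightarrow> real) \<Rightarrow> real \<Rightarrow> bool" where
  "local_existence_Lq R lam \<phi> f q \<longleftrightarrow>
     (\<forall>u0::real^'n \<Rightarrow> real. u0 \<in> borel_measurable lborel \<longrightarrow> (\<forall>x. 0 \<le> u0 x) \<longrightarrow>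
        (\<integral>\<^sup>+ x \<in> ball 0 R. ennreal (\<bar>u0 x\<bar> powr q) \<partial>lborel) < \<infinity> \<longrightarrow>
        (\<exists>T>0. \<exists>u. local_integral_solution R lam \<phi> f u0 T u \<and> Linf_Lq R q T u))"

end

theory Submission
  imports Defs "HOL-Probability.Characteristic_Functions"
begin

text \<open>
  Everything about the semigroup is drawn from its quadratic form
  $(2\pi)^{-d} \int |\xi|^\alpha |\widehat u(\xi)|^2 d\xi$. Since $|\xi|^\alpha$ is a mixture of the symbols
  $1 - e^{-s|\xi|^2}$ (a limit of them if $\alpha = 2$), the form decreases under normal contractions,
  hence the semigroup is sub-Markov. Splitting Fourier integrals at a suitable radius gives Nash's
  inequality and with it a kernel bound of order $t^{-d/\alpha}$.

  Sufficiency: with $p = 1 + \alpha q/d$, Picard iteration from zero is monotone, and it stays bounded in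
  $\sup_t t^\beta \|u(t)\|_{L^r}$ for some $r > p$, $r > q$ and $\beta = (d/\alpha)(1/q - 1/r)$. The exponent $p$
  is critical, so this needs the linear part to be small in that norm for short times, which holds by
  density of bounded functions.

  Necessity: extended by zero, the ground state of a smaller ball $B_r$ is a subsolution in $B_R$, so
  on a set of measure of order $r^d$ the solution starting from $1_{B_r}$ stays of order one until
  time $r^\alpha$. If $f(s_k) s_k^{-p}$ is unbounded, take $u_0 = \sup_k a_k 1_{B_{r_k}}$ with $a_k$ of order $s_k$
  and $r_k^d = 2^{-k} s_k^{-q}$. Then the source alone forces the mean of $u$ over $B_{r_k}$ at time
  $r_k^\alpha$ above every bound compatible with $u(t)$ in $L^q$.
\<close>

section \<open>Gaussian means in Fourier space\<close>

text \<open>The eigensystem is the only access to the semigroup. Its eigenfunctions are fixed up to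
  null sets, and \<open>dirichlet_heat_kernel\<close> is a pointwise series with an unspecified
  value where it diverges. So the kernel is controlled almost everywhere only: a trace bound gives
  convergence off a null set, and sign and size are read off from integrals over boxes, which the
  spectral expansion evaluates. The Picard iterates live in [0,\<infinity>], where monotone limits
  always exist; finiteness is deduced afterwards from the bounds.

  Criticality shows in the exponents: with \<sigma> = d/\<alpha>, smoothing from L^(r/p) to L^r
  costs t^(-q/r), and the time integral returns exactly t^(-\<beta>), so no positive power of t is
  left to make the nonlinear term small.

  In the necessity part the equation holds only for almost every (x,t), so u(t) is tested against a
  weight at almost every time. One ground state, dilated, serves all small balls: its eigenvalue
  scales like r^(-\<alpha>), so up to time r^\<alpha> its decay is bounded independently of
  r.\<close>

lemma cis_measurable[measurable]: "cis \<in> borel_measurable borel"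
  by (intro borel_measurable_continuous_onI continuous_on_cis continuous_intros)

lemma cnj_measurable[measurable]: "cnj \<in> borel_measurable borel"
  by (intro borel_measurable_continuous_onI continuous_intros)

text \<open>The characteristic function of the standard normal law, after the substitution x to
  \<open>sqrt (2 * s)\<close> x.\<close>

lemma gauss_cis_1d:
  fixes s z :: real
  assumes s: "s > 0"
  shows "has_bochner_integral lborel (\<lambda>x. complex_of_real (exp (- s * x\<^sup>2)) * cis (z * x))
           (complex_of_real (sqrt (pi / s) * exp (- z\<^sup>2 / (4 * s))))"
proof -
  define c where "c = sqrt (2 * s)"
  have c: "c > 0" "c\<^sup>2 = 2 * s" using s by (auto simp: c_def)
  define g where "g = (\<lambda>x::real. std_normal_density x *\<^sub>R iexp ((z / c) * x))"
  have int_g: "integrable lborel g"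
  proof (rule Bochner_Integration.integrable_bound)
    show "integrable lborel std_normal_density" by simp
  qed (auto simp: g_def normal_density_nonneg)
  have "char std_normal_distribution (z / c) = (\<integral>x. g x \<partial>lborel)"
    unfolding char_def g_def by (subst integral_density) (auto simp: normal_density_nonneg)
  then have "has_bochner_integral lborel g (complex_of_real (exp (- ((z / c)\<^sup>2) / 2)))"
    using int_g by (simp add: char_std_normal_distribution has_bochner_integral_iff)
  then have "has_bochner_integral lborel (\<lambda>x. g (0 + c * x)) (complex_of_real (exp (- ((z / c)\<^sup>2) / 2)) /\<^sub>R \<bar>c\<bar>)"
    by (rule lborel_has_bochner_integral_real_affine_iff[THEN iffD1, rotated]) (use c in auto)
  then have 1: "has_bochner_integral lborel (\<lambda>x. complex_of_real (sqrt (2 * pi)) * g (0 + c * x))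
     (complex_of_real (sqrt (2 * pi)) * (complex_of_real (exp (- ((z / c)\<^sup>2) / 2)) /\<^sub>R \<bar>c\<bar>))"
    by (rule has_bochner_integral_mult_right)
  have 2: "complex_of_real (sqrt (2 * pi)) * g (0 + c * x) = complex_of_real (exp (- s * x\<^sup>2)) * cis (z * x)" for x
  proof -
    have "z / c * (0 + c * x) = z * x" "(0 + c * x)\<^sup>2 = 2 * s * x\<^sup>2" using c by (auto simp: power_mult_distrib)
    moreover have "sqrt (2 * pi) * std_normal_density (0 + c * x) = exp (- (0 + c * x)\<^sup>2 / 2)"
      by (simp add: std_normal_density_def)
    ultimately show ?thesis
      by (simp only: g_def cis_conv_exp scaleR_conv_of_real mult.assoc[symmetric] of_real_mult[symmetric]) simp
  qed
  have 3: "sqrt (2 * pi) / c = sqrt (pi / s)"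
    using s by (simp add: c_def real_sqrt_mult real_sqrt_divide)
  have "z\<^sup>2 / c\<^sup>2 / 2 = z\<^sup>2 / (4 * s)" using c by (simp add: field_simps)
  then have 4: "complex_of_real (sqrt (2 * pi)) * (complex_of_real (exp (- ((z / c)\<^sup>2) / 2)) /\<^sub>R \<bar>c\<bar>)
      = complex_of_real (sqrt (pi / s) * exp (- z\<^sup>2 / (4 * s)))"
    using c by (simp add: 3[symmetric] power_divide scaleR_conv_of_real field_simps)
  show ?thesis using 1 unfolding 2 4 .
qed

lemma exp_norm_sq_eq_prod:
  fixes x :: "'a::euclidean_space"
  shows "exp (c * (norm x)\<^sup>2) = (\<Prod>b\<in>Basis. exp (c * (x \<bullet> b)\<^sup>2))"
  unfolding power2_norm_eq_inner euclidean_inner[of x x]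
  by (simp add: exp_sum[symmetric] sum_distrib_left power2_eq_square)

lemma cis_sum: "finite A \<Longrightarrow> cis (sum f A) = (\<Prod>i\<in>A. cis (f i))"
  by (induction A rule: finite_induct) (auto simp: cis_mult[symmetric])

text \<open>Gaussian and character both factor over the basis, so the integral is a product of
  one-dimensional ones.\<close>

lemma gauss_cis:
  fixes z :: "'a::euclidean_space"
  assumes s: "s > 0"
  shows "has_bochner_integral lborel (\<lambda>x. complex_of_real (exp (- s * (norm x)\<^sup>2)) * cis (z \<bullet> x))
           (complex_of_real (sqrt (pi / s) ^ DIM('a) * exp (- (norm z)\<^sup>2 / (4 * s))))"
proof -
  define f where "f = (\<lambda>(b::'a) (x::real). complex_of_real (exp (- s * x\<^sup>2)) * cis ((z \<bullet> b) * x))"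
  define v where "v = (\<lambda>b. complex_of_real (sqrt (pi / s) * exp (- (z \<bullet> b)\<^sup>2 / (4 * s))))"
  have f: "has_bochner_integral lborel (f b) (v b)" for b
    unfolding f_def v_def by (rule gauss_cis_1d[OF s])
  interpret P: product_sigma_finite "\<lambda>_::'a. lborel :: real measure" ..
  have "has_bochner_integral (\<Pi>\<^sub>M b\<in>(Basis::'a set). lborel) (\<lambda>x. \<Prod>b\<in>Basis. f b (x b)) (\<Prod>b\<in>Basis. v b)"
    using P.product_integral_prod[of Basis f] P.product_integrable_prod[of Basis f] f
    by (auto simp: has_bochner_integral_iff)
  then have 1: "has_bochner_integral (\<Pi>\<^sub>M b\<in>(Basis::'a set). lborel)
      (\<lambda>x. (\<lambda>y::'a. \<Prod>b\<in>Basis. f b (y \<bullet> b)) (\<Sum>b\<in>Basis. x b *\<^sub>R b)) (\<Prod>b\<in>Basis. v b)"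
    by (simp cong: prod.cong)
  have [measurable]: "f b \<in> borel_measurable borel" for b
    using f[of b] by (auto simp: has_bochner_integral_iff dest: borel_measurable_integrable)
  have meas: "(\<lambda>y::'a. \<Prod>b\<in>Basis. f b (y \<bullet> b)) \<in> borel_measurable borel" by measurable
  have T: "(\<lambda>x. \<Sum>b\<in>Basis. x b *\<^sub>R b) \<in> (\<Pi>\<^sub>M b\<in>(Basis::'a set). (lborel::real measure)) \<rightarrow>\<^sub>M borel"
    by measurable
  have 2: "has_bochner_integral lborel (\<lambda>y::'a. \<Prod>b\<in>Basis. f b (y \<bullet> b)) (\<Prod>b\<in>Basis. v b)"
    using 1 unfolding has_bochner_integral_iff
    by (subst (1 2) lborel_eq) (simp add: integral_distr[OF T meas] integrable_distr_eq[OF T meas])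
  have 3: "(\<Prod>b\<in>Basis. f b (y \<bullet> b)) = complex_of_real (exp (- s * (norm y)\<^sup>2)) * cis (z \<bullet> y)" for y
  proof -
    have "cis (z \<bullet> y) = (\<Prod>b\<in>Basis. cis ((z \<bullet> b) * (y \<bullet> b)))"
      unfolding euclidean_inner[of z y] by (simp add: cis_sum)
    then show ?thesis
      unfolding exp_norm_sq_eq_prod f_def by (simp add: prod.distrib)
  qed
  have 4: "(\<Prod>b\<in>Basis. v b) = complex_of_real (sqrt (pi / s) ^ DIM('a) * exp (- (norm z)\<^sup>2 / (4 * s)))"
    using exp_norm_sq_eq_prod[of "- 1 / (4 * s)" z] by (simp add: v_def prod.distrib)
  show ?thesis using 2 unfolding 3 4 .
qed

text \<open>The Fourier transform of exp(-s|x|^2). It is (2 pi)^d times the Gauss-Weierstrass kernel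
  at time s, so its total mass is (2 pi)^d rather than 1.\<close>

definition gauss :: "real \<Rightarrow> 'a::euclidean_space \<Rightarrow> real" where
  "gauss s z = sqrt (pi / s) ^ DIM('a) * exp (- (norm z)\<^sup>2 / (4 * s))"

lemma gauss_nonneg: "s > 0 \<Longrightarrow> 0 \<le> gauss s z"
  by (simp add: gauss_def)

lemma gauss_measurable[measurable]: "gauss s \<in> borel_measurable borel"
  unfolding gauss_def by measurable

lemma gauss_minus: "gauss s (x - y) = gauss s (y - x)"
  by (simp add: gauss_def norm_minus_commute)

lemma gauss_cos:
  fixes z :: "'a::euclidean_space"
  assumes "s > 0"
  shows "(\<integral>x. complex_of_real (exp (- s * (norm x)\<^sup>2)) * cis (z \<bullet> x) \<partial>lborel) = complex_of_real (gauss s z)"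
  using gauss_cis[OF assms, of z] by (simp add: has_bochner_integral_iff gauss_def)

lemma gauss_exp_integral:
  assumes s: "s > 0"
  shows "has_bochner_integral lborel (\<lambda>x::'a::euclidean_space. exp (- s * (norm x)\<^sup>2)) (sqrt (pi / s) ^ DIM('a))"
proof -
  have "has_bochner_integral lborel (\<lambda>x::'a. complex_of_real (exp (- s * (norm x)\<^sup>2))) (complex_of_real (sqrt (pi / s) ^ DIM('a)))"
    using gauss_cis[OF s, of "0::'a"] by simp
  from has_bochner_integral_Re[OF this] show ?thesis by simp
qed

lemma gauss_integral:
  assumes s: "s > 0"
  shows "has_bochner_integral lborel (gauss s :: 'a::euclidean_space \<Rightarrow> real) ((2 * pi) ^ DIM('a))"
proof -
  have "has_bochner_integral lborel (\<lambda>x::'a. sqrt (pi / s) ^ DIM('a) * exp (- (1 / (4 * s)) * (norm x)\<^sup>2))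
      (sqrt (pi / s) ^ DIM('a) * sqrt (pi / (1 / (4 * s))) ^ DIM('a))"
    by (intro has_bochner_integral_mult_right gauss_exp_integral) (use s in auto)
  moreover have "sqrt (pi / s) ^ DIM('a) * sqrt (pi / (1 / (4 * s))) ^ DIM('a) = (2 * pi) ^ DIM('a)"
  proof -
    have "sqrt (pi / s) * sqrt (pi / (1 / (4 * s))) = sqrt ((2 * pi)\<^sup>2)"
      unfolding real_sqrt_mult[symmetric] using s by (simp add: power2_eq_square)
    moreover have "sqrt ((2 * pi)\<^sup>2) = 2 * pi" by (simp only: real_sqrt_abs) simp
    ultimately show ?thesis unfolding power_mult_distrib[symmetric] by simp
  qed
  ultimately show ?thesis using s by (simp add: gauss_def[abs_def] field_simps)
qed

lemma nn_gauss_integral: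
  assumes s: "s > 0"
  shows "(\<integral>\<^sup>+x. ennreal (gauss s (x::'a::euclidean_space)) \<partial>lborel) = ennreal ((2 * pi) ^ DIM('a))"
  using gauss_integral[OF s, where 'a='a] gauss_nonneg[OF s]
  by (subst nn_integral_eq_integral) (auto simp: has_bochner_integral_iff)

lemma nn_gauss_integral_shift:
  assumes s: "s > 0"
  shows "(\<integral>\<^sup>+y. ennreal (gauss s (x - y::'a::euclidean_space)) \<partial>lborel) = ennreal ((2 * pi) ^ DIM('a))"
proof -
  have "(\<integral>\<^sup>+y. ennreal (gauss s (x - y::'a)) \<partial>lborel) = (\<integral>\<^sup>+y. ennreal (gauss s (- x + y)) \<partial>lborel)"
    by (subst gauss_minus) simp
  also have "\<dots> = (\<integral>\<^sup>+y. ennreal (gauss s y) \<partial>distr lborel borel ((+) (- x)))"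
    by (subst nn_integral_distr) auto
  also have "\<dots> = ennreal ((2 * pi) ^ DIM('a))"
    unfolding lborel_distr_plus by (rule nn_gauss_integral[OF s])
  finally show ?thesis .
qed

section \<open>The Fourier transform of integrable functions and its Gaussian means\<close>

lemma integrable_pair_mult:
  fixes f :: "'a::euclidean_space \<Rightarrow> real" and g :: "'b::euclidean_space \<Rightarrow> real"
  assumes f: "integrable lborel f" and g: "integrable lborel g"
  shows "integrable (lborel \<Otimes>\<^sub>M lborel) (\<lambda>z. f (fst z) * g (snd z))"
proof -
  have [measurable]: "f \<in> borel_measurable borel" "g \<in> borel_measurable borel"
    using f g by (auto dest: borel_measurable_integrable)
  have "integrable (lborel \<Otimes>\<^sub>M lborel) (\<lambda>(x, y). f x * g y)"
    by (rule lborel_pair.Fubini_integrable) (use f g in \<open>auto simp: abs_mult\<close>)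
  then show ?thesis by (simp add: case_prod_beta')
qed

lemma fourier_measurable:
  fixes u :: "real^'n \<Rightarrow> real"
  assumes [measurable]: "u \<in> borel_measurable borel"
  shows "fourier u \<in> borel_measurable borel"
proof -
  have "(\<lambda>\<xi>. (\<integral>x. cis (- (x \<bullet> \<xi>)) * complex_of_real (u x) \<partial>lborel)) \<in> borel_measurable borel"
    by (rule lborel.borel_measurable_lebesgue_integral) simp
  then show ?thesis by (simp add: fourier_def[abs_def])
qed

lemma fourier_integrand_integrable:
  fixes u :: "real^'n \<Rightarrow> real"
  assumes u: "integrable lborel u"
  shows "integrable lborel (\<lambda>x. cis (- (x \<bullet> \<xi>)) * complex_of_real (u x))"
proof -
  have [measurable]: "u \<in> borel_measurable borel" using u by (auto dest: borel_measurable_integrable)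
  show ?thesis
    by (rule Bochner_Integration.integrable_bound[OF u]) (auto simp: norm_mult)
qed

lemma fourier_bound:
  fixes u :: "real^'n \<Rightarrow> real"
  assumes u: "integrable lborel u"
  shows "cmod (fourier u \<xi>) \<le> (\<integral>x. \<bar>u x\<bar> \<partial>lborel)"
  unfolding fourier_def
  by (rule order.trans[OF integral_norm_bound]) (simp add: norm_mult)

lemma fourier_add:
  fixes u v :: "real^'n \<Rightarrow> real"
  assumes "integrable lborel u" "integrable lborel v"
  shows "fourier (\<lambda>x. u x + v x) \<xi> = fourier u \<xi> + fourier v \<xi>"
  using assms unfolding fourier_def
  by (subst Bochner_Integration.integral_add[symmetric])
    (auto intro!: fourier_integrand_integrable simp: ring_distribs)

lemma fourier_scale:
  fixes u :: "real^'n \<Rightarrow> real"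
  shows "fourier (\<lambda>x. c * u x) \<xi> = of_real c * fourier u \<xi>"
  unfolding fourier_def by (subst integral_mult_right_zero[symmetric]) (simp add: mult_ac)

text \<open>Write the squared modulus as a double integral in (x,y) and integrate over \<xi> before
  x and y. The Gaussian weight makes the triple integral absolutely convergent although u is merely
  integrable.\<close>

lemma gauss_fourier:
  fixes u :: "real^'n \<Rightarrow> real"
  assumes u: "integrable lborel u" and s: "s > 0"
  shows "(\<integral>\<xi>. exp (- s * (norm \<xi>)\<^sup>2) * (cmod (fourier u \<xi>))\<^sup>2 \<partial>lborel)
       = (\<integral>z. u (fst z) * u (snd z) * gauss s (fst z - snd z) \<partial>(lborel \<Otimes>\<^sub>M lborel))"
proof -
  have um[measurable]: "u \<in> borel_measurable borel" using u by (auto dest: borel_measurable_integrable)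
  let ?P = "lborel \<Otimes>\<^sub>M lborel :: ((real^'n) \<times> (real^'n)) measure"
  define U where "U = (\<lambda>z. u (fst z) * u (snd z))"
  have U: "integrable ?P U" unfolding U_def by (rule integrable_pair_mult[OF u u])
  then have [measurable]: "U \<in> borel_measurable ?P" by (auto dest: borel_measurable_integrable)
  have fm[measurable]: "fourier u \<in> borel_measurable borel" by (rule fourier_measurable) fact
  define H where "H = (\<lambda>(\<xi>::real^'n, z). complex_of_real (exp (- s * (norm \<xi>)\<^sup>2)) * cis ((fst z - snd z) \<bullet> \<xi>) * complex_of_real (U z))"
  interpret Q: pair_sigma_finite "lborel :: (real^'n) measure" ?P
    unfolding lborel_prod ..
  have Hm[measurable]: "H \<in> borel_measurable (lborel \<Otimes>\<^sub>M ?P)"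
    unfolding H_def by measurable
  have G: "integrable lborel (\<lambda>\<xi>::real^'n. exp (- s * (norm \<xi>)\<^sup>2))"
    using gauss_exp_integral[OF s] by (auto simp: has_bochner_integral_iff)
  have H: "integrable (lborel \<Otimes>\<^sub>M ?P) H"
  proof (rule Q.Fubini_integrable[OF Hm])
    show "integrable lborel (\<lambda>x. \<integral> y. norm (H (x, y)) \<partial>?P)"
      using G U by (simp add: H_def norm_mult)
    show "AE x in lborel. integrable ?P (\<lambda>y. H (x, y))"
    proof (rule AE_I2)
      fix \<xi> :: "real^'n"
      have "integrable ?P (\<lambda>z. exp (- s * (norm \<xi>)\<^sup>2) * U z)" using U by simp
      then show "integrable ?P (\<lambda>y. H (\<xi>, y))"
        by (rule Bochner_Integration.integrable_bound) (auto simp: H_def norm_mult abs_mult)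
    qed
  qed
  have inner1: "(\<integral>\<xi>. H (\<xi>, z) \<partial>lborel) = complex_of_real (U z * gauss s (fst z - snd z))" for z
    using gauss_cos[OF s, of "fst z - snd z"] by (simp add: H_def mult.commute)
  have inner2: "(\<integral>z. H (\<xi>, z) \<partial>?P) = complex_of_real (exp (- s * (norm \<xi>)\<^sup>2) * (cmod (fourier u \<xi>))\<^sup>2)" for \<xi>
  proof -
    define g where "g = (\<lambda>x. cis (- (x \<bullet> \<xi>)) * complex_of_real (u x))"
    have g: "integrable lborel g" unfolding g_def by (rule fourier_integrand_integrable[OF u])
    then have gm[measurable]: "g \<in> borel_measurable borel" by (auto dest: borel_measurable_integrable)
    have gg: "integrable ?P (\<lambda>z. cnj (g (fst z)) * g (snd z))"
    proof (rule Bochner_Integration.integrable_bound[OF U])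
      show "(\<lambda>z. cnj (g (fst z)) * g (snd z)) \<in> borel_measurable ?P"
        unfolding g_def by measurable
    qed (auto simp: g_def U_def norm_mult abs_mult)
    have "(\<integral>z. H (\<xi>, z) \<partial>?P) = complex_of_real (exp (- s * (norm \<xi>)\<^sup>2)) * (\<integral>z. cnj (g (fst z)) * g (snd z) \<partial>?P)"
    proof (subst integral_mult_right_zero[symmetric], rule Bochner_Integration.integral_cong[OF refl])
      fix z :: "(real^'n) \<times> (real^'n)"
      have "cis ((fst z - snd z) \<bullet> \<xi>) = cis (fst z \<bullet> \<xi>) * cis (- (snd z \<bullet> \<xi>))"
        by (simp add: cis_mult inner_diff_left)
      then show "H (\<xi>, z) = complex_of_real (exp (- s * (norm \<xi>)\<^sup>2)) * (cnj (g (fst z)) * g (snd z))"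
        by (simp add: H_def g_def U_def cis_cnj mult_ac)
    qed
    also have "(\<integral>z. cnj (g (fst z)) * g (snd z) \<partial>?P) = (\<integral>x. \<integral>y. cnj (g x) * g y \<partial>lborel \<partial>lborel)"
      using lborel_pair.integral_fst'[OF gg] by simp
    also have "\<dots> = cnj (fourier u \<xi>) * fourier u \<xi>"
      by (simp add: fourier_def g_def[symmetric])
    finally show ?thesis
      by (simp only: of_real_mult complex_norm_square) (simp add: mult_ac)
  qed
  have "complex_of_real (\<integral>\<xi>. exp (- s * (norm \<xi>)\<^sup>2) * (cmod (fourier u \<xi>))\<^sup>2 \<partial>lborel) = (\<integral>\<xi>. \<integral>z. H (\<xi>, z) \<partial>?P \<partial>lborel)"
    by (simp only: inner2 integral_complex_of_real)
  also have "\<dots> = (\<integral>z. \<integral>\<xi>. H (\<xi>, z) \<partial>lborel \<partial>?P)"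
    using Q.Fubini_integral[of "curry H"] H by simp
  also have "\<dots> = complex_of_real (\<integral>z. U z * gauss s (fst z - snd z) \<partial>?P)"
    by (simp only: inner1 integral_complex_of_real)
  finally show ?thesis unfolding U_def of_real_eq_iff .
qed

section \<open>Plancherel's identity on the ball\<close>

lemma nn_integral_fatou_le:
  fixes f :: "nat \<Rightarrow> 'a \<Rightarrow> real"
  assumes [measurable]: "\<And>n. f n \<in> borel_measurable M"
    and lim: "AE x in M. (\<lambda>n. f n x) \<longlonglongrightarrow> g x"
    and le: "\<And>n. (\<integral>\<^sup>+x. ennreal (f n x) \<partial>M) \<le> C"
  shows "(\<integral>\<^sup>+x. ennreal (g x) \<partial>M) \<le> C"
proof -
  have "(\<integral>\<^sup>+x. ennreal (g x) \<partial>M) = (\<integral>\<^sup>+x. liminf (\<lambda>n. ennreal (f n x)) \<partial>M)"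
  proof (rule nn_integral_cong_AE, use lim in eventually_elim)
    case (elim x)
    then have "(\<lambda>n. ennreal (f n x)) \<longlonglongrightarrow> ennreal (g x)" by (intro tendsto_ennrealI)
    then show ?case by (simp add: lim_imp_Liminf)
  qed
  also have "\<dots> \<le> liminf (\<lambda>n. \<integral>\<^sup>+x. ennreal (f n x) \<partial>M)"
    by (rule nn_integral_liminf) measurable
  also have "\<dots> \<le> liminf (\<lambda>n. C)"
    by (rule Liminf_mono) (simp add: le)
  also have "\<dots> = C" by (simp add: Liminf_const)
  finally show ?thesis .
qed

lemma integrable_nonneg_of_nn_le:
  assumes "f \<in> borel_measurable M" "\<And>x. 0 \<le> f x" "(\<integral>\<^sup>+x. ennreal (f x) \<partial>M) \<le> ennreal C" "0 \<le> C"
  shows "integrable M f" "(\<integral>x. f x \<partial>M) \<le> C"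
proof -
  have "(\<integral>\<^sup>+x. ennreal (norm (f x)) \<partial>M) < \<infinity>"
    using assms by (auto simp: abs_of_nonneg intro: le_less_trans)
  then show i: "integrable M f" using assms(1) by (auto simp: integrable_iff_bounded)
  show "(\<integral>x. f x \<partial>M) \<le> C"
    using assms nn_integral_eq_integral[OF i] by auto
qed

lemma lborel_integral_affine:
  fixes f :: "'a::euclidean_space \<Rightarrow> 'b::{banach, second_countable_topology}"
  assumes [measurable]: "f \<in> borel_measurable borel" and c: "c \<noteq> 0"
  shows "(\<integral>x. f x \<partial>lborel) = \<bar>c\<bar> ^ DIM('a) *\<^sub>R (\<integral>x. f (t + c *\<^sub>R x) \<partial>lborel)"
  by (subst lborel_affine[OF c, of t]) (simp add: integral_density integral_distr)

lemma lborel_nn_integral_affine: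
  fixes f :: "'a::euclidean_space \<Rightarrow> ennreal"
  assumes [measurable]: "f \<in> borel_measurable borel" and c: "c \<noteq> 0"
  shows "(\<integral>\<^sup>+x. f x \<partial>lborel) = ennreal (\<bar>c\<bar> ^ DIM('a)) * (\<integral>\<^sup>+x. f (t + c *\<^sub>R x) \<partial>lborel)"
  by (subst lborel_affine[OF c, of t])
    (simp add: nn_integral_density nn_integral_distr nn_integral_cmult)

lemma lborel_integrable_affine:
  fixes f :: "'a::euclidean_space \<Rightarrow> 'b::{banach, second_countable_topology}"
  assumes f: "integrable lborel f" and c: "c \<noteq> 0"
  shows "integrable lborel (\<lambda>x. f (t + c *\<^sub>R x))"
proof -
  have [measurable]: "f \<in> borel_measurable borel" using f by auto
  have "(\<integral>\<^sup>+x. ennreal (norm (f x)) \<partial>lborel) < \<infinity>" using f by (auto simp: integrable_iff_bounded)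
  then show ?thesis
    using lborel_nn_integral_affine[of "\<lambda>x. ennreal (norm (f x))" c t] c
    by (auto simp: integrable_iff_bounded ennreal_mult_less_top)
qed

text \<open>The functions vanish at every point outside the ball, as in \<open>frac_domain\<close>,
  and not just at almost every point. Their support has finite measure, so they are integrable and
  \<open>fourier\<close> is a convergent integral for them.\<close>

definition l2_ball :: "real \<Rightarrow> (real^'n \<Rightarrow> real) \<Rightarrow> bool" where
  "l2_ball R u \<longleftrightarrow> u \<in> borel_measurable lborel \<and> (\<forall>x. x \<notin> ball 0 R \<longrightarrow> u x = 0) \<and>
     integrable lborel (\<lambda>x. (u x)\<^sup>2)"

lemma l2_ball_meas: "l2_ball R u \<Longrightarrow> u \<in> borel_measurable borel"
  by (simp add: l2_ball_def)

lemma l2_ball_sq: "l2_ball R u \<Longrightarrow> integrable lborel (\<lambda>x. (u x)\<^sup>2)"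
  by (simp add: l2_ball_def)

lemma integrable_indicator_ball: "integrable lborel (indicator (ball 0 R :: (real^'n) set) :: _ \<Rightarrow> real)"
  by (intro integrable_real_indicator emeasure_bounded_finite bounded_ball) simp

lemma l2_ball_mult:
  assumes u: "l2_ball R u" and v: "l2_ball R v"
  shows "integrable lborel (\<lambda>x. u x * v x)"
proof (rule Bochner_Integration.integrable_bound)
  show "integrable lborel (\<lambda>x. (u x)\<^sup>2 + (v x)\<^sup>2)" using u v by (auto simp: l2_ball_def)
  show "(\<lambda>x. u x * v x) \<in> borel_measurable lborel" using u v by (auto simp: l2_ball_def)
  have "\<bar>u x * v x\<bar> \<le> (u x)\<^sup>2 + (v x)\<^sup>2" for x
    using sum_squares_bound[of "\<bar>u x\<bar>" "\<bar>v x\<bar>"] zero_le_power2[of "u x"] zero_le_power2[of "v x"]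
    unfolding abs_mult power2_abs by linarith
  then show "AE x in lborel. norm (u x * v x) \<le> norm ((u x)\<^sup>2 + (v x)\<^sup>2)" by auto
qed

lemma l2_ball_indicator: "A \<in> sets borel \<Longrightarrow> A \<subseteq> ball 0 R \<Longrightarrow> l2_ball R (indicator A)"
proof -
  assume A: "A \<in> sets borel" "A \<subseteq> ball 0 R"
  have "emeasure lborel A < \<infinity>"
    using A by (intro emeasure_bounded_finite bounded_subset[OF bounded_ball])
  then have "integrable lborel (indicator A :: _ \<Rightarrow> real)"
    using A by (intro integrable_real_indicator) auto
  moreover have "(\<lambda>x. (indicator A x :: real)\<^sup>2) = indicator A" by (auto simp: indicator_def)
  ultimately show ?thesis using A by (auto simp: l2_ball_def indicator_eq_0_iff)
qed

lemma l2_ball_integrable: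
  assumes u: "l2_ball R u"
  shows "integrable lborel u"
proof -
  have "integrable lborel (\<lambda>x. u x * indicator (ball 0 R) x)"
    by (rule l2_ball_mult[OF u l2_ball_indicator]) auto
  moreover have "u x * indicator (ball 0 R) x = u x" for x
    using u by (auto simp: l2_ball_def indicator_def)
  ultimately show ?thesis by simp
qed

lemma l2_ball_lincomb:
  assumes u: "l2_ball R u" and v: "l2_ball R v"
  shows "l2_ball R (\<lambda>x. a * u x + b * v x)"
proof -
  have "integrable lborel (\<lambda>x. a\<^sup>2 * (u x)\<^sup>2 + b\<^sup>2 * (v x)\<^sup>2 + 2 * a * b * (u x * v x))"
    using l2_ball_mult[OF u v] u v by (auto simp: l2_ball_def)
  then have "integrable lborel (\<lambda>x. (a * u x + b * v x)\<^sup>2)"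
    by (rule Bochner_Integration.integrable_cong[THEN iffD1, rotated 2])
      (auto simp: power2_eq_square algebra_simps)
  then show ?thesis using u v by (auto simp: l2_ball_def)
qed

lemma l2_ball_add: "l2_ball R u \<Longrightarrow> l2_ball R v \<Longrightarrow> l2_ball R (\<lambda>x. u x + v x)"
  using l2_ball_lincomb[of R u v 1 1] by simp

lemma l2_ball_diff: "l2_ball R u \<Longrightarrow> l2_ball R v \<Longrightarrow> l2_ball R (\<lambda>x. u x - v x)"
  using l2_ball_lincomb[of R u v 1 "-1"] by simp

lemma l2_ball_scale: "l2_ball R u \<Longrightarrow> l2_ball R (\<lambda>x. a * u x)"
  using l2_ball_lincomb[of R u u a 0] by simp

lemma l2_ball_dominated:
  assumes u: "l2_ball R u" and [measurable]: "v \<in> borel_measurable borel" and le: "\<And>x. \<bar>v x\<bar> \<le> \<bar>u x\<bar>"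
  shows "l2_ball R v"
proof -
  have "integrable lborel (\<lambda>x. (v x)\<^sup>2)"
    by (rule Bochner_Integration.integrable_bound[OF l2_ball_sq[OF u]])
      (use le in \<open>auto simp: abs_le_square_iff[symmetric]\<close>)
  moreover have "v x = 0" if "x \<notin> ball 0 R" for x using le[of x] that u by (auto simp: l2_ball_def)
  ultimately show ?thesis by (auto simp: l2_ball_def)
qed

lemma l2_ball_bounded:
  assumes [measurable]: "v \<in> borel_measurable borel" and le: "\<And>x. \<bar>v x\<bar> \<le> M" and "\<And>x. x \<notin> ball 0 R \<Longrightarrow> v x = 0"
  shows "l2_ball R v"
proof (rule l2_ball_dominated[OF l2_ball_scale[OF l2_ball_indicator[of "ball 0 R"]], of _ v M])
  show "\<bar>v x\<bar> \<le> \<bar>M * indicator (ball 0 R) x\<bar>" for x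
    using le[of x] assms(3)[of x] by (auto simp: indicator_def)
qed auto

text \<open>Polarization: 2 u(x) u(y) = u(x)^2 + u(y)^2 - (u(x) - u(y))^2, and each of the two
  squares integrates against \<open>gauss\<close> to (2 pi)^d times the squared norm. The remaining
  difference integral is non-negative, which yields Bessel's inequality, and it shrinks under
  contractions of u.\<close>

lemma gauss_fourier_defect:
  fixes u :: "real^'n \<Rightarrow> real"
  assumes u: "l2_ball R u" and s: "s > 0"
  shows "integrable (lborel \<Otimes>\<^sub>M lborel) (\<lambda>z. (u (fst z) - u (snd z))\<^sup>2 * gauss s (fst z - snd z))"
    and "(\<integral>\<xi>. exp (- s * (norm \<xi>)\<^sup>2) * (cmod (fourier u \<xi>))\<^sup>2 \<partial>lborel)
       = (2 * pi) ^ CARD('n) * (\<integral>x. (u x)\<^sup>2 \<partial>lborel)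
         - (\<integral>z. (u (fst z) - u (snd z))\<^sup>2 * gauss s (fst z - snd z) \<partial>(lborel \<Otimes>\<^sub>M lborel)) / 2"
proof -
  let ?P = "lborel \<Otimes>\<^sub>M lborel :: ((real^'n) \<times> (real^'n)) measure"
  have [measurable]: "u \<in> borel_measurable borel" using u by (rule l2_ball_meas)
  have gi: "integrable lborel (\<lambda>y::real^'n. gauss s (x - y))" "(\<integral>y. gauss s (x - y) \<partial>lborel) = (2 * pi) ^ CARD('n)" for x :: "real^'n"
    using nn_gauss_integral_shift[OF s, of x] gauss_nonneg[OF s, where 'a="real^'n"]
    by (auto simp: nn_integral_eq_integrable)
  define A where "A = (\<lambda>z::(real^'n)\<times>(real^'n). (u (fst z))\<^sup>2 * gauss s (fst z - snd z))"
  define B where "B = (\<lambda>z::(real^'n)\<times>(real^'n). (u (snd z))\<^sup>2 * gauss s (fst z - snd z))"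
  define C where "C = (\<lambda>z::(real^'n)\<times>(real^'n). u (fst z) * u (snd z) * gauss s (fst z - snd z))"
  have A: "integrable ?P A"
  proof (rule lborel_pair.Fubini_integrable)
    show "A \<in> borel_measurable ?P" unfolding A_def by measurable
    show "integrable lborel (\<lambda>x. \<integral> y. norm (A (x, y)) \<partial>lborel)"
      using gi gauss_nonneg[OF s, where 'a="real^'n"] l2_ball_sq[OF u] by (simp add: A_def)
    show "AE x in lborel. integrable lborel (\<lambda>y. A (x, y))"
      using gi by (simp add: A_def)
  qed
  have iA: "integral\<^sup>L ?P A = (2 * pi) ^ CARD('n) * (\<integral>x. (u x)\<^sup>2 \<partial>lborel)"
    using lborel_pair.integral_fst'[OF A] gi by (simp add: A_def mult.commute)
  have BA: "B = (\<lambda>(x, y). A (y, x))" by (auto simp: A_def B_def gauss_minus)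
  have Am: "A \<in> borel_measurable ?P" using A by auto
  have B: "integrable ?P B" unfolding BA by (rule lborel_pair.integrable_product_swap[OF A])
  have iB: "integral\<^sup>L ?P B = integral\<^sup>L ?P A"
    unfolding BA by (rule lborel_pair.integral_product_swap[OF Am])
  have C: "integrable ?P C"
  proof (rule Bochner_Integration.integrable_bound)
    show "integrable ?P (\<lambda>z. A z + B z)" using A B by auto
    show "C \<in> borel_measurable ?P" unfolding C_def by measurable
    have "\<bar>u x * u y\<bar> \<le> (u x)\<^sup>2 + (u y)\<^sup>2" for x y
      using sum_squares_bound[of "\<bar>u x\<bar>" "\<bar>u y\<bar>"] zero_le_power2[of "u x"] zero_le_power2[of "u y"]
      unfolding abs_mult power2_abs by linarith
    then have "\<bar>u x * u y\<bar> * gauss s (x - y) \<le> ((u x)\<^sup>2 + (u y)\<^sup>2) * gauss s (x - y)" for x y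
      using gauss_nonneg[OF s, of "x - y"] by (intro mult_right_mono)
    then show "AE z in ?P. norm (C z) \<le> norm (A z + B z)"
      using gauss_nonneg[OF s, where 'a="real^'n"] by (auto simp: A_def B_def C_def abs_mult ring_distribs)
  qed
  have eq: "(u (fst z) - u (snd z))\<^sup>2 * gauss s (fst z - snd z) = A z + B z - 2 * C z" for z
    by (simp add: A_def B_def C_def power2_eq_square algebra_simps)
  show "integrable ?P (\<lambda>z. (u (fst z) - u (snd z))\<^sup>2 * gauss s (fst z - snd z))"
    unfolding eq using A B C by auto
  have "(\<integral>z. (u (fst z) - u (snd z))\<^sup>2 * gauss s (fst z - snd z) \<partial>?P) = integral\<^sup>L ?P A + integral\<^sup>L ?P A - 2 * integral\<^sup>L ?P C"
    unfolding eq using A B C iB by auto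
  then show "(\<integral>\<xi>. exp (- s * (norm \<xi>)\<^sup>2) * (cmod (fourier u \<xi>))\<^sup>2 \<partial>lborel)
       = (2 * pi) ^ CARD('n) * (\<integral>x. (u x)\<^sup>2 \<partial>lborel)
         - (\<integral>z. (u (fst z) - u (snd z))\<^sup>2 * gauss s (fst z - snd z) \<partial>?P) / 2"
    unfolding gauss_fourier[OF l2_ball_integrable[OF u] s] iA C_def[symmetric]
    by (simp add: C_def[symmetric] field_simps)
qed

lemma integrable_exp_fourier:
  fixes u :: "real^'n \<Rightarrow> real"
  assumes u: "l2_ball R u" and s: "s > 0"
  shows "integrable lborel (\<lambda>\<xi>. exp (- s * (norm \<xi>)\<^sup>2) * (cmod (fourier u \<xi>))\<^sup>2)"
proof (rule Bochner_Integration.integrable_bound)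
  have [measurable]: "u \<in> borel_measurable borel" using u by (rule l2_ball_meas)
  have [measurable]: "fourier u \<in> borel_measurable borel" by (rule fourier_measurable) fact
  show "integrable lborel (\<lambda>\<xi>::real^'n. exp (- s * (norm \<xi>)\<^sup>2) * (\<integral>x. \<bar>u x\<bar> \<partial>lborel)\<^sup>2)"
    using gauss_exp_integral[OF s] by (auto simp: has_bochner_integral_iff)
  show "(\<lambda>\<xi>. exp (- s * (norm \<xi>)\<^sup>2) * (cmod (fourier u \<xi>))\<^sup>2) \<in> borel_measurable lborel"
    by measurable
  show "AE \<xi> in lborel. norm (exp (- s * (norm \<xi>)\<^sup>2) * (cmod (fourier u \<xi>))\<^sup>2)
      \<le> norm (exp (- s * (norm \<xi>)\<^sup>2) * (\<integral>x. \<bar>u x\<bar> \<partial>lborel)\<^sup>2)"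
    using fourier_bound[OF l2_ball_integrable[OF u]] by (auto intro!: mult_left_mono power_mono)
qed

text \<open>The Gaussian means are bounded uniformly in s, because the difference integral is
  non-negative. Fatou's lemma along s = 1/(n+1) removes the Gaussian.\<close>

lemma bessel_fourier:
  fixes u :: "real^'n \<Rightarrow> real"
  assumes u: "l2_ball R u"
  shows "integrable lborel (\<lambda>\<xi>. (cmod (fourier u \<xi>))\<^sup>2)"
    and "(\<integral>\<xi>. (cmod (fourier u \<xi>))\<^sup>2 \<partial>lborel) \<le> (2 * pi) ^ CARD('n) * (\<integral>x. (u x)\<^sup>2 \<partial>lborel)"
proof -
  have [measurable]: "u \<in> borel_measurable borel" using u by (rule l2_ball_meas)
  have [measurable]: "fourier u \<in> borel_measurable borel" by (rule fourier_measurable) fact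
  let ?C = "(2 * pi) ^ CARD('n) * (\<integral>x. (u x)\<^sup>2 \<partial>lborel)"
  have le: "(\<integral>\<^sup>+\<xi>. ennreal (exp (- (1 / Suc n) * (norm \<xi>)\<^sup>2) * (cmod (fourier u \<xi>))\<^sup>2) \<partial>lborel) \<le> ennreal ?C" for n
  proof -
    have s: "1 / real (Suc n) > 0" by simp
    have "0 \<le> (\<integral>z. (u (fst z) - u (snd z))\<^sup>2 * gauss (1 / Suc n) (fst z - snd z) \<partial>(lborel \<Otimes>\<^sub>M lborel))"
      by (intro Bochner_Integration.integral_nonneg) (auto intro!: mult_nonneg_nonneg gauss_nonneg)
    then have "(\<integral>\<xi>. exp (- (1 / Suc n) * (norm \<xi>)\<^sup>2) * (cmod (fourier u \<xi>))\<^sup>2 \<partial>lborel) \<le> ?C"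
      using gauss_fourier_defect(2)[OF u s] by linarith
    then show ?thesis
      using nn_integral_eq_integral[OF integrable_exp_fourier[OF u s]] by (simp add: ennreal_leI)
  qed
  have *: "(\<integral>\<^sup>+\<xi>. ennreal ((cmod (fourier u \<xi>))\<^sup>2) \<partial>lborel) \<le> ennreal ?C"
  proof (rule nn_integral_fatou_le[OF _ _ le])
    show "AE \<xi> in lborel. (\<lambda>n. exp (- (1 / Suc n) * (norm \<xi>)\<^sup>2) * (cmod (fourier u \<xi>))\<^sup>2) \<longlonglongrightarrow> (cmod (fourier u \<xi>))\<^sup>2"
    proof (rule AE_I2)
      fix \<xi> :: "real^'n"
      have "(\<lambda>n. - (1 / real (Suc n)) * (norm \<xi>)\<^sup>2) \<longlonglongrightarrow> - 0 * (norm \<xi>)\<^sup>2"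
          by (intro tendsto_mult tendsto_minus tendsto_const LIMSEQ_inverse_real_of_nat[unfolded inverse_eq_divide])
      then have "(\<lambda>n. exp (- (1 / real (Suc n)) * (norm \<xi>)\<^sup>2) * (cmod (fourier u \<xi>))\<^sup>2) \<longlonglongrightarrow> exp (- 0 * (norm \<xi>)\<^sup>2) * (cmod (fourier u \<xi>))\<^sup>2"
        by (rule tendsto_mult[OF tendsto_exp tendsto_const])
      then show "(\<lambda>n. exp (- (1 / real (Suc n)) * (norm \<xi>)\<^sup>2) * (cmod (fourier u \<xi>))\<^sup>2) \<longlonglongrightarrow> (cmod (fourier u \<xi>))\<^sup>2"
        by simp
    qed
  qed measurable
  show "integrable lborel (\<lambda>\<xi>. (cmod (fourier u \<xi>))\<^sup>2)"
    and "(\<integral>\<xi>. (cmod (fourier u \<xi>))\<^sup>2 \<partial>lborel) \<le> ?C"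
    by (rule integrable_nonneg_of_nn_le[OF _ _ *]; simp)+
qed

text \<open>The gap in Bessel's inequality. As a non-negative quadratic form bounded by the squared
  norm, it vanishes on a set closed under multiples, sums and L^2 limits, so Plancherel's identity
  can be built up from indicators.\<close>

definition plancherel_defect :: "(real^'n \<Rightarrow> real) \<Rightarrow> real" where
  "plancherel_defect u = (2 * pi) ^ CARD('n) * (\<integral>x. (u x)\<^sup>2 \<partial>lborel) - (\<integral>\<xi>. (cmod (fourier u \<xi>))\<^sup>2 \<partial>lborel)"

lemma plancherel_defect_nonneg: "l2_ball R u \<Longrightarrow> 0 \<le> plancherel_defect u"
  using bessel_fourier(2)[of R u] by (simp add: plancherel_defect_def)

lemma plancherel_defect_le: "plancherel_defect (u :: real^'n \<Rightarrow> real) \<le> (2 * pi) ^ CARD('n) * (\<integral>x. (u x)\<^sup>2 \<partial>lborel)"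
  by (simp add: plancherel_defect_def)

lemma plancherel_defect_scale: "plancherel_defect (\<lambda>x. c * u x) = c\<^sup>2 * plancherel_defect u"
  by (simp add: plancherel_defect_def fourier_scale norm_mult power_mult_distrib algebra_simps)

text \<open>The parallelogram law for the defect, from which the non-negative defect of u - v is
  dropped.\<close>

lemma plancherel_defect_add_le:
  fixes u v :: "real^'n \<Rightarrow> real"
  assumes u: "l2_ball R u" and v: "l2_ball R v"
  shows "plancherel_defect (\<lambda>x. u x + v x) \<le> 2 * plancherel_defect u + 2 * plancherel_defect v"
proof -
  define m where "m = (\<lambda>x. u x + (-1) * v x)"
  let ?p = "\<lambda>x. u x + v x" and ?m = m
  have p: "l2_ball R ?p" and m: "l2_ball R ?m"
    using l2_ball_add[OF u v] l2_ball_diff[OF u v] by (auto simp: m_def)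
  have iv: "integrable lborel u" "integrable lborel v" "integrable lborel (\<lambda>x. (-1) * v x)"
    using l2_ball_integrable u v by auto
  have "(\<integral>x. (?p x)\<^sup>2 \<partial>lborel) + (\<integral>x. (?m x)\<^sup>2 \<partial>lborel) = (\<integral>x. 2 * (u x)\<^sup>2 + 2 * (v x)\<^sup>2 \<partial>lborel)"
    using l2_ball_sq[OF p] l2_ball_sq[OF m]
    by (subst Bochner_Integration.integral_add[symmetric]) (auto simp: m_def power2_eq_square algebra_simps)
  also have "\<dots> = 2 * (\<integral>x. (u x)\<^sup>2 \<partial>lborel) + 2 * (\<integral>x. (v x)\<^sup>2 \<partial>lborel)"
    using l2_ball_sq[OF u] l2_ball_sq[OF v] by simp
  finally have 1: "(\<integral>x. (?p x)\<^sup>2 \<partial>lborel) + (\<integral>x. (?m x)\<^sup>2 \<partial>lborel) = 2 * (\<integral>x. (u x)\<^sup>2 \<partial>lborel) + 2 * (\<integral>x. (v x)\<^sup>2 \<partial>lborel)" .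
  have par: "(cmod (a + b))\<^sup>2 + (cmod (a - b))\<^sup>2 = 2 * (cmod a)\<^sup>2 + 2 * (cmod b)\<^sup>2" for a b
    unfolding cmod_power2 by (simp add: power2_eq_square algebra_simps)
  have fp: "fourier ?p \<xi> = fourier u \<xi> + fourier v \<xi>" and fm: "fourier ?m \<xi> = fourier u \<xi> - fourier v \<xi>" for \<xi>
    using fourier_add[OF iv(1,2)] fourier_add[OF iv(1,3)] fourier_scale[of "-1" v] by (auto simp: m_def)
  have "(\<integral>\<xi>. (cmod (fourier ?p \<xi>))\<^sup>2 \<partial>lborel) + (\<integral>\<xi>. (cmod (fourier ?m \<xi>))\<^sup>2 \<partial>lborel)
      = (\<integral>\<xi>. 2 * (cmod (fourier u \<xi>))\<^sup>2 + 2 * (cmod (fourier v \<xi>))\<^sup>2 \<partial>lborel)"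
    using bessel_fourier(1)[OF p] bessel_fourier(1)[OF m]
    by (subst Bochner_Integration.integral_add[symmetric]) (auto simp: fp fm par)
  also have "\<dots> = 2 * (\<integral>\<xi>. (cmod (fourier u \<xi>))\<^sup>2 \<partial>lborel) + 2 * (\<integral>\<xi>. (cmod (fourier v \<xi>))\<^sup>2 \<partial>lborel)"
    using bessel_fourier(1)[OF u] bessel_fourier(1)[OF v] by simp
  finally have 2: "(\<integral>\<xi>. (cmod (fourier ?p \<xi>))\<^sup>2 \<partial>lborel) + (\<integral>\<xi>. (cmod (fourier ?m \<xi>))\<^sup>2 \<partial>lborel)
    = 2 * (\<integral>\<xi>. (cmod (fourier u \<xi>))\<^sup>2 \<partial>lborel) + 2 * (\<integral>\<xi>. (cmod (fourier v \<xi>))\<^sup>2 \<partial>lborel)" .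
  have "plancherel_defect ?p + plancherel_defect ?m = (2 * pi) ^ CARD('n) * ((\<integral>x. (?p x)\<^sup>2 \<partial>lborel) + (\<integral>x. (?m x)\<^sup>2 \<partial>lborel))
     - ((\<integral>\<xi>. (cmod (fourier ?p \<xi>))\<^sup>2 \<partial>lborel) + (\<integral>\<xi>. (cmod (fourier ?m \<xi>))\<^sup>2 \<partial>lborel))"
    unfolding plancherel_defect_def by (simp add: algebra_simps)
  also have "\<dots> = 2 * plancherel_defect u + 2 * plancherel_defect v"
    unfolding 1 2 plancherel_defect_def by (simp add: algebra_simps)
  finally show ?thesis using plancherel_defect_nonneg[OF m] by linarith
qed

text \<open>Here the Gaussian means converge pointwise, because the set is open.\<close>
lemma plancherel_defect_open:
  fixes O' :: "(real^'n) set"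
  assumes O': "open O'" "O' \<subseteq> ball 0 R"
  shows "plancherel_defect (indicator O') = 0"
proof -
  define u where "u = (indicator O' :: real^'n \<Rightarrow> real)"
  have [measurable]: "O' \<in> sets borel" using O' by auto
  have u: "l2_ball R u" unfolding u_def by (rule l2_ball_indicator) (use O' in auto)
  have [measurable]: "u \<in> borel_measurable borel" using u by (rule l2_ball_meas)
  let ?P = "lborel \<Otimes>\<^sub>M lborel :: ((real^'n) \<times> (real^'n)) measure"
  define h where "h = (\<lambda>n. 1 / real (Suc n))"
  have h: "h n > 0" for n by (simp add: h_def)
  have h0: "h \<longlonglongrightarrow> 0" unfolding h_def by (rule LIMSEQ_inverse_real_of_nat[unfolded inverse_eq_divide])
  define G where "G = (gauss 1 :: real^'n \<Rightarrow> real)"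
  have G: "integrable lborel G" "(\<integral>z. G z \<partial>lborel) = (2 * pi) ^ CARD('n)" "\<And>z. 0 \<le> G z"
    using gauss_integral[of 1, where 'a="real^'n"] gauss_nonneg[of 1] by (auto simp: has_bochner_integral_iff G_def)
  have [measurable]: "G \<in> borel_measurable borel" unfolding G_def by measurable
  \<comment> \<open>The substitution y = x - h z turns the Gaussian of width h into the fixed
    profile \<open>G\<close> and moves h into the argument of u. The Gaussian parameter is the
    square of h so that lengths scale linearly.\<close>
  have J: "(\<integral>\<xi>. exp (- (h n)\<^sup>2 * (norm \<xi>)\<^sup>2) * (cmod (fourier u \<xi>))\<^sup>2 \<partial>lborel)
     = (\<integral>z. u (fst z) * u (fst z - h n *\<^sub>R snd z) * G (snd z) \<partial>?P)" for n
  proof -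
    have sc: "h n ^ CARD('n) * gauss ((h n)\<^sup>2) (h n *\<^sub>R z) = G z" for z :: "real^'n"
    proof -
      have "sqrt (pi / (h n)\<^sup>2) = sqrt pi / h n" using h[of n] by (simp add: real_sqrt_divide)
      then show ?thesis using h[of n]
        by (simp add: gauss_def G_def power_divide power_mult_distrib)
    qed
    have I: "integrable ?P (\<lambda>z. u (fst z) * u (snd z) * gauss ((h n)\<^sup>2) (fst z - snd z))"
    proof (rule Bochner_Integration.integrable_bound)
      show "integrable ?P (\<lambda>z. u (fst z) * u (snd z) * sqrt (pi / (h n)\<^sup>2) ^ CARD('n))"
        using integrable_pair_mult[OF l2_ball_integrable[OF u] l2_ball_integrable[OF u]] by simp
      have g: "\<bar>gauss ((h n)\<^sup>2) z\<bar> \<le> \<bar>sqrt (pi / (h n)\<^sup>2) ^ CARD('n)\<bar>" for z :: "real^'n"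
        by (auto simp: gauss_def abs_mult intro!: mult_left_le)
      show "AE z in ?P. norm (u (fst z) * u (snd z) * gauss ((h n)\<^sup>2) (fst z - snd z))
         \<le> norm (u (fst z) * u (snd z) * sqrt (pi / (h n)\<^sup>2) ^ CARD('n))"
        using g unfolding real_norm_def abs_mult by (intro AE_I2 mult_left_mono) simp_all
    qed measurable
    have I2: "integrable ?P (\<lambda>z. u (fst z) * u (fst z - h n *\<^sub>R snd z) * G (snd z))"
    proof (rule Bochner_Integration.integrable_bound)
      show "integrable ?P (\<lambda>z. u (fst z) * G (snd z))"
        by (rule integrable_pair_mult[OF l2_ball_integrable[OF u] G(1)])
      show "AE z in ?P. norm (u (fst z) * u (fst z - h n *\<^sub>R snd z) * G (snd z)) \<le> norm (u (fst z) * G (snd z))"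
        by (auto simp: u_def indicator_def)
    qed measurable
    have "(\<integral>\<xi>. exp (- (h n)\<^sup>2 * (norm \<xi>)\<^sup>2) * (cmod (fourier u \<xi>))\<^sup>2 \<partial>lborel)
      = (\<integral>x. \<integral>y. u x * u y * gauss ((h n)\<^sup>2) (x - y) \<partial>lborel \<partial>lborel)"
      using gauss_fourier[OF l2_ball_integrable[OF u], of "(h n)\<^sup>2"] h[of n] lborel_pair.integral_fst'[OF I] by simp
    also have "\<dots> = (\<integral>x. \<integral>z. u x * u (x - h n *\<^sub>R z) * G z \<partial>lborel \<partial>lborel)"
    proof (rule Bochner_Integration.integral_cong[OF refl])
      fix x :: "real^'n"
      have "(\<integral>y. u x * u y * gauss ((h n)\<^sup>2) (x - y) \<partial>lborel)
         = \<bar>- h n\<bar> ^ DIM(real^'n) *\<^sub>R (\<integral>z. u x * u (x + (- h n) *\<^sub>R z) * gauss ((h n)\<^sup>2) (x - (x + (- h n) *\<^sub>R z)) \<partial>lborel)"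
        by (rule lborel_integral_affine) (use h[of n] in auto)
      also have "\<dots> = (\<integral>z. u x * u (x - h n *\<^sub>R z) * (h n ^ CARD('n) * gauss ((h n)\<^sup>2) (h n *\<^sub>R z)) \<partial>lborel)"
        using h[of n] by (simp add: mult_ac flip: integral_mult_right_zero)
      finally show "(\<integral>y. u x * u y * gauss ((h n)\<^sup>2) (x - y) \<partial>lborel) = (\<integral>z. u x * u (x - h n *\<^sub>R z) * G z \<partial>lborel)"
        unfolding sc .
    qed
    also have "\<dots> = (\<integral>z. u (fst z) * u (fst z - h n *\<^sub>R snd z) * G (snd z) \<partial>?P)"
      using lborel_pair.integral_fst'[OF I2] by simp
    finally show ?thesis .
  qed
  have lim: "(\<lambda>n. \<integral>z. u (fst z) * u (fst z - h n *\<^sub>R snd z) * G (snd z) \<partial>?P) \<longlonglongrightarrow> (\<integral>z. u (fst z) * G (snd z) \<partial>?P)"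
  proof (rule integral_dominated_convergence)
    show "integrable ?P (\<lambda>z. u (fst z) * G (snd z))"
      by (rule integrable_pair_mult[OF l2_ball_integrable[OF u] G(1)])
    show "AE z in ?P. norm (u (fst z) * u (fst z - h n *\<^sub>R snd z) * G (snd z)) \<le> u (fst z) * G (snd z)" for n
      using G by (auto simp: u_def indicator_def)
    show "AE z in ?P. (\<lambda>n. u (fst z) * u (fst z - h n *\<^sub>R snd z) * G (snd z)) \<longlonglongrightarrow> u (fst z) * G (snd z)"
    proof (rule AE_I2)
      fix z :: "(real^'n) \<times> (real^'n)"
      show "(\<lambda>n. u (fst z) * u (fst z - h n *\<^sub>R snd z) * G (snd z)) \<longlonglongrightarrow> u (fst z) * G (snd z)"
      proof (cases "fst z \<in> O'")
        case True
        have "(\<lambda>n. fst z - h n *\<^sub>R snd z) \<longlonglongrightarrow> fst z - 0 *\<^sub>R snd z"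
          by (intro tendsto_intros h0)
        then have "\<forall>\<^sub>F n in sequentially. fst z - h n *\<^sub>R snd z \<in> O'"
          using True O' by (auto dest: topological_tendstoD)
        then have "\<forall>\<^sub>F n in sequentially. u (fst z) * u (fst z - h n *\<^sub>R snd z) * G (snd z) = u (fst z) * G (snd z)"
          by eventually_elim (auto simp: u_def)
        then show ?thesis by (rule tendsto_eventually)
      qed (simp add: u_def)
    qed
  qed measurable
  have uu: "(u x)\<^sup>2 = u x" for x by (auto simp: u_def indicator_def)
  have "(\<integral>z. u (fst z) * G (snd z) \<partial>?P) = (2 * pi) ^ CARD('n) * (\<integral>x. (u x)\<^sup>2 \<partial>lborel)"
    using lborel_pair.integral_fst'[OF integrable_pair_mult[OF l2_ball_integrable[OF u] G(1)]] G(2) by (simp add: uu mult.commute)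
  then have lim2: "(\<lambda>n. (\<integral>\<xi>. exp (- (h n)\<^sup>2 * (norm \<xi>)\<^sup>2) * (cmod (fourier u \<xi>))\<^sup>2 \<partial>lborel)) \<longlonglongrightarrow> (2 * pi) ^ CARD('n) * (\<integral>x. (u x)\<^sup>2 \<partial>lborel)"
    using lim unfolding J by simp
  have "(\<integral>\<xi>. exp (- (h n)\<^sup>2 * (norm \<xi>)\<^sup>2) * (cmod (fourier u \<xi>))\<^sup>2 \<partial>lborel) \<le> (\<integral>\<xi>. (cmod (fourier u \<xi>))\<^sup>2 \<partial>lborel)" for n
    using h[of n] by (intro integral_mono integrable_exp_fourier[OF u] bessel_fourier(1)[OF u])
      (auto intro!: mult_left_le_one_le)
  then have "(2 * pi) ^ CARD('n) * (\<integral>x. (u x)\<^sup>2 \<partial>lborel) \<le> (\<integral>\<xi>. (cmod (fourier u \<xi>))\<^sup>2 \<partial>lborel)"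
    by (intro LIMSEQ_le_const2[OF lim2]) auto
  then show ?thesis using plancherel_defect_nonneg[OF u] by (simp add: plancherel_defect_def u_def)
qed

text \<open>The error u - v has defect at most (2 pi)^d times its squared norm, so the defect of u
  is arbitrarily small.\<close>

lemma plancherel_defect_limit:
  fixes u :: "real^'n \<Rightarrow> real"
  assumes u: "l2_ball R u" and ex: "\<And>e. e > 0 \<Longrightarrow> \<exists>v. l2_ball R v \<and> plancherel_defect v = 0 \<and> (\<integral>x. (u x - v x)\<^sup>2 \<partial>lborel) \<le> e"
  shows "plancherel_defect u = 0"
proof (rule antisym[OF field_le_epsilon plancherel_defect_nonneg[OF u]])
  fix e :: real assume e: "e > 0"
  define e' where "e' = e / (2 * (2 * pi) ^ CARD('n))"
  have e': "e' > 0" using e by (simp add: e'_def)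
  obtain v where v: "l2_ball R v" "plancherel_defect v = 0" "(\<integral>x. (u x - v x)\<^sup>2 \<partial>lborel) \<le> e'"
    using ex[OF e'] by blast
  have "plancherel_defect u = plancherel_defect (\<lambda>x. v x + (u x - v x))" by simp
  also have "\<dots> \<le> 2 * plancherel_defect v + 2 * plancherel_defect (\<lambda>x. u x - v x)"
    by (rule plancherel_defect_add_le[OF v(1) l2_ball_diff[OF u v(1)]])
  also have "\<dots> \<le> 2 * ((2 * pi) ^ CARD('n) * (\<integral>x. (u x - v x)\<^sup>2 \<partial>lborel))"
    using plancherel_defect_le[of "\<lambda>x. u x - v x"] v(2) by simp
  also have "\<dots> \<le> 2 * ((2 * pi) ^ CARD('n) * e')"
    using v(3) by (intro mult_left_mono) auto
  also have "\<dots> = e" by (simp add: e'_def)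
  finally show "plancherel_defect u \<le> 0 + e" by simp
qed

text \<open>Outer regularity: an open superset of nearly the same measure, intersected with the
  ball, is close in L^2.\<close>

lemma plancherel_defect_indicator:
  fixes A :: "(real^'n) set"
  assumes A: "A \<in> sets borel" "A \<subseteq> ball 0 R"
  shows "plancherel_defect (indicator A) = 0"
proof (rule plancherel_defect_limit[OF l2_ball_indicator[OF A]])
  fix e :: real assume e: "e > 0"
  from outer_regular_lborel_le[OF A(1) e] obtain U where U: "open U" "A \<subseteq> U" "emeasure lborel (U - A) \<le> e" .
  let ?O = "U \<inter> ball 0 R"
  have "(\<integral>x. (indicator A x - indicator ?O x :: real)\<^sup>2 \<partial>lborel) = (\<integral>x. indicator (?O - A) x \<partial>lborel)"
    using U(2) A(2) by (intro Bochner_Integration.integral_cong) (auto simp: indicator_def power2_eq_square)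
  also have "\<dots> = measure lborel (?O - A)" by simp
  also have "\<dots> \<le> e"
  proof -
    have "emeasure lborel (?O - A) \<le> emeasure lborel (U - A)"
      using A U(1) by (intro emeasure_mono) auto
    then show ?thesis using U(3) e by (auto simp: measure_def intro!: enn2real_leI)
  qed
  finally show "\<exists>v. l2_ball R v \<and> plancherel_defect v = 0 \<and> (\<integral>x. (indicator A x - v x)\<^sup>2 \<partial>lborel) \<le> e"
    using plancherel_defect_open[of ?O R] l2_ball_indicator[of ?O R] U(1) by (intro exI[of _ "indicator ?O"]) auto
qed

text \<open>Monotone induction over non-negative Borel functions. Membership in L^2 of the ball
  stands in the conclusion because the induction has to recover it for each piece, which works by
  domination: non-negative summands and increasing approximants lie below the given
  function.\<close>

lemma plancherel_defect_nonneg_fun: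
  fixes u :: "real^'n \<Rightarrow> real"
  assumes "u \<in> borel_measurable borel" "\<And>x. 0 \<le> u x"
  shows "l2_ball R u \<Longrightarrow> plancherel_defect u = 0"
  using assms
proof (induction rule: borel_measurable_induct_real)
  case (set A)
  have "A \<subseteq> ball 0 R"
  proof
    fix x assume "x \<in> A" then show "x \<in> ball 0 R" using set(2) by (cases "x \<in> ball 0 R") (auto simp: l2_ball_def)
  qed
  with set(1) show ?case by (intro plancherel_defect_indicator) auto
next
  case (mult u c)
  show ?case
  \<comment> \<open>For c = 0 nothing about u can be recovered from c u, but then the defect is zero
    trivially.\<close>
  proof (cases "c = 0")
    case True then show ?thesis by (simp add: plancherel_defect_scale[of 0 u, simplified])
  next
    case False
    then have "l2_ball R u" using l2_ball_scale[OF mult.prems, of "1 / c"] by simp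
    then show ?thesis using mult.IH by (simp add: plancherel_defect_scale)
  qed
next
  case (add u v)
  have le: "\<bar>u x\<bar> \<le> \<bar>v x + u x\<bar>" "\<bar>v x\<bar> \<le> \<bar>v x + u x\<bar>" for x
    using add.hyps(2)[of x] add.hyps(4)[of x] by auto
  have u: "l2_ball R u" and v: "l2_ball R v"
    by (rule l2_ball_dominated[OF add.prems]; use add.hyps le in auto)+
  have "plancherel_defect (\<lambda>x. v x + u x) \<le> 0"
    using plancherel_defect_add_le[OF v u] add.IH(1)[OF u] add.IH(2)[OF v] by simp
  then show ?case using plancherel_defect_nonneg[OF add.prems] by simp
next
  case (seq U)
  have Ux: "(\<lambda>i. U i x) \<longlonglongrightarrow> u x" for x using seq.hyps by simp
  have Uinc: "incseq (\<lambda>i. U i x)" for x using seq.hyps by (auto simp: incseq_def le_fun_def)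
  have Ule: "U i x \<le> u x" for i x using incseq_le[OF Uinc Ux] .
  have U: "l2_ball R (U i)" for i
    by (rule l2_ball_dominated[OF seq.prems]) (use seq.hyps order.trans[OF Ule abs_ge_self] in auto)
  have lim: "(\<lambda>i. \<integral>x. (u x - U i x)\<^sup>2 \<partial>lborel) \<longlonglongrightarrow> (\<integral>x. 0 \<partial>(lborel::(real^'n) measure))"
  proof (rule integral_dominated_convergence[where w = "\<lambda>x. (u x)\<^sup>2"])
    show "integrable lborel (\<lambda>x. (u x)\<^sup>2)" using seq.prems by (rule l2_ball_sq)
    show "(\<lambda>x. (u x - U i x)\<^sup>2) \<in> borel_measurable lborel" for i
      using l2_ball_meas[OF seq.prems] seq.hyps by simp
    show "AE x in lborel. (\<lambda>i. (u x - U i x)\<^sup>2) \<longlonglongrightarrow> 0"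
    proof (rule AE_I2)
      fix x
      have "(\<lambda>i. (u x - U i x)\<^sup>2) \<longlonglongrightarrow> (u x - u x)\<^sup>2" by (intro tendsto_intros Ux)
      then show "(\<lambda>i. (u x - U i x)\<^sup>2) \<longlonglongrightarrow> 0" by simp
    qed
    show "AE x in lborel. norm ((u x - U i x)\<^sup>2) \<le> (u x)\<^sup>2" for i
      using Ule seq.hyps by (auto intro!: power_mono simp: algebra_simps)
  qed auto
  show ?case
  proof (rule plancherel_defect_limit[OF seq.prems])
    fix e :: real assume "e > 0"
    then have "\<forall>\<^sub>F i in sequentially. (\<integral>x. (u x - U i x)\<^sup>2 \<partial>lborel) < e"
      using order_tendstoD(2)[OF lim, of e] by simp
    then obtain i where "(\<integral>x. (u x - U i x)\<^sup>2 \<partial>lborel) < e" by (auto simp: eventually_sequentially)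
    then show "\<exists>v. l2_ball R v \<and> plancherel_defect v = 0 \<and> (\<integral>x. (u x - v x)\<^sup>2 \<partial>lborel) \<le> e"
      using seq.IH[OF U] U by (intro exI[of _ "U i"]) auto
  qed
qed

theorem plancherel:
  fixes u :: "real^'n \<Rightarrow> real"
  assumes u: "l2_ball R u"
  shows "(\<integral>\<xi>. (cmod (fourier u \<xi>))\<^sup>2 \<partial>lborel) = (2 * pi) ^ CARD('n) * (\<integral>x. (u x)\<^sup>2 \<partial>lborel)"
proof -
  have [measurable]: "u \<in> borel_measurable borel" using u by (rule l2_ball_meas)
  have p: "l2_ball R (\<lambda>x. max 0 (u x))" and m: "l2_ball R (\<lambda>x. max 0 (- u x))"
    by (rule l2_ball_dominated[OF u]; auto)+
  have "plancherel_defect (\<lambda>x. max 0 (u x) + (-1) * max 0 (- u x))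
     \<le> 2 * plancherel_defect (\<lambda>x. max 0 (u x)) + 2 * plancherel_defect (\<lambda>x. (-1) * max 0 (- u x))"
    by (rule plancherel_defect_add_le[OF p l2_ball_scale[OF m]])
  also have "\<dots> = 0"
    unfolding plancherel_defect_scale by (subst (1 2) plancherel_defect_nonneg_fun[of _ R]) (use p m in auto)
  also have "(\<lambda>x. max 0 (u x) + (-1) * max 0 (- u x)) = u" by (auto simp: max_def)
  finally show ?thesis using plancherel_defect_nonneg[OF u] by (simp add: plancherel_defect_def)
qed

section \<open>Normal contractions of the energy\<close>

lemma nn_integral_powr_near_0:
  assumes "b < 1" "0 < c"
  shows "(\<integral>\<^sup>+s. ennreal (s powr (- b)) * indicator {0..c} s \<partial>lborel) < \<infinity>"
proof -
  have "(\<integral>\<^sup>+s. ennreal (s powr (- b)) * indicator {0..c} s \<partial>lborel) = ennreal (c powr (- b + 1) / (- b + 1))"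
    by (rule nn_integral_has_integral_lebesgue'[OF _ has_integral_powr_from_0]) (use assms in auto)
  then show ?thesis by simp
qed

lemma nn_integral_powr_tail:
  assumes "1 < b"
  shows "(\<integral>\<^sup>+s. ennreal (s powr (- b)) * indicator {1..} s \<partial>lborel) < \<infinity>"
proof -
  have "(\<integral>\<^sup>+s. ennreal (s powr (- b)) * indicator {1..} s \<partial>lborel) = ennreal (- (1 powr (- b + 1)) / (- b + 1))"
    by (rule nn_integral_has_integral_lebesgue'[OF _ has_integral_powr_to_inf]) (use assms in auto)
  then show ?thesis by simp
qed

definition normal_contraction :: "(real \<Rightarrow> real) \<Rightarrow> bool" where
  "normal_contraction F \<longleftrightarrow> F 0 = 0 \<and> (\<forall>a b. \<bar>F a - F b\<bar> \<le> \<bar>a - b\<bar>)"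

lemma normal_contraction_measurable:
  assumes "normal_contraction F"
  shows "F \<in> borel_measurable borel"
proof (rule borel_measurable_continuous_onI)
  show "continuous_on UNIV F"
    using assms by (intro continuous_on_iff[THEN iffD2] ballI allI impI)
      (auto simp: normal_contraction_def dist_real_def intro: le_less_trans)
qed

lemma normal_contraction_abs_le: "normal_contraction F \<Longrightarrow> \<bar>F a\<bar> \<le> \<bar>a\<bar>"
  unfolding normal_contraction_def by (metis diff_zero)

lemma l2_ball_contraction:
  assumes u: "l2_ball R u" and F: "normal_contraction F"
  shows "l2_ball R (\<lambda>x. F (u x))"
proof (rule l2_ball_dominated[OF u])
  show "(\<lambda>x. F (u x)) \<in> borel_measurable borel"
    using measurable_compose[OF l2_ball_meas[OF u] normal_contraction_measurable[OF F]] by simp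
qed (rule normal_contraction_abs_le[OF F])

text \<open>By Plancherel's identity the L^2 terms cancel and only the difference integral survives.
  In this form a contraction applied to u lowers the integrand pointwise, which cannot be seen in
  Fourier space.\<close>

lemma gauss_energy_eq:
  fixes u :: "real^'n \<Rightarrow> real"
  assumes u: "l2_ball R u" and s: "s > 0"
  shows "(\<integral>\<^sup>+\<xi>. ennreal ((1 - exp (- s * (norm \<xi>)\<^sup>2)) * (cmod (fourier u \<xi>))\<^sup>2) \<partial>lborel)
    = ennreal ((\<integral>z. (u (fst z) - u (snd z))\<^sup>2 * gauss s (fst z - snd z) \<partial>(lborel \<Otimes>\<^sub>M lborel)) / 2)"
proof -
  have eq: "(1 - exp (- s * (norm \<xi>)\<^sup>2)) * (cmod (fourier u \<xi>))\<^sup>2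
      = (cmod (fourier u \<xi>))\<^sup>2 - exp (- s * (norm \<xi>)\<^sup>2) * (cmod (fourier u \<xi>))\<^sup>2" for \<xi>
    by (simp add: algebra_simps)
  have i: "integrable lborel (\<lambda>\<xi>. (1 - exp (- s * (norm \<xi>)\<^sup>2)) * (cmod (fourier u \<xi>))\<^sup>2)"
    unfolding eq using bessel_fourier(1)[OF u] integrable_exp_fourier[OF u s] by auto
  have "0 \<le> (1 - exp (- s * (norm \<xi>)\<^sup>2)) * (cmod (fourier u \<xi>))\<^sup>2" for \<xi>
    using s by (intro mult_nonneg_nonneg) auto
  then have "(\<integral>\<^sup>+\<xi>. ennreal ((1 - exp (- s * (norm \<xi>)\<^sup>2)) * (cmod (fourier u \<xi>))\<^sup>2) \<partial>lborel)
     = ennreal (\<integral>\<xi>. (1 - exp (- s * (norm \<xi>)\<^sup>2)) * (cmod (fourier u \<xi>))\<^sup>2 \<partial>lborel)"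
    by (intro nn_integral_eq_integral i) auto
  also have "(\<integral>\<xi>. (1 - exp (- s * (norm \<xi>)\<^sup>2)) * (cmod (fourier u \<xi>))\<^sup>2 \<partial>lborel)
    = (\<integral>z. (u (fst z) - u (snd z))\<^sup>2 * gauss s (fst z - snd z) \<partial>(lborel \<Otimes>\<^sub>M lborel)) / 2"
    unfolding eq using bessel_fourier(1)[OF u] integrable_exp_fourier[OF u s]
      gauss_fourier_defect(2)[OF u s] plancherel[OF u]
    by (subst Bochner_Integration.integral_diff) auto
  finally show ?thesis .
qed

lemma gauss_energy_contraction:
  fixes u :: "real^'n \<Rightarrow> real"
  assumes u: "l2_ball R u" and F: "normal_contraction F" and s: "s > 0"
  shows "(\<integral>\<^sup>+\<xi>. ennreal ((1 - exp (- s * (norm \<xi>)\<^sup>2)) * (cmod (fourier (\<lambda>x. F (u x)) \<xi>))\<^sup>2) \<partial>lborel)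
    \<le> (\<integral>\<^sup>+\<xi>. ennreal ((1 - exp (- s * (norm \<xi>)\<^sup>2)) * (cmod (fourier u \<xi>))\<^sup>2) \<partial>lborel)"
proof -
  have Fu: "l2_ball R (\<lambda>x. F (u x))" by (rule l2_ball_contraction[OF u F])
  have "(F a - F b)\<^sup>2 \<le> (a - b)\<^sup>2" for a b
    using F by (simp add: abs_le_square_iff[symmetric] normal_contraction_def)
  then have "(\<integral>z. (F (u (fst z)) - F (u (snd z)))\<^sup>2 * gauss s (fst z - snd z) \<partial>(lborel \<Otimes>\<^sub>M lborel))
      \<le> (\<integral>z. (u (fst z) - u (snd z))\<^sup>2 * gauss s (fst z - snd z) \<partial>(lborel \<Otimes>\<^sub>M lborel))"
    using gauss_fourier_defect(1)[OF u s] gauss_fourier_defect(1)[OF Fu s]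
    by (intro integral_mono) (auto intro!: mult_right_mono gauss_nonneg[OF s])
  then show ?thesis unfolding gauss_energy_eq[OF u s] gauss_energy_eq[OF Fu s]
    by (intro ennreal_leI) simp
qed

text \<open>Extended-valued, so that it is meaningful before membership in the form domain is known.
  On the form domain it is (2 pi)^d times \<open>frac_form\<close>.\<close>

definition energy :: "real \<Rightarrow> (real^'n \<Rightarrow> real) \<Rightarrow> ennreal" where
  "energy \<alpha> u = (\<integral>\<^sup>+\<xi>. ennreal (norm \<xi> powr \<alpha> * (cmod (fourier u \<xi>))\<^sup>2) \<partial>lborel)"

text \<open>The symbol is a mixture of the Gaussian symbols: up to a constant,
  $|\xi|^\alpha = \int_0^\infty (1 - e^{-s|\xi|^2}) s^{-1-\alpha/2} ds$ for $\alpha < 2$.\<close>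
lemma energy_contraction_less_2:
  fixes u :: "real^'n \<Rightarrow> real"
  assumes u: "l2_ball R u" and F: "normal_contraction F" and \<alpha>: "0 < \<alpha>" "\<alpha> < 2"
  shows "energy \<alpha> (\<lambda>x. F (u x)) \<le> energy \<alpha> u"
proof -
  define g where "g = (\<lambda>(r::real) s. ennreal ((1 - exp (- s * r)) * s powr (- 1 - \<alpha> / 2)) * indicator {0<..} s)"
  have [measurable]: "case_prod g \<in> borel_measurable (borel \<Otimes>\<^sub>M borel)" unfolding g_def by measurable
  define c where "c = (\<integral>\<^sup>+s. g 1 s \<partial>lborel)"
  have mix: "(\<integral>\<^sup>+s. g ((norm \<xi>)\<^sup>2) s \<partial>lborel) = c * ennreal (norm \<xi> powr \<alpha>)" for \<xi> :: "real^'n"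
  proof (cases "\<xi> = 0")
    case True then show ?thesis using \<alpha> by (simp add: g_def)
  next
    case False
    define r where "r = (norm \<xi>)\<^sup>2"
    have r: "r > 0" using False by (simp add: r_def)
    have pw: "r powr (\<alpha> / 2) = norm \<xi> powr \<alpha>"
      using False powr_powr[of "norm \<xi>" 2 "\<alpha> / 2"] by (simp add: r_def powr_numeral)
    \<comment> \<open>Homogeneity of the mixture: substituting s/r for s pulls out the factor
      r^(\<alpha>/2), where r is the square of the norm of \<xi>.\<close>
    have scal: "ennreal (1 / r) * g r (0 + (1 / r) * s) = g 1 s * ennreal (norm \<xi> powr \<alpha>)" for s
    proof (cases "s > 0")
      case True
      have "(s / r) powr (- 1 - \<alpha> / 2) / r = s powr (- 1 - \<alpha> / 2) * r powr (\<alpha> / 2)"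
      proof -
        have "(s / r) powr (- 1 - \<alpha> / 2) = s powr (- 1 - \<alpha> / 2) * (r powr 1 * r powr (\<alpha> / 2))"
        proof -
          have "(s / r) powr (- 1 - \<alpha> / 2) = s powr (- 1 - \<alpha> / 2) * r powr (- (- 1 - \<alpha> / 2))"
            by (simp only: powr_divide powr_minus_divide[of r "- 1 - \<alpha> / 2"]
                times_divide_eq_right mult_1_right)
          also have "r powr (- (- 1 - \<alpha> / 2)) = r powr 1 * r powr (\<alpha> / 2)"
            unfolding powr_add[symmetric] by (simp add: add.commute)
          finally show ?thesis .
        qed
        then show ?thesis using r by simp
      qed
      moreover have "(1 / r) * (A * B) = A * (B / r)" for A B by simp
      ultimately have "(1 / r) * ((1 - exp (- s)) * (s / r) powr (- 1 - \<alpha> / 2)) = (1 - exp (- s)) * s powr (- 1 - \<alpha> / 2) * norm \<xi> powr \<alpha>"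
        by (simp only: pw mult.assoc)
      then have "ennreal (1 / r) * ennreal ((1 - exp (- s)) * (s / r) powr (- 1 - \<alpha> / 2)) = ennreal ((1 - exp (- s)) * s powr (- 1 - \<alpha> / 2)) * ennreal (norm \<xi> powr \<alpha>)"
        using r True by (subst (1 2) ennreal_mult[symmetric]) (auto simp: mult_ac)
      then show ?thesis using r True by (simp add: g_def)
    next
      case False then show ?thesis using r by (simp add: g_def zero_less_divide_iff)
    qed
    have "(\<integral>\<^sup>+s. g r s \<partial>lborel) = ennreal \<bar>1 / r\<bar> * (\<integral>\<^sup>+s. g r (0 + (1 / r) * s) \<partial>lborel)"
      by (rule nn_integral_real_affine) (use r in \<open>auto simp: g_def\<close>)
    also have "\<dots> = (\<integral>\<^sup>+s. ennreal (1 / r) * g r (0 + (1 / r) * s) \<partial>lborel)"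
      using r by (subst nn_integral_cmult) (auto simp: g_def)
    also have "\<dots> = c * ennreal (norm \<xi> powr \<alpha>)"
      unfolding scal c_def by (rule nn_integral_multc) (simp add: g_def)
    finally show ?thesis unfolding r_def .
  qed
  \<comment> \<open>Near zero, 1 - e^(-s) \<le> s leaves s^(-\<alpha>/2), integrable since \<alpha>
    < 2; at infinity s^(-1-\<alpha>/2) is integrable since \<alpha> > 0. Together with positivity
    this allows c to be cancelled at the end.\<close>
  have c_fin: "c < \<infinity>"
  proof -
    have "c \<le> (\<integral>\<^sup>+s. ennreal (s powr (- (\<alpha> / 2))) * indicator {0..1} s + ennreal (s powr (- (1 + \<alpha> / 2))) * indicator {1..} s \<partial>lborel)"
      unfolding c_def
    proof (rule nn_integral_mono)
      fix s :: real
      consider "s \<le> 0" | "0 < s" "s < 1" | "1 \<le> s" by linarith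
      then show "g 1 s \<le> ennreal (s powr (- (\<alpha> / 2))) * indicator {0..1} s + ennreal (s powr (- (1 + \<alpha> / 2))) * indicator {1..} s"
      proof cases
        case 2
        have "(1 - exp (- s)) * s powr (- 1 - \<alpha> / 2) \<le> s powr 1 * s powr (- 1 - \<alpha> / 2)"
          using exp_ge_add_one_self[of "- s"] 2 by (intro mult_right_mono) auto
        also have "\<dots> = s powr (- (\<alpha> / 2))" unfolding powr_add[symmetric] by simp
        finally show ?thesis using 2 by (simp add: g_def ennreal_leI)
      next
        case 3
        have "(1 - exp (- s)) * s powr (- 1 - \<alpha> / 2) \<le> 1 * s powr (- 1 - \<alpha> / 2)"
          by (intro mult_right_mono) auto
        also have "\<dots> = s powr (- (1 + \<alpha> / 2))" by simp
        finally have "g 1 s \<le> ennreal (s powr (- (1 + \<alpha> / 2))) * indicator {1..} s"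
          using 3 by (simp add: g_def ennreal_leI)
        then show ?thesis by (rule order.trans) simp
      qed (simp add: g_def)
    qed
    also have "\<dots> < \<infinity>"
      using nn_integral_powr_near_0[of "\<alpha> / 2" 1] nn_integral_powr_tail[of "1 + \<alpha> / 2"] \<alpha>
      by (subst nn_integral_add) auto
    finally show ?thesis .
  qed
  have c_pos: "c > 0"
  proof (rule ccontr)
    assume "\<not> c > 0"
    then have "AE s in lborel. g 1 s = 0"
      unfolding c_def by (subst nn_integral_0_iff_AE[symmetric]) (auto simp: g_def)
    then have "AE s in lborel. s \<notin> {0<..<1::real}"
    proof eventually_elim
      case (elim s)
      then show ?case by (auto simp: g_def ennreal_eq_0_iff mult_le_0_iff)
    qed
    then have "emeasure lborel {0<..<1::real} = 0"
      by (subst (asm) AE_iff_measurable[of "{0<..<1}"]) auto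
    then show False by simp
  qed
  have en: "c * energy \<alpha> v = (\<integral>\<^sup>+s. ennreal (s powr (- 1 - \<alpha> / 2)) * indicator {0<..} s *
      (\<integral>\<^sup>+\<xi>. ennreal ((1 - exp (- s * (norm \<xi>)\<^sup>2)) * (cmod (fourier v \<xi>))\<^sup>2) \<partial>lborel) \<partial>lborel)" if v: "l2_ball R v" for v :: "real^'n \<Rightarrow> real"
  proof -
    have [measurable]: "fourier v \<in> borel_measurable borel" by (rule fourier_measurable[OF l2_ball_meas[OF v]])
    have "c * energy \<alpha> v = (\<integral>\<^sup>+\<xi>. c * ennreal (norm \<xi> powr \<alpha> * (cmod (fourier v \<xi>))\<^sup>2) \<partial>lborel)"
      unfolding energy_def by (rule nn_integral_cmult[symmetric]) measurable
    also have "\<dots> = (\<integral>\<^sup>+\<xi>. (\<integral>\<^sup>+s. g ((norm \<xi>)\<^sup>2) s * ennreal ((cmod (fourier v \<xi>))\<^sup>2) \<partial>lborel) \<partial>lborel)"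
    proof (rule nn_integral_cong)
      fix \<xi> :: "real^'n"
      have "c * ennreal (norm \<xi> powr \<alpha> * (cmod (fourier v \<xi>))\<^sup>2) = (\<integral>\<^sup>+s. g ((norm \<xi>)\<^sup>2) s \<partial>lborel) * ennreal ((cmod (fourier v \<xi>))\<^sup>2)"
        unfolding mix by (simp add: ennreal_mult mult.assoc)
      also have "\<dots> = (\<integral>\<^sup>+s. g ((norm \<xi>)\<^sup>2) s * ennreal ((cmod (fourier v \<xi>))\<^sup>2) \<partial>lborel)"
        by (rule nn_integral_multc[symmetric]) (simp add: g_def)
      finally show "c * ennreal (norm \<xi> powr \<alpha> * (cmod (fourier v \<xi>))\<^sup>2) = (\<integral>\<^sup>+s. g ((norm \<xi>)\<^sup>2) s * ennreal ((cmod (fourier v \<xi>))\<^sup>2) \<partial>lborel)" .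
    qed
    also have "\<dots> = (\<integral>\<^sup>+s. (\<integral>\<^sup>+\<xi>. g ((norm \<xi>)\<^sup>2) s * ennreal ((cmod (fourier v \<xi>))\<^sup>2) \<partial>lborel) \<partial>lborel)"
      by (rule lborel_pair.Fubini'[symmetric]) (unfold g_def, measurable)
    also have "\<dots> = (\<integral>\<^sup>+s. ennreal (s powr (- 1 - \<alpha> / 2)) * indicator {0<..} s *
      (\<integral>\<^sup>+\<xi>. ennreal ((1 - exp (- s * (norm \<xi>)\<^sup>2)) * (cmod (fourier v \<xi>))\<^sup>2) \<partial>lborel) \<partial>lborel)"
    proof (rule nn_integral_cong)
      fix s :: real
      show "(\<integral>\<^sup>+\<xi>. g ((norm \<xi>)\<^sup>2) s * ennreal ((cmod (fourier v \<xi>))\<^sup>2) \<partial>lborel) = ennreal (s powr (- 1 - \<alpha> / 2)) * indicator {0<..} s *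
        (\<integral>\<^sup>+\<xi>. ennreal ((1 - exp (- s * (norm \<xi>)\<^sup>2)) * (cmod (fourier v \<xi>))\<^sup>2) \<partial>lborel)"
      proof (cases "s > 0")
        case True
        then show ?thesis
          by (subst nn_integral_cmult[symmetric])
            (auto simp: g_def ennreal_mult[symmetric] mult_ac intro!: nn_integral_cong)
      qed (simp add: g_def)
    qed
    finally show ?thesis .
  qed
  have "c * energy \<alpha> (\<lambda>x. F (u x)) \<le> c * energy \<alpha> u"
    unfolding en[OF u] en[OF l2_ball_contraction[OF u F]]
  proof (rule nn_integral_mono)
    fix s :: real
    show "ennreal (s powr (- 1 - \<alpha> / 2)) * indicator {0<..} s *
        (\<integral>\<^sup>+\<xi>. ennreal ((1 - exp (- s * (norm \<xi>)\<^sup>2)) * (cmod (fourier (\<lambda>x. F (u x)) \<xi>))\<^sup>2) \<partial>lborel)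
      \<le> ennreal (s powr (- 1 - \<alpha> / 2)) * indicator {0<..} s *
        (\<integral>\<^sup>+\<xi>. ennreal ((1 - exp (- s * (norm \<xi>)\<^sup>2)) * (cmod (fourier u \<xi>))\<^sup>2) \<partial>lborel)"
      using gauss_energy_contraction[OF u F, of s] by (cases "s > 0") (auto intro!: mult_left_mono)
  qed
  then show ?thesis
    using c_fin c_pos by (simp add: ennreal_mult_le_mult_iff)
qed

text \<open>For \<alpha> = 2 the mixture integral diverges at zero. Instead the symbol r is the
  limit of (n+1)(1 - e^(-r/(n+1))), which stays below r: Fatou's lemma handles the contracted
  function, the bound by r the original one.\<close>

lemma energy_contraction_2:
  fixes u :: "real^'n \<Rightarrow> real"
  assumes u: "l2_ball R u" and F: "normal_contraction F"
  shows "energy 2 (\<lambda>x. F (u x)) \<le> energy 2 u"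
proof -
  let ?v = "\<lambda>x. F (u x)"
  have Fu: "l2_ball R ?v" by (rule l2_ball_contraction[OF u F])
  have [measurable]: "fourier u \<in> borel_measurable borel" by (rule fourier_measurable[OF l2_ball_meas[OF u]])
  have [measurable]: "fourier ?v \<in> borel_measurable borel" by (rule fourier_measurable[OF l2_ball_meas[OF Fu]])
  define a where "a = (\<lambda>(n::nat) (r::real). Suc n * (1 - exp (- (1 / Suc n) * r)))"
  have a_lim: "(\<lambda>n. a n r) \<longlonglongrightarrow> r" for r
  proof (cases "r = 0")
    case False
    have "((\<lambda>h. (exp (0 + h) - exp 0) / h) \<longlongrightarrow> exp 0) (at (0::real))"
      using DERIV_exp[of "0::real"] unfolding DERIV_def .
    moreover have "filterlim (\<lambda>n. - (1 / real (Suc n)) * r) (at 0) sequentially"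
      unfolding filterlim_at
    proof
      show "\<forall>\<^sub>F x in sequentially. - (1 / real (Suc x)) * r \<in> UNIV \<and> - (1 / real (Suc x)) * r \<noteq> 0"
        using False by simp
      have "(\<lambda>n. - (1 / real (Suc n)) * r) \<longlonglongrightarrow> - 0 * r"
        by (intro tendsto_mult tendsto_minus tendsto_const LIMSEQ_inverse_real_of_nat[unfolded inverse_eq_divide])
      then show "(\<lambda>n. - (1 / real (Suc n)) * r) \<longlonglongrightarrow> 0" by simp
    qed
    ultimately have "(\<lambda>n. (exp (0 + (- (1 / real (Suc n)) * r)) - exp 0) / (- (1 / real (Suc n)) * r)) \<longlonglongrightarrow> exp 0"
      by (rule filterlim_compose)
    from tendsto_mult_left[OF this, of r]
    have "(\<lambda>n. r * ((exp (0 + (- (1 / real (Suc n)) * r)) - exp 0) / (- (1 / real (Suc n)) * r))) \<longlonglongrightarrow> r" by simp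
    moreover have "r * ((exp (0 + (- (1 / real (Suc n)) * r)) - exp 0) / (- (1 / real (Suc n)) * r)) = a n r" for n
      unfolding a_def using False by (simp del: of_nat_Suc add: field_simps)
    ultimately show ?thesis by simp
  qed (simp add: a_def)
  have a_le: "a n r \<le> r" for n r
  proof -
    have "1 - exp (- (1 / Suc n) * r) \<le> (1 / Suc n) * r"
      using exp_ge_add_one_self[of "- (1 / Suc n) * r"] by simp
    then have "Suc n * (1 - exp (- (1 / Suc n) * r)) \<le> Suc n * ((1 / Suc n) * r)"
      by (intro mult_left_mono) auto
    then show ?thesis by (simp add: a_def)
  qed
  have "(\<integral>\<^sup>+\<xi>. ennreal ((norm \<xi>)\<^sup>2 * (cmod (fourier ?v \<xi>))\<^sup>2) \<partial>lborel) \<le> (\<integral>\<^sup>+\<xi>. ennreal ((norm \<xi>)\<^sup>2 * (cmod (fourier u \<xi>))\<^sup>2) \<partial>lborel)"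
  proof (rule nn_integral_fatou_le)
    show "(\<lambda>\<xi>. a n ((norm \<xi>)\<^sup>2) * (cmod (fourier ?v \<xi>))\<^sup>2) \<in> borel_measurable lborel" for n
      unfolding a_def by measurable
    show "AE \<xi> in lborel. (\<lambda>n. a n ((norm \<xi>)\<^sup>2) * (cmod (fourier ?v \<xi>))\<^sup>2) \<longlonglongrightarrow> (norm \<xi>)\<^sup>2 * (cmod (fourier ?v \<xi>))\<^sup>2"
      by (intro AE_I2 tendsto_mult tendsto_const a_lim)
    fix n
    have aw: "(\<integral>\<^sup>+\<xi>. ennreal (a n ((norm \<xi>)\<^sup>2) * (cmod (fourier w \<xi>))\<^sup>2) \<partial>lborel)
        = ennreal (Suc n) * (\<integral>\<^sup>+\<xi>. ennreal ((1 - exp (- (1 / Suc n) * (norm \<xi>)\<^sup>2)) * (cmod (fourier w \<xi>))\<^sup>2) \<partial>lborel)"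
      if [measurable]: "fourier w \<in> borel_measurable borel" for w :: "real^'n \<Rightarrow> real"
      unfolding a_def
      by (subst nn_integral_cmult[symmetric], measurable) (simp del: of_nat_Suc add: ennreal_mult'[symmetric] mult.assoc)
    have "(\<integral>\<^sup>+\<xi>. ennreal (a n ((norm \<xi>)\<^sup>2) * (cmod (fourier ?v \<xi>))\<^sup>2) \<partial>lborel)
       \<le> (\<integral>\<^sup>+\<xi>. ennreal (a n ((norm \<xi>)\<^sup>2) * (cmod (fourier u \<xi>))\<^sup>2) \<partial>lborel)"
      using gauss_energy_contraction[OF u F, of "1 / Suc n"]
      by (subst (1 2) aw) (auto intro!: mult_left_mono)
    also have "\<dots> \<le> (\<integral>\<^sup>+\<xi>. ennreal ((norm \<xi>)\<^sup>2 * (cmod (fourier u \<xi>))\<^sup>2) \<partial>lborel)"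
      by (intro nn_integral_mono ennreal_leI mult_right_mono a_le) auto
    finally show "(\<integral>\<^sup>+\<xi>. ennreal (a n ((norm \<xi>)\<^sup>2) * (cmod (fourier ?v \<xi>))\<^sup>2) \<partial>lborel)
       \<le> (\<integral>\<^sup>+\<xi>. ennreal ((norm \<xi>)\<^sup>2 * (cmod (fourier u \<xi>))\<^sup>2) \<partial>lborel)" .
  qed
  then show ?thesis by (simp add: energy_def powr_numeral)
qed

lemma energy_contraction:
  fixes u :: "real^'n \<Rightarrow> real"
  assumes "l2_ball R u" "normal_contraction F" "0 < \<alpha>" "\<alpha> \<le> 2"
  shows "energy \<alpha> (\<lambda>x. F (u x)) \<le> energy \<alpha> u"
  using energy_contraction_less_2[OF assms(1-3)] energy_contraction_2[OF assms(1,2)] assms(4)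
  by (cases "\<alpha> = 2") auto

section \<open>The form, Nash's inequality and dilations\<close>

lemma quadratic_nonneg_imp_cs:
  fixes A B C :: real
  assumes "\<And>t. 0 \<le> A - 2 * t * B + t\<^sup>2 * C" and C: "0 \<le> C"
  shows "B\<^sup>2 \<le> A * C"
proof (cases "C = 0")
  case True
  have "B = 0"
  proof (rule ccontr)
    assume "B \<noteq> 0"
    then show False using assms(1)[of "(A + 1) / (2 * B)"] True by (simp add: field_simps)
  qed
  then show ?thesis using assms(1)[of 0] True by simp
next
  case False
  with C have C: "C > 0" by simp
  have "0 \<le> (A - 2 * (B / C) * B + (B / C)\<^sup>2 * C) * C" using assms(1)[of "B / C"] C by simp
  also have "\<dots> = A * C - B\<^sup>2" using C by (simp add: power2_eq_square field_simps)
  finally show ?thesis by simp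
qed

lemma l2_ball_cs:
  assumes u: "l2_ball R u" and v: "l2_ball R v"
  shows "(\<integral>x. u x * v x \<partial>lborel)\<^sup>2 \<le> (\<integral>x. (u x)\<^sup>2 \<partial>lborel) * (\<integral>x. (v x)\<^sup>2 \<partial>lborel)"
proof (rule quadratic_nonneg_imp_cs)
  fix t :: real
  have "0 \<le> (\<integral>x. (u x - t * v x)\<^sup>2 \<partial>lborel)" by simp
  also have "(\<integral>x. (u x - t * v x)\<^sup>2 \<partial>lborel) = (\<integral>x. (u x)\<^sup>2 - 2 * t * (u x * v x) + t\<^sup>2 * (v x)\<^sup>2 \<partial>lborel)"
    by (intro Bochner_Integration.integral_cong) (auto simp: power2_eq_square algebra_simps)
  also have "\<dots> = (\<integral>x. (u x)\<^sup>2 \<partial>lborel) - 2 * t * (\<integral>x. u x * v x \<partial>lborel) + t\<^sup>2 * (\<integral>x. (v x)\<^sup>2 \<partial>lborel)"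
    using l2_ball_sq[OF u] l2_ball_sq[OF v] l2_ball_mult[OF u v] by simp
  finally show "0 \<le> (\<integral>x. (u x)\<^sup>2 \<partial>lborel) - 2 * t * (\<integral>x. u x * v x \<partial>lborel) + t\<^sup>2 * (\<integral>x. (v x)\<^sup>2 \<partial>lborel)" .
qed simp

definition ip :: "(real^'n \<Rightarrow> real) \<Rightarrow> (real^'n \<Rightarrow> real) \<Rightarrow> real" where
  "ip u v = (\<integral>x. u x * v x \<partial>lborel)"

lemma ip_commute: "ip u v = ip v u"
  by (simp add: ip_def mult.commute)

lemma ip_self: "ip u u = (\<integral>x. (u x)\<^sup>2 \<partial>lborel)"
  by (simp add: ip_def power2_eq_square)

lemma ip_nonneg: "0 \<le> ip u u"
  by (simp add: ip_self)

lemma ip_cs: "l2_ball R u \<Longrightarrow> l2_ball R v \<Longrightarrow> (ip u v)\<^sup>2 \<le> ip u u * ip v v"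
  unfolding ip_self by (simp add: ip_def l2_ball_cs)

lemma ip_cs_abs: "l2_ball R u \<Longrightarrow> l2_ball R v \<Longrightarrow> \<bar>ip u v\<bar> \<le> sqrt (ip u u) * sqrt (ip v v)"
  using ip_cs[of R u v] by (simp add: real_le_rsqrt real_sqrt_mult[symmetric])

lemma ip_lincomb:
  assumes "l2_ball R u" "l2_ball R v" "l2_ball R w"
  shows "ip (\<lambda>x. a * u x + b * v x) w = a * ip u w + b * ip v w"
proof -
  have "ip (\<lambda>x. a * u x + b * v x) w = (\<integral>x. a * (u x * w x) + b * (v x * w x) \<partial>lborel)"
    by (simp add: ip_def algebra_simps)
  also have "\<dots> = a * ip u w + b * ip v w"
    using l2_ball_mult[OF assms(1,3)] l2_ball_mult[OF assms(2,3)] by (simp add: ip_def)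
  finally show ?thesis .
qed

lemma ip_diff: "l2_ball R u \<Longrightarrow> l2_ball R v \<Longrightarrow> l2_ball R w \<Longrightarrow> ip (\<lambda>x. u x - v x) w = ip u w - ip v w"
  using ip_lincomb[of R u v w 1 "-1"] by simp

lemma ip_add: "l2_ball R u \<Longrightarrow> l2_ball R v \<Longrightarrow> l2_ball R w \<Longrightarrow> ip (\<lambda>x. u x + v x) w = ip u w + ip v w"
  using ip_lincomb[of R u v w 1 1] by simp

lemma ip_mono:
  assumes "l2_ball R u" "l2_ball R v" "l2_ball R w" "AE x in lborel. u x \<le> v x" "\<And>x. 0 \<le> w x"
  shows "ip u w \<le> ip v w"
  unfolding ip_def
  by (rule integral_mono_AE) (use assms l2_ball_mult in \<open>auto elim!: eventually_mono intro: mult_right_mono\<close>)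

section \<open>The form domain and the algebra of the form\<close>

lemma frac_domain_iff: "frac_domain \<alpha> R u \<longleftrightarrow> l2_ball R u \<and> energy \<alpha> u < \<infinity>"
proof -
  have "integrable lborel (\<lambda>\<xi>. norm \<xi> powr \<alpha> * (cmod (fourier u \<xi>))\<^sup>2) \<longleftrightarrow> energy \<alpha> u < \<infinity>" if u: "l2_ball R u"
  proof -
    have [measurable]: "fourier u \<in> borel_measurable borel" by (rule fourier_measurable[OF l2_ball_meas[OF u]])
    show ?thesis by (auto simp: integrable_iff_bounded energy_def)
  qed
  then show ?thesis by (auto simp: frac_domain_def l2_ball_def)
qed

lemma frac_domain_l2: "frac_domain \<alpha> R u \<Longrightarrow> l2_ball R u"
  by (simp add: frac_domain_iff)

lemma frac_domain_integrable:
  "frac_domain \<alpha> R u \<Longrightarrow> integrable lborel (\<lambda>\<xi>. norm \<xi> powr \<alpha> * (cmod (fourier u \<xi>))\<^sup>2)"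
  by (simp add: frac_domain_def)

lemma fourier_lincomb:
  assumes u: "l2_ball R u" and v: "l2_ball R v"
  shows "fourier (\<lambda>x. a * u x + b * v x) \<xi> = of_real a * fourier u \<xi> + of_real b * fourier v \<xi>"
  using fourier_add[OF l2_ball_integrable[OF l2_ball_scale[OF u, of a]] l2_ball_integrable[OF l2_ball_scale[OF v, of b]]]
  by (simp add: fourier_scale)

lemma frac_form_integrable:
  assumes u: "frac_domain \<alpha> R u" and v: "frac_domain \<alpha> R v"
  shows "integrable lborel (\<lambda>\<xi>. norm \<xi> powr \<alpha> * Re (fourier u \<xi> * cnj (fourier v \<xi>)))"
proof (rule Bochner_Integration.integrable_bound)
  have [measurable]: "fourier u \<in> borel_measurable borel" "fourier v \<in> borel_measurable borel"
    using fourier_measurable l2_ball_meas frac_domain_l2 u v by blast+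
  show "integrable lborel (\<lambda>\<xi>. norm \<xi> powr \<alpha> * (cmod (fourier u \<xi>))\<^sup>2 + norm \<xi> powr \<alpha> * (cmod (fourier v \<xi>))\<^sup>2)"
    using frac_domain_integrable u v by (intro Bochner_Integration.integrable_add)
  show "(\<lambda>\<xi>. norm \<xi> powr \<alpha> * Re (fourier u \<xi> * cnj (fourier v \<xi>))) \<in> borel_measurable lborel"
    by measurable
  have "\<bar>Re (a * cnj b)\<bar> \<le> (cmod a)\<^sup>2 + (cmod b)\<^sup>2" for a b :: complex
  proof -
    have "\<bar>Re (a * cnj b)\<bar> \<le> cmod a * cmod b" using abs_Re_le_cmod[of "a * cnj b"] by (simp add: norm_mult)
    also have "\<dots> \<le> (cmod a)\<^sup>2 + (cmod b)\<^sup>2"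
      using sum_squares_bound[of "cmod a" "cmod b"] mult_nonneg_nonneg[of "cmod a" "cmod b"] norm_ge_zero[of a] norm_ge_zero[of b]
      by linarith
    finally show ?thesis .
  qed
  then have "norm \<xi> powr \<alpha> * \<bar>Re (fourier u \<xi> * cnj (fourier v \<xi>))\<bar> \<le> norm \<xi> powr \<alpha> * ((cmod (fourier u \<xi>))\<^sup>2 + (cmod (fourier v \<xi>))\<^sup>2)" for \<xi>
    by (intro mult_left_mono) auto
  then show "AE \<xi> in lborel. norm (norm \<xi> powr \<alpha> * Re (fourier u \<xi> * cnj (fourier v \<xi>)))
      \<le> norm (norm \<xi> powr \<alpha> * (cmod (fourier u \<xi>))\<^sup>2 + norm \<xi> powr \<alpha> * (cmod (fourier v \<xi>))\<^sup>2)"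
    unfolding real_norm_def abs_mult ring_distribs[symmetric] by (intro AE_I2) simp
qed

lemma two_pi_powr: "(2 * pi) ^ n * (2 * pi) powr (- real n) = 1"
  by (subst powr_realpow[symmetric]) (simp_all add: powr_add[symmetric])

lemma frac_domain_lincomb:
  assumes u: "frac_domain \<alpha> R u" and v: "frac_domain \<alpha> R v"
  shows "frac_domain \<alpha> R (\<lambda>x. a * u x + b * v x)"
proof -
  note l2 = frac_domain_l2[OF u] frac_domain_l2[OF v]
  have "integrable lborel (\<lambda>\<xi>. a\<^sup>2 * (norm \<xi> powr \<alpha> * (cmod (fourier u \<xi>))\<^sup>2) + b\<^sup>2 * (norm \<xi> powr \<alpha> * (cmod (fourier v \<xi>))\<^sup>2)
      + 2 * a * b * (norm \<xi> powr \<alpha> * Re (fourier u \<xi> * cnj (fourier v \<xi>))))"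
    using frac_form_integrable[OF u v] frac_domain_integrable[OF u] frac_domain_integrable[OF v] by auto
  moreover have "(cmod (of_real a * z + of_real b * w))\<^sup>2 = a\<^sup>2 * (cmod z)\<^sup>2 + b\<^sup>2 * (cmod w)\<^sup>2 + 2 * a * b * Re (z * cnj w)" for z w
    unfolding cmod_power2 by (simp add: power2_eq_square algebra_simps)
  then have "a\<^sup>2 * (p * (cmod z)\<^sup>2) + b\<^sup>2 * (p * (cmod w)\<^sup>2) + 2 * a * b * (p * Re (z * cnj w))
      = p * (cmod (of_real a * z + of_real b * w))\<^sup>2" for z w p
    by (simp only: ring_distribs mult_ac)
  ultimately have "integrable lborel (\<lambda>\<xi>. norm \<xi> powr \<alpha> * (cmod (fourier (\<lambda>x. a * u x + b * v x) \<xi>))\<^sup>2)"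
    by (simp only: fourier_lincomb[OF l2])
  then show ?thesis using l2_ball_lincomb[OF l2] by (auto simp: frac_domain_def l2_ball_def)
qed

lemma frac_domain_add: "frac_domain \<alpha> R u \<Longrightarrow> frac_domain \<alpha> R v \<Longrightarrow> frac_domain \<alpha> R (\<lambda>x. u x + v x)"
  using frac_domain_lincomb[of \<alpha> R u v 1 1] by simp

lemma frac_domain_diff: "frac_domain \<alpha> R u \<Longrightarrow> frac_domain \<alpha> R v \<Longrightarrow> frac_domain \<alpha> R (\<lambda>x. u x - v x)"
  using frac_domain_lincomb[of \<alpha> R u v 1 "-1"] by simp

lemma frac_domain_scale: "frac_domain \<alpha> R u \<Longrightarrow> frac_domain \<alpha> R (\<lambda>x. a * u x)"
  using frac_domain_lincomb[of \<alpha> R u u a 0] by simp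

lemma frac_form_commute: "frac_form \<alpha> u v = frac_form \<alpha> v u"
  unfolding frac_form_def by (intro arg_cong2[of _ _ _ _ "(*)"] Bochner_Integration.integral_cong refl)
    (simp add: algebra_simps)

lemma frac_form_lincomb:
  assumes u: "frac_domain \<alpha> R u" and v: "frac_domain \<alpha> R v" and w: "frac_domain \<alpha> R w"
  shows "frac_form \<alpha> (\<lambda>x. a * u x + b * v x) w = a * frac_form \<alpha> u w + b * frac_form \<alpha> v w"
proof -
  note l2 = frac_domain_l2[OF u] frac_domain_l2[OF v]
  have "(\<integral>\<xi>. norm \<xi> powr \<alpha> * Re (fourier (\<lambda>x. a * u x + b * v x) \<xi> * cnj (fourier w \<xi>)) \<partial>lborel)
    = (\<integral>\<xi>. a * (norm \<xi> powr \<alpha> * Re (fourier u \<xi> * cnj (fourier w \<xi>))) + b * (norm \<xi> powr \<alpha> * Re (fourier v \<xi> * cnj (fourier w \<xi>))) \<partial>lborel)"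
    by (intro Bochner_Integration.integral_cong) (auto simp: fourier_lincomb[OF l2] algebra_simps)
  also have "\<dots> = a * (\<integral>\<xi>. norm \<xi> powr \<alpha> * Re (fourier u \<xi> * cnj (fourier w \<xi>)) \<partial>lborel)
      + b * (\<integral>\<xi>. norm \<xi> powr \<alpha> * Re (fourier v \<xi> * cnj (fourier w \<xi>)) \<partial>lborel)"
    using frac_form_integrable[OF u w] frac_form_integrable[OF v w] by simp
  finally show ?thesis unfolding frac_form_def by (simp add: algebra_simps)
qed

lemma frac_form_add: "frac_domain \<alpha> R u \<Longrightarrow> frac_domain \<alpha> R v \<Longrightarrow> frac_domain \<alpha> R w \<Longrightarrow>
  frac_form \<alpha> (\<lambda>x. u x + v x) w = frac_form \<alpha> u w + frac_form \<alpha> v w"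
  using frac_form_lincomb[of \<alpha> R u v w 1 1] by simp

lemma frac_form_diff: "frac_domain \<alpha> R u \<Longrightarrow> frac_domain \<alpha> R v \<Longrightarrow> frac_domain \<alpha> R w \<Longrightarrow>
  frac_form \<alpha> (\<lambda>x. u x - v x) w = frac_form \<alpha> u w - frac_form \<alpha> v w"
  using frac_form_lincomb[of \<alpha> R u v w 1 "-1"] by simp

lemma frac_form_scale: "frac_domain \<alpha> R u \<Longrightarrow> frac_domain \<alpha> R w \<Longrightarrow>
  frac_form \<alpha> (\<lambda>x. a * u x) w = a * frac_form \<alpha> u w"
  using frac_form_lincomb[of \<alpha> R u u w a 0] by simp

lemma frac_form_nonneg: "0 \<le> frac_form \<alpha> u u"
  unfolding frac_form_def by (intro mult_nonneg_nonneg Bochner_Integration.integral_nonneg)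
    (auto simp: complex_mult_cnj)

lemma frac_form_energy:
  fixes u :: "real^'n \<Rightarrow> real"
  assumes "frac_domain \<alpha> R u"
  shows "energy \<alpha> u = ennreal ((2 * pi) ^ CARD('n) * frac_form \<alpha> u u)"
proof -
  have "energy \<alpha> u = ennreal (\<integral>\<xi>. norm \<xi> powr \<alpha> * (cmod (fourier u \<xi>))\<^sup>2 \<partial>lborel)"
    unfolding energy_def by (rule nn_integral_eq_integral[OF frac_domain_integrable[OF assms]]) simp
  moreover have "Re (z * cnj z) = (cmod z)\<^sup>2" for z
    by (simp add: complex_mult_cnj cmod_power2)
  ultimately show ?thesis
    by (simp only: frac_form_def mult.assoc[symmetric] mult_1 two_pi_powr)
qed

lemma frac_form_contraction:
  fixes u :: "real^'n \<Rightarrow> real"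
  assumes u: "frac_domain \<alpha> R u" and F: "normal_contraction F" and \<alpha>: "0 < \<alpha>" "\<alpha> \<le> 2"
  shows "frac_domain \<alpha> R (\<lambda>x. F (u x))" "frac_form \<alpha> (\<lambda>x. F (u x)) (\<lambda>x. F (u x)) \<le> frac_form \<alpha> u u"
proof -
  have le: "energy \<alpha> (\<lambda>x. F (u x)) \<le> energy \<alpha> u"
    by (rule energy_contraction[OF frac_domain_l2[OF u] F \<alpha>])
  then show d: "frac_domain \<alpha> R (\<lambda>x. F (u x))"
    using u l2_ball_contraction[OF _ F] by (auto simp: frac_domain_iff)
  show "frac_form \<alpha> (\<lambda>x. F (u x)) (\<lambda>x. F (u x)) \<le> frac_form \<alpha> u u"
    using le unfolding frac_form_energy[OF u] frac_form_energy[OF d]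
    by (simp add: ennreal_le_iff frac_form_nonneg mult_le_cancel_left)
qed

text \<open>Perturbing the projection $Pu$ in the direction $u - Pu$ does not change $P$ of it, so the
  first variation of the energy in that direction is non-negative.\<close>
lemma frac_form_projection_nonneg:
  fixes u :: "real^'n \<Rightarrow> real"
  assumes u: "frac_domain \<alpha> R u" and P: "normal_contraction P" and \<alpha>: "0 < \<alpha>" "\<alpha> \<le> 2"
    and proj: "\<And>a e. 0 \<le> e \<Longrightarrow> e \<le> 1 \<Longrightarrow> P (P a + e * (a - P a)) = P a"
  shows "0 \<le> frac_form \<alpha> u (\<lambda>x. u x - P (u x))"
proof -
  let ?p = "\<lambda>x. P (u x)" and ?w = "\<lambda>x. u x - P (u x)"
  have p: "frac_domain \<alpha> R ?p" by (rule frac_form_contraction(1)[OF u P \<alpha>])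
  have w: "frac_domain \<alpha> R ?w" by (rule frac_domain_diff[OF u p])
  have var: "0 \<le> 2 * frac_form \<alpha> ?p ?w + e * frac_form \<alpha> ?w ?w" if e: "0 < e" "e \<le> 1" for e
  proof -
    have z: "frac_domain \<alpha> R (\<lambda>x. 1 * ?p x + e * ?w x)" by (rule frac_domain_lincomb[OF p w])
    have "frac_form \<alpha> ?p ?p \<le> frac_form \<alpha> (\<lambda>x. 1 * ?p x + e * ?w x) (\<lambda>x. 1 * ?p x + e * ?w x)"
      using frac_form_contraction(2)[OF z P \<alpha>] proj[of e] e by simp
    also have "\<dots> = frac_form \<alpha> ?p ?p + 2 * e * frac_form \<alpha> ?p ?w + e\<^sup>2 * frac_form \<alpha> ?w ?w"
      unfolding frac_form_lincomb[OF p w z] frac_form_commute[of \<alpha> _ "\<lambda>x. 1 * ?p x + e * ?w x"]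
      unfolding frac_form_lincomb[OF p w p] frac_form_lincomb[OF p w w] frac_form_commute[of \<alpha> ?w ?p]
      by (simp add: power2_eq_square algebra_simps)
    finally have "0 \<le> e * (2 * frac_form \<alpha> ?p ?w + e * frac_form \<alpha> ?w ?w)"
      by (simp add: power2_eq_square algebra_simps)
    then show ?thesis using e by (simp add: zero_le_mult_iff)
  qed
  have "0 \<le> 2 * frac_form \<alpha> ?p ?w"
  proof (rule field_le_epsilon)
    fix d :: real assume d: "d > 0"
    \<comment> \<open>The first variation satisfies 0 \<le> 2 E(Pu, w) + e E(w, w) for 0 < e \<le>
      1; this e makes the second term at most d, the + 1 guarding against E(w, w) = 0.\<close>
    define e where "e = min 1 (d / (frac_form \<alpha> ?w ?w + 1))"
    have nn: "0 \<le> frac_form \<alpha> ?w ?w" by (rule frac_form_nonneg)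
    have e: "0 < e" "e \<le> 1" using d nn by (auto simp: e_def)
    have "e * frac_form \<alpha> ?w ?w \<le> d / (frac_form \<alpha> ?w ?w + 1) * frac_form \<alpha> ?w ?w"
      by (intro mult_right_mono nn) (simp add: e_def)
    also have "\<dots> \<le> d" using d nn by (simp add: field_simps)
    finally show "0 \<le> 2 * frac_form \<alpha> ?p ?w + d" using var[OF e] by linarith
  qed
  moreover have "frac_form \<alpha> u ?w = frac_form \<alpha> ?p ?w + frac_form \<alpha> ?w ?w"
    using frac_form_add[OF p w w] by simp
  ultimately show ?thesis using frac_form_nonneg[of \<alpha> ?w] by linarith
qed

lemma normal_contraction_clamp: "normal_contraction (\<lambda>a. max 0 (min 1 a))"
  by (auto simp: normal_contraction_def)

lemma normal_contraction_max: "normal_contraction (\<lambda>a. max 0 a)"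
  by (auto simp: normal_contraction_def)

lemma normal_contraction_abs: "normal_contraction (\<lambda>a. \<bar>a\<bar>)"
  by (auto simp: normal_contraction_def)

text \<open>On a bounded ball L^2 convergence implies L^1 convergence, hence pointwise convergence
  of the Fourier transforms, and Fatou's lemma applies. It carries energy bounds from partial sums
  of eigenfunction expansions to their limits.\<close>

lemma frac_form_lsc:
  fixes u :: "real^'n \<Rightarrow> real"
  assumes un: "\<And>n. frac_domain \<alpha> R (U n)" and u: "l2_ball R u"
    and lim: "(\<lambda>n. \<integral>x. (U n x - u x)\<^sup>2 \<partial>lborel) \<longlonglongrightarrow> 0"
    and le: "\<And>n. frac_form \<alpha> (U n) (U n) \<le> C"
  shows "frac_domain \<alpha> R u" "frac_form \<alpha> u u \<le> C"
proof -
  note l2 = frac_domain_l2[OF un]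
  have [measurable]: "fourier (U n) \<in> borel_measurable borel" for n by (rule fourier_measurable[OF l2_ball_meas[OF l2]])
  have C: "0 \<le> C" using le[of 0] frac_form_nonneg[of \<alpha> "U 0"] by linarith
  have one: "l2_ball R (indicator (ball 0 R))" by (rule l2_ball_indicator) auto
  have fl: "(\<lambda>n. fourier (U n) \<xi>) \<longlonglongrightarrow> fourier u \<xi>" for \<xi>
  proof -
    have d: "l2_ball R (\<lambda>x. U n x + (-1) * u x)" for n using l2_ball_diff[OF l2 u] by simp
    have b: "cmod (fourier (U n) \<xi> - fourier u \<xi>) \<le> sqrt ((\<integral>x. (U n x - u x)\<^sup>2 \<partial>lborel) * ip (indicator (ball 0 R :: (real^'n) set)) (indicator (ball 0 R)))" for n
    proof -
      have "fourier (U n) \<xi> - fourier u \<xi> = fourier (\<lambda>x. U n x + (-1) * u x) \<xi>"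
        using fourier_lincomb[OF l2 u, of 1 n "-1"] by simp
      then have "cmod (fourier (U n) \<xi> - fourier u \<xi>) \<le> (\<integral>x. \<bar>U n x + (-1) * u x\<bar> \<partial>lborel)"
        using fourier_bound[OF l2_ball_integrable[OF d]] by simp
      also have "\<dots> = ip (\<lambda>x. \<bar>U n x + (-1) * u x\<bar>) (indicator (ball 0 R))"
        unfolding ip_def using d[of n]
        by (intro Bochner_Integration.integral_cong) (auto simp: l2_ball_def indicator_def)
      also have "\<dots> \<le> sqrt ((\<integral>x. (U n x - u x)\<^sup>2 \<partial>lborel) * ip (indicator (ball 0 R :: (real^'n) set)) (indicator (ball 0 R)))"
        using ip_cs[OF l2_ball_contraction[OF d normal_contraction_abs] one, of n]
        by (intro real_le_rsqrt) (simp add: ip_self)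
      finally show ?thesis .
    qed
    have "(\<lambda>n. sqrt ((\<integral>x. (U n x - u x)\<^sup>2 \<partial>lborel) * ip (indicator (ball 0 R :: (real^'n) set)) (indicator (ball 0 R)))) \<longlonglongrightarrow> sqrt (0 * ip (indicator (ball 0 R :: (real^'n) set)) (indicator (ball 0 R)))"
      by (intro tendsto_real_sqrt tendsto_mult lim tendsto_const)
    then have B0: "(\<lambda>n. sqrt ((\<integral>x. (U n x - u x)\<^sup>2 \<partial>lborel) * ip (indicator (ball 0 R :: (real^'n) set)) (indicator (ball 0 R)))) \<longlonglongrightarrow> 0"
      by simp
    have "(\<lambda>n. fourier (U n) \<xi> - fourier u \<xi>) \<longlonglongrightarrow> 0"
      by (rule Lim_null_comparison[OF always_eventually B0]) (intro allI b)
    then show ?thesis by (simp add: LIM_zero_iff)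
  qed
  have en: "energy \<alpha> u \<le> ennreal ((2 * pi) ^ CARD('n) * C)"
    unfolding energy_def
  proof (rule nn_integral_fatou_le)
    show "AE \<xi> in lborel. (\<lambda>n. norm \<xi> powr \<alpha> * (cmod (fourier (U n) \<xi>))\<^sup>2) \<longlonglongrightarrow> norm \<xi> powr \<alpha> * (cmod (fourier u \<xi>))\<^sup>2"
      by (intro AE_I2 tendsto_intros fl)
    show "(\<integral>\<^sup>+\<xi>. ennreal (norm \<xi> powr \<alpha> * (cmod (fourier (U n) \<xi>))\<^sup>2) \<partial>lborel) \<le> ennreal ((2 * pi) ^ CARD('n) * C)" for n
      using frac_form_energy[OF un, of n] le[of n] by (auto simp: energy_def intro!: ennreal_leI mult_left_mono)
  qed measurable
  then show d: "frac_domain \<alpha> R u" using u by (auto simp: frac_domain_iff intro: le_less_trans)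
  show "frac_form \<alpha> u u \<le> C"
    using en C unfolding frac_form_energy[OF d] by (simp add: ennreal_le_iff mult_le_cancel_left)
qed

text \<open>Plancherel's integral is split at the sphere of radius \<rho>: inside, the transform is
  bounded by the L^1 norm; outside, 1 \<le> \<rho>^(-\<alpha>) |\<xi>|^\<alpha>. The radius stays
  free, to be matched to the time later.\<close>

lemma nash:
  fixes u :: "real^'n \<Rightarrow> real"
  assumes u: "frac_domain \<alpha> R u" and \<rho>: "\<rho> > 0" and \<alpha>: "\<alpha> > 0"
  shows "ip u u \<le> unit_ball_vol (CARD('n)) / (2 * pi) ^ CARD('n) * \<rho> ^ CARD('n) * (\<integral>x. \<bar>u x\<bar> \<partial>lborel)\<^sup>2
     + \<rho> powr (- \<alpha>) * frac_form \<alpha> u u"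
proof -
  define N where "N = (2 * pi) ^ CARD('n)"
  have N: "N > 0" by (simp add: N_def)
  note l2 = frac_domain_l2[OF u]
  let ?M = "\<integral>x. \<bar>u x\<bar> \<partial>lborel"
  have i1: "integrable lborel (\<lambda>\<xi>::real^'n. indicator (ball 0 \<rho>) \<xi> * ?M\<^sup>2)"
    by (intro integrable_mult_left integrable_indicator_ball)
  have i2: "integrable lborel (\<lambda>\<xi>. \<rho> powr (- \<alpha>) * (norm \<xi> powr \<alpha> * (cmod (fourier u \<xi>))\<^sup>2))"
    using frac_domain_integrable[OF u] by simp
  have pt: "(cmod (fourier u \<xi>))\<^sup>2 \<le> indicator (ball 0 \<rho>) \<xi> * ?M\<^sup>2 + \<rho> powr (- \<alpha>) * (norm \<xi> powr \<alpha> * (cmod (fourier u \<xi>))\<^sup>2)" for \<xi>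
  proof (cases "\<xi> \<in> ball 0 \<rho>")
    case True
    have "(cmod (fourier u \<xi>))\<^sup>2 \<le> ?M\<^sup>2" by (intro power_mono fourier_bound[OF l2_ball_integrable[OF l2]]) auto
    then show ?thesis using True by (simp add: add_increasing2)
  next
    case False
    have "1 = \<rho> powr (- \<alpha>) * \<rho> powr \<alpha>" using \<rho> by (simp add: powr_add[symmetric])
    also have "\<dots> \<le> \<rho> powr (- \<alpha>) * norm \<xi> powr \<alpha>"
      using False \<rho> \<alpha> by (intro mult_left_mono powr_mono2) auto
    finally have "1 * (cmod (fourier u \<xi>))\<^sup>2 \<le> \<rho> powr (- \<alpha>) * norm \<xi> powr \<alpha> * (cmod (fourier u \<xi>))\<^sup>2"
      by (rule mult_right_mono) simp
    then show ?thesis using False by (simp add: mult.assoc)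
  qed
  have vol: "(\<integral>\<xi>. indicator (ball (0::real^'n) \<rho>) \<xi> * ?M\<^sup>2 \<partial>lborel) = unit_ball_vol (CARD('n)) * \<rho> ^ CARD('n) * ?M\<^sup>2"
    using \<rho> content_ball[of \<rho> "0::real^'n"] by simp
  have Re: "Re (z * cnj z) = (cmod z)\<^sup>2" for z
    by (simp add: complex_mult_cnj cmod_power2)
  have fr: "(\<integral>\<xi>. norm \<xi> powr \<alpha> * (cmod (fourier u \<xi>))\<^sup>2 \<partial>lborel) = N * frac_form \<alpha> u u"
    by (simp only: frac_form_def N_def Re mult.assoc[symmetric] mult_1 two_pi_powr)
  have "N * ip u u = (\<integral>\<xi>. (cmod (fourier u \<xi>))\<^sup>2 \<partial>lborel)"
    unfolding ip_self N_def by (rule plancherel[OF l2, symmetric])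
  also have "\<dots> \<le> (\<integral>\<xi>. indicator (ball 0 \<rho>) \<xi> * ?M\<^sup>2 + \<rho> powr (- \<alpha>) * (norm \<xi> powr \<alpha> * (cmod (fourier u \<xi>))\<^sup>2) \<partial>lborel)"
    by (intro integral_mono bessel_fourier(1)[OF l2] Bochner_Integration.integrable_add i1 i2 pt)
  also have "\<dots> = unit_ball_vol (CARD('n)) * \<rho> ^ CARD('n) * ?M\<^sup>2 + \<rho> powr (- \<alpha>) * (N * frac_form \<alpha> u u)"
    by (subst Bochner_Integration.integral_add[OF i1 i2]) (simp add: vol fr del: integral_mult_left_zero)
  finally have "ip u u \<le> (unit_ball_vol (CARD('n)) * \<rho> ^ CARD('n) * ?M\<^sup>2 + \<rho> powr (- \<alpha>) * (N * frac_form \<alpha> u u)) / N"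
    using N by (simp add: pos_le_divide_eq mult.commute)
  also have "\<dots> = unit_ball_vol (CARD('n)) / N * \<rho> ^ CARD('n) * ?M\<^sup>2 + \<rho> powr (- \<alpha>) * frac_form \<alpha> u u"
    using N by (simp add: field_simps)
  finally show ?thesis unfolding N_def .
qed

section \<open>Dilations\<close>

lemma fourier_dilation:
  fixes u :: "real^'n \<Rightarrow> real"
  assumes [measurable]: "u \<in> borel_measurable borel" and c: "c > 0"
  shows "fourier (\<lambda>x. u (c *\<^sub>R x)) \<xi> = fourier u (\<xi> /\<^sub>R c) /\<^sub>R c ^ CARD('n)"
proof -
  have "fourier u (\<xi> /\<^sub>R c) = \<bar>c\<bar> ^ DIM(real^'n) *\<^sub>R (\<integral>x. cis (- ((0 + c *\<^sub>R x) \<bullet> (\<xi> /\<^sub>R c))) * complex_of_real (u (0 + c *\<^sub>R x)) \<partial>lborel)"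
    unfolding fourier_def by (rule lborel_integral_affine) (use c in auto)
  also have "\<dots> = c ^ CARD('n) *\<^sub>R fourier (\<lambda>x. u (c *\<^sub>R x)) \<xi>"
  proof -
    have "(0 + c *\<^sub>R x) \<bullet> (\<xi> /\<^sub>R c) = x \<bullet> \<xi>" for x using c by simp
    then show ?thesis using c by (simp only: fourier_def) simp
  qed
  finally show ?thesis using c by simp
qed

text \<open>Each transform gains c^(-d) and its frequencies are stretched by c, so the form scales
  by c^(\<alpha>-d). As the inner product scales by c^(-d), eigenvalues scale by c^\<alpha>.\<close>

lemma frac_form_dilation:
  fixes u v :: "real^'n \<Rightarrow> real"
  assumes u[measurable]: "u \<in> borel_measurable borel" and v[measurable]: "v \<in> borel_measurable borel" and c: "c > 0"
  shows "frac_form \<alpha> (\<lambda>x. u (c *\<^sub>R x)) (\<lambda>x. v (c *\<^sub>R x)) = c powr \<alpha> / c ^ CARD('n) * frac_form \<alpha> u v"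
proof -
  have [measurable]: "fourier u \<in> borel_measurable borel" "fourier v \<in> borel_measurable borel"
    by (rule fourier_measurable; measurable)+
  let ?h = "\<lambda>\<xi>. norm \<xi> powr \<alpha> * Re (fourier u \<xi> * cnj (fourier v \<xi>))"
  have "(\<integral>\<xi>. norm \<xi> powr \<alpha> * Re (fourier (\<lambda>x. u (c *\<^sub>R x)) \<xi> * cnj (fourier (\<lambda>x. v (c *\<^sub>R x)) \<xi>)) \<partial>lborel)
     = (\<integral>\<xi>. c powr \<alpha> / (c ^ CARD('n))\<^sup>2 * ?h (0 + (1 / c) *\<^sub>R \<xi>) \<partial>lborel)"
  proof (rule Bochner_Integration.integral_cong[OF refl])
    fix \<xi> :: "real^'n"
    have 1: "norm \<xi> powr \<alpha> = c powr \<alpha> * norm ((1 / c) *\<^sub>R \<xi>) powr \<alpha>"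
      using c by (simp add: powr_mult[symmetric])
    have 2: "Re ((a /\<^sub>R k) * cnj (b /\<^sub>R k)) = Re (a * cnj b) / k\<^sup>2" for a b :: complex and k :: real
      by (simp add: scaleR_conv_of_real power2_eq_square field_simps add_divide_distrib[symmetric])
    show "norm \<xi> powr \<alpha> * Re (fourier (\<lambda>x. u (c *\<^sub>R x)) \<xi> * cnj (fourier (\<lambda>x. v (c *\<^sub>R x)) \<xi>))
        = c powr \<alpha> / (c ^ CARD('n))\<^sup>2 * ?h (0 + (1 / c) *\<^sub>R \<xi>)"
      unfolding fourier_dilation[OF u c] fourier_dilation[OF v c] 2
      by (subst 1) (simp add: divide_inverse mult_ac)
  qed
  also have "\<dots> = c powr \<alpha> / (c ^ CARD('n))\<^sup>2 * (\<integral>\<xi>. ?h (0 + (1 / c) *\<^sub>R \<xi>) \<partial>lborel)"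
    by (rule integral_mult_right_zero)
  also have "(\<integral>\<xi>. ?h (0 + (1 / c) *\<^sub>R \<xi>) \<partial>lborel) = c ^ CARD('n) * (\<integral>\<xi>. ?h \<xi> \<partial>lborel)"
  proof -
    have "(\<integral>\<xi>. ?h \<xi> \<partial>lborel) = \<bar>1 / c\<bar> ^ DIM(real^'n) *\<^sub>R (\<integral>\<xi>. ?h (0 + (1 / c) *\<^sub>R \<xi>) \<partial>lborel)"
      by (rule lborel_integral_affine) (use c in auto)
    then show ?thesis using c by (simp add: power_divide)
  qed
  finally show ?thesis using c unfolding frac_form_def by (simp add: power2_eq_square)
qed

lemma ip_dilation:
  fixes u v :: "real^'n \<Rightarrow> real"
  assumes [measurable]: "u \<in> borel_measurable borel" "v \<in> borel_measurable borel" and c: "c > 0"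
  shows "ip (\<lambda>x. u (c *\<^sub>R x)) (\<lambda>x. v (c *\<^sub>R x)) = ip u v / c ^ CARD('n)"
proof -
  have "ip u v = \<bar>c\<bar> ^ DIM(real^'n) *\<^sub>R (\<integral>x. u (0 + c *\<^sub>R x) * v (0 + c *\<^sub>R x) \<partial>lborel)"
    unfolding ip_def by (rule lborel_integral_affine) (use c in auto)
  then show ?thesis using c by (simp add: ip_def)
qed

lemma l2_ball_dilation:
  fixes u :: "real^'n \<Rightarrow> real"
  assumes u: "l2_ball R u" and c: "c > 0"
  shows "l2_ball (R / c) (\<lambda>x. u (c *\<^sub>R x))"
proof -
  have [measurable]: "u \<in> borel_measurable borel" by (rule l2_ball_meas[OF u])
  have "integrable lborel (\<lambda>x. (u (0 + c *\<^sub>R x))\<^sup>2)"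
    by (rule lborel_integrable_affine[OF l2_ball_sq[OF u]]) (use c in auto)
  moreover have "u (c *\<^sub>R x) = 0" if "x \<notin> ball 0 (R / c)" for x
    using that u c by (auto simp: l2_ball_def field_simps)
  ultimately show ?thesis by (auto simp: l2_ball_def)
qed

lemma frac_domain_dilation:
  fixes u :: "real^'n \<Rightarrow> real"
  assumes u: "frac_domain \<alpha> R u" and c: "c > 0"
  shows "frac_domain \<alpha> (R / c) (\<lambda>x. u (c *\<^sub>R x))"
proof -
  have um: "u \<in> borel_measurable borel" by (rule l2_ball_meas[OF frac_domain_l2[OF u]])
  have "integrable lborel (\<lambda>\<xi>. c powr \<alpha> / (c ^ CARD('n))\<^sup>2 * (norm (0 + (1 / c) *\<^sub>R \<xi>) powr \<alpha> * (cmod (fourier u (0 + (1 / c) *\<^sub>R \<xi>)))\<^sup>2))"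
    using lborel_integrable_affine[OF frac_domain_integrable[OF u], of "1 / c" 0] c by simp
  moreover have "c powr \<alpha> / (c ^ CARD('n))\<^sup>2 * (norm (0 + (1 / c) *\<^sub>R \<xi>) powr \<alpha> * (cmod (fourier u (0 + (1 / c) *\<^sub>R \<xi>)))\<^sup>2)
      = norm \<xi> powr \<alpha> * (cmod (fourier (\<lambda>x. u (c *\<^sub>R x)) \<xi>))\<^sup>2" for \<xi>
  proof -
    have 1: "norm \<xi> powr \<alpha> = c powr \<alpha> * norm ((1 / c) *\<^sub>R \<xi>) powr \<alpha>"
      using c by (simp add: powr_mult[symmetric])
    show ?thesis unfolding fourier_dilation[OF um c]
      by (subst 1) (use c in \<open>simp add: divide_inverse power_mult_distrib power_inverse mult_ac\<close>)
  qed
  ultimately show ?thesis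
    using l2_ball_dilation[OF frac_domain_l2[OF u] c] by (auto simp: frac_domain_def l2_ball_def)
qed

lemma frac_domain_mono_radius: "frac_domain \<alpha> r u \<Longrightarrow> r \<le> R \<Longrightarrow> frac_domain \<alpha> R u"
  by (auto simp: frac_domain_def)

section \<open>The Dirichlet semigroup\<close>

lemma nn_integral_exp_abs_finite:
  assumes c: "c > 0"
  shows "(\<integral>\<^sup>+(x::real). ennreal (exp (- c * \<bar>x\<bar>)) \<partial>lborel) < \<infinity>"
proof -
  have 1: "(\<integral>\<^sup>+x. ennreal (exp (- c * x)) * indicator {0..} x \<partial>lborel) = ennreal (exp (- c * 0) / c)"
    by (rule nn_integral_has_integral_lebesgue'[OF _ has_integral_exp_minus_to_infinity]) (use c in auto)
  have "(\<integral>\<^sup>+(x::real). ennreal (exp (- c * x)) * indicator {0..} x \<partial>lborel)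
     = ennreal \<bar>-1\<bar> * (\<integral>\<^sup>+x. ennreal (exp (- c * (0 + (-1) * x))) * indicator {0..} (0 + (-1) * x) \<partial>lborel)"
    by (rule nn_integral_real_affine) auto
  then have 2: "(\<integral>\<^sup>+x. ennreal (exp (- c * (- x))) * indicator {0..} (- x) \<partial>lborel) = ennreal (exp (- c * 0) / c)"
    using 1 by simp
  have "(\<integral>\<^sup>+(x::real). ennreal (exp (- c * \<bar>x\<bar>)) \<partial>lborel)
     \<le> (\<integral>\<^sup>+x. ennreal (exp (- c * x)) * indicator {0..} x + ennreal (exp (- c * (- x))) * indicator {0..} (- x) \<partial>lborel)"
    by (intro nn_integral_mono) (auto simp: indicator_def)
  also have "\<dots> < \<infinity>"
    by (subst nn_integral_add) (use 1 2 in auto)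
  finally show ?thesis .
qed

lemma nn_integral_exp_norm_finite:
  assumes c: "c > 0"
  shows "(\<integral>\<^sup>+(x::'a::euclidean_space). ennreal (exp (- c * norm x)) \<partial>lborel) < \<infinity>"
proof -
  define d where "d = c / DIM('a)"
  have d: "d > 0" using c by (simp add: d_def)
  have "exp (- c * norm x) \<le> (\<Prod>b\<in>Basis. exp (- d * \<bar>x \<bullet> b\<bar>))" for x :: 'a
  proof -
    have "(\<Sum>b\<in>Basis. \<bar>x \<bullet> b\<bar>) \<le> (\<Sum>b\<in>(Basis::'a set). norm x)"
      by (intro sum_mono Basis_le_norm)
    then have "d * (\<Sum>b\<in>Basis. \<bar>x \<bullet> b\<bar>) \<le> d * (DIM('a) * norm x)"
      using d by (intro mult_left_mono) auto
    also have "\<dots> = c * norm x" by (simp add: d_def)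
    finally show ?thesis by (simp add: exp_sum[symmetric] sum_distrib_left[symmetric] sum_negf)
  qed
  then have "(\<integral>\<^sup>+(x::'a). ennreal (exp (- c * norm x)) \<partial>lborel) \<le> (\<integral>\<^sup>+(x::'a). (\<Prod>b\<in>Basis. ennreal (exp (- d * \<bar>x \<bullet> b\<bar>))) \<partial>lborel)"
    by (intro nn_integral_mono) (auto simp: prod_ennreal intro!: ennreal_leI)
  also have "\<dots> = (\<Prod>b\<in>(Basis::'a set). \<integral>\<^sup>+x. ennreal (exp (- d * \<bar>x\<bar>)) \<partial>lborel)"
    by (rule nn_integral_lborel_prod) auto
  also have "\<dots> < \<infinity>"
    using nn_integral_exp_abs_finite[OF d]
    by (simp add: power_less_top_ennreal)
  finally show ?thesis .
qed

text \<open>Outside the unit ball |\<xi>| \<le> |\<xi>|^\<alpha>, so exp(-t|\<xi>|) dominates;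
  inside, the integrand is at most 1.\<close>

lemma integrable_exp_norm_powr:
  assumes t: "t > 0" and \<alpha>: "\<alpha> \<ge> 1"
  shows "integrable lborel (\<lambda>\<xi>::real^'n. exp (- t * norm \<xi> powr \<alpha>))"
proof (rule Bochner_Integration.integrable_bound)
  have "integrable lborel (\<lambda>\<xi>::real^'n. exp (- t * norm \<xi>))"
    using nn_integral_exp_norm_finite[OF t, where 'a="real^'n"] by (auto simp: integrable_iff_bounded)
  then show "integrable lborel (\<lambda>\<xi>::real^'n. exp (- t * norm \<xi>) + indicator (ball 0 1) \<xi>)"
    by (intro Bochner_Integration.integrable_add integrable_indicator_ball)
  have "exp (- t * norm \<xi> powr \<alpha>) \<le> exp (- t * norm \<xi>) + indicator (ball 0 1) \<xi>" for \<xi> :: "real^'n"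
  proof (cases "norm \<xi> < 1")
    case True
    have "exp (- t * norm \<xi> powr \<alpha>) \<le> 1" using t by simp
    then show ?thesis using True by (simp add: add_increasing)
  next
    case False
    then have "norm \<xi> powr 1 \<le> norm \<xi> powr \<alpha>" using \<alpha> by (intro powr_mono) auto
    then show ?thesis using False t by simp
  qed
  then show "AE \<xi> in lborel. norm (exp (- t * norm \<xi> powr \<alpha>)) \<le> norm (exp (- t * norm \<xi>) + indicator (ball 0 1) (\<xi>::real^'n))"
    by (intro AE_I2) (auto intro: order.trans[OF _ abs_ge_self])
qed measurable

lemma x_exp_minus_le: "x * exp (- x) \<le> (1::real)"
proof -
  have "x \<le> exp x" using exp_ge_add_one_self[of x] by linarith
  then show ?thesis by (simp add: exp_minus field_simps)
qed

section \<open>Eigenfunction expansions of functions and of the form\<close>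

locale dirichlet_system =
  fixes \<alpha> R :: real and lam :: "nat \<Rightarrow> real" and \<phi> :: "nat \<Rightarrow> real^'n \<Rightarrow> real"
  assumes \<alpha>: "1 < \<alpha>" "\<alpha> \<le> 2" and R: "0 < R" and eigensystem: "dirichlet_eigensystem \<alpha> R lam \<phi>"
begin

abbreviation "L2 \<equiv> l2_ball R"
abbreviation "V \<equiv> frac_domain \<alpha> R"
abbreviation "E \<equiv> frac_form \<alpha>"

definition coef :: "(real^'n \<Rightarrow> real) \<Rightarrow> nat \<Rightarrow> real" where
  "coef g k = ip g (\<phi> k)"

lemma \<alpha>_pos: "0 < \<alpha>" using \<alpha> by simp

lemma V_phi: "V (\<phi> k)"
  using eigensystem by (simp add: dirichlet_eigensystem_def)

lemma L2_phi: "L2 (\<phi> k)"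
  by (rule frac_domain_l2[OF V_phi])

lemma phi_meas[measurable]: "\<phi> k \<in> borel_measurable borel"
  by (rule l2_ball_meas[OF L2_phi])

lemma phi_outside: "x \<notin> ball 0 R \<Longrightarrow> \<phi> k x = 0"
  using L2_phi[of k] by (simp add: l2_ball_def)

lemma ip_phi: "ip (\<phi> k) (\<phi> j) = (if k = j then 1 else 0)"
  using eigensystem by (simp add: dirichlet_eigensystem_def ip_def)

lemma E_phi: "V v \<Longrightarrow> E (\<phi> k) v = lam k * coef v k"
  using eigensystem by (simp add: dirichlet_eigensystem_def ip_def coef_def mult.commute)

lemma parseval: "L2 g \<Longrightarrow> (\<lambda>k. (coef g k)\<^sup>2) sums ip g g"
  using eigensystem by (simp add: dirichlet_eigensystem_def l2_ball_def coef_def ip_def[symmetric] ip_self)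

lemma coef_phi: "coef (\<phi> k) j = (if k = j then 1 else 0)"
  by (simp add: coef_def ip_phi)

lemma coef_add: "L2 u \<Longrightarrow> L2 v \<Longrightarrow> coef (\<lambda>x. u x + v x) k = coef u k + coef v k"
  unfolding coef_def by (rule ip_add[OF _ _ L2_phi])

lemma coef_diff: "L2 u \<Longrightarrow> L2 v \<Longrightarrow> coef (\<lambda>x. u x - v x) k = coef u k - coef v k"
  unfolding coef_def by (rule ip_diff[OF _ _ L2_phi])

lemma summable_coef_sq: "L2 g \<Longrightarrow> summable (\<lambda>k. (coef g k)\<^sup>2)"
  using parseval by (rule sums_summable)

text \<open>Polarization of Parseval's identity, which the eigensystem provides for squares.\<close>

lemma parseval_ip:
  assumes g: "L2 g" and h: "L2 h"
  shows "(\<lambda>k. coef g k * coef h k) sums ip g h"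
proof -
  have p: "L2 (\<lambda>x. g x + h x)" and m: "L2 (\<lambda>x. g x - h x)" by (rule l2_ball_add[OF g h], rule l2_ball_diff[OF g h])
  have "(\<lambda>k. ((coef (\<lambda>x. g x + h x) k)\<^sup>2 - (coef (\<lambda>x. g x - h x) k)\<^sup>2) / 4)
      sums ((ip (\<lambda>x. g x + h x) (\<lambda>x. g x + h x) - ip (\<lambda>x. g x - h x) (\<lambda>x. g x - h x)) / 4)"
    by (intro sums_divide sums_diff parseval p m)
  moreover have "((coef (\<lambda>x. g x + h x) k)\<^sup>2 - (coef (\<lambda>x. g x - h x) k)\<^sup>2) / 4 = coef g k * coef h k" for k
    unfolding coef_add[OF g h] coef_diff[OF g h] by (simp add: power2_eq_square algebra_simps)
  moreover have "(ip (\<lambda>x. g x + h x) (\<lambda>x. g x + h x) - ip (\<lambda>x. g x - h x) (\<lambda>x. g x - h x)) / 4 = ip g h"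
    unfolding ip_add[OF g h p] ip_diff[OF g h m] ip_commute[of g "\<lambda>x. g x + h x"] ip_commute[of h "\<lambda>x. g x + h x"]
      ip_commute[of g "\<lambda>x. g x - h x"] ip_commute[of h "\<lambda>x. g x - h x"]
      ip_add[OF g h g] ip_add[OF g h h] ip_diff[OF g h g] ip_diff[OF g h h] ip_commute[of h g] by simp
  ultimately show ?thesis by simp
qed

lemma abs_mult_le_sq: "\<bar>a * b\<bar> \<le> a\<^sup>2 + (b::real)\<^sup>2"
proof -
  have "0 \<le> (\<bar>a\<bar> - \<bar>b\<bar>)\<^sup>2 + a\<^sup>2 + b\<^sup>2" by simp
  then show ?thesis by (simp add: power2_eq_square abs_mult algebra_simps abs_mult_self_eq)
qed

lemma lam_nonneg: "0 \<le> lam k"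
  using E_phi[OF V_phi, of k k] frac_form_nonneg[of \<alpha> "\<phi> k"] by (simp add: coef_phi)

definition partial :: "(nat \<Rightarrow> real) \<Rightarrow> nat \<Rightarrow> real^'n \<Rightarrow> real" where
  "partial a n x = (\<Sum>k<n. a k * \<phi> k x)"

lemma partial_Suc: "partial a (Suc n) = (\<lambda>x. 1 * partial a n x + a n * \<phi> n x)"
  by (simp add: partial_def fun_eq_iff)

lemma V_partial: "V (partial a n)"
proof (induction n)
  case 0
  show ?case using frac_domain_scale[OF V_phi, of 0 0] by (simp add: partial_def[abs_def])
next
  case (Suc n)
  then show ?case unfolding partial_Suc by (rule frac_domain_lincomb[OF _ V_phi])
qed

lemma L2_partial: "L2 (partial a n)"
  by (rule frac_domain_l2[OF V_partial])

lemma ip_partial: "L2 v \<Longrightarrow> ip (partial a n) v = (\<Sum>k<n. a k * coef v k)"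
proof (induction n)
  case 0
  show ?case by (simp add: partial_def[abs_def] ip_def)
next
  case (Suc n)
  then show ?case unfolding partial_Suc ip_lincomb[OF L2_partial L2_phi Suc.prems]
    by (simp add: coef_def ip_commute)
qed

lemma coef_partial: "coef (partial a n) j = (if j < n then a j else 0)"
  unfolding coef_def[of "partial a n"] ip_partial[OF L2_phi] by (simp add: coef_phi if_distrib cong: if_cong)

lemma E_partial: "V v \<Longrightarrow> E (partial a n) v = (\<Sum>k<n. a k * (lam k * coef v k))"
proof (induction n)
  case 0
  show ?case using frac_form_scale[OF V_phi \<open>V v\<close>, of 0 0] by (simp add: partial_def[abs_def])
next
  case (Suc n)
  then show ?case unfolding partial_Suc frac_form_lincomb[OF V_partial V_phi Suc.prems]
    by (simp add: E_phi)
qed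

lemma ip_partial_self: "ip (partial a n) (partial a n) = (\<Sum>k<n. (a k)\<^sup>2)"
  unfolding ip_partial[OF L2_partial] by (simp add: coef_partial power2_eq_square)

lemma E_partial_self: "E (partial a n) (partial a n) = (\<Sum>k<n. lam k * (a k)\<^sup>2)"
  unfolding E_partial[OF V_partial] by (simp add: coef_partial power2_eq_square mult_ac)

lemma partial_coef_L2_limit:
  assumes u: "L2 u"
  shows "(\<lambda>n. \<integral>x. (partial (coef u) n x - u x)\<^sup>2 \<partial>lborel) \<longlonglongrightarrow> 0"
proof -
  have "(\<integral>x. (partial (coef u) n x - u x)\<^sup>2 \<partial>lborel) = ip u u - (\<Sum>k<n. (coef u k)\<^sup>2)" for n
  proof -
    let ?d = "\<lambda>x. partial (coef u) n x - u x"
    have d: "L2 ?d" by (rule l2_ball_diff[OF L2_partial u])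
    have "ip ?d ?d = ip (partial (coef u) n) ?d - ip u ?d" by (rule ip_diff[OF L2_partial u d])
    also have "\<dots> = ip (partial (coef u) n) (partial (coef u) n) - ip u (partial (coef u) n) - (ip (partial (coef u) n) u - ip u u)"
      unfolding ip_commute[of _ ?d] ip_diff[OF L2_partial u L2_partial] ip_diff[OF L2_partial u u] by simp
    also have "\<dots> = ip u u - (\<Sum>k<n. (coef u k)\<^sup>2)"
      unfolding ip_commute[of u "partial (coef u) n"] ip_partial[OF u] ip_partial_self by (simp add: power2_eq_square)
    finally show ?thesis by (simp add: ip_self)
  qed
  moreover have "(\<lambda>n. ip u u - (\<Sum>k<n. (coef u k)\<^sup>2)) \<longlonglongrightarrow> ip u u - ip u u"
    using parseval[OF u] unfolding sums_def by (intro tendsto_intros)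
  ultimately show ?thesis by simp
qed

text \<open>Non-negativity of E(u - p, u - p) for the partial sums p is Bessel's inequality for the
  form. Conversely, the partial sums converge in L^2 with energies below the sum of the series, so
  lower semicontinuity bounds E(u, u) by it. Thus no energy escapes the eigenfunctions.\<close>

lemma E_self_sums:
  assumes u: "V u"
  shows "(\<lambda>k. lam k * (coef u k)\<^sup>2) sums E u u"
proof -
  have le: "(\<Sum>k<n. lam k * (coef u k)\<^sup>2) \<le> E u u" for n
  proof -
    let ?p = "partial (coef u) n" let ?d = "\<lambda>x. u x - ?p x"
    have d: "V ?d" by (rule frac_domain_diff[OF u V_partial])
    have "0 \<le> E ?d ?d" by (rule frac_form_nonneg)
    also have "E ?d ?d = E u u - E ?p u - (E ?p u - E ?p ?p)"
      unfolding frac_form_diff[OF u V_partial d] frac_form_commute[of \<alpha> _ ?d]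
        frac_form_diff[OF u V_partial u] frac_form_diff[OF u V_partial V_partial] frac_form_commute[of \<alpha> u ?p] by simp
    also have "\<dots> = E u u - (\<Sum>k<n. lam k * (coef u k)\<^sup>2)"
      unfolding E_partial[OF u] E_partial_self by (simp add: power2_eq_square mult_ac)
    finally show ?thesis by simp
  qed
  have s: "summable (\<lambda>k. lam k * (coef u k)\<^sup>2)"
    by (rule summableI_nonneg_bounded[OF _ le]) (simp add: lam_nonneg)
  have "E u u \<le> (\<Sum>k. lam k * (coef u k)\<^sup>2)"
  proof (rule frac_form_lsc(2)[OF V_partial frac_domain_l2[OF u] partial_coef_L2_limit[OF frac_domain_l2[OF u]]])
    show "E (partial (coef u) n) (partial (coef u) n) \<le> (\<Sum>k. lam k * (coef u k)\<^sup>2)" for n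
      unfolding E_partial_self by (rule sum_le_suminf[OF s]) (auto simp: lam_nonneg)
  qed
  moreover have "(\<Sum>k. lam k * (coef u k)\<^sup>2) \<le> E u u" by (rule suminf_le_const[OF s le])
  ultimately show ?thesis using summable_sums[OF s] by simp
qed

lemma E_sums:
  assumes u: "V u" and v: "V v"
  shows "(\<lambda>k. lam k * (coef u k * coef v k)) sums E u v"
proof -
  note l2 = frac_domain_l2[OF u] frac_domain_l2[OF v]
  let ?p = "\<lambda>x. u x + v x" and ?m = "\<lambda>x. u x - v x"
  have p: "V ?p" and m: "V ?m" by (rule frac_domain_add[OF u v], rule frac_domain_diff[OF u v])
  have "(\<lambda>k. (lam k * (coef ?p k)\<^sup>2 - lam k * (coef ?m k)\<^sup>2) / 4) sums ((E ?p ?p - E ?m ?m) / 4)"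
    by (intro sums_divide sums_diff E_self_sums p m)
  moreover have "(lam k * (coef ?p k)\<^sup>2 - lam k * (coef ?m k)\<^sup>2) / 4 = lam k * (coef u k * coef v k)" for k
    unfolding coef_add[OF l2] coef_diff[OF l2] by (simp add: power2_eq_square algebra_simps)
  moreover have "(E ?p ?p - E ?m ?m) / 4 = E u v"
    unfolding frac_form_add[OF u v p] frac_form_diff[OF u v m] frac_form_commute[of \<alpha> u ?p] frac_form_commute[of \<alpha> v ?p]
      frac_form_commute[of \<alpha> u ?m] frac_form_commute[of \<alpha> v ?m]
      frac_form_add[OF u v u] frac_form_add[OF u v v] frac_form_diff[OF u v u] frac_form_diff[OF u v v] frac_form_commute[of \<alpha> v u] by simp
  ultimately show ?thesis by simp
qed

text \<open>Parseval's identity for cos(x \<bullet> \<xi>) and sin(x \<bullet> \<xi>) cut off to the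
  ball: their coefficients are, up to sign, the real and imaginary parts of the transforms of the
  eigenfunctions, and their squares add up to 1 on the ball.\<close>

lemma fourier_phi_sq_sums:
  "(\<lambda>k. (cmod (fourier (\<phi> k) \<xi>))\<^sup>2) sums measure lborel (ball (0::real^'n) R)"
proof -
  have [measurable]: "ball (0::real^'n) R \<in> sets borel" by simp
  define C where "C = (\<lambda>x. cos (x \<bullet> \<xi>) * indicator (ball (0::real^'n) R) x)"
  define S where "S = (\<lambda>x. sin (x \<bullet> \<xi>) * indicator (ball (0::real^'n) R) x)"
  have C: "L2 C"
  proof (rule l2_ball_bounded)
    show "\<bar>C x\<bar> \<le> 1" for x by (simp add: C_def indicator_def)
    show "C x = 0" if "x \<notin> ball 0 R" for x using that by (simp add: C_def)
  qed (unfold C_def, measurable)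
  have S: "L2 S"
  proof (rule l2_ball_bounded)
    show "\<bar>S x\<bar> \<le> 1" for x by (simp add: S_def indicator_def)
    show "S x = 0" if "x \<notin> ball 0 R" for x using that by (simp add: S_def)
  qed (unfold S_def, measurable)
  have f: "(cmod (fourier (\<phi> k) \<xi>))\<^sup>2 = (coef C k)\<^sup>2 + (coef S k)\<^sup>2" for k
  proof -
    have i: "integrable lborel (\<lambda>x. cis (- (x \<bullet> \<xi>)) * complex_of_real (\<phi> k x))"
      by (rule fourier_integrand_integrable[OF l2_ball_integrable[OF L2_phi]])
    have "Re (fourier (\<phi> k) \<xi>) = (\<integral>x. Re (cis (- (x \<bullet> \<xi>)) * complex_of_real (\<phi> k x)) \<partial>lborel)"
      unfolding fourier_def by (rule integral_Re[symmetric, OF i])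
    also have "\<dots> = coef C k"
      unfolding coef_def ip_def C_def using phi_outside[of _ k]
      by (intro Bochner_Integration.integral_cong) (auto simp: indicator_def)
    finally have 1: "Re (fourier (\<phi> k) \<xi>) = coef C k" .
    have "Im (fourier (\<phi> k) \<xi>) = (\<integral>x. Im (cis (- (x \<bullet> \<xi>)) * complex_of_real (\<phi> k x)) \<partial>lborel)"
      unfolding fourier_def by (rule integral_Im[symmetric, OF i])
    also have "\<dots> = - coef S k"
      unfolding coef_def ip_def S_def using phi_outside[of _ k]
      by (subst Bochner_Integration.integral_minus[symmetric], intro Bochner_Integration.integral_cong) (auto simp: indicator_def)
    finally show ?thesis using 1 by (simp add: cmod_power2)
  qed
  have "ip C C + ip S S = (\<integral>x. (C x)\<^sup>2 + (S x)\<^sup>2 \<partial>lborel)"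
    unfolding ip_self using l2_ball_sq[OF C] l2_ball_sq[OF S] by simp
  also have "\<dots> = (\<integral>x. indicator (ball (0::real^'n) R) x \<partial>lborel)"
    by (intro Bochner_Integration.integral_cong) (auto simp: C_def S_def indicator_def)
  finally show ?thesis
    unfolding f using sums_add[OF parseval[OF C] parseval[OF S]] by simp
qed

text \<open>Berezin's argument: by Jensen's inequality for the probability density
  $(2\pi)^{-n} |\widehat{\varphi_k}|^2$, whose mean of $|\xi|^\alpha$ is the eigenvalue.\<close>
lemma summable_exp_lam:
  assumes t: "t > 0"
  shows "summable (\<lambda>k. exp (- lam k * t))"
proof (rule summableI_nonneg_bounded)
  define N where "N = (2 * pi) ^ CARD('n)"
  have N: "N > 0" by (simp add: N_def)
  let ?B = "measure lborel (ball (0::real^'n) R)"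
  have \<alpha>1: "\<alpha> \<ge> 1" using \<alpha> by simp
  note ei = integrable_exp_norm_powr[OF t \<alpha>1, where 'n='n]
  have fm[measurable]: "fourier (\<phi> k) \<in> borel_measurable borel" for k by (rule fourier_measurable) simp
  have ik: "integrable lborel (\<lambda>\<xi>. exp (- t * norm \<xi> powr \<alpha>) * (cmod (fourier (\<phi> k) \<xi>))\<^sup>2)" for k
    by (rule Bochner_Integration.integrable_bound[OF bessel_fourier(1)[OF L2_phi, of k]])
      (use t in \<open>auto simp: abs_mult intro!: mult_left_le_one_le\<close>)
  have J: "N * exp (- lam k * t) \<le> (\<integral>\<xi>. exp (- t * norm \<xi> powr \<alpha>) * (cmod (fourier (\<phi> k) \<xi>))\<^sup>2 \<partial>lborel)" for k
  proof -
    have m1: "(\<integral>\<xi>. (cmod (fourier (\<phi> k) \<xi>))\<^sup>2 \<partial>lborel) = N"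
      unfolding plancherel[OF L2_phi] N_def using ip_phi[of k k] by (simp add: ip_self)
    have Re: "Re (z * cnj z) = (cmod z)\<^sup>2" for z by (simp add: complex_mult_cnj cmod_power2)
    have "lam k = E (\<phi> k) (\<phi> k)" using E_phi[OF V_phi, of k k] by (simp add: coef_phi)
    then have m2: "(\<integral>\<xi>. norm \<xi> powr \<alpha> * (cmod (fourier (\<phi> k) \<xi>))\<^sup>2 \<partial>lborel) = N * lam k"
      by (simp only: frac_form_def N_def Re mult.assoc[symmetric] mult_1 two_pi_powr)
    have i: "integrable lborel (\<lambda>\<xi>. exp (- lam k * t) * (1 + t * lam k) * (cmod (fourier (\<phi> k) \<xi>))\<^sup>2
          - exp (- lam k * t) * t * (norm \<xi> powr \<alpha> * (cmod (fourier (\<phi> k) \<xi>))\<^sup>2))"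
      using bessel_fourier(1)[OF L2_phi, of k] frac_domain_integrable[OF V_phi, of k] by auto
    have "N * exp (- lam k * t) = exp (- lam k * t) * (1 + t * lam k) * N - exp (- lam k * t) * t * (N * lam k)"
      by (simp add: algebra_simps)
    also have "\<dots> = (\<integral>\<xi>. exp (- lam k * t) * (1 + t * lam k) * (cmod (fourier (\<phi> k) \<xi>))\<^sup>2
          - exp (- lam k * t) * t * (norm \<xi> powr \<alpha> * (cmod (fourier (\<phi> k) \<xi>))\<^sup>2) \<partial>lborel)"
      using bessel_fourier(1)[OF L2_phi, of k] frac_domain_integrable[OF V_phi, of k] by (simp add: m1 m2)
    also have "\<dots> \<le> (\<integral>\<xi>. exp (- t * norm \<xi> powr \<alpha>) * (cmod (fourier (\<phi> k) \<xi>))\<^sup>2 \<partial>lborel)"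
    proof (rule integral_mono[OF i ik])
      fix \<xi> :: "real^'n"
      \<comment> \<open>Jensen's inequality in the form of the tangent line: x to exp(-t x) lies
        above its tangent at x = \<open>lam k\<close>, the mean of |\<xi>|^\<alpha>.\<close>
      have "exp (- lam k * t) * (1 + (t * lam k - t * norm \<xi> powr \<alpha>)) \<le> exp (- lam k * t) * exp (t * lam k - t * norm \<xi> powr \<alpha>)"
        by (intro mult_left_mono exp_ge_add_one_self) auto
      also have "\<dots> = exp (- t * norm \<xi> powr \<alpha>)" by (simp add: exp_add[symmetric])
      finally have "exp (- lam k * t) * (1 + (t * lam k - t * norm \<xi> powr \<alpha>)) * (cmod (fourier (\<phi> k) \<xi>))\<^sup>2 \<le> exp (- t * norm \<xi> powr \<alpha>) * (cmod (fourier (\<phi> k) \<xi>))\<^sup>2"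
        by (rule mult_right_mono) simp
      then show "exp (- lam k * t) * (1 + t * lam k) * (cmod (fourier (\<phi> k) \<xi>))\<^sup>2
          - exp (- lam k * t) * t * (norm \<xi> powr \<alpha> * (cmod (fourier (\<phi> k) \<xi>))\<^sup>2) \<le> exp (- t * norm \<xi> powr \<alpha>) * (cmod (fourier (\<phi> k) \<xi>))\<^sup>2"
        by (simp add: algebra_simps)
    qed
    finally show ?thesis .
  qed
  fix n
  show "0 \<le> exp (- lam n * t)" by simp
  have "N * (\<Sum>k<n. exp (- lam k * t)) \<le> (\<Sum>k<n. \<integral>\<xi>. exp (- t * norm \<xi> powr \<alpha>) * (cmod (fourier (\<phi> k) \<xi>))\<^sup>2 \<partial>lborel)"
    unfolding sum_distrib_left by (intro sum_mono J)
  also have "\<dots> = (\<integral>\<xi>. (\<Sum>k<n. exp (- t * norm \<xi> powr \<alpha>) * (cmod (fourier (\<phi> k) \<xi>))\<^sup>2) \<partial>lborel)"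
    by (rule Bochner_Integration.integral_sum[symmetric, OF ik])
  also have "\<dots> \<le> (\<integral>(\<xi>::real^'n). exp (- t * norm \<xi> powr \<alpha>) * ?B \<partial>lborel)"
  proof (rule integral_mono)
    show "integrable lborel (\<lambda>\<xi>. \<Sum>k<n. exp (- t * norm \<xi> powr \<alpha>) * (cmod (fourier (\<phi> k) \<xi>))\<^sup>2)"
      by (intro Bochner_Integration.integrable_sum ik)
    show "integrable lborel (\<lambda>\<xi>::real^'n. exp (- t * norm \<xi> powr \<alpha>) * ?B)" using ei by simp
    fix \<xi> :: "real^'n"
    have "(\<Sum>k<n. (cmod (fourier (\<phi> k) \<xi>))\<^sup>2) \<le> ?B"
      using sum_le_suminf[OF sums_summable[OF fourier_phi_sq_sums], of "{..<n}" \<xi>] sums_unique[OF fourier_phi_sq_sums[of \<xi>]] by auto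
    then show "(\<Sum>k<n. exp (- t * norm \<xi> powr \<alpha>) * (cmod (fourier (\<phi> k) \<xi>))\<^sup>2) \<le> exp (- t * norm \<xi> powr \<alpha>) * ?B"
      unfolding sum_distrib_left[symmetric] by (intro mult_left_mono) auto
  qed
  finally show "(\<Sum>k<n. exp (- lam k * t)) \<le> (\<integral>(\<xi>::real^'n). exp (- t * norm \<xi> powr \<alpha>) * ?B \<partial>lborel) / N"
    using N by (simp add: pos_le_divide_eq mult.commute)
qed

text \<open>The points where the diagonal series of the kernel converges at all positive times.
  Since |ab| \<le> a^2 + b^2, the kernel series converges absolutely at every pair of such points,
  and so does the series of the semigroup at each of them.\<close>

definition good :: "real^'n \<Rightarrow> bool" where
  "good x \<longleftrightarrow> (\<forall>t>0. summable (\<lambda>k. exp (- lam k * t) * (\<phi> k x)\<^sup>2))"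

text \<open>The terms decrease in t, so the countably many times 1/(m+1) suffice. At each of them
  the diagonal series integrates to the trace, the sum of exp(-\<open>lam k\<close> t), which is
  finite.\<close>

lemma good_AE: "AE x in lborel. good x"
proof -
  have "AE x in lborel. summable (\<lambda>k. exp (- lam k * (1 / Suc m)) * (\<phi> k x)\<^sup>2)" for m
  proof -
    let ?f = "\<lambda>k x. exp (- lam k * (1 / Suc m)) * (\<phi> k x)\<^sup>2"
    have t: "1 / real (Suc m) > 0" by simp
    have "(\<integral>\<^sup>+x. (\<Sum>k. ennreal (?f k x)) \<partial>lborel) = (\<Sum>k. \<integral>\<^sup>+x. ennreal (?f k x) \<partial>lborel)"
      by (rule nn_integral_suminf) measurable
    also have "\<dots> = (\<Sum>k. ennreal (exp (- lam k * (1 / Suc m))))"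
    proof (rule suminf_cong)
      fix k
      have "(\<integral>\<^sup>+x. ennreal (?f k x) \<partial>lborel) = ennreal (\<integral>x. ?f k x \<partial>lborel)"
        by (rule nn_integral_eq_integral) (use l2_ball_sq[OF L2_phi, of k] in auto)
      also have "(\<integral>x. ?f k x \<partial>lborel) = exp (- lam k * (1 / Suc m))"
        using ip_phi[of k k] by (simp add: ip_self)
      finally show "(\<integral>\<^sup>+x. ennreal (?f k x) \<partial>lborel) = ennreal (exp (- lam k * (1 / Suc m)))" .
    qed
    also have "\<dots> \<noteq> \<infinity>" using summable_exp_lam[OF t] by (simp add: ennreal_suminf_neq_top)
    finally have "AE x in lborel. (\<Sum>k. ennreal (?f k x)) \<noteq> \<infinity>"
      by (intro nn_integral_PInf_AE) auto
    then show ?thesis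
    proof eventually_elim
      case (elim x)
      then show ?case by (intro summable_suminf_not_top) auto
    qed
  qed
  then have "AE x in lborel. \<forall>m. summable (\<lambda>k. exp (- lam k * (1 / Suc m)) * (\<phi> k x)\<^sup>2)"
    by (simp add: AE_all_countable)
  then show ?thesis
  proof eventually_elim
    case (elim x)
    show ?case unfolding good_def
    proof (intro allI impI)
      fix t :: real assume t: "t > 0"
      then obtain m where m: "1 / real (Suc m) < t" using nat_approx_posE by blast
      show "summable (\<lambda>k. exp (- lam k * t) * (\<phi> k x)\<^sup>2)"
      proof (rule summable_comparison_test'[OF elim[rule_format, of m]])
        fix k
        have "- lam k * t \<le> - lam k * (1 / Suc m)" using m lam_nonneg[of k] by (simp only: mult_minus_left neg_le_iff_le) (intro mult_left_mono, auto)
        then show "norm (exp (- lam k * t) * (\<phi> k x)\<^sup>2) \<le> exp (- lam k * (1 / Suc m)) * (\<phi> k x)\<^sup>2"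
          by (simp add: mult_right_mono)
      qed
    qed
  qed
qed

text \<open>Fatou's lemma bounds the distance from the pointwise sum to a partial sum by the tail of
  the coefficients, so the pointwise sum is also the L^2 sum. Almost everywhere convergence is
  assumed, because the kernel and the semigroup are given as pointwise series.\<close>

lemma riesz_fischer:
  assumes a: "summable (\<lambda>k. (a k)\<^sup>2)" and conv: "AE x in lborel. summable (\<lambda>k. a k * \<phi> k x)"
  defines "u \<equiv> \<lambda>x. \<Sum>k. a k * \<phi> k x"
  shows "L2 u" "coef u k = a k"
proof -
  have um[measurable]: "u \<in> borel_measurable borel" unfolding u_def by measurable
  have out: "u x = 0" if "x \<notin> ball 0 R" for x using phi_outside[OF that] by (simp add: u_def)
  define \<tau> where "\<tau> = (\<lambda>M. \<Sum>k. (a (k + M))\<^sup>2)"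
  have \<tau>0: "0 \<le> \<tau> M" for M unfolding \<tau>_def
    by (rule suminf_nonneg) (use a summable_iff_shift[of "\<lambda>k. (a k)\<^sup>2" M] in auto)
  have \<tau>lim: "\<tau> \<longlonglongrightarrow> 0" unfolding \<tau>_def using suminf_exist_split2[OF a] by simp
  have pm[measurable]: "partial a n \<in> borel_measurable borel" for n by (rule l2_ball_meas[OF L2_partial])
  have tail: "(\<integral>\<^sup>+x. ennreal ((u x - partial a M x)\<^sup>2) \<partial>lborel) \<le> ennreal (\<tau> M)" for M
  proof (rule nn_integral_fatou_le)
    show "(\<lambda>x. (partial a (n + M) x - partial a M x)\<^sup>2) \<in> borel_measurable lborel" for n by measurable
    show "AE x in lborel. (\<lambda>n. (partial a (n + M) x - partial a M x)\<^sup>2) \<longlonglongrightarrow> (u x - partial a M x)\<^sup>2"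
      using conv
    proof eventually_elim
      case (elim x)
      have "(\<lambda>n. partial a n x) \<longlonglongrightarrow> u x"
        unfolding partial_def u_def using summable_LIMSEQ[OF elim] .
      then have "(\<lambda>n. partial a (n + M) x) \<longlonglongrightarrow> u x" by (rule LIMSEQ_ignore_initial_segment)
      then show ?case by (intro tendsto_intros)
    qed
    fix n
    let ?d = "\<lambda>x. partial a (n + M) x - partial a M x"
    have d: "L2 ?d" by (rule l2_ball_diff[OF L2_partial L2_partial])
    have d_eq: "?d = (\<lambda>x. partial (\<lambda>k. if k < M then 0 else a k) (n + M) x)"
    proof
      fix x
      have "(\<Sum>k<n + M. (if k < M then a k * \<phi> k x else 0)) = (\<Sum>k<M. a k * \<phi> k x)"
        by (rule sum.mono_neutral_cong_right) auto
      moreover have "(\<Sum>k<n + M. a k * \<phi> k x) = (\<Sum>k<n + M. (if k < M then a k * \<phi> k x else 0)) + (\<Sum>k<n + M. (if k < M then 0 else a k) * \<phi> k x)"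
        unfolding sum.distrib[symmetric] by (intro sum.cong) auto
      ultimately show "?d x = partial (\<lambda>k. if k < M then 0 else a k) (n + M) x" by (simp add: partial_def)
    qed
    have "(\<integral>\<^sup>+x. ennreal ((?d x)\<^sup>2) \<partial>lborel) = ennreal (ip ?d ?d)"
      unfolding ip_self by (rule nn_integral_eq_integral[OF l2_ball_sq[OF d]]) simp
    also have "ip ?d ?d = (\<Sum>k<n + M. (if k < M then 0 else a k)\<^sup>2)"
      unfolding d_eq by (rule ip_partial_self)
    also have "\<dots> = (\<Sum>k=M..<n + M. (a k)\<^sup>2)"
      by (rule sum.mono_neutral_cong_right) auto
    also have "\<dots> = (\<Sum>k<n. (a (k + M))\<^sup>2)"
      using sum.shift_bounds_nat_ivl[of "\<lambda>k. (a k)\<^sup>2" 0 M n] by (simp add: atLeast0LessThan)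
    also have "\<dots> \<le> \<tau> M" unfolding \<tau>_def
      by (rule sum_le_suminf) (use a summable_iff_shift[of "\<lambda>k. (a k)\<^sup>2" M] in auto)
    finally show "(\<integral>\<^sup>+x. ennreal ((?d x)\<^sup>2) \<partial>lborel) \<le> ennreal (\<tau> M)" by (simp add: ennreal_leI)
  qed
  show u: "L2 u"
    using integrable_nonneg_of_nn_le(1)[OF _ _ tail[of 0] \<tau>0] out by (auto simp: l2_ball_def partial_def)
  have "(\<lambda>M. coef u k - coef (partial a M) k) \<longlonglongrightarrow> 0"
  proof (rule Lim_null_comparison[OF always_eventually])
    show "(\<lambda>M. sqrt (\<tau> M)) \<longlonglongrightarrow> 0" using tendsto_real_sqrt[OF \<tau>lim] by simp
    show "\<forall>M. norm (coef u k - coef (partial a M) k) \<le> sqrt (\<tau> M)"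
    proof
      fix M
      let ?d = "\<lambda>x. u x - partial a M x"
      have d: "L2 ?d" by (rule l2_ball_diff[OF u L2_partial])
      have "ip ?d ?d \<le> \<tau> M"
        unfolding ip_self by (rule integrable_nonneg_of_nn_le(2)[OF _ _ tail \<tau>0]) auto
      moreover have "(coef ?d k)\<^sup>2 \<le> ip ?d ?d * 1"
        using ip_cs[OF d L2_phi, of k] by (simp add: coef_def ip_phi)
      ultimately have "\<bar>coef ?d k\<bar> \<le> sqrt (\<tau> M)" by (intro real_le_rsqrt) simp
      then show "norm (coef u k - coef (partial a M) k) \<le> sqrt (\<tau> M)" by (simp add: coef_diff[OF u L2_partial])
    qed
  qed
  moreover have "\<forall>\<^sub>F M in sequentially. coef u k - coef (partial a M) k = coef u k - a k"
    using eventually_gt_at_top[of k] by eventually_elim (simp add: coef_partial)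
  ultimately have "(\<lambda>M. coef u k - a k) \<longlonglongrightarrow> 0" by (rule Lim_transform_eventually)
  then show "coef u k = a k" by (simp add: LIMSEQ_const_iff)
qed

text \<open>The semigroup in spectral form, real-valued and meant for L^2 data.
  \<open>pk_row\<close> identifies it with the integral against the kernel at every good
  point.\<close>

definition sg :: "real \<Rightarrow> (real^'n \<Rightarrow> real) \<Rightarrow> real^'n \<Rightarrow> real" where
  "sg t v x = (\<Sum>k. exp (- lam k * t) * coef v k * \<phi> k x)"

lemma exp_lam_le_1: "0 \<le> t \<Longrightarrow> exp (- lam k * t) \<le> 1"
  using lam_nonneg[of k] by simp

lemma sg_summable:
  assumes v: "L2 v" and t: "t > 0" and x: "good x"
  shows "summable (\<lambda>k. \<bar>exp (- lam k * t) * coef v k * \<phi> k x\<bar>)"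
proof (rule summable_comparison_test')
  show "summable (\<lambda>k. (coef v k)\<^sup>2 + exp (- lam k * t) * (\<phi> k x)\<^sup>2)"
    using summable_coef_sq[OF v] x t by (intro summable_add) (auto simp: good_def)
  fix k
  have "\<bar>exp (- lam k * t) * coef v k * \<phi> k x\<bar> \<le> exp (- lam k * t) * ((coef v k)\<^sup>2 + (\<phi> k x)\<^sup>2)"
    using abs_mult_le_sq[of "coef v k" "\<phi> k x"] by (simp add: abs_mult mult.assoc)
  also have "\<dots> \<le> (coef v k)\<^sup>2 + exp (- lam k * t) * (\<phi> k x)\<^sup>2"
    using mult_right_mono[OF exp_lam_le_1[of t k], of "(coef v k)\<^sup>2"] t by (simp add: ring_distribs)
  finally show "norm (\<bar>exp (- lam k * t) * coef v k * \<phi> k x\<bar>) \<le> (coef v k)\<^sup>2 + exp (- lam k * t) * (\<phi> k x)\<^sup>2" by simp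
qed

lemma sg_coef_summable:
  assumes v: "L2 v" and t: "t \<ge> 0"
  shows "summable (\<lambda>k. (exp (- lam k * t) * coef v k)\<^sup>2)"
proof (rule summable_comparison_test'[OF summable_coef_sq[OF v]])
  fix k
  have "(exp (- lam k * t))\<^sup>2 \<le> 1" using exp_lam_le_1[OF t, of k] by (simp add: abs_square_le_1)
  then show "norm ((exp (- lam k * t) * coef v k)\<^sup>2) \<le> (coef v k)\<^sup>2"
    by (simp add: power_mult_distrib mult_left_le_one_le)
qed

lemma sg_L2: "L2 v \<Longrightarrow> t > 0 \<Longrightarrow> L2 (sg t v)"
  and coef_sg: "L2 v \<Longrightarrow> t > 0 \<Longrightarrow> coef (sg t v) k = exp (- lam k * t) * coef v k"
proof -
  assume v: "L2 v" and t: "t > 0"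
  have "AE x in lborel. summable (\<lambda>k. exp (- lam k * t) * coef v k * \<phi> k x)"
    using good_AE by eventually_elim (rule summable_rabs_cancel[OF sg_summable[OF v t]])
  from riesz_fischer[OF sg_coef_summable[OF v less_imp_le[OF t]] this]
  show "L2 (sg t v)" "coef (sg t v) k = exp (- lam k * t) * coef v k"
    unfolding sg_def[abs_def] by auto
qed

lemma lam_exp_le: "t > 0 \<Longrightarrow> lam k * exp (- lam k * t) \<le> 1 / t"
  using x_exp_minus_le[of "lam k * t"] by (simp add: field_simps)

text \<open>The bound \<lambda> e^(-\<lambda>t) \<le> 1/t makes the energies of the partial sums
  bounded, and the form is lower semicontinuous.\<close>

lemma sg_V:
  assumes v: "L2 v" and t: "t > 0"
  shows "V (sg t v)"
proof (rule frac_form_lsc(1)[OF V_partial sg_L2[OF v t] partial_coef_L2_limit[OF sg_L2[OF v t]]])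
  fix n
  have "E (partial (coef (sg t v)) n) (partial (coef (sg t v)) n) = (\<Sum>k<n. lam k * (exp (- lam k * t) * coef v k)\<^sup>2)"
    unfolding E_partial_self coef_sg[OF v t] ..
  also have "\<dots> \<le> (\<Sum>k<n. 1 / t * (coef v k)\<^sup>2)"
  proof (rule sum_mono)
    fix k
    have "lam k * (exp (- lam k * t))\<^sup>2 \<le> lam k * exp (- lam k * t) * 1"
      unfolding power2_eq_square mult.assoc[symmetric]
      by (intro mult_left_mono exp_lam_le_1) (use t lam_nonneg in auto)
    also have "\<dots> \<le> 1 / t" using lam_exp_le[OF t] by simp
    finally have "lam k * (exp (- lam k * t))\<^sup>2 * (coef v k)\<^sup>2 \<le> 1 / t * (coef v k)\<^sup>2"
      by (rule mult_right_mono) simp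
    then show "lam k * (exp (- lam k * t) * coef v k)\<^sup>2 \<le> 1 / t * (coef v k)\<^sup>2"
      by (simp add: power_mult_distrib mult.assoc)
  qed
  also have "\<dots> = 1 / t * (\<Sum>k<n. (coef v k)\<^sup>2)" by (simp add: sum_distrib_left)
  also have "\<dots> \<le> 1 / t * (\<Sum>k. (coef v k)\<^sup>2)"
    using t by (intro mult_left_mono sum_le_suminf[OF summable_coef_sq[OF v]]) auto
  finally show "E (partial (coef (sg t v)) n) (partial (coef (sg t v)) n) \<le> 1 / t * (\<Sum>k. (coef v k)\<^sup>2)" .
qed

lemma ip_sg_sums:
  assumes v: "L2 v" and w: "L2 w" and t: "t > 0"
  shows "(\<lambda>k. exp (- lam k * t) * (coef v k * coef w k)) sums ip (sg t v) w"
  using parseval_ip[OF sg_L2[OF v t] w] by (simp add: coef_sg[OF v t] mult.assoc)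

lemma ip_sg_commute: "L2 v \<Longrightarrow> L2 w \<Longrightarrow> t > 0 \<Longrightarrow> ip (sg t v) w = ip v (sg t w)"
  using sums_unique2[OF ip_sg_sums[of v w t]] ip_sg_sums[of w v t] by (simp add: ip_commute[of v] mult.commute)

end

section \<open>The sub-Markov property\<close>

lemma AE_in_interior_cbox:
  fixes c d :: "'a::euclidean_space"
  shows "AE x in lborel. x \<in> cbox c d \<longrightarrow> x \<in> box c d"
proof (rule AE_I)
  have "emeasure lborel (cbox c d - box c d) = emeasure lborel (cbox c d) - emeasure lborel (box c d)"
    using box_subset_cbox by (intro emeasure_Diff) (auto simp: emeasure_lborel_box_eq)
  also have "\<dots> = 0" by (simp add: emeasure_lborel_box_eq emeasure_lborel_cbox_eq)
  finally show "emeasure lborel (cbox c d - box c d) = 0" .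
qed auto

text \<open>Let \<mu> and \<nu> have the positive and the negative part of g as densities. The
  hypothesis says \<nu> \<le> \<mu> on open boxes, hence on countable disjoint unions of them. A
  bounded piece S of the set where g < 0 is covered by non-overlapping boxes of nearly the same
  total measure; \<mu> vanishes on S and is small on the excess, so \<nu>(S) = 0. It is applied to
  the kernel on the product space.\<close>

lemma AE_nonneg_of_box_integrals:
  fixes g :: "'a::euclidean_space \<Rightarrow> real"
  assumes g: "integrable lborel g" and box: "\<And>c d. 0 \<le> (\<integral>x. indicator (box c d) x * g x \<partial>lborel)"
  shows "AE x in lborel. 0 \<le> g x"
proof -
  have gm[measurable]: "g \<in> borel_measurable borel" using g by auto
  define gp where "gp = (\<lambda>x. max 0 (g x))"
  define gn where "gn = (\<lambda>x. max 0 (- g x))"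
  have [measurable]: "gp \<in> borel_measurable borel" "gn \<in> borel_measurable borel"
    unfolding gp_def gn_def by measurable
  have ip: "integrable lborel gp" "integrable lborel gn" unfolding gp_def gn_def using g by auto
  define \<mu> where "\<mu> = density lborel (\<lambda>x. ennreal (gp x))"
  define \<nu> where "\<nu> = density lborel (\<lambda>x. ennreal (gn x))"
  have em: "emeasure \<mu> A = (\<integral>\<^sup>+x. ennreal (gp x) * indicator A x \<partial>lborel)"
           "emeasure \<nu> A = (\<integral>\<^sup>+x. ennreal (gn x) * indicator A x \<partial>lborel)" if "A \<in> sets borel" for A
    using that unfolding \<mu>_def \<nu>_def by (auto intro!: emeasure_density)
  have sets[simp, measurable_cong]: "sets \<mu> = sets borel" "sets \<nu> = sets borel" by (auto simp: \<mu>_def \<nu>_def)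
  have box': "emeasure \<nu> (box c d) \<le> emeasure \<mu> (box c d)" for c d
  proof -
    have i1: "integrable lborel (\<lambda>x. indicator (box c d) x * gp x)" "integrable lborel (\<lambda>x. indicator (box c d) x * gn x)"
      using integrable_mult_indicator[OF _ ip(1), of "box c d"] integrable_mult_indicator[OF _ ip(2), of "box c d"] by auto
    have "(\<integral>x. indicator (box c d) x * g x \<partial>lborel) = (\<integral>x. indicator (box c d) x * gp x - indicator (box c d) x * gn x \<partial>lborel)"
      by (intro Bochner_Integration.integral_cong) (auto simp: gp_def gn_def max_def)
    also have "\<dots> = (\<integral>x. indicator (box c d) x * gp x \<partial>lborel) - (\<integral>x. indicator (box c d) x * gn x \<partial>lborel)"
      using i1 by simp
    finally have le: "(\<integral>x. indicator (box c d) x * gn x \<partial>lborel) \<le> (\<integral>x. indicator (box c d) x * gp x \<partial>lborel)"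
      using box[of c d] by simp
    have "emeasure \<nu> (box c d) = (\<integral>\<^sup>+x. ennreal (indicator (box c d) x * gn x) \<partial>lborel)"
      by (subst em) (auto intro!: nn_integral_cong simp: indicator_def)
    also have "\<dots> = ennreal (\<integral>x. indicator (box c d) x * gn x \<partial>lborel)"
      by (rule nn_integral_eq_integral[OF i1(2)]) (auto simp: gn_def)
    also have "\<dots> \<le> ennreal (\<integral>x. indicator (box c d) x * gp x \<partial>lborel)" by (rule ennreal_leI[OF le])
    also have "\<dots> = (\<integral>\<^sup>+x. ennreal (indicator (box c d) x * gp x) \<partial>lborel)"
      by (rule nn_integral_eq_integral[OF i1(1), symmetric]) (auto simp: gp_def)
    also have "\<dots> = emeasure \<mu> (box c d)"
      by (subst em) (auto intro!: nn_integral_cong simp: indicator_def)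
    finally show ?thesis .
  qed
  have main: "emeasure \<nu> ({x. g x < 0} \<inter> cbox a b) = 0" for a b
  proof -
    define S where "S = {x. g x < 0} \<inter> cbox a b"
    have S[measurable]: "S \<in> sets borel" unfolding S_def by measurable
    have fm: "S \<in> lmeasurable"
      using S by (intro bounded_set_imp_lmeasurable) (auto simp: S_def intro: bounded_subset[OF bounded_cbox])
    have "emeasure \<nu> S \<le> 0 + ennreal e" if e: "e > 0" for e
    proof -
      \<comment> \<open>Absolute continuity of \<mu>, by truncation: the part of the density above
        level K has integral below e/2, the part below K costs K times the excess measure.\<close>
      have "(\<lambda>K. \<integral>x. max 0 (gp x - real K) \<partial>lborel) \<longlonglongrightarrow> (\<integral>x. 0 \<partial>(lborel::'a measure))"
      proof (rule integral_dominated_convergence[OF _ _ ip(1)])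
        show "AE x in lborel. (\<lambda>K. max 0 (gp x - real K)) \<longlonglongrightarrow> 0"
        proof (rule AE_I2)
          fix x
          obtain N :: nat where "gp x \<le> N" using real_arch_simple by blast
          then have "\<forall>\<^sub>F K in sequentially. max 0 (gp x - real K) = 0"
            unfolding eventually_sequentially by (intro exI[of _ N]) auto
          then show "(\<lambda>K. max 0 (gp x - real K)) \<longlonglongrightarrow> 0" by (rule tendsto_eventually)
        qed
        show "AE x in lborel. norm (max 0 (gp x - real i)) \<le> gp x" for i by (auto simp: gp_def)
      qed auto
      then have "\<forall>\<^sub>F K in sequentially. (\<integral>x. max 0 (gp x - real K) \<partial>lborel) < e / 2"
        using e by (intro order_tendstoD(2)) auto
      then obtain K :: nat where K: "(\<integral>x. max 0 (gp x - real K) \<partial>lborel) < e / 2"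
        by (auto simp: eventually_sequentially)
      have iK: "integrable lborel (\<lambda>x. max 0 (gp x - real K))"
        by (rule Bochner_Integration.integrable_bound[OF ip(1)]) (auto simp: gp_def)
      \<comment> \<open>The excess measure allowed to the cover, so that K \<delta> \<le> e/2; the +
        1 keeps the denominator positive for K = 0.\<close>
      define \<delta> where "\<delta> = e / 2 / (real K + 1)"
      have \<delta>: "\<delta> > 0" using e by (simp add: \<delta>_def)
      obtain \<D> where D: "countable \<D>" "\<And>K. K \<in> \<D> \<Longrightarrow> K \<subseteq> cbox a b \<and> K \<noteq> {} \<and> (\<exists>c d. K = cbox c d)"
        "pairwise (\<lambda>A B. interior A \<inter> interior B = {}) \<D>" "S \<subseteq> \<Union>\<D>" "\<Union>\<D> \<in> lmeasurable"
        "measure lebesgue (\<Union>\<D>) \<le> measure lebesgue S + \<delta>"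
        using measurable_outer_intervals_bounded[OF fm _ \<delta>, of a b] unfolding S_def by (metis Int_lower2)
      define T where "T = (\<Union>K\<in>\<D>. interior K)"
      have Tb[measurable]: "T \<in> sets borel" unfolding T_def by (intro borel_open open_UN) auto
      have UDb[measurable]: "\<Union>\<D> \<in> sets borel"
        using D(1,2) by (intro sets.countable_Union) (auto dest!: D(2))
      \<comment> \<open>Faces of boxes are null sets, so passing to the interiors, which are
        pairwise disjoint, loses nothing.\<close>
      have ST: "AE x in lborel. x \<in> \<Union>\<D> \<longrightarrow> x \<in> T"
      proof -
        have "AE x in lborel. \<forall>K\<in>\<D>. x \<in> K \<longrightarrow> x \<in> interior K"
        proof (rule AE_ball_countable[THEN iffD2, OF D(1)], rule ballI)
          fix K assume "K \<in> \<D>"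
          from D(2)[OF this] obtain c d where "K = cbox c d" by blast
          then show "AE x in lborel. x \<in> K \<longrightarrow> x \<in> interior K" using AE_in_interior_cbox[of c d] by (simp add: interior_cbox)
        qed
        then show ?thesis by eventually_elim (auto simp: T_def)
      qed
      have diff: "emeasure lborel (T - S) \<le> ennreal \<delta>"
      proof -
        have "emeasure lborel (T - S) \<le> emeasure lborel (\<Union>\<D> - S)"
          by (intro emeasure_mono) (auto simp: T_def dest: interior_subset[THEN subsetD])
        also have "\<dots> = emeasure lebesgue (\<Union>\<D> - S)" by simp
        also have "\<dots> = ennreal (measure lebesgue (\<Union>\<D> - S))"
          using D(5) fm by (intro emeasure_eq_measure2 fmeasurable.Diff)
        also have "measure lebesgue (\<Union>\<D> - S) = measure lebesgue (\<Union>\<D>) - measure lebesgue S"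
          using D(4,5) fm by (simp add: measurable_measure_Diff fmeasurableD)
        also have "ennreal \<dots> \<le> ennreal \<delta>" using D(6) by (intro ennreal_leI) simp
        finally show ?thesis .
      qed
      have disj: "disjoint_family_on interior \<D>"
        using D(3) by (auto simp: disjoint_family_on_def pairwise_def)
      have "emeasure \<nu> S \<le> emeasure \<nu> T"
      proof (rule emeasure_mono_AE)
        show "AE x in \<nu>. x \<in> S \<longrightarrow> x \<in> T"
          unfolding \<nu>_def using ST D(4) by (subst AE_density) (auto elim!: eventually_mono)
      qed simp
      also have "\<dots> = (\<integral>\<^sup>+K. emeasure \<nu> (interior K) \<partial>count_space \<D>)"
        unfolding T_def by (rule emeasure_UN_countable[OF _ D(1) disj]) auto
      also have "\<dots> \<le> (\<integral>\<^sup>+K. emeasure \<mu> (interior K) \<partial>count_space \<D>)"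
      proof (rule nn_integral_mono)
        fix K assume "K \<in> space (count_space \<D>)"
        then have "K \<in> \<D>" by simp
        from D(2)[OF this] obtain c d where "K = cbox c d" by blast
        then show "emeasure \<nu> (interior K) \<le> emeasure \<mu> (interior K)" using box'[of c d] by (simp add: interior_cbox)
      qed
      also have "\<dots> = emeasure \<mu> T"
        unfolding T_def by (rule emeasure_UN_countable[symmetric, OF _ D(1) disj]) auto
      also have "\<dots> \<le> (\<integral>\<^sup>+x. ennreal K * indicator (T - S) x + ennreal (max 0 (gp x - real K)) \<partial>lborel)"
      proof (subst em(1), simp, rule nn_integral_mono)
        fix x
        show "ennreal (gp x) * indicator T x \<le> ennreal K * indicator (T - S) x + ennreal (max 0 (gp x - real K))"
        proof (cases "x \<in> S")
          case True then show ?thesis by (simp add: S_def gp_def)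
        next
          case False
          have "ennreal (gp x) \<le> ennreal (K + max 0 (gp x - real K))" by (intro ennreal_leI) auto
          then have "ennreal (gp x) \<le> ennreal K + ennreal (max 0 (gp x - real K))" by (simp add: ennreal_plus[symmetric] del: ennreal_plus)
          then show ?thesis using False by (auto simp: indicator_def)
        qed
      qed
      also have "\<dots> = ennreal K * emeasure lborel (T - S) + ennreal (\<integral>x. max 0 (gp x - real K) \<partial>lborel)"
        by (subst nn_integral_add) (auto simp: nn_integral_cmult_indicator nn_integral_eq_integral[OF iK])
      also have "\<dots> \<le> ennreal K * ennreal \<delta> + ennreal (e / 2)"
        using K by (intro add_mono mult_left_mono diff ennreal_leI) auto
      also have "\<dots> = ennreal (K * \<delta> + e / 2)" using \<delta> e by (simp add: ennreal_mult)
      also have "\<dots> \<le> ennreal e"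
      proof (rule ennreal_leI)
        have "real K * \<delta> \<le> (real K + 1) * \<delta>" using \<delta> by (intro mult_right_mono) auto
        also have "\<dots> = e / 2"
        proof -
          have "0 < real K + 1" by simp
          then have "(real K + 1) * (x / (real K + 1)) = x" for x by simp
          then show ?thesis unfolding \<delta>_def .
        qed
        finally show "real K * \<delta> + e / 2 \<le> e" by simp
      qed
      finally show ?thesis by simp
    qed
    then have "emeasure \<nu> S \<le> 0" by (rule ennreal_le_epsilon)
    then show ?thesis by (simp add: S_def)
  qed
  have "AE x in lborel. \<not> (g x < 0 \<and> x \<in> cbox (- real m *\<^sub>R One) (real m *\<^sub>R One))" for m :: nat
  proof -
    let ?S = "{x. g x < 0} \<inter> cbox (- real m *\<^sub>R One) (real m *\<^sub>R One :: 'a)"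
    have "AE x in lborel. ennreal (gn x) * indicator ?S x = 0"
      using main[of "- real m *\<^sub>R One" "real m *\<^sub>R One"] by (subst nn_integral_0_iff_AE[symmetric]) (auto simp: em(2))
    then show ?thesis
      by eventually_elim (auto simp: gn_def indicator_def ennreal_eq_0_iff split: if_splits)
  qed
  then have "AE x in lborel. \<forall>m::nat. \<not> (g x < 0 \<and> x \<in> cbox (- real m *\<^sub>R One) (real m *\<^sub>R One))"
    by (intro AE_all_countable[THEN iffD2] allI)
  then show ?thesis
  proof eventually_elim
    case (elim x)
    obtain m :: nat where m: "norm x \<le> m" using real_arch_simple by blast
    have "x \<in> cbox (- real m *\<^sub>R One) (real m *\<^sub>R One)"
      unfolding mem_box
    proof
      fix i :: 'a assume "i \<in> Basis"
      then have "\<bar>x \<bullet> i\<bar> \<le> m" using Basis_le_norm[of i x] m by linarith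
      then show "(- real m *\<^sub>R One) \<bullet> i \<le> x \<bullet> i \<and> x \<bullet> i \<le> (real m *\<^sub>R One) \<bullet> i" using \<open>i \<in> Basis\<close> by auto
    qed
    then show ?case using elim[rule_format, of m] by simp
  qed
qed

text \<open>Cutting [a,b] into n+1 equal pieces leaves a total error C(b-a)^2/(n+1). This stands in
  for a differential inequality h' \<le> 0, with h never differentiated.\<close>

lemma quadratic_increment_decreasing:
  fixes h :: "real \<Rightarrow> real"
  assumes ab: "a < b" and inc: "\<And>s t. a \<le> s \<Longrightarrow> s < t \<Longrightarrow> t \<le> b \<Longrightarrow> h t - h s \<le> C * (t - s)\<^sup>2"
  shows "h b \<le> h a"
proof -
  have le: "h b - h a \<le> C * (b - a)\<^sup>2 * (1 / real (Suc n))" for n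
  proof -
    define \<delta> where "\<delta> = (b - a) / Suc n"
    have \<delta>: "\<delta> > 0" "Suc n * \<delta> = b - a" using ab by (auto simp: \<delta>_def)
    have "h b - h a = (\<Sum>i<Suc n. h (a + Suc i * \<delta>) - h (a + i * \<delta>))"
      using sum_lessThan_telescope[of "\<lambda>i. h (a + i * \<delta>)" "Suc n"] \<delta>(2) by simp
    also have "\<dots> \<le> (\<Sum>i<Suc n. C * \<delta>\<^sup>2)"
    proof (rule sum_mono)
      fix i assume i: "i \<in> {..<Suc n}"
      have "Suc i * \<delta> \<le> Suc n * \<delta>" using i \<delta> by (intro mult_right_mono) auto
      then have "a + Suc i * \<delta> \<le> b" using \<delta>(2) by linarith
      moreover have "a + i * \<delta> < a + Suc i * \<delta>" using \<delta> by (simp add: algebra_simps)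
      moreover have "a \<le> a + i * \<delta>" using \<delta> by simp
      ultimately have "h (a + Suc i * \<delta>) - h (a + i * \<delta>) \<le> C * ((a + Suc i * \<delta>) - (a + i * \<delta>))\<^sup>2"
        by (intro inc)
      then show "h (a + Suc i * \<delta>) - h (a + i * \<delta>) \<le> C * \<delta>\<^sup>2" by (simp add: algebra_simps)
    qed
    also have "\<dots> = C * (b - a)\<^sup>2 * (1 / real (Suc n))"
      by (simp add: \<delta>_def power2_eq_square del: of_nat_Suc)
    finally show ?thesis .
  qed
  have "(\<lambda>n. C * (b - a)\<^sup>2 * (1 / real (Suc n))) \<longlonglongrightarrow> C * (b - a)\<^sup>2 * 0"
    by (intro tendsto_mult tendsto_const LIMSEQ_inverse_real_of_nat[unfolded inverse_eq_divide])
  then have "h b - h a \<le> C * (b - a)\<^sup>2 * 0"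
    by (rule LIMSEQ_le_const) (use le in auto)
  then show ?thesis by simp
qed

lemma exp_second_order: "0 \<le> x \<Longrightarrow> \<bar>exp x - 1 - x\<bar> \<le> x\<^sup>2 * exp (x::real)"
proof -
  assume x: "0 \<le> x"
  have "1 - x \<le> exp (- x)" using exp_ge_add_one_self[of "- x"] by simp
  then have "(1 - x) * exp x \<le> exp (- x) * exp x" by (intro mult_right_mono) auto
  then have 1: "exp x - 1 \<le> x * exp x" by (simp add: exp_minus algebra_simps)
  have "exp x - 1 - x \<le> x * (exp x - 1)" using 1 by (simp add: algebra_simps)
  also have "\<dots> \<le> x * (x * exp x)" using 1 x by (intro mult_left_mono) auto
  finally have "exp x - 1 - x \<le> x\<^sup>2 * exp x" by (simp add: power2_eq_square mult.assoc)
  moreover have "0 \<le> exp x - 1 - x" using exp_ge_add_one_self[of x] by linarith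
  ultimately show ?thesis by simp
qed

lemma sums_abs_le:
  fixes f :: "nat \<Rightarrow> real"
  assumes "f sums S" "\<And>k. \<bar>f k\<bar> \<le> g k" "g sums T"
  shows "\<bar>S\<bar> \<le> T"
proof -
  have s: "summable (\<lambda>k. \<bar>f k\<bar>)"
    by (rule summable_comparison_test'[OF sums_summable[OF assms(3)]]) (use assms(2) in auto)
  have "\<bar>S\<bar> = \<bar>suminf f\<bar>" using sums_unique[OF assms(1)] by simp
  also have "\<dots> \<le> (\<Sum>k. \<bar>f k\<bar>)" by (rule summable_rabs[OF s])
  also have "\<dots> \<le> suminf g" by (rule suminf_le[OF assms(2) s sums_summable[OF assms(3)]])
  finally show ?thesis using sums_unique[OF assms(3)] by simp
qed

context dirichlet_system
begin

text \<open>Dominated convergence for series.\<close>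

lemma exp_lam_limit:
  assumes g: "summable (\<lambda>k. \<bar>g k\<bar>)"
  shows "(\<lambda>m. \<Sum>k. (1 - exp (- lam k * (1 / real (Suc m)))) * g k) \<longlonglongrightarrow> 0"
proof -
  have "((\<lambda>m. \<Sum>k. (1 - exp (- lam k * (1 / real (Suc m)))) * g k) \<longlonglongrightarrow> (\<Sum>k. (1 - exp (- lam k * 0)) * g k))"
  proof (rule tannerys_theorem[THEN conjunct2, THEN conjunct2])
    show "(\<lambda>m. (1 - exp (- lam k * (1 / real (Suc m)))) * g k) \<longlonglongrightarrow> (1 - exp (- lam k * 0)) * g k" for k
      by (intro tendsto_mult tendsto_diff tendsto_exp tendsto_const LIMSEQ_inverse_real_of_nat[unfolded inverse_eq_divide])
    have "norm ((1 - exp (- lam k * (1 / real (Suc m)))) * g k) \<le> \<bar>g k\<bar>" for k m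
      unfolding real_norm_def abs_mult
    proof (rule mult_left_le_one_le)
      have "exp (- lam k * (1 / real (Suc m))) \<le> 1" by (rule exp_lam_le_1) simp
      then show "\<bar>1 - exp (- lam k * (1 / real (Suc m)))\<bar> \<le> 1" by (simp add: abs_if)
    qed auto
    then show "\<forall>\<^sub>F (k, m) in at_top \<times>\<^sub>F sequentially. norm ((1 - exp (- lam k * (1 / real (Suc m)))) * g k) \<le> \<bar>g k\<bar>"
      by (intro always_eventually) auto
  qed (use g in auto)
  then show ?thesis by simp
qed

text \<open>First-order Taylor expansion in time, based at the later time t, where the derivative is
  -E(S(t)v, w). The remainder is uniform for s \<ge> a because \<lambda>^2 e^(-\<lambda>s) is the
  square of \<lambda> e^(-\<lambda>s/2) \<le> 2/s.\<close>

lemma sg_increment: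
  assumes v: "L2 v" and w: "V w" and a: "0 < a" "a \<le> s" "s < t"
  shows "\<bar>ip (sg t v) w - ip (sg s v) w + (t - s) * E (sg t v) w\<bar> \<le> (2 / a)\<^sup>2 * (t - s)\<^sup>2 * (ip v v + ip w w)"
proof -
  have w2: "L2 w" by (rule frac_domain_l2[OF w])
  have st: "0 < s" "0 < t" using a by auto
  define \<delta> where "\<delta> = t - s"
  have \<delta>: "\<delta> > 0" using a by (simp add: \<delta>_def)
  have "(\<lambda>k. exp (- lam k * t) * (coef v k * coef w k) - exp (- lam k * s) * (coef v k * coef w k)
      + (t - s) * (lam k * (coef (sg t v) k * coef w k))) sums (ip (sg t v) w - ip (sg s v) w + (t - s) * E (sg t v) w)"
    by (intro sums_add sums_diff sums_mult ip_sg_sums v w2 st E_sums sg_V w)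
  moreover have "\<bar>exp (- lam k * t) * (coef v k * coef w k) - exp (- lam k * s) * (coef v k * coef w k)
      + (t - s) * (lam k * (coef (sg t v) k * coef w k))\<bar> \<le> (2 / a)\<^sup>2 * (t - s)\<^sup>2 * ((coef v k)\<^sup>2 + (coef w k)\<^sup>2)" for k
  proof -
    have x: "0 \<le> lam k * \<delta>" using lam_nonneg \<delta> by simp
    have e: "exp (- lam k * s) = exp (- lam k * t) * exp (lam k * \<delta>)"
      by (simp add: exp_add[symmetric] \<delta>_def algebra_simps)
    have "exp (- lam k * t) * (coef v k * coef w k) - exp (- lam k * s) * (coef v k * coef w k)
      + (t - s) * (lam k * (coef (sg t v) k * coef w k))
      = - (exp (- lam k * t) * (exp (lam k * \<delta>) - 1 - lam k * \<delta>)) * (coef v k * coef w k)"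
      unfolding coef_sg[OF v st(2)] e by (simp add: \<delta>_def algebra_simps)
    moreover have "\<bar>- (exp (- lam k * t) * (exp (lam k * \<delta>) - 1 - lam k * \<delta>)) * (coef v k * coef w k)\<bar>
        = exp (- lam k * t) * \<bar>exp (lam k * \<delta>) - 1 - lam k * \<delta>\<bar> * \<bar>coef v k * coef w k\<bar>"
      by (simp add: abs_mult)
    moreover have "\<dots> \<le> ((2 / a)\<^sup>2 * \<delta>\<^sup>2) * ((coef v k)\<^sup>2 + (coef w k)\<^sup>2)"
    proof (rule mult_mono[OF _ abs_mult_le_sq])
      have "exp (- lam k * t) * \<bar>exp (lam k * \<delta>) - 1 - lam k * \<delta>\<bar> \<le> exp (- lam k * t) * ((lam k * \<delta>)\<^sup>2 * exp (lam k * \<delta>))"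
        by (intro mult_left_mono exp_second_order[OF x]) simp
      also have "\<dots> = ((lam k)\<^sup>2 * exp (- lam k * s)) * \<delta>\<^sup>2" unfolding e by (simp add: power_mult_distrib mult_ac)
      also have "(lam k)\<^sup>2 * exp (- lam k * s) = (lam k * exp (- lam k * (s / 2)))\<^sup>2"
        by (simp add: power_mult_distrib power2_eq_square exp_add[symmetric] algebra_simps)
      also have "(lam k * exp (- lam k * (s / 2)))\<^sup>2 * \<delta>\<^sup>2 \<le> (2 / a)\<^sup>2 * \<delta>\<^sup>2"
      proof (rule mult_right_mono)
        show "(lam k * exp (- lam k * (s / 2)))\<^sup>2 \<le> (2 / a)\<^sup>2"
      proof (rule power_mono)
        have "lam k * exp (- lam k * (s / 2)) \<le> 1 / (s / 2)" using st by (intro lam_exp_le) auto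
        also have "\<dots> \<le> 2 / a" using a by (simp add: field_simps)
        finally show "lam k * exp (- lam k * (s / 2)) \<le> 2 / a" .
      qed (simp add: lam_nonneg)
      qed simp
      finally show "exp (- lam k * t) * \<bar>exp (lam k * \<delta>) - 1 - lam k * \<delta>\<bar> \<le> (2 / a)\<^sup>2 * \<delta>\<^sup>2" .
    qed auto
    ultimately show ?thesis by (simp add: \<delta>_def)
  qed
  moreover have "(\<lambda>k. (2 / a)\<^sup>2 * (t - s)\<^sup>2 * ((coef v k)\<^sup>2 + (coef w k)\<^sup>2)) sums ((2 / a)\<^sup>2 * (t - s)\<^sup>2 * (ip v v + ip w w))"
    by (intro sums_mult sums_add parseval v w2)
  ultimately show ?thesis by (rule sums_abs_le)
qed

lemma ip_sg_self_sums:
  assumes v: "L2 v" and t: "t > 0"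
  shows "(\<lambda>k. exp (- lam k * (2 * t)) * (coef v k)\<^sup>2) sums ip (sg t v) (sg t v)"
proof -
  have "exp (- lam k * t) * exp (- lam k * t) = exp (- lam k * (2 * t))" for k
    by (simp add: exp_add[symmetric] algebra_simps)
  then show ?thesis
    using parseval[OF sg_L2[OF v t]] unfolding coef_sg[OF v t] by (simp add: power2_eq_square power_mult_distrib mult_ac)
qed

lemma ip_sg_self_le:
  assumes v: "L2 v" and t: "t > 0"
  shows "ip (sg t v) (sg t v) \<le> ip v v"
proof (rule sums_le[OF _ ip_sg_self_sums[OF v t] parseval[OF v]])
  show "exp (- lam k * (2 * t)) * (coef v k)\<^sup>2 \<le> (coef v k)\<^sup>2" for k
    using t by (intro mult_left_le_one_le exp_lam_le_1) auto
qed

lemma sg_limit: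
  assumes v: "L2 v"
  shows "(\<lambda>m. \<integral>x. (sg (1 / Suc m) v x - v x)\<^sup>2 \<partial>lborel) \<longlonglongrightarrow> 0"
proof (rule Lim_null_comparison[OF always_eventually exp_lam_limit])
  show "summable (\<lambda>k. \<bar>(coef v k)\<^sup>2\<bar>)" using summable_coef_sq[OF v] by simp
  show "\<forall>m. norm (\<integral>x. (sg (1 / Suc m) v x - v x)\<^sup>2 \<partial>lborel) \<le> (\<Sum>k. (1 - exp (- lam k * (1 / real (Suc m)))) * (coef v k)\<^sup>2)"
  proof
    fix m
    define t where "t = 1 / real (Suc m)"
    have t: "t > 0" by (simp add: t_def)
    have d: "L2 (\<lambda>x. sg t v x - v x)" by (rule l2_ball_diff[OF sg_L2[OF v t] v])
    have "(\<integral>x. (sg t v x - v x)\<^sup>2 \<partial>lborel) = (\<Sum>k. (coef (\<lambda>x. sg t v x - v x) k)\<^sup>2)"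
      using sums_unique[OF parseval[OF d]] by (simp add: ip_self)
    also have "\<dots> \<le> (\<Sum>k. (1 - exp (- lam k * t)) * (coef v k)\<^sup>2)"
    proof (rule suminf_le)
      show "summable (\<lambda>k. (coef (\<lambda>x. sg t v x - v x) k)\<^sup>2)" by (rule summable_coef_sq[OF d])
      have e: "0 \<le> 1 - exp (- lam k * t)" "1 - exp (- lam k * t) \<le> 1" for k using exp_lam_le_1[of t k] t by auto
      show "summable (\<lambda>k. (1 - exp (- lam k * t)) * (coef v k)\<^sup>2)"
        by (rule summable_comparison_test'[OF summable_coef_sq[OF v]])
          (use e in \<open>auto simp: abs_mult intro!: mult_left_le_one_le\<close>)
      fix k
      have "(coef (\<lambda>x. sg t v x - v x) k)\<^sup>2 = (1 - exp (- lam k * t))\<^sup>2 * (coef v k)\<^sup>2"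
        unfolding coef_diff[OF sg_L2[OF v t] v] coef_sg[OF v t] by (simp add: power2_eq_square algebra_simps)
      also have "\<dots> \<le> (1 - exp (- lam k * t)) * (coef v k)\<^sup>2"
        using e[of k] unfolding power2_eq_square[of "1 - exp (- lam k * t)"]
        by (intro mult_right_mono mult_left_le_one_le) auto
      finally show "(coef (\<lambda>x. sg t v x - v x) k)\<^sup>2 \<le> (1 - exp (- lam k * t)) * (coef v k)\<^sup>2" .
    qed
    finally show "norm (\<integral>x. (sg (1 / Suc m) v x - v x)\<^sup>2 \<partial>lborel) \<le> (\<Sum>k. (1 - exp (- lam k * (1 / real (Suc m)))) * (coef v k)\<^sup>2)"
      by (simp add: t_def)
  qed
qed

abbreviation clamp :: "real \<Rightarrow> real" where
  "clamp a \<equiv> max 0 (min 1 a)"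

text \<open>The squared distance of $S(t)v$ from the convex set $\{0 \<le> u \<le> 1\}$ is non-increasing in time.\<close>
lemma sg_markov:
  assumes v: "L2 v" and v01: "\<And>x. 0 \<le> v x \<and> v x \<le> 1" and b: "b > 0"
  shows "AE x in lborel. 0 \<le> sg b v x \<and> sg b v x \<le> 1"
proof -
  define W where "W = (\<lambda>t x. sg t v x - clamp (sg t v x))"
  define h where "h = (\<lambda>t. ip (W t) (W t) / 2)"
  have VW: "V (W t)" if "t > 0" for t
    unfolding W_def by (rule frac_domain_diff[OF sg_V[OF v that] frac_form_contraction(1)[OF sg_V[OF v that] normal_contraction_clamp \<alpha>_pos \<alpha>(2)]])
  have LW: "L2 (W t)" if "t > 0" for t by (rule frac_domain_l2[OF VW[OF that]])
  have EW: "0 \<le> E (sg t v) (W t)" if "t > 0" for t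
    unfolding W_def
  proof (rule frac_form_projection_nonneg[OF sg_V[OF v that] normal_contraction_clamp \<alpha>_pos \<alpha>(2)])
    fix a e :: real assume e: "0 \<le> e" "e \<le> 1"
    show "clamp (clamp a + e * (a - clamp a)) = clamp a"
    proof -
      consider "a < 0" | "0 \<le> a" "a \<le> 1" | "1 < a" by linarith
      then show ?thesis
      proof cases
        case 1
        then have "e * a \<le> 0" using e by (intro mult_nonneg_nonpos) auto
        then show ?thesis using 1 by simp
      next
        case 3
        then have "0 \<le> e * (a - 1)" using e by simp
        then show ?thesis using 3 by simp
      qed simp
    qed
  qed
  \<comment> \<open>Convexity of half the squared distance to [0,1]: it lies above its tangent at a,
    and its derivative there is a - \<open>clamp a\<close>.\<close>
  have conv: "(a - clamp a)\<^sup>2 / 2 - (c - clamp c)\<^sup>2 / 2 \<le> (a - clamp a) * (a - c)" for a c :: real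
  proof -
    have "0 \<le> (a - clamp a) * (clamp a - clamp c)"
      by (cases "a < 0"; cases "a > 1") (auto simp: max_def min_def mult_nonpos_nonpos mult_nonpos_nonneg)
    moreover have "0 \<le> ((a - clamp a) - (c - clamp c))\<^sup>2" by simp
    moreover have "2 * (d * (d - e + p)) - (d\<^sup>2 - e\<^sup>2) = (d - e)\<^sup>2 + 2 * (d * p)" for d e p :: real
      by (simp add: power2_eq_square algebra_simps)
    from this[of "a - clamp a" "c - clamp c" "clamp a - clamp c"]
    have "2 * ((a - clamp a) * (a - c)) - ((a - clamp a)\<^sup>2 - (c - clamp c)\<^sup>2)
       = ((a - clamp a) - (c - clamp c))\<^sup>2 + 2 * ((a - clamp a) * (clamp a - clamp c))" by simp
    ultimately show ?thesis by linarith
  qed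
  have Wle: "ip (W t) (W t) \<le> ip v v" if t: "t > 0" for t
  proof -
    have "ip (W t) (W t) \<le> ip (sg t v) (sg t v)"
      unfolding ip_self
    proof (rule integral_mono[OF l2_ball_sq[OF LW[OF t]] l2_ball_sq[OF sg_L2[OF v t]]])
      show "(W t x)\<^sup>2 \<le> (sg t v x)\<^sup>2" for x
        unfolding abs_le_square_iff[symmetric] W_def by (auto simp: max_def min_def)
    qed
    then show ?thesis using ip_sg_self_le[OF v t] by simp
  qed
  have dec: "h b \<le> h a" if a: "0 < a" "a < b" for a
  proof (rule quadratic_increment_decreasing[OF a(2)])
    fix s t assume st: "a \<le> s" "s < t" "t \<le> b"
    have pos: "s > 0" "t > 0" using a st by auto
    have "h t - h s = (\<integral>x. (W t x)\<^sup>2 / 2 - (W s x)\<^sup>2 / 2 \<partial>lborel)"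
      unfolding h_def ip_self using l2_ball_sq[OF LW[OF pos(1)]] l2_ball_sq[OF LW[OF pos(2)]] by simp
    also have "\<dots> \<le> (\<integral>x. W t x * (sg t v x - sg s v x) \<partial>lborel)"
    proof (rule integral_mono)
      show "integrable lborel (\<lambda>x. W t x * (sg t v x - sg s v x))"
        by (rule l2_ball_mult[OF LW[OF pos(2)] l2_ball_diff[OF sg_L2[OF v pos(2)] sg_L2[OF v pos(1)]]])
      show "(W t x)\<^sup>2 / 2 - (W s x)\<^sup>2 / 2 \<le> W t x * (sg t v x - sg s v x)" for x
        unfolding W_def by (rule conv)
    qed (use l2_ball_sq[OF LW[OF pos(1)]] l2_ball_sq[OF LW[OF pos(2)]] in auto)
    also have "\<dots> = ip (sg t v) (W t) - ip (sg s v) (W t)"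
      using ip_diff[OF sg_L2[OF v pos(2)] sg_L2[OF v pos(1)] LW[OF pos(2)]] by (simp add: ip_def mult.commute)
    also have "\<dots> \<le> (2 / a)\<^sup>2 * (t - s)\<^sup>2 * (ip v v + ip (W t) (W t))"
    proof -
      have "0 \<le> (t - s) * E (sg t v) (W t)" using EW[OF pos(2)] st by simp
      then show ?thesis using sg_increment[OF v VW[OF pos(2)] a(1) st(1,2)] by linarith
    qed
    also have "\<dots> \<le> (2 / a)\<^sup>2 * (t - s)\<^sup>2 * (ip v v + ip v v)"
      using Wle[OF pos(2)] by (intro mult_left_mono) auto
    finally show "h t - h s \<le> ((2 / a)\<^sup>2 * (ip v v + ip v v)) * (t - s)\<^sup>2" by (simp add: mult_ac)
  qed
  \<comment> \<open>Since v itself takes values in [0,1], the distance of S(t)v from that set is at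
    most its distance from v, which tends to zero with t.\<close>
  have hle: "h t \<le> (\<integral>x. (sg t v x - v x)\<^sup>2 \<partial>lborel)" if t: "t > 0" for t
  proof -
    have "ip (W t) (W t) \<le> (\<integral>x. (sg t v x - v x)\<^sup>2 \<partial>lborel)"
      unfolding ip_self
    proof (rule integral_mono[OF l2_ball_sq[OF LW[OF t]] l2_ball_sq[OF l2_ball_diff[OF sg_L2[OF v t] v]]])
      fix x
      show "(W t x)\<^sup>2 \<le> (sg t v x - v x)\<^sup>2"
        using v01[of x] unfolding abs_le_square_iff[symmetric] W_def by (auto simp: max_def min_def)
    qed
    then show ?thesis using ip_nonneg[of "W t"] by (simp add: h_def)
  qed
  have "h b \<le> 0"
  proof (rule LIMSEQ_le_const[OF sg_limit[OF v]])
    obtain N where N: "1 / real (Suc N) < b" using b nat_approx_posE by blast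
    show "\<exists>N. \<forall>m\<ge>N. h b \<le> (\<integral>x. (sg (1 / Suc m) v x - v x)\<^sup>2 \<partial>lborel)"
    proof (intro exI allI impI)
      fix m assume "m \<ge> N"
      then have "1 / real (Suc m) \<le> 1 / real (Suc N)" by (intro divide_left_mono) auto
      then have "1 / real (Suc m) < b" using N by simp
      then show "h b \<le> (\<integral>x. (sg (1 / Suc m) v x - v x)\<^sup>2 \<partial>lborel)"
        using dec[of "1 / Suc m"] hle[of "1 / Suc m"] by (meson of_nat_0_less_iff order.trans zero_less_Suc zero_less_divide_1_iff)
    qed
  qed
  then have "(\<integral>x. (W b x)\<^sup>2 \<partial>lborel) = 0" using ip_nonneg[of "W b"] unfolding h_def ip_self by linarith
  then have "AE x in lborel. (W b x)\<^sup>2 = 0"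
    using integral_nonneg_eq_0_iff_AE[OF l2_ball_sq[OF LW[OF b]]] by simp
  then show ?thesis
    by eventually_elim (auto simp: W_def max_def min_def split: if_splits)
qed

end

section \<open>Ultracontractivity and the heat kernel\<close>

context dirichlet_system
begin

lemma sg_lincomb:
  assumes u: "L2 u" and v: "L2 v" and t: "t > 0" and x: "good x"
  shows "sg t (\<lambda>x. a * u x + b * v x) x = a * sg t u x + b * sg t v x"
proof -
  have "coef (\<lambda>x. a * u x + b * v x) k = a * coef u k + b * coef v k" for k
    unfolding coef_def by (rule ip_lincomb[OF u v L2_phi])
  then have "sg t (\<lambda>x. a * u x + b * v x) x
     = (\<Sum>k. a * (exp (- lam k * t) * coef u k * \<phi> k x) + b * (exp (- lam k * t) * coef v k * \<phi> k x))"
    unfolding sg_def by (intro suminf_cong) (simp add: algebra_simps)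
  also have "\<dots> = a * sg t u x + b * sg t v x"
    using summable_rabs_cancel[OF sg_summable[OF u t x]] summable_rabs_cancel[OF sg_summable[OF v t x]]
    unfolding sg_def by (simp add: suminf_add[symmetric] suminf_mult summable_mult)
  finally show ?thesis .
qed

lemma sg_abs_le_1:
  assumes v: "L2 v" and le: "\<And>x. \<bar>v x\<bar> \<le> 1" and t: "t > 0"
  shows "AE x in lborel. \<bar>sg t v x\<bar> \<le> 1"
proof -
  have [measurable]: "v \<in> borel_measurable borel" by (rule l2_ball_meas[OF v])
  let ?p = "\<lambda>x. max 0 (v x)" and ?m = "\<lambda>x. max 0 (- v x)"
  have p: "L2 ?p" and m: "L2 ?m" by (rule l2_ball_dominated[OF v]; auto)+
  have b: "0 \<le> ?p x \<and> ?p x \<le> 1" "0 \<le> ?m x \<and> ?m x \<le> 1" for x using le[of x] by auto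
  show ?thesis using sg_markov[OF p b(1) t] sg_markov[OF m b(2) t] good_AE
  proof eventually_elim
    case (elim x)
    have "v = (\<lambda>x. 1 * ?p x + (-1) * ?m x)" by (auto simp: max_def)
    then have "sg t v x = 1 * sg t ?p x + (-1) * sg t ?m x" using sg_lincomb[OF p m t elim(3), of 1 "-1"] by simp
    then show ?case using elim by auto
  qed
qed

text \<open>Duality: test with the sign of S(t)v and move the semigroup onto it by symmetry, where
  it stays bounded by 1.\<close>

lemma sg_L1_contraction:
  assumes v: "L2 v" and t: "t > 0"
  shows "(\<integral>x. \<bar>sg t v x\<bar> \<partial>lborel) \<le> (\<integral>x. \<bar>v x\<bar> \<partial>lborel)"
proof -
  have l: "L2 (sg t v)" by (rule sg_L2[OF v t])
  have [measurable]: "sg t v \<in> borel_measurable borel" by (rule l2_ball_meas[OF l])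
  define w where "w = (\<lambda>x. sgn (sg t v x))"
  have w: "L2 w"
  proof (rule l2_ball_bounded)
    show "\<bar>w x\<bar> \<le> 1" for x by (simp add: w_def abs_sgn_eq)
    show "w x = 0" if "x \<notin> ball 0 R" for x using that l by (simp add: w_def l2_ball_def)
  qed (unfold w_def, measurable)
  have "(\<integral>x. \<bar>sg t v x\<bar> \<partial>lborel) = ip (sg t v) w"
    unfolding ip_def w_def by (simp add: abs_sgn)
  also have "\<dots> = ip v (sg t w)" by (rule ip_sg_commute[OF v w t])
  also have "\<dots> \<le> (\<integral>x. \<bar>v x\<bar> \<partial>lborel)"
    unfolding ip_def
  proof (rule integral_mono_AE)
    show "integrable lborel (\<lambda>x. v x * sg t w x)" by (rule l2_ball_mult[OF v sg_L2[OF w t]])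
    show "integrable lborel (\<lambda>x. \<bar>v x\<bar>)" using l2_ball_integrable[OF v] by simp
    have "AE x in lborel. \<bar>sg t w x\<bar> \<le> 1"
      by (rule sg_abs_le_1[OF w _ t]) (simp add: w_def abs_sgn_eq)
    then show "AE x in lborel. v x * sg t w x \<le> \<bar>v x\<bar>"
    proof eventually_elim
      case (elim x)
      have "v x * sg t w x \<le> \<bar>v x\<bar> * \<bar>sg t w x\<bar>" by (simp add: abs_mult[symmetric])
      also have "\<dots> \<le> \<bar>v x\<bar>" using elim by (intro mult_left_le) auto
      finally show ?case .
    qed
  qed
  finally show ?thesis .
qed

text \<open>The decay exponent d/\<alpha>: the kernel is bounded by a multiple of
  t^(-\<sigma>).\<close>

definition \<sigma> :: real where "\<sigma> = real CARD('n) / \<alpha>"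

lemma \<sigma>_pos: "0 < \<sigma>"
  using \<alpha>_pos by (simp add: \<sigma>_def)

text \<open>Twice the constant of Nash's inequality times K^\<sigma>, where K = 2^(\<sigma>+1) and
  the 2 is the sum of the geometric series in the iteration over halved times.\<close>

definition ultra_const :: real where
  "ultra_const = 2 * (unit_ball_vol (CARD('n)) / (2 * pi) ^ CARD('n) * (2 powr (\<sigma> + 1)) powr \<sigma>)"

lemma ultra_const_nonneg: "0 \<le> ultra_const"
  by (simp add: ultra_const_def)

text \<open>Nash's inequality at frequency radius $(K/t)^{1/\alpha}$ bounds $y(t) = \|S(t)v\|_2^2$ by
  $y(t/2)$ with a small factor, which is then iterated.\<close>
lemma ultracontractivity:
  assumes v: "L2 v" and t: "t > 0"
  shows "ip (sg t v) (sg t v) \<le> ultra_const * t powr (- \<sigma>) * (\<integral>x. \<bar>v x\<bar> \<partial>lborel)\<^sup>2"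
proof -
  let ?M = "\<integral>x. \<bar>v x\<bar> \<partial>lborel"
  define c0 where "c0 = unit_ball_vol (CARD('n)) / (2 * pi) ^ CARD('n)"
  have c0: "c0 \<ge> 0" by (simp add: c0_def)
  define y where "y = (\<lambda>t. ip (sg t v) (sg t v))"
  \<comment> \<open>Halving the time costs a factor 2^\<sigma>. With this K the coefficient of
    (t/2)^\<sigma> y(t/2) is exactly 1/2, so the iteration converges.\<close>
  define K where "K = (2::real) powr (\<sigma> + 1)"
  have K: "K > 0" by (simp add: K_def)
  define A where "A = c0 * K powr \<sigma> * ?M\<^sup>2"
  have A: "A \<ge> 0" using c0 by (simp add: A_def)
  have step: "t powr \<sigma> * y t \<le> A + (t / 2) powr \<sigma> * y (t / 2) / 2" if t: "t > 0" for t
  proof -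
    define \<rho> where "\<rho> = (K / t) powr (1 / \<alpha>)"
    have \<rho>: "\<rho> > 0" using K t by (simp add: \<rho>_def)
    have \<rho>n: "\<rho> ^ CARD('n) = K powr \<sigma> / t powr \<sigma>"
      using K t \<rho> by (simp add: powr_realpow[symmetric] \<rho>_def powr_powr \<sigma>_def powr_divide)
    have \<rho>a: "\<rho> powr (- \<alpha>) = t / K"
      using K t \<alpha>_pos by (simp add: \<rho>_def powr_powr powr_minus inverse_eq_divide)
    have Ele: "E (sg t v) (sg t v) \<le> 1 / t * y (t / 2)"
    proof (rule sums_le)
      show "(\<lambda>k. lam k * (coef (sg t v) k)\<^sup>2) sums E (sg t v) (sg t v)" by (rule E_self_sums[OF sg_V[OF v t]])
      show "(\<lambda>k. 1 / t * (exp (- lam k * (2 * (t / 2))) * (coef v k)\<^sup>2)) sums (1 / t * y (t / 2))"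
        unfolding y_def by (intro sums_mult ip_sg_self_sums v) (use t in simp)
      fix k
      have "lam k * (coef (sg t v) k)\<^sup>2 = (lam k * exp (- lam k * t)) * (exp (- lam k * t) * (coef v k)\<^sup>2)"
        unfolding coef_sg[OF v t] by (simp add: power2_eq_square mult_ac)
      also have "\<dots> \<le> 1 / t * (exp (- lam k * t) * (coef v k)\<^sup>2)"
        by (intro mult_right_mono lam_exp_le[OF t]) auto
      finally show "lam k * (coef (sg t v) k)\<^sup>2 \<le> 1 / t * (exp (- lam k * (2 * (t / 2))) * (coef v k)\<^sup>2)" by simp
    qed
    have "y t \<le> c0 * \<rho> ^ CARD('n) * (\<integral>x. \<bar>sg t v x\<bar> \<partial>lborel)\<^sup>2 + \<rho> powr (- \<alpha>) * E (sg t v) (sg t v)"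
      unfolding y_def c0_def by (rule nash[OF sg_V[OF v t] \<rho> \<alpha>_pos])
    also have "\<dots> \<le> c0 * \<rho> ^ CARD('n) * ?M\<^sup>2 + \<rho> powr (- \<alpha>) * (1 / t * y (t / 2))"
      using c0 \<rho> by (intro add_mono mult_left_mono power_mono sg_L1_contraction[OF v t] Ele) auto
    also have "\<dots> = A / t powr \<sigma> + y (t / 2) / K"
      unfolding \<rho>n \<rho>a A_def using t K by (simp add: field_simps)
    finally have "t powr \<sigma> * y t \<le> t powr \<sigma> * (A / t powr \<sigma> + y (t / 2) / K)"
      by (intro mult_left_mono) auto
    also have "\<dots> = A + t powr \<sigma> / K * y (t / 2)" using t by (simp add: ring_distribs)
    also have "t powr \<sigma> / K = (t / 2) powr \<sigma> / 2"
      by (simp add: K_def powr_divide powr_add)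
    finally show ?thesis by simp
  qed
  \<comment> \<open>The crude bound y \<le> |v|^2 starts the induction; its contribution is halved
    at every step and vanishes in the limit.\<close>
  have iter: "t powr \<sigma> * y t \<le> 2 * A + (1 / 2) ^ m * (t powr \<sigma> * ip v v)" if "t > 0" for m t
    using that
  proof (induction m arbitrary: t)
    case 0
    have "t powr \<sigma> * y t \<le> t powr \<sigma> * ip v v"
      unfolding y_def by (intro mult_left_mono ip_sg_self_le[OF v 0]) simp
    then show ?case using A by simp
  next
    case (Suc m)
    have "t powr \<sigma> * y t \<le> A + (t / 2) powr \<sigma> * y (t / 2) / 2" by (rule step[OF Suc.prems])
    also have "\<dots> \<le> A + (2 * A + (1 / 2) ^ m * ((t / 2) powr \<sigma> * ip v v)) / 2"
      using Suc.IH[of "t / 2"] Suc.prems by simp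
    also have "\<dots> = 2 * A + (1 / 2) ^ Suc m * ((t / 2) powr \<sigma> * ip v v)" by (simp add: field_simps)
    also have "\<dots> \<le> 2 * A + (1 / 2) ^ Suc m * (t powr \<sigma> * ip v v)"
      using Suc.prems \<sigma>_pos ip_nonneg[of v]
      by (intro add_left_mono mult_left_mono mult_right_mono powr_mono2) auto
    finally show ?case .
  qed
  have "(\<lambda>m. 2 * A + (1 / 2) ^ m * (t powr \<sigma> * ip v v)) \<longlonglongrightarrow> 2 * A + 0 * (t powr \<sigma> * ip v v)"
    by (intro tendsto_intros LIMSEQ_power_zero) auto
  then have "t powr \<sigma> * y t \<le> 2 * A + 0 * (t powr \<sigma> * ip v v)"
    by (rule LIMSEQ_le_const) (use iter[OF t] in auto)
  then have "y t \<le> 2 * A / t powr \<sigma>" using t by (simp add: field_simps)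
  also have "\<dots> = ultra_const * t powr (- \<sigma>) * ?M\<^sup>2"
    by (simp add: A_def ultra_const_def c0_def K_def powr_minus divide_inverse mult_ac)
  finally show ?thesis unfolding y_def .
qed

section \<open>The heat kernel as a function of two points\<close>

abbreviation pk :: "real \<Rightarrow> real^'n \<Rightarrow> real^'n \<Rightarrow> real" where
  "pk \<equiv> dirichlet_heat_kernel lam \<phi>"

lemma pk_measurable[measurable (raw)]:
  assumes [measurable]: "t \<in> borel_measurable M" "X \<in> borel_measurable M" "Y \<in> borel_measurable M"
  shows "(\<lambda>w. pk (t w) (X w) (Y w)) \<in> borel_measurable M"
  unfolding dirichlet_heat_kernel_def by measurable

lemma pk_sym: "pk t x y = pk t y x"
  unfolding dirichlet_heat_kernel_def by (intro suminf_cong) (simp add: mult_ac)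

lemma pk_meas2: "(\<lambda>z. pk t (fst z) (snd z)) \<in> borel_measurable (borel \<Otimes>\<^sub>M borel)"
  unfolding dirichlet_heat_kernel_def by measurable

text \<open>At a good x the coefficients exp(-\<open>lam k\<close> t) \<open>\<phi> k x\<close> are
  square-summable, so the row of the kernel is the L^2 function with these coefficients, and
  Parseval's identity evaluates its inner product with v.\<close>

lemma pk_row:
  assumes x: "good x" and t: "t > 0"
  shows "L2 (pk t x)" "L2 v \<Longrightarrow> ip (pk t x) v = sg t v x"
proof -
  let ?a = "\<lambda>k. exp (- lam k * t) * \<phi> k x"
  have "(?a k)\<^sup>2 = exp (- lam k * (2 * t)) * (\<phi> k x)\<^sup>2" for k
    by (simp add: power2_eq_square exp_add[symmetric] algebra_simps)
  then have 1: "summable (\<lambda>k. (?a k)\<^sup>2)" using x t by (simp add: good_def)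
  have 2: "AE y in lborel. summable (\<lambda>k. ?a k * \<phi> k y)"
    using good_AE
  proof eventually_elim
    case (elim y)
    have s: "summable (\<lambda>k. exp (- lam k * t) * (\<phi> k x)\<^sup>2 + exp (- lam k * t) * (\<phi> k y)\<^sup>2)"
      using x elim t by (intro summable_add) (auto simp: good_def)
    show ?case
    proof (rule summable_comparison_test'[OF s])
      fix k
      have "exp (- lam k * t) * \<bar>\<phi> k x * \<phi> k y\<bar> \<le> exp (- lam k * t) * ((\<phi> k x)\<^sup>2 + (\<phi> k y)\<^sup>2)"
        by (intro mult_left_mono abs_mult_le_sq) simp
      then show "norm (?a k * \<phi> k y) \<le> exp (- lam k * t) * (\<phi> k x)\<^sup>2 + exp (- lam k * t) * (\<phi> k y)\<^sup>2"
        by (simp add: abs_mult ring_distribs mult.assoc)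
    qed
  qed
  have eq: "pk t x = (\<lambda>y. \<Sum>k. ?a k * \<phi> k y)" by (simp add: dirichlet_heat_kernel_def fun_eq_iff)
  show l: "L2 (pk t x)" unfolding eq by (rule riesz_fischer(1)[OF 1 2])
  assume v: "L2 v"
  have "(\<lambda>k. coef (pk t x) k * coef v k) sums ip (pk t x) v" by (rule parseval_ip[OF l v])
  then have "(\<lambda>k. ?a k * coef v k) sums ip (pk t x) v"
    unfolding eq riesz_fischer(2)[OF 1 2] .
  from sums_unique[OF this] show "ip (pk t x) v = sg t v x"
    unfolding sg_def by (simp add: mult_ac)
qed

lemma pk_outside: "x \<notin> ball 0 R \<or> y \<notin> ball 0 R \<Longrightarrow> pk t x y = 0"
  using phi_outside by (auto simp: dirichlet_heat_kernel_def)

text \<open>On the product of the ball with itself |p(t,x,y)| \<le> q(x) + q(y), where q is the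
  diagonal series, whose integral is the finite trace.\<close>

lemma pk_integrable:
  assumes t: "t > 0"
  shows "integrable (lborel \<Otimes>\<^sub>M lborel) (\<lambda>z. pk t (fst z) (snd z))"
proof -
  let ?P = "lborel \<Otimes>\<^sub>M lborel :: ((real^'n) \<times> (real^'n)) measure"
  define q where "q = (\<lambda>x. \<Sum>k. exp (- lam k * t) * (\<phi> k x)\<^sup>2)"
  have [measurable]: "q \<in> borel_measurable borel" unfolding q_def by measurable
  have [measurable]: "(\<lambda>z. pk t (fst z) (snd z)) \<in> borel_measurable ?P" using pk_meas2[of t] by simp
  have term_int: "(\<integral>\<^sup>+x. ennreal (exp (- lam k * t) * (\<phi> k x)\<^sup>2) \<partial>lborel) = ennreal (exp (- lam k * t))" for k
  proof -
    have "(\<integral>\<^sup>+x. ennreal (exp (- lam k * t) * (\<phi> k x)\<^sup>2) \<partial>lborel) = ennreal (\<integral>x. exp (- lam k * t) * (\<phi> k x)\<^sup>2 \<partial>lborel)"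
      by (rule nn_integral_eq_integral) (use l2_ball_sq[OF L2_phi, of k] in auto)
    also have "(\<integral>x. exp (- lam k * t) * (\<phi> k x)\<^sup>2 \<partial>lborel) = exp (- lam k * t)"
      using ip_phi[of k k] by (simp add: ip_self)
    finally show ?thesis .
  qed
  have "(\<integral>\<^sup>+x. ennreal (norm (q x)) \<partial>lborel) \<le> (\<integral>\<^sup>+x. (\<Sum>k. ennreal (exp (- lam k * t) * (\<phi> k x)\<^sup>2)) \<partial>lborel)"
  proof (rule nn_integral_mono_AE, use good_AE in eventually_elim)
    case (elim x)
    then have s: "summable (\<lambda>k. exp (- lam k * t) * (\<phi> k x)\<^sup>2)" using t by (simp add: good_def)
    have "0 \<le> q x" unfolding q_def by (rule suminf_nonneg[OF s]) simp
    moreover have "(\<Sum>k. ennreal (exp (- lam k * t) * (\<phi> k x)\<^sup>2)) = ennreal (q x)"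
      unfolding q_def by (rule suminf_ennreal2[OF _ s]) simp
    ultimately show ?case by (simp only: real_norm_def abs_of_nonneg order.refl)
  qed
  also have "\<dots> = (\<Sum>k. ennreal (exp (- lam k * t)))"
    by (subst nn_integral_suminf, measurable) (simp only: term_int)
  also have "\<dots> < \<infinity>" using summable_exp_lam[OF t] by (simp add: ennreal_suminf_neq_top less_top)
  finally have q: "integrable lborel q" by (auto simp: integrable_iff_bounded)
  let ?B = "indicator (ball 0 R) :: real^'n \<Rightarrow> real"
  show ?thesis
  proof (rule Bochner_Integration.integrable_bound)
    show "integrable ?P (\<lambda>z. q (fst z) * ?B (snd z) + ?B (fst z) * q (snd z))"
      by (intro Bochner_Integration.integrable_add integrable_pair_mult q integrable_indicator_ball)
    have ae: "AE z in ?P. good (fst z) \<and> good (snd z)"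
    proof -
      obtain Nn where Nn: "Nn \<in> null_sets lborel" "{x \<in> space lborel. \<not> good x} \<subseteq> Nn" using good_AE by (auto simp: eventually_ae_filter)
      have "Nn \<times> UNIV \<in> null_sets ?P" "UNIV \<times> Nn \<in> null_sets ?P"
        using lborel.emeasure_pair_measure_Times[of Nn lborel UNIV] lborel.emeasure_pair_measure_Times[of UNIV lborel Nn]
          null_setsD1[OF Nn(1)] null_setsD2[OF Nn(1)] by (auto intro!: null_setsI)
      then have "Nn \<times> UNIV \<union> UNIV \<times> Nn \<in> null_sets ?P" by (rule null_sets.Un)
      then show ?thesis by (rule AE_I') (use Nn in auto)
    qed
    then show "AE z in ?P. norm (pk t (fst z) (snd z)) \<le> norm (q (fst z) * ?B (snd z) + ?B (fst z) * q (snd z))"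
    proof eventually_elim
      case (elim z)
      obtain x y where z: "z = (x, y)" by (cases z)
      show ?case
      proof (cases "x \<in> ball 0 R \<and> y \<in> ball 0 R")
        case False
        then show ?thesis using pk_outside[of x y t] by (auto simp: z)
      next
        case True
        have sx: "summable (\<lambda>k. exp (- lam k * t) * (\<phi> k x)\<^sup>2)" and sy: "summable (\<lambda>k. exp (- lam k * t) * (\<phi> k y)\<^sup>2)"
          using elim t by (auto simp: z good_def)
        have le: "\<bar>exp (- lam k * t) * \<phi> k x * \<phi> k y\<bar> \<le> exp (- lam k * t) * (\<phi> k x)\<^sup>2 + exp (- lam k * t) * (\<phi> k y)\<^sup>2" for k
          using mult_left_mono[OF abs_mult_le_sq[of "\<phi> k x" "\<phi> k y"], of "exp (- lam k * t)"]
          by (simp add: abs_mult ring_distribs mult.assoc)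
        have s: "summable (\<lambda>k. \<bar>exp (- lam k * t) * \<phi> k x * \<phi> k y\<bar>)"
          by (rule summable_comparison_test'[OF summable_add[OF sx sy]]) (use le in auto)
        have "\<bar>pk t x y\<bar> \<le> (\<Sum>k. \<bar>exp (- lam k * t) * \<phi> k x * \<phi> k y\<bar>)"
          unfolding dirichlet_heat_kernel_def by (rule summable_rabs[OF s])
        also have "\<dots> \<le> (\<Sum>k. exp (- lam k * t) * (\<phi> k x)\<^sup>2 + exp (- lam k * t) * (\<phi> k y)\<^sup>2)"
          by (rule suminf_le[OF le s summable_add[OF sx sy]])
        also have "\<dots> = q x + q y" unfolding q_def by (rule suminf_add[OF sx sy, symmetric])
        finally show ?thesis using True by (simp add: z)
      qed
    qed
  qed measurable
qed

lemma pk_box_integral: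
  assumes t: "t > 0" and A: "A \<in> sets borel" and B: "B \<in> sets borel"
  shows "(\<integral>z. indicator (A \<times> B) z * pk t (fst z) (snd z) \<partial>(lborel \<Otimes>\<^sub>M lborel))
     = ip (indicator (A \<inter> ball 0 R)) (sg t (indicator (B \<inter> ball 0 R)))"
proof -
  let ?P = "lborel \<Otimes>\<^sub>M lborel :: ((real^'n) \<times> (real^'n)) measure"
  have AB: "A \<times> B \<in> sets ?P" using A B by auto
  have lB: "L2 (indicator (B \<inter> ball 0 R))" by (rule l2_ball_indicator) (use B in auto)
  have i: "integrable ?P (\<lambda>z. indicator (A \<times> B) z * pk t (fst z) (snd z))"
    using integrable_mult_indicator[OF AB pk_integrable[OF t]] by simp
  have "(\<integral>z. indicator (A \<times> B) z * pk t (fst z) (snd z) \<partial>?P)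
     = (\<integral>x. \<integral>y. indicator (A \<times> B) (x, y) * pk t x y \<partial>lborel \<partial>lborel)"
    using lborel_pair.integral_fst'[OF i] by simp
  also have "\<dots> = ip (indicator (A \<inter> ball 0 R)) (sg t (indicator (B \<inter> ball 0 R)))"
    unfolding ip_def[of "indicator (A \<inter> ball 0 R)"]
  proof (rule integral_cong_AE)
    have [measurable]: "A \<in> sets borel" "ball (0::real^'n) R \<in> sets borel" using A by auto
    have [measurable]: "sg t (indicator (B \<inter> ball 0 R)) \<in> borel_measurable borel"
      by (rule l2_ball_meas[OF sg_L2[OF lB t]])
    show "(\<lambda>x. indicator (A \<inter> ball 0 R) x * sg t (indicator (B \<inter> ball 0 R)) x) \<in> borel_measurable lborel" by measurable
    have im: "(\<lambda>z. indicator (A \<times> B) z * pk t (fst z) (snd z)) \<in> borel_measurable ?P" using i by (rule borel_measurable_integrable)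
    show "(\<lambda>x. \<integral>y. indicator (A \<times> B) (x, y) * pk t x y \<partial>lborel) \<in> borel_measurable lborel"
      by (rule lborel.borel_measurable_lebesgue_integral) (use im in \<open>simp add: case_prod_beta'\<close>)
    show "AE x in lborel. (\<integral>y. indicator (A \<times> B) (x, y) * pk t x y \<partial>lborel) = indicator (A \<inter> ball 0 R) x * sg t (indicator (B \<inter> ball 0 R)) x"
      using good_AE
    proof eventually_elim
      case (elim x)
      have "(\<integral>y. indicator (A \<times> B) (x, y) * pk t x y \<partial>lborel) = indicator (A \<inter> ball 0 R) x * ip (pk t x) (indicator (B \<inter> ball 0 R))"
        unfolding ip_def integral_mult_right_zero[symmetric] using pk_outside[of x _ t]
        by (intro Bochner_Integration.integral_cong) (auto simp: indicator_def)
      then show ?case unfolding pk_row(2)[OF elim t lB] .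
    qed
  qed
  finally show ?thesis .
qed

text \<open>The constant of ultracontractivity at time t/2, since the time is shared equally between
  the two arguments of the kernel.\<close>

definition heat_bound :: "real \<Rightarrow> real" where
  "heat_bound t = ultra_const * (t / 2) powr (- \<sigma>)"

lemma heat_bound_nonneg: "0 \<le> heat_bound t"
  using ultra_const_nonneg by (simp add: heat_bound_def)

lemma box_prod_eq: "box c d = box (fst c) (fst d) \<times> box (snd c) (snd (d :: 'a::euclidean_space \<times> 'b::euclidean_space))"
  by (cases c; cases d) (auto simp: box_def Basis_prod_def ball_Un)

text \<open>Write S(t) = S(t/2) S(t/2), move one factor to u, and apply the Cauchy-Schwarz
  inequality and ultracontractivity to both sides. Applied to indicators of box sections it bounds
  the kernel.\<close>

lemma ip_sg_indicator_le:
  assumes t: "t > 0" and u: "L2 u" and v: "L2 v"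
  shows "ip u (sg t v) \<le> heat_bound t * ((\<integral>x. \<bar>u x\<bar> \<partial>lborel) * (\<integral>x. \<bar>v x\<bar> \<partial>lborel))"
proof -
  have t2: "t / 2 > 0" using t by simp
  let ?Mu = "\<integral>x. \<bar>u x\<bar> \<partial>lborel" and ?Mv = "\<integral>x. \<bar>v x\<bar> \<partial>lborel"
  have "ip u (sg t v) = ip (sg (t / 2) u) (sg (t / 2) v)"
  proof (rule sums_unique2)
    show "(\<lambda>k. coef u k * coef (sg t v) k) sums ip u (sg t v)" by (rule parseval_ip[OF u sg_L2[OF v t]])
    have "exp (- lam k * (t / 2)) * exp (- lam k * (t / 2)) = exp (- lam k * t)" for k
      by (simp add: exp_add[symmetric] algebra_simps)
    then have "coef (sg (t / 2) u) k * coef (sg (t / 2) v) k = coef u k * coef (sg t v) k" for k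
      unfolding coef_sg[OF u t2] coef_sg[OF v t2] coef_sg[OF v t]
      by (metis (no_types, opaque_lifting) mult.assoc mult.left_commute)
    then show "(\<lambda>k. coef u k * coef (sg t v) k) sums ip (sg (t / 2) u) (sg (t / 2) v)"
      using parseval_ip[OF sg_L2[OF u t2] sg_L2[OF v t2]] by simp
  qed
  also have "\<dots> \<le> heat_bound t * (?Mu * ?Mv)"
  proof (rule power2_le_imp_le)
    have "(ip (sg (t / 2) u) (sg (t / 2) v))\<^sup>2 \<le> ip (sg (t / 2) u) (sg (t / 2) u) * ip (sg (t / 2) v) (sg (t / 2) v)"
      by (rule ip_cs[OF sg_L2[OF u t2] sg_L2[OF v t2]])
    also have "\<dots> \<le> (heat_bound t * ?Mu\<^sup>2) * (heat_bound t * ?Mv\<^sup>2)"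
      using ultracontractivity[OF u t2] ultracontractivity[OF v t2] heat_bound_nonneg[of t]
      by (intro mult_mono) (auto simp: heat_bound_def ip_nonneg)
    finally show "(ip (sg (t / 2) u) (sg (t / 2) v))\<^sup>2 \<le> (heat_bound t * (?Mu * ?Mv))\<^sup>2"
      by (simp add: power2_eq_square mult_ac)
    show "0 \<le> heat_bound t * (?Mu * ?Mv)" by (intro mult_nonneg_nonneg heat_bound_nonneg) auto
  qed
  finally show ?thesis .
qed

text \<open>Integrals of the kernel over boxes are inner products of indicators with the semigroup.
  They are non-negative by the Markov property, and at most \<open>heat_bound t\<close> times the
  product of the measures, so both inequalities follow from the box criterion.\<close>

lemma pk_bounds:
  assumes t: "t > 0"
  shows "AE z in lborel \<Otimes>\<^sub>M lborel. 0 \<le> pk t (fst z) (snd z) \<and> pk t (fst z) (snd z) \<le> heat_bound t"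
proof -
  let ?P = "lborel \<Otimes>\<^sub>M lborel :: ((real^'n) \<times> (real^'n)) measure"
  let ?B = "indicator (ball 0 R) :: real^'n \<Rightarrow> real"
  have bm: "box c d \<in> sets borel" for c d :: "real^'n" by simp
  have lo: "AE z in (lborel :: ((real^'n) \<times> (real^'n)) measure). 0 \<le> pk t (fst z) (snd z)"
  proof (rule AE_nonneg_of_box_integrals)
    show "integrable lborel (\<lambda>z. pk t (fst z) (snd z))" using pk_integrable[OF t] by (simp add: lborel_prod)
    fix c d :: "(real^'n) \<times> (real^'n)"
    let ?u = "indicator (box (fst c) (fst d) \<inter> ball 0 R) :: real^'n \<Rightarrow> real"
    let ?v = "indicator (box (snd c) (snd d) \<inter> ball 0 R) :: real^'n \<Rightarrow> real"
    have v: "L2 ?v" by (rule l2_ball_indicator) auto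
    have "0 \<le> ip ?u (sg t ?v)"
      unfolding ip_def
    proof (rule integral_nonneg_AE)
      have "AE x in lborel. 0 \<le> sg t ?v x \<and> sg t ?v x \<le> 1"
        by (rule sg_markov[OF v _ t]) (auto simp: indicator_def)
      then show "AE x in lborel. 0 \<le> ?u x * sg t ?v x" by eventually_elim auto
    qed
    then show "0 \<le> (\<integral>z. indicator (box c d) z * pk t (fst z) (snd z) \<partial>lborel)"
      using pk_box_integral[OF t bm bm, of "fst c" "fst d" "snd c" "snd d"] unfolding box_prod_eq[of c d] lborel_prod by simp
  qed
  have up: "AE z in (lborel :: ((real^'n) \<times> (real^'n)) measure). 0 \<le> heat_bound t * (?B (fst z) * ?B (snd z)) - pk t (fst z) (snd z)"
  proof (rule AE_nonneg_of_box_integrals)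
    have iB: "integrable ?P (\<lambda>z. ?B (fst z) * ?B (snd z))"
      by (rule integrable_pair_mult[OF integrable_indicator_ball integrable_indicator_ball])
    show "integrable lborel (\<lambda>z. heat_bound t * (?B (fst z) * ?B (snd z)) - pk t (fst z) (snd z))"
      using pk_integrable[OF t] iB unfolding lborel_prod by auto
    fix c d :: "(real^'n) \<times> (real^'n)"
    let ?u = "indicator (box (fst c) (fst d) \<inter> ball 0 R) :: real^'n \<Rightarrow> real"
    let ?v = "indicator (box (snd c) (snd d) \<inter> ball 0 R) :: real^'n \<Rightarrow> real"
    have u: "L2 ?u" and v: "L2 ?v" by (rule l2_ball_indicator; auto)+
    have uv: "integrable ?P (\<lambda>z. ?u (fst z) * ?v (snd z))"
      by (rule integrable_pair_mult[OF l2_ball_integrable[OF u] l2_ball_integrable[OF v]])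
    have ip: "integrable ?P (\<lambda>z. indicator (box c d) z * pk t (fst z) (snd z))"
    proof -
      have "box c d \<in> sets ?P" unfolding lborel_prod by simp
      from integrable_mult_indicator[OF this pk_integrable[OF t]] show ?thesis by simp
    qed
    have "(\<integral>z. indicator (box c d) z * (heat_bound t * (?B (fst z) * ?B (snd z)) - pk t (fst z) (snd z)) \<partial>?P)
      = (\<integral>z. heat_bound t * (?u (fst z) * ?v (snd z)) - indicator (box c d) z * pk t (fst z) (snd z) \<partial>?P)"
      by (intro Bochner_Integration.integral_cong) (auto simp: box_prod_eq[of c d] indicator_def algebra_simps)
    also have "\<dots> = heat_bound t * (\<integral>z. ?u (fst z) * ?v (snd z) \<partial>?P) - (\<integral>z. indicator (box c d) z * pk t (fst z) (snd z) \<partial>?P)"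
      using uv ip by simp
    also have "(\<integral>z. ?u (fst z) * ?v (snd z) \<partial>?P) = (\<integral>x. \<bar>?u x\<bar> \<partial>lborel) * (\<integral>x. \<bar>?v x\<bar> \<partial>lborel)"
      using lborel_pair.integral_fst'[OF uv] by simp
    also have "(\<integral>z. indicator (box c d) z * pk t (fst z) (snd z) \<partial>?P) = ip ?u (sg t ?v)"
      using pk_box_integral[OF t bm bm, of "fst c" "fst d" "snd c" "snd d"] unfolding box_prod_eq[of c d] by simp
    finally show "0 \<le> (\<integral>z. indicator (box c d) z * (heat_bound t * (?B (fst z) * ?B (snd z)) - pk t (fst z) (snd z)) \<partial>lborel)"
      using ip_sg_indicator_le[OF t u v] unfolding lborel_prod by simp
  qed
  from lo up show ?thesis unfolding lborel_prod
  proof eventually_elim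
    case (elim z)
    have "heat_bound t * (?B (fst z) * ?B (snd z)) \<le> heat_bound t"
      using heat_bound_nonneg[of t] by (intro mult_left_le) (auto simp: indicator_def)
    then show ?case using elim by auto
  qed
qed

text \<open>The mass of a row is S(t) applied to the indicator of the ball, which the Markov
  property bounds by 1.\<close>

lemma pk_row_integral:
  assumes t: "t > 0"
  shows "AE x in lborel. (\<integral>\<^sup>+y. ennreal (pk t x y) \<partial>lborel) \<le> 1"
proof -
  have "AE x in lborel. AE y in lborel. 0 \<le> pk t x y \<and> pk t x y \<le> heat_bound t"
    using lborel_pair.AE_pair[OF pk_bounds[OF t]] by simp
  moreover have B: "L2 (indicator (ball 0 R))" by (rule l2_ball_indicator) auto
  then have "AE x in lborel. 0 \<le> sg t (indicator (ball 0 R)) x \<and> sg t (indicator (ball 0 R)) x \<le> 1"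
    by (rule sg_markov[OF _ _ t]) (auto simp: indicator_def)
  ultimately show ?thesis using good_AE
  proof eventually_elim
    case (elim x)
    have l: "L2 (pk t x)" by (rule pk_row(1)[OF elim(3) t])
    have "(\<integral>\<^sup>+y. ennreal (pk t x y) \<partial>lborel) = ennreal (\<integral>y. pk t x y \<partial>lborel)"
      by (rule nn_integral_eq_integral[OF l2_ball_integrable[OF l]]) (use elim in auto)
    also have "(\<integral>y. pk t x y \<partial>lborel) = ip (pk t x) (indicator (ball 0 R))"
      unfolding ip_def using pk_outside[of x _ t] by (intro Bochner_Integration.integral_cong) (auto simp: indicator_def)
    also have "\<dots> = sg t (indicator (ball 0 R)) x" by (rule pk_row(2)[OF elim(3) t B])
    finally show ?case using elim by simp
  qed
qed

end

section \<open>Powers and norms of extended non-negative functions\<close>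

text \<open>Real powers on [0,\<infinity>], with infinity mapped to itself, so that norms of
  iterates not yet known to be finite can be written down.\<close>

definition epow :: "real \<Rightarrow> ennreal \<Rightarrow> ennreal" where
  "epow a x = (if x = \<infinity> then \<infinity> else ennreal (enn2real x powr a))"

lemma epow_ennreal: "0 \<le> r \<Longrightarrow> epow a (ennreal r) = ennreal (r powr a)"
  by (simp add: epow_def)

lemma epow_top[simp]: "epow a \<infinity> = \<infinity>" "epow a top = top"
  by (simp_all add: epow_def)

lemma epow_0[simp]: "epow a 0 = 0"
  using epow_ennreal[of 0 a] by simp

lemma epow_measurable[measurable]: "epow a \<in> borel_measurable borel"
  unfolding epow_def[abs_def] by measurable

lemma epow_mono:
  assumes a: "0 < a" and le: "x \<le> y"
  shows "epow a x \<le> epow a y"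
proof (cases x; cases y)
  fix r s assume r: "0 \<le> r" "x = ennreal r" and s: "0 \<le> s" "y = ennreal s"
  then have "r \<le> s" using le by simp
  then show ?thesis using r s a by (simp add: epow_ennreal ennreal_leI powr_mono2)
qed (use le in \<open>auto simp: top_unique\<close>)

lemma epow_epow:
  assumes "0 < a" "0 < b"
  shows "epow a (epow b x) = epow (a * b) x"
  by (cases x) (auto simp: epow_ennreal powr_powr mult.commute)

lemma epow_1[simp]: "epow 1 x = x"
  by (cases x) (auto simp: epow_ennreal)

lemma epow_mult:
  assumes a: "0 < a"
  shows "epow a (x * y) = epow a x * epow a y"
proof (cases x; cases y)
  fix r s assume r: "0 \<le> r" "x = ennreal r" and s: "0 \<le> s" "y = ennreal s"
  then show ?thesis by (simp add: epow_ennreal ennreal_mult[symmetric] powr_mult)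
next
  fix r assume r: "0 \<le> r" "x = ennreal r" and y: "y = top"
  show ?thesis
    using r y by (cases "r = 0") (auto simp: epow_ennreal ennreal_mult_top)
next
  fix r assume r: "0 \<le> r" "y = ennreal r" and y: "x = top"
  show ?thesis
    using r y by (cases "r = 0") (auto simp: epow_ennreal ennreal_top_mult)
qed auto

lemma epow_add_exp:
  assumes "0 < a" "0 < b"
  shows "epow (a + b) x = epow a x * epow b x"
  by (cases x) (auto simp: epow_ennreal ennreal_mult[symmetric] powr_add)

lemma epow_le_iff:
  assumes a: "0 < a"
  shows "epow a x \<le> y \<longleftrightarrow> x \<le> epow (1 / a) y"
proof
  assume "epow a x \<le> y"
  then have "epow (1 / a) (epow a x) \<le> epow (1 / a) y" using a by (intro epow_mono) auto
  then show "x \<le> epow (1 / a) y" using a by (simp add: epow_epow)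
next
  assume "x \<le> epow (1 / a) y"
  then have "epow a x \<le> epow a (epow (1 / a) y)" using a by (intro epow_mono) auto
  then show "epow a x \<le> y" using a by (simp add: epow_epow)
qed

text \<open>The powers a and 1/a are adjoint by \<open>epow_le_iff\<close>, so they preserve
  suprema.\<close>

lemma epow_SUP:
  assumes a: "0 < a"
  shows "epow a (SUP n. f n) = (SUP n. epow a (f n))"
proof (rule antisym)
  have "f n \<le> epow (1 / a) (SUP n. epow a (f n))" for n
    unfolding epow_le_iff[OF a, symmetric] by (rule SUP_upper) simp
  then show "epow a (SUP n. f n) \<le> (SUP n. epow a (f n))"
    unfolding epow_le_iff[OF a] by (rule SUP_least)
  show "(SUP n. epow a (f n)) \<le> epow a (SUP n. f n)"
    by (intro SUP_least epow_mono[OF a] SUP_upper) simp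
qed

lemma epow_add_le:
  assumes a: "0 < a"
  shows "epow a (x + y) \<le> ennreal (2 powr a) * (epow a x + epow a y)"
proof -
  have "x + y \<le> 2 * max x y"
    unfolding mult_2 by (intro add_mono) auto
  also have "(2::ennreal) * max x y = ennreal 2 * max x y" by simp
  finally have "epow a (x + y) \<le> epow a (ennreal 2 * max x y)" by (rule epow_mono[OF a])
  also have "\<dots> = ennreal (2 powr a) * epow a (max x y)"
    by (simp add: epow_mult[OF a] epow_ennreal del: ennreal_numeral)
  also have "\<dots> \<le> ennreal (2 powr a) * (epow a x + epow a y)"
    by (intro mult_left_mono) (auto simp: max_def)
  finally show ?thesis .
qed

text \<open>The graph of w^a lies above its tangent line at c; the terms are arranged so that both
  sides stay non-negative.\<close>

lemma epow_young:
  assumes a: "1 \<le> a" and c: "0 < c"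
  shows "ennreal (a * c powr (a - 1)) * w \<le> epow a w + ennreal ((a - 1) * c powr a)"
proof (cases w)
  case (real r)
  have "a * c powr (a - 1) * r \<le> r powr a + (a - 1) * c powr a"
  proof (cases "r = 0")
    case True
    then show ?thesis using a by simp
  next
    case False
    then have r: "r > 0" using real by simp
    have "((\<lambda>x. x powr a) has_field_derivative a * c powr (a - 1)) (at c within {0<..})"
      using c by (auto intro!: derivative_eq_intros)
    then have "a * c powr (a - 1) * (r - c) \<le> r powr a - c powr a"
      using r c by (intro convex_on_imp_above_tangent[OF powr_convex[OF a]]) (auto simp: interior_open)
    moreover have "c powr (a - 1) * c = c powr a" using c by (simp add: powr_diff)
    ultimately show ?thesis by (simp add: algebra_simps)
  qed
  then have "ennreal (a * c powr (a - 1) * r) \<le> ennreal (r powr a + (a - 1) * c powr a)" by (rule ennreal_leI)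
  then show ?thesis using real a by (simp add: epow_ennreal ennreal_mult[symmetric])
next
  case top
  then show ?thesis by simp
qed

text \<open>Integrate the tangent inequality at any c between zero and the mean. The constant (a-1)
  c^a enters multiplied by the mass of k, so mass at most 1 is enough. Letting c be arbitrarily
  large also settles an infinite mean.\<close>

lemma jensen_epow:
  assumes a: "1 \<le> a" and [measurable]: "k \<in> borel_measurable M" "w \<in> borel_measurable M"
    and k: "(\<integral>\<^sup>+y. k y \<partial>M) \<le> 1"
  shows "epow a (\<integral>\<^sup>+y. k y * w y \<partial>M) \<le> (\<integral>\<^sup>+y. k y * epow a (w y) \<partial>M)"
proof -
  let ?I = "\<integral>\<^sup>+y. k y * w y \<partial>M" and ?J = "\<integral>\<^sup>+y. k y * epow a (w y) \<partial>M"
  have key: "ennreal (c powr a) \<le> ?J" if c: "0 < c" and cI: "ennreal c \<le> ?I" for c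
  proof -
    have cc: "a * c powr (a - 1) * c = c powr a + (a - 1) * c powr a"
      using c by (simp add: powr_diff algebra_simps)
    have "ennreal (c powr a) + ennreal ((a - 1) * c powr a) = ennreal (a * c powr (a - 1)) * ennreal c"
      using a c by (simp add: ennreal_mult[symmetric] ennreal_plus[symmetric] cc del: ennreal_plus)
    also have "\<dots> \<le> ennreal (a * c powr (a - 1)) * ?I" by (intro mult_left_mono cI) simp
    also have "\<dots> = (\<integral>\<^sup>+y. k y * (ennreal (a * c powr (a - 1)) * w y) \<partial>M)"
      by (subst nn_integral_cmult[symmetric]) (auto simp: mult_ac)
    also have "\<dots> \<le> (\<integral>\<^sup>+y. k y * (epow a (w y) + ennreal ((a - 1) * c powr a)) \<partial>M)"
      by (intro nn_integral_mono mult_left_mono epow_young a c) auto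
    also have "\<dots> = ?J + (\<integral>\<^sup>+y. k y \<partial>M) * ennreal ((a - 1) * c powr a)"
      by (simp add: ring_distribs nn_integral_add nn_integral_multc)
    also have "\<dots> \<le> ?J + 1 * ennreal ((a - 1) * c powr a)"
      by (intro add_mono mult_right_mono k) auto
    finally show ?thesis by (simp add: ennreal_add_left_cancel_le add.commute)
  qed
  show ?thesis
  proof (cases ?I)
    case (real r)
    show ?thesis
    proof (cases "r = 0")
      case True then show ?thesis using real by simp
    next
      case False
      then have "r > 0" using real by simp
      from key[OF this] show ?thesis using real by (simp add: epow_ennreal)
    qed
  next
    case top
    have "?J = top"
    proof (rule ccontr)
      assume "?J \<noteq> top"
      then obtain j where j: "0 \<le> j" "?J = ennreal j" by (cases ?J) auto
      have "ennreal (((j + 1) powr (1 / a)) powr a) \<le> ?J"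
        by (rule key) (use j in \<open>auto simp: top\<close>)
      moreover have "((j + 1) powr (1 / a)) powr a = j + 1" using j a by (simp add: powr_powr)
      ultimately show False using j by simp
    qed
    then show ?thesis by simp
  qed
qed

text \<open>For A \<ge> 0 this says that the L^a norm over the whole space is at most A, written
  through a-th powers to avoid roots of extended numbers.\<close>

definition Lb :: "real \<Rightarrow> ('a::euclidean_space \<Rightarrow> ennreal) \<Rightarrow> real \<Rightarrow> bool" where
  "Lb a w A \<longleftrightarrow> (\<integral>\<^sup>+x. epow a (w x) \<partial>lborel) \<le> ennreal (A powr a)"

lemma Lb_mono_AE:
  assumes "0 < a" "Lb a v A" "AE x in lborel. w x \<le> v x" "0 \<le> A" "A \<le> B"
  shows "Lb a w B"
proof -
  have "(\<integral>\<^sup>+x. epow a (w x) \<partial>lborel) \<le> (\<integral>\<^sup>+x. epow a (v x) \<partial>lborel)"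
    by (rule nn_integral_mono_AE) (use assms(3) in eventually_elim, rule epow_mono[OF assms(1)])
  also have "\<dots> \<le> ennreal (A powr a)" using assms(2) by (simp add: Lb_def)
  also have "\<dots> \<le> ennreal (B powr a)" using assms by (intro ennreal_leI powr_mono2) auto
  finally show ?thesis by (simp add: Lb_def)
qed

text \<open>The factor 4 is two factors of 2: one from the pointwise bound for (x+y)^a, one from A^a
  + B^a \<le> 2^a (A+B)^a.\<close>

lemma Lb_add:
  assumes a: "1 \<le> a" and v: "Lb a v A" and w: "Lb a w B" and AB: "0 \<le> A" "0 \<le> B"
    and [measurable]: "v \<in> borel_measurable borel" "w \<in> borel_measurable borel"
  shows "Lb a (\<lambda>x. v x + w x) (4 * (A + B))"
proof -
  have a0: "0 < a" using a by simp
  have "(\<integral>\<^sup>+x. epow a (v x + w x) \<partial>lborel) \<le> (\<integral>\<^sup>+x. ennreal (2 powr a) * (epow a (v x) + epow a (w x)) \<partial>lborel)"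
    by (intro nn_integral_mono epow_add_le a0)
  also have "\<dots> = ennreal (2 powr a) * ((\<integral>\<^sup>+x. epow a (v x) \<partial>lborel) + (\<integral>\<^sup>+x. epow a (w x) \<partial>lborel))"
    by (simp add: nn_integral_cmult nn_integral_add)
  also have "\<dots> \<le> ennreal (2 powr a) * (ennreal (A powr a) + ennreal (B powr a))"
    using v w by (intro mult_left_mono add_mono) (auto simp: Lb_def)
  also have "\<dots> = ennreal (2 powr a * (A powr a + B powr a))"
    by (simp add: ennreal_mult ennreal_plus)
  also have "\<dots> \<le> ennreal ((4 * (A + B)) powr a)"
  proof (rule ennreal_leI)
    have "A powr a + B powr a \<le> 2 * (A + B) powr a"
      using AB a powr_mono2[of a A "A + B"] powr_mono2[of a B "A + B"] by simp
    also have "\<dots> \<le> 2 powr a * (A + B) powr a"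
      using a powr_mono[of 1 a 2] by (intro mult_right_mono) auto
    finally have "2 powr a * (A powr a + B powr a) \<le> 2 powr a * (2 powr a * (A + B) powr a)"
      by (intro mult_left_mono) auto
    also have "\<dots> = (4 * (A + B)) powr a"
      using AB by (simp add: powr_mult[symmetric])
    finally show "2 powr a * (A powr a + B powr a) \<le> (4 * (A + B)) powr a" .
  qed
  finally show ?thesis by (simp add: Lb_def)
qed

lemma Lb_scale:
  assumes a: "0 < a" and v: "Lb a v A" and c: "0 \<le> c" "0 \<le> A" and [measurable]: "v \<in> borel_measurable borel"
  shows "Lb a (\<lambda>x. ennreal c * v x) (c * A)"
proof -
  have "(\<integral>\<^sup>+x. epow a (ennreal c * v x) \<partial>lborel) = ennreal (c powr a) * (\<integral>\<^sup>+x. epow a (v x) \<partial>lborel)"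
    using c by (simp add: epow_mult[OF a] epow_ennreal nn_integral_cmult)
  also have "\<dots> \<le> ennreal (c powr a) * ennreal (A powr a)"
    using v by (intro mult_left_mono) (auto simp: Lb_def)
  also have "\<dots> = ennreal ((c * A) powr a)" using c by (simp add: ennreal_mult[symmetric] powr_mult)
  finally show ?thesis by (simp add: Lb_def)
qed

lemma Lb_epow:
  assumes "0 < p" "0 < r" "Lb r w A" "0 \<le> A"
  shows "Lb (r / p) (\<lambda>x. epow p (w x)) (A powr p)"
  using assms by (simp add: Lb_def epow_epow powr_powr)

lemma Lb_SUP:
  fixes w :: "nat \<Rightarrow> 'a::euclidean_space \<Rightarrow> ennreal"
  assumes a: "0 < a" and w: "\<And>n. Lb a (w n) A" and inc: "incseq w" and [measurable]: "\<And>n. w n \<in> borel_measurable borel"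
  shows "Lb a (\<lambda>x. SUP n. w n x) A"
proof -
  have "(\<integral>\<^sup>+x. epow a (SUP n. w n x) \<partial>lborel) = (\<integral>\<^sup>+x. (SUP n. epow a (w n x)) \<partial>lborel)"
    by (simp add: epow_SUP[OF a])
  also have "\<dots> = (SUP n. \<integral>\<^sup>+x. epow a (w n x) \<partial>lborel)"
    by (rule nn_integral_monotone_convergence_SUP)
      (use inc in \<open>auto simp: incseq_def le_fun_def intro!: epow_mono[OF a]\<close>)
  also have "\<dots> \<le> ennreal (A powr a)" using w by (intro SUP_least) (auto simp: Lb_def)
  finally show ?thesis by (simp add: Lb_def)
qed

lemma Lb_const_ball:
  assumes "0 < a" "0 \<le> c"
  shows "Lb a (\<lambda>x. ennreal c * indicator (ball (0::'a::euclidean_space) R) x) (c * measure lborel (ball (0::'a) R) powr (1 / a))"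
proof -
  let ?m = "measure lborel (ball (0::'a) R)"
  have "epow a (ennreal c * indicator (ball 0 R) x) = ennreal (c powr a) * indicator (ball 0 R) x" for x :: 'a
    using assms by (auto simp: indicator_def epow_ennreal)
  then have "(\<integral>\<^sup>+x. epow a (ennreal c * indicator (ball (0::'a) R) x) \<partial>lborel) = ennreal (c powr a) * emeasure lborel (ball (0::'a) R)"
    by (simp add: nn_integral_cmult_indicator)
  also have "emeasure lborel (ball (0::'a) R) = ennreal ?m"
    by (intro emeasure_eq_ennreal_measure) (use emeasure_bounded_finite[OF bounded_ball, of "0::'a" R] in auto)
  also have "ennreal (c powr a) * ennreal ?m = ennreal ((c * ?m powr (1 / a)) powr a)"
    using assms by (simp add: ennreal_mult[symmetric] powr_mult powr_powr)
  finally show ?thesis by (simp add: Lb_def)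
qed

text \<open>Minkowski's integral inequality, by Jensen's inequality for the density \<open>\<omega> / W\<close>.\<close>
lemma Lb_time_integral:
  fixes G :: "real \<Rightarrow> 'a::euclidean_space \<Rightarrow> ennreal"
  assumes a: "1 \<le> a" and [measurable]: "(\<lambda>z. G (fst z) (snd z)) \<in> borel_measurable (borel \<Otimes>\<^sub>M borel)" "\<omega> \<in> borel_measurable borel"
    and \<omega>: "\<And>s. 0 < s \<Longrightarrow> s < t \<Longrightarrow> 0 < \<omega> s"
    and W: "(\<integral>\<^sup>+s\<in>{0<..<t}. ennreal (\<omega> s) \<partial>lborel) \<le> ennreal W" "0 < W" and M: "0 \<le> M"
    and G: "\<And>s. 0 < s \<Longrightarrow> s < t \<Longrightarrow> Lb a (G s) (M * \<omega> s)"
  shows "Lb a (\<lambda>x. \<integral>\<^sup>+s\<in>{0<..<t}. G s x \<partial>lborel) (M * W)"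
proof -
  have a0: "0 < a" using a by simp
  have [measurable]: "(\<lambda>(s, x). G s x) \<in> borel_measurable (borel \<Otimes>\<^sub>M borel)" by (simp add: case_prod_beta')
  define k where "k = (\<lambda>s. ennreal (\<omega> s / W) * indicator {0<..<t} s)"
  have [measurable]: "k \<in> borel_measurable borel" unfolding k_def by measurable
  have km: "(\<integral>\<^sup>+s. k s \<partial>lborel) \<le> 1"
  proof -
    have "(\<integral>\<^sup>+s. k s \<partial>lborel) = (\<integral>\<^sup>+s. ennreal (1 / W) * (ennreal (\<omega> s) * indicator {0<..<t} s) \<partial>lborel)"
      using W(2) \<omega> by (intro nn_integral_cong) (auto simp: k_def indicator_def ennreal_mult'[symmetric])
    also have "\<dots> = ennreal (1 / W) * (\<integral>\<^sup>+s\<in>{0<..<t}. ennreal (\<omega> s) \<partial>lborel)"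
      by (rule nn_integral_cmult) measurable
    also have "\<dots> \<le> ennreal (1 / W) * ennreal W" using W by (intro mult_left_mono) auto
    also have "\<dots> = 1" using W(2) by (simp add: ennreal_mult[symmetric])
    finally show ?thesis .
  qed
  have eq: "(\<integral>\<^sup>+s\<in>{0<..<t}. G s x \<partial>lborel) = (\<integral>\<^sup>+s. k s * (ennreal (W / \<omega> s) * G s x) \<partial>lborel)" for x
  proof (rule nn_integral_cong)
    fix s
    show "G s x * indicator {0<..<t} s = k s * (ennreal (W / \<omega> s) * G s x)"
    proof (cases "0 < s \<and> s < t")
      case True
      then have "ennreal (\<omega> s / W) * ennreal (W / \<omega> s) = 1"
        using W(2) \<omega>[of s] by (simp add: ennreal_mult[symmetric])
      then show ?thesis using True by (simp add: k_def mult.assoc[symmetric])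
    qed (auto simp: k_def)
  qed
  have "(\<integral>\<^sup>+x. epow a (\<integral>\<^sup>+s\<in>{0<..<t}. G s x \<partial>lborel) \<partial>lborel)
      \<le> (\<integral>\<^sup>+x. (\<integral>\<^sup>+s. k s * epow a (ennreal (W / \<omega> s) * G s x) \<partial>lborel) \<partial>lborel)"
    unfolding eq by (intro nn_integral_mono jensen_epow a km) measurable
  also have "\<dots> = (\<integral>\<^sup>+s. (\<integral>\<^sup>+x. k s * epow a (ennreal (W / \<omega> s) * G s x) \<partial>lborel) \<partial>lborel)"
    by (rule lborel_pair.Fubini'[symmetric]) measurable
  also have "\<dots> \<le> (\<integral>\<^sup>+s. k s * ennreal ((M * W) powr a) \<partial>lborel)"
  proof (rule nn_integral_mono)
    fix s
    have [measurable]: "G s \<in> borel_measurable borel" by measurable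
    show "(\<integral>\<^sup>+x. k s * epow a (ennreal (W / \<omega> s) * G s x) \<partial>lborel) \<le> k s * ennreal ((M * W) powr a)"
    proof (cases "0 < s \<and> s < t")
      case True
      then have o: "0 < \<omega> s" using \<omega> by simp
      have "Lb a (\<lambda>x. ennreal (W / \<omega> s) * G s x) (W / \<omega> s * (M * \<omega> s))"
        by (rule Lb_scale[OF a0 G]) (use True W(2) o M in auto)
      then have "(\<integral>\<^sup>+x. epow a (ennreal (W / \<omega> s) * G s x) \<partial>lborel) \<le> ennreal ((M * W) powr a)"
        using o by (simp add: Lb_def mult.commute)
      then show ?thesis by (subst nn_integral_cmult) (auto intro!: mult_left_mono)
    qed (auto simp: k_def)
  qed
  also have "\<dots> = (\<integral>\<^sup>+s. k s \<partial>lborel) * ennreal ((M * W) powr a)" by (rule nn_integral_multc) measurable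
  also have "\<dots> \<le> 1 * ennreal ((M * W) powr a)" by (intro mult_right_mono km) simp
  finally show ?thesis by (simp add: Lb_def)
qed

text \<open>On each half of (0,t) one of the two factors is at most its value at t/2, and the other
  is integrated exactly. The power of t is the homogeneity of the Beta integral.\<close>

lemma beta_weight_integral:
  assumes \<gamma>: "0 \<le> \<gamma>" "\<gamma> < 1" and \<kappa>: "0 \<le> \<kappa>" "\<kappa> < 1" and t: "0 < t"
  shows "(\<integral>\<^sup>+s\<in>{0<..<t}. ennreal ((t - s) powr (- \<gamma>) * s powr (- \<kappa>)) \<partial>lborel)
     \<le> ennreal ((2 powr \<gamma> / (1 - \<kappa>) + 2 powr \<kappa> / (1 - \<gamma>)) * t powr (1 - \<gamma> - \<kappa>))"
proof -
  have I: "(\<integral>\<^sup>+s. ennreal (s powr (- b)) * indicator {0..t} s \<partial>lborel) = ennreal (t powr (1 - b) / (1 - b))" if "b < 1" for b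
    using nn_integral_has_integral_lebesgue'[OF _ has_integral_powr_from_0[of "- b" t]] that t by simp
  have I2: "(\<integral>\<^sup>+s. ennreal ((t - s) powr (- b)) * indicator {0..t} s \<partial>lborel) = ennreal (t powr (1 - b) / (1 - b))" if "b < 1" for b
  proof -
    have "(\<integral>\<^sup>+s. ennreal (s powr (- b)) * indicator {0..t} s \<partial>lborel)
      = ennreal \<bar>-1\<bar> * (\<integral>\<^sup>+s. ennreal ((t + (-1) * s) powr (- b)) * indicator {0..t} (t + (-1) * s) \<partial>lborel)"
      by (rule nn_integral_real_affine) auto
    also have "\<dots> = (\<integral>\<^sup>+s. ennreal ((t - s) powr (- b)) * indicator {0..t} s \<partial>lborel)"
      by (auto intro!: nn_integral_cong simp: indicator_def)
    finally show ?thesis using I[OF that] by simp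
  qed
  have "(\<integral>\<^sup>+s\<in>{0<..<t}. ennreal ((t - s) powr (- \<gamma>) * s powr (- \<kappa>)) \<partial>lborel)
    \<le> (\<integral>\<^sup>+s. ennreal ((t / 2) powr (- \<gamma>)) * (ennreal (s powr (- \<kappa>)) * indicator {0..t} s)
         + ennreal ((t / 2) powr (- \<kappa>)) * (ennreal ((t - s) powr (- \<gamma>)) * indicator {0..t} s) \<partial>lborel)"
  proof (rule nn_integral_mono)
    fix s
    show "ennreal ((t - s) powr (- \<gamma>) * s powr (- \<kappa>)) * indicator {0<..<t} s
      \<le> ennreal ((t / 2) powr (- \<gamma>)) * (ennreal (s powr (- \<kappa>)) * indicator {0..t} s)
         + ennreal ((t / 2) powr (- \<kappa>)) * (ennreal ((t - s) powr (- \<gamma>)) * indicator {0..t} s)"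
    proof (cases "0 < s \<and> s < t")
      case True
      have "(t - s) powr (- \<gamma>) * s powr (- \<kappa>) \<le> (t / 2) powr (- \<gamma>) * s powr (- \<kappa>) + (t / 2) powr (- \<kappa>) * (t - s) powr (- \<gamma>)"
      proof (cases "s \<le> t / 2")
        case True': True
        have "(t - s) powr (- \<gamma>) \<le> (t / 2) powr (- \<gamma>)" using True True' \<gamma> by (intro powr_mono2') auto
        then have "(t - s) powr (- \<gamma>) * s powr (- \<kappa>) \<le> (t / 2) powr (- \<gamma>) * s powr (- \<kappa>)" by (rule mult_right_mono) simp
        then show ?thesis by (simp add: add_increasing2)
      next
        case False
        have "s powr (- \<kappa>) \<le> (t / 2) powr (- \<kappa>)" using True False \<kappa> t by (intro powr_mono2') auto
        then have "s powr (- \<kappa>) * (t - s) powr (- \<gamma>) \<le> (t / 2) powr (- \<kappa>) * (t - s) powr (- \<gamma>)" by (rule mult_right_mono) simp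
        then show ?thesis by (simp add: add_increasing mult.commute)
      qed
      then have "ennreal ((t - s) powr (- \<gamma>) * s powr (- \<kappa>)) \<le> ennreal ((t / 2) powr (- \<gamma>) * s powr (- \<kappa>) + (t / 2) powr (- \<kappa>) * (t - s) powr (- \<gamma>))"
        by (rule ennreal_leI)
      then show ?thesis using True by (simp add: ennreal_mult)
    qed auto
  qed
  also have "\<dots> = ennreal ((t / 2) powr (- \<gamma>)) * ennreal (t powr (1 - \<kappa>) / (1 - \<kappa>)) + ennreal ((t / 2) powr (- \<kappa>)) * ennreal (t powr (1 - \<gamma>) / (1 - \<gamma>))"
    using I[OF \<kappa>(2)] I2[OF \<gamma>(2)] by (simp add: nn_integral_add nn_integral_cmult)
  also have "\<dots> = ennreal ((t / 2) powr (- \<gamma>) * (t powr (1 - \<kappa>) / (1 - \<kappa>)) + (t / 2) powr (- \<kappa>) * (t powr (1 - \<gamma>) / (1 - \<gamma>)))"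
  proof -
    have "ennreal x * ennreal y + ennreal x' * ennreal y' = ennreal (x * y + x' * y')"
      if "0 \<le> x" "0 \<le> y" "0 \<le> x'" "0 \<le> y'" for x y x' y'
      using that by (simp add: ennreal_mult)
    then show ?thesis using \<gamma> \<kappa> by simp
  qed
  also have "(t / 2) powr (- \<gamma>) * (t powr (1 - \<kappa>) / (1 - \<kappa>)) + (t / 2) powr (- \<kappa>) * (t powr (1 - \<gamma>) / (1 - \<gamma>))
     = (2 powr \<gamma> / (1 - \<kappa>) + 2 powr \<kappa> / (1 - \<gamma>)) * t powr (1 - \<gamma> - \<kappa>)"
  proof -
    have h: "(t / 2) powr (- b) = 2 powr b * t powr (- b)" for b
      by (simp only: powr_divide powr_minus_divide) simp
    have "t powr (- \<gamma>) * t powr (1 - \<kappa>) = t powr (1 - \<gamma> - \<kappa>)" "t powr (- \<kappa>) * t powr (1 - \<gamma>) = t powr (1 - \<gamma> - \<kappa>)"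
      by (simp_all add: powr_add[symmetric] algebra_simps)
    moreover have "2 powr c * x * (y / d) = 2 powr c / d * (x * y)" for c x y d :: real by simp
    ultimately show ?thesis by (simp only: h ring_distribs)
  qed
  finally show ?thesis .
qed

section \<open>Smoothing by the heat flow\<close>

context dirichlet_system
begin

text \<open>The semigroup acting on [0,\<infinity>]-valued functions. Integrating over the whole
  space agrees with integrating over the ball, because the kernel vanishes outside.\<close>

definition heat :: "real \<Rightarrow> (real^'n \<Rightarrow> ennreal) \<Rightarrow> real^'n \<Rightarrow> ennreal" where
  "heat t w x = (\<integral>\<^sup>+y. ennreal (pk t x y) * w y \<partial>lborel)"

lemma heat_measurable[measurable]:
  assumes [measurable]: "w \<in> borel_measurable borel"
  shows "heat t w \<in> borel_measurable borel"
  unfolding heat_def[abs_def] by measurable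

lemma heat_mono_AE: "AE y in lborel. y \<in> ball 0 R \<longrightarrow> v y \<le> w y \<Longrightarrow> heat t v x \<le> heat t w x"
  unfolding heat_def
  by (rule nn_integral_mono_AE, erule eventually_mono) (use pk_outside[of x _ t] in \<open>auto intro: mult_left_mono\<close>)

lemma heat_cong_AE:
  assumes "AE y in lborel. y \<in> ball 0 R \<longrightarrow> v y = w y"
  shows "heat t v x = heat t w x"
  by (rule antisym; rule heat_mono_AE; use assms in eventually_elim; simp)

lemma dirichlet_semigroup_heat: "dirichlet_semigroup R lam \<phi> t v x = heat t (\<lambda>y. ennreal (v y)) x"
  unfolding dirichlet_semigroup_def heat_def
  by (intro nn_integral_cong) (use pk_outside[of x _ t] in \<open>auto simp: indicator_def\<close>)

lemma heat_add:
  assumes [measurable]: "v \<in> borel_measurable borel" "w \<in> borel_measurable borel"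
  shows "heat t (\<lambda>y. v y + w y) x = heat t v x + heat t w x"
  unfolding heat_def by (simp add: distrib_left nn_integral_add)

lemma heat_jensen:
  assumes t: "0 < t" and a: "1 \<le> a" and w[measurable]: "w \<in> borel_measurable borel"
  shows "AE x in lborel. epow a (heat t w x) \<le> heat t (\<lambda>y. epow a (w y)) x"
  using pk_row_integral[OF t]
proof eventually_elim
  case (elim x)
  show ?case unfolding heat_def by (rule jensen_epow[OF a _ _ elim]) measurable
qed

text \<open>By symmetry of the kernel the columns, like the rows, have mass at most 1.\<close>

lemma heat_mass:
  assumes t: "0 < t" and [measurable]: "w \<in> borel_measurable borel"
  shows "(\<integral>\<^sup>+x. heat t w x \<partial>lborel) \<le> (\<integral>\<^sup>+y. w y \<partial>lborel)"
proof -
  have "(\<integral>\<^sup>+x. heat t w x \<partial>lborel) = (\<integral>\<^sup>+y. (\<integral>\<^sup>+x. ennreal (pk t x y) * w y \<partial>lborel) \<partial>lborel)"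
    unfolding heat_def by (rule lborel_pair.Fubini') measurable
  also have "\<dots> = (\<integral>\<^sup>+y. (\<integral>\<^sup>+x. ennreal (pk t y x) \<partial>lborel) * w y \<partial>lborel)"
    by (simp add: nn_integral_multc pk_sym[of t _ "_::real^'n"])
  also have "\<dots> \<le> (\<integral>\<^sup>+y. 1 * w y \<partial>lborel)"
    by (rule nn_integral_mono_AE) (use pk_row_integral[OF t] in eventually_elim, rule mult_right_mono, auto)
  finally show ?thesis by simp
qed

lemma heat_sup:
  assumes t: "0 < t" and [measurable]: "w \<in> borel_measurable borel"
  shows "AE x in lborel. heat t w x \<le> ennreal (heat_bound t) * (\<integral>\<^sup>+y. w y \<partial>lborel)"
proof -
  have "AE x in lborel. AE y in lborel. 0 \<le> pk t x y \<and> pk t x y \<le> heat_bound t"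
    using lborel_pair.AE_pair[OF pk_bounds[OF t]] by simp
  then show ?thesis
  proof eventually_elim
    case (elim x)
    have "heat t w x \<le> (\<integral>\<^sup>+y. ennreal (heat_bound t) * w y \<partial>lborel)"
      unfolding heat_def
      by (rule nn_integral_mono_AE) (use elim in eventually_elim, auto intro!: mult_right_mono ennreal_leI)
    then show ?case by (simp add: nn_integral_cmult)
  qed
qed

lemma Lb_heat_same:
  assumes t: "0 < t" and a: "1 \<le> a" and w[measurable]: "w \<in> borel_measurable borel" and A: "Lb a w A"
  shows "Lb a (heat t w) A"
proof -
  have "(\<integral>\<^sup>+x. epow a (heat t w x) \<partial>lborel) \<le> (\<integral>\<^sup>+x. heat t (\<lambda>y. epow a (w y)) x \<partial>lborel)"
    by (rule nn_integral_mono_AE[OF heat_jensen[OF t a w]])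
  also have "\<dots> \<le> (\<integral>\<^sup>+x. epow a (w x) \<partial>lborel)" by (rule heat_mass[OF t]) measurable
  finally show ?thesis using A by (simp add: Lb_def)
qed

text \<open>Interpolation: split the b-th power into exponents b-a and a. The first factor is
  bounded uniformly through Jensen's inequality and the kernel bound, the second integrates by the
  L^a contraction.\<close>

lemma Lb_heat:
  assumes t: "0 < t" and a: "1 \<le> a" "a < b" and w[measurable]: "w \<in> borel_measurable borel" and A: "Lb a w A" "0 \<le> A"
  shows "Lb b (heat t w) (heat_bound t powr (1 / a - 1 / b) * A)"
proof -
  let ?N = "\<integral>\<^sup>+x. epow a (w x) \<partial>lborel"
  let ?H = "heat_bound t"
  have a0: "0 < a" "0 < b" "0 < b - a" "0 < (b - a) / a" using a by auto
  have N: "?N \<le> ennreal (A powr a)" using A by (simp add: Lb_def)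
  have "AE x in lborel. epow a (heat t w x) \<le> ennreal ?H * ?N"
    using heat_jensen[OF t a(1) w] heat_sup[OF t, of "\<lambda>y. epow a (w y)"] by (auto elim!: eventually_elim2)
  then have sup: "AE x in lborel. epow (b - a) (heat t w x) \<le> ennreal ((?H * A powr a) powr ((b - a) / a))"
  proof eventually_elim
    case (elim x)
    have "epow (b - a) (heat t w x) = epow ((b - a) / a) (epow a (heat t w x))"
      using a0 by (simp add: epow_epow)
    also have "\<dots> \<le> epow ((b - a) / a) (ennreal ?H * ennreal (A powr a))"
      by (intro epow_mono[OF a0(4)] order.trans[OF elim] mult_left_mono N) simp
    also have "\<dots> = ennreal ((?H * A powr a) powr ((b - a) / a))"
      using heat_bound_nonneg[of t] by (simp add: ennreal_mult[symmetric] epow_ennreal)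
    finally show ?case .
  qed
  have "(\<integral>\<^sup>+x. epow b (heat t w x) \<partial>lborel) = (\<integral>\<^sup>+x. epow (b - a) (heat t w x) * epow a (heat t w x) \<partial>lborel)"
    using epow_add_exp[OF a0(3,1)] by simp
  also have "\<dots> \<le> (\<integral>\<^sup>+x. ennreal ((?H * A powr a) powr ((b - a) / a)) * epow a (heat t w x) \<partial>lborel)"
    by (rule nn_integral_mono_AE) (use sup in eventually_elim, rule mult_right_mono, auto)
  also have "\<dots> = ennreal ((?H * A powr a) powr ((b - a) / a)) * (\<integral>\<^sup>+x. epow a (heat t w x) \<partial>lborel)"
    by (rule nn_integral_cmult) measurable
  also have "\<dots> \<le> ennreal ((?H * A powr a) powr ((b - a) / a)) * ennreal (A powr a)"
    using Lb_heat_same[OF t a(1) w A(1)] by (intro mult_left_mono) (auto simp: Lb_def)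
  also have "\<dots> = ennreal ((?H powr (1 / a - 1 / b) * A) powr b)"
  proof -
    have e1: "(1 / a - 1 / b) * b = (b - a) / a" using a0 by (simp add: field_simps)
    have e2: "a * ((b - a) / a) + a = b" using a0 by (simp add: field_simps)
    have "(?H * A powr a) powr ((b - a) / a) * A powr a = ?H powr ((b - a) / a) * (A powr (a * ((b - a) / a)) * A powr a)"
      by (simp add: powr_mult powr_powr mult.assoc)
    also have "\<dots> = ?H powr ((b - a) / a) * A powr b"
      unfolding powr_add[symmetric] e2 ..
    also have "\<dots> = (?H powr (1 / a - 1 / b) * A) powr b"
      by (simp only: powr_mult powr_powr e1)
    finally show ?thesis by (simp add: ennreal_mult[symmetric])
  qed
  finally show ?thesis by (simp add: Lb_def)
qed

definition heat_const :: real where "heat_const = ultra_const * 2 powr \<sigma>"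

lemma heat_bound_powr:
  assumes "0 < t"
  shows "heat_bound t powr e = heat_const powr e * t powr (- (\<sigma> * e))"
proof -
  have "(t / 2) powr (- \<sigma>) = 2 powr \<sigma> * t powr (- \<sigma>)"
    by (simp only: powr_divide powr_minus_divide) simp
  then have "heat_bound t = heat_const * t powr (- \<sigma>)"
    by (simp add: heat_bound_def heat_const_def)
  then show ?thesis by (simp add: powr_mult powr_powr)
qed

lemma Lb_heat':
  assumes "0 < t" "1 \<le> a" "a < b" "w \<in> borel_measurable borel" "Lb a w A" "0 \<le> A"
  shows "Lb b (heat t w) (heat_const powr (1 / a - 1 / b) * t powr (- (\<sigma> * (1 / a - 1 / b))) * A)"
  using Lb_heat[OF assms] by (simp only: heat_bound_powr[OF assms(1)])

lemma heat_const_le: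
  assumes t: "0 < t" and c: "0 \<le> c"
  shows "AE x in lborel. heat t (\<lambda>y. ennreal c * indicator (ball 0 R) y) x \<le> ennreal c * indicator (ball 0 R) x"
  using pk_row_integral[OF t]
proof eventually_elim
  case (elim x)
  show ?case
  proof (cases "x \<in> ball 0 R")
    case True
    have "heat t (\<lambda>y. ennreal c * indicator (ball 0 R) y) x \<le> (\<integral>\<^sup>+y. ennreal c * ennreal (pk t x y) \<partial>lborel)"
      unfolding heat_def by (intro nn_integral_mono) (auto simp: indicator_def mult.commute)
    also have "\<dots> \<le> ennreal c * 1" by (subst nn_integral_cmult, measurable) (rule mult_left_mono[OF elim], simp)
    finally show ?thesis using True by simp
  next
    case False
    then have "heat t (\<lambda>y. ennreal c * indicator (ball 0 R) y) x = 0"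
      unfolding heat_def using pk_outside[of x _ t] by simp
    then show ?thesis by simp
  qed
qed

text \<open>The linear part is small in the scale-invariant norm, because bounded functions are dense.\<close>
lemma heat_small:
  fixes u0 :: "real^'n \<Rightarrow> real"
  assumes q: "1 \<le> q" "q < r" and [measurable]: "u0 \<in> borel_measurable borel" and u0: "\<And>x. 0 \<le> u0 x"
    and fin: "(\<integral>\<^sup>+x\<in>ball 0 R. ennreal (u0 x powr q) \<partial>lborel) < \<infinity>" and \<eta>: "0 < \<eta>"
  defines "\<beta> \<equiv> \<sigma> * (1 / q - 1 / r)"
  shows "\<exists>T>0. \<forall>t. 0 < t \<and> t < T \<longrightarrow> Lb r (heat t (\<lambda>y. ennreal (u0 y))) (\<eta> * t powr (- \<beta>))"
proof -
  have [measurable]: "ball (0::real^'n) R \<in> sets borel" by simp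
  have r0: "0 < q" "0 < r" "1 \<le> r" using q by auto
  have \<beta>: "0 < \<beta>" using q r0 \<sigma>_pos unfolding \<beta>_def by (intro mult_pos_pos) (auto simp: field_simps)
  define C where "C = heat_const powr (1 / q - 1 / r)"
  have C: "0 \<le> C" by (simp add: C_def)
  \<comment> \<open>Each of the two parts may use half of \<eta>. With the factor 4 of
    \<open>Lb_add\<close> this asks for 8 C e \<le> \<eta>, and for 8 b \<le> \<eta> t^(-\<beta>),
    which dictates T.\<close>
  define e where "e = \<eta> / (8 * (C + 1))"
  have e: "0 < e" using \<eta> C by (simp add: e_def)
  \<comment> \<open>The excess of u0 over the level m: it tends to zero in L^q by dominated
    convergence, while the rest of u0 is at most m.\<close>
  define w where "w = (\<lambda>(m::nat) y. max 0 (u0 y - real m))"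
  define F where "F = (\<lambda>y. u0 y powr q * indicator (ball 0 R) y)"
  have F: "integrable lborel F"
  proof -
    have "(\<integral>\<^sup>+x. ennreal (norm (F x)) \<partial>lborel) = (\<integral>\<^sup>+x\<in>ball 0 R. ennreal (u0 x powr q) \<partial>lborel)"
      by (intro nn_integral_cong) (auto simp: F_def indicator_def)
    then show ?thesis using fin by (auto simp: integrable_iff_bounded F_def)
  qed
  have "(\<lambda>m. \<integral>y. w m y powr q * indicator (ball 0 R) y \<partial>lborel) \<longlonglongrightarrow> (\<integral>y. 0 \<partial>(lborel :: (real^'n) measure))"
  proof (rule integral_dominated_convergence[OF _ _ F])
    show "AE y in lborel. (\<lambda>m. w m y powr q * indicator (ball 0 R) y) \<longlonglongrightarrow> 0"
    proof (rule AE_I2)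
      fix y
      obtain N :: nat where "u0 y \<le> N" using real_arch_simple by blast
      then have "\<forall>\<^sub>F m in sequentially. w m y powr q * indicator (ball 0 R) y = 0"
        unfolding eventually_sequentially by (intro exI[of _ N]) (auto simp: w_def)
      then show "(\<lambda>m. w m y powr q * indicator (ball 0 R) y) \<longlonglongrightarrow> 0" by (rule tendsto_eventually)
    qed
    show "AE y in lborel. norm (w m y powr q * indicator (ball 0 R) y) \<le> F y" for m
    proof (rule AE_I2)
      fix y
      have "w m y powr q \<le> u0 y powr q" using u0[of y] r0 by (intro powr_mono2) (auto simp: w_def)
      then show "norm (w m y powr q * indicator (ball 0 R) y) \<le> F y" by (auto simp: F_def indicator_def)
    qed
  qed (unfold w_def, measurable)
  then have "\<forall>\<^sub>F m in sequentially. (\<integral>y. w m y powr q * indicator (ball 0 R) y \<partial>lborel) < e powr q"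
    using e by (intro order_tendstoD(2)) auto
  then obtain m where m: "(\<integral>y. w m y powr q * indicator (ball 0 R) y \<partial>lborel) < e powr q"
    by (auto simp: eventually_sequentially)
  have wm[measurable]: "w m \<in> borel_measurable borel" unfolding w_def by measurable
  have w0: "0 \<le> w m y" for y by (simp add: w_def)
  let ?wB = "\<lambda>y. ennreal (w m y) * indicator (ball 0 R) y"
  have LwB: "Lb q ?wB e"
  proof -
    have "(\<integral>\<^sup>+y. epow q (?wB y) \<partial>lborel) = (\<integral>\<^sup>+y. ennreal (w m y powr q * indicator (ball 0 R) y) \<partial>lborel)"
      using w0 by (intro nn_integral_cong) (auto simp: indicator_def epow_ennreal)
    also have "\<dots> = ennreal (\<integral>y. w m y powr q * indicator (ball 0 R) y \<partial>lborel)"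
    proof (rule nn_integral_eq_integral)
      show "integrable lborel (\<lambda>y. w m y powr q * indicator (ball 0 R) y)"
      proof (rule Bochner_Integration.integrable_bound[OF F])
        show "AE y in lborel. norm (w m y powr q * indicator (ball 0 R) y) \<le> norm (F y)"
        proof (rule AE_I2)
          fix y
          have "w m y powr q \<le> u0 y powr q" using u0[of y] r0 by (intro powr_mono2) (auto simp: w_def)
          then show "norm (w m y powr q * indicator (ball 0 R) y) \<le> norm (F y)" by (auto simp: F_def indicator_def)
        qed
      qed measurable
    qed auto
    finally show ?thesis using m by (simp add: Lb_def ennreal_leI)
  qed
  let ?mB = "\<lambda>y. ennreal (real m) * indicator (ball 0 R) y :: ennreal"
  define b where "b = real m * measure lborel (ball (0::real^'n) R) powr (1 / r)"
  have b: "0 \<le> b" by (simp add: b_def)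
  define T where "T = (\<eta> / (8 * (b + 1))) powr (1 / \<beta>)"
  have T: "0 < T" using \<eta> b by (simp add: T_def)
  show ?thesis
  proof (intro exI conjI allI impI, rule T)
    fix t assume t: "0 < t \<and> t < T"
    then have t0: "0 < t" by simp
    have L1: "Lb r (heat t ?wB) (C * t powr (- \<beta>) * e)"
      unfolding C_def \<beta>_def by (rule Lb_heat'[OF t0 q _ LwB]) (use e in auto)
    have L2: "Lb r (heat t ?mB) b"
      by (rule Lb_mono_AE[OF r0(2) Lb_const_ball[OF r0(2), of "real m" R] heat_const_le[OF t0]]) (auto simp: b_def)
    have L3: "Lb r (\<lambda>x. heat t ?wB x + heat t ?mB x) (4 * (C * t powr (- \<beta>) * e + b))"
      by (rule Lb_add[OF r0(3) L1 L2]) (use C e b in auto)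
    show "Lb r (heat t (\<lambda>y. ennreal (u0 y))) (\<eta> * t powr (- \<beta>))"
    proof (rule Lb_mono_AE[OF r0(2) L3])
      have "heat t (\<lambda>y. ennreal (u0 y)) x \<le> heat t ?wB x + heat t ?mB x" for x
      proof (subst heat_add[symmetric], measurable, rule heat_mono_AE, rule AE_I2, rule impI)
        fix y :: "real^'n" assume "y \<in> ball 0 R"
        have "ennreal (u0 y) \<le> ennreal (w m y + real m)" by (intro ennreal_leI) (auto simp: w_def)
        then show "ennreal (u0 y) \<le> ?wB y + ?mB y" using \<open>y \<in> ball 0 R\<close> w0[of y] by simp
      qed
      then show "AE x in lborel. heat t (\<lambda>y. ennreal (u0 y)) x \<le> heat t ?wB x + heat t ?mB x" by simp
      show "0 \<le> 4 * (C * t powr (- \<beta>) * e + b)" using C e b by auto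
      have "t powr \<beta> \<le> T powr \<beta>" using t \<beta> by (intro powr_mono2) auto
      also have "T powr \<beta> = \<eta> / (8 * (b + 1))" using \<eta> b \<beta> by (simp add: T_def powr_powr)
      finally have "t powr \<beta> * (8 * (b + 1)) \<le> \<eta>" using b by (simp add: field_simps)
      moreover have "8 * b * t powr \<beta> \<le> t powr \<beta> * (8 * (b + 1))" by (simp add: algebra_simps)
      ultimately have "8 * b * t powr \<beta> \<le> \<eta>" by linarith
      then have "8 * b * t powr \<beta> * t powr (- \<beta>) \<le> \<eta> * t powr (- \<beta>)" by (rule mult_right_mono) simp
      moreover have "t powr \<beta> * t powr (- \<beta>) = 1" using t0 by (simp add: powr_add[symmetric])
      ultimately have 1: "8 * b \<le> \<eta> * t powr (- \<beta>)" by (simp add: mult.assoc)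
      have "8 * (C * e) \<le> \<eta>"
      proof -
        have "8 * (C * e) = \<eta> * (C / (C + 1))" using C by (simp add: e_def field_simps)
        also have "\<dots> \<le> \<eta> * 1" using C \<eta> by (intro mult_left_mono) auto
        finally show ?thesis by simp
      qed
      then have "8 * (C * e) * t powr (- \<beta>) \<le> \<eta> * t powr (- \<beta>)" by (rule mult_right_mono) simp
      then show "4 * (C * t powr (- \<beta>) * e + b) \<le> \<eta> * t powr (- \<beta>)" using 1 by (simp add: algebra_simps)
    qed
  qed
qed

end

section \<open>Extension of the source term to infinite arguments\<close>

definition ext :: "(real \<Rightarrow> real) \<Rightarrow> ennreal \<Rightarrow> ennreal" where
  "ext f x = (SUP r\<in>{r. 0 \<le> r \<and> ennreal r \<le> x}. ennreal (f r))"

lemma ext_mono: "x \<le> y \<Longrightarrow> ext f x \<le> ext f y"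
  unfolding ext_def by (rule SUP_subset_mono) (auto intro: order.trans)

lemma ext_ennreal:
  assumes f: "mono_on {0..} f" and r: "0 \<le> r"
  shows "ext f (ennreal r) = ennreal (f r)"
  unfolding ext_def
proof (rule antisym)
  show "(SUP r\<in>{s. 0 \<le> s \<and> ennreal s \<le> ennreal r}. ennreal (f r)) \<le> ennreal (f r)"
    using r by (intro SUP_least ennreal_leI mono_onD[OF f]) auto
  show "ennreal (f r) \<le> (SUP r\<in>{s. 0 \<le> s \<and> ennreal s \<le> ennreal r}. ennreal (f r))"
    using r by (intro SUP_upper) auto
qed

lemma ext_measurable:
  assumes f: "mono_on {0..} f" and c: "continuous_on {0..} f"
  shows "ext f \<in> borel_measurable borel"
proof -
  have "continuous_on UNIV (\<lambda>x. f (max 0 x))"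
    by (rule continuous_on_compose2[OF c]) (auto intro: continuous_intros)
  then have [measurable]: "(\<lambda>x. f (max 0 x)) \<in> borel_measurable borel" by (rule borel_measurable_continuous_onI)
  have "ext f = (\<lambda>x. if x = \<infinity> then ext f \<infinity> else ennreal (f (max 0 (enn2real x))))"
  proof
    fix x show "ext f x = (if x = \<infinity> then ext f \<infinity> else ennreal (f (max 0 (enn2real x))))"
      by (cases x) (auto simp: ext_ennreal[OF f])
  qed
  also have "\<dots> \<in> borel_measurable borel" by measurable
  finally show ?thesis .
qed

text \<open>The supremum in the definition of \<open>ext\<close> gives f its limit as the value at
  infinity, so monotone limits can pass through f even where they are infinite. The argument is
  left-continuity: a finite r > 0 below the supremum is approached by r(1 - 1/(m+1)), each of which
  is exceeded by some member of the sequence; at r = 0 any member will do.\<close>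

lemma ext_SUP:
  assumes f: "mono_on {0..} f" and c: "continuous_on {0..} f"
  shows "ext f (SUP n::nat. a n) = (SUP n. ext f (a n))"
proof (rule antisym)
  show "(SUP n. ext f (a n)) \<le> ext f (SUP n. a n)"
    by (intro SUP_least ext_mono SUP_upper) simp
  show "ext f (SUP n. a n) \<le> (SUP n. ext f (a n))"
    unfolding ext_def[of f "SUP n. a n"]
  proof (rule SUP_least)
    fix r assume "r \<in> {r. 0 \<le> r \<and> ennreal r \<le> (SUP n. a n)}"
    then have r: "0 \<le> r" "ennreal r \<le> (SUP n. a n)" by auto
    have below: "ennreal (f s) \<le> (SUP n. ext f (a n))" if s: "0 \<le> s" "s < r \<or> s = 0" for s
    proof (cases "s = 0")
      case True
      have "ennreal (f s) \<le> ext f (a 0)" unfolding ext_def using True by (intro SUP_upper) auto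
      also have "\<dots> \<le> (SUP n. ext f (a n))" by (rule SUP_upper) simp
      finally show ?thesis .
    next
      case False
      then have "s < r" using s by simp
      then have "ennreal s < ennreal r" using s by (intro ennreal_lessI) auto
      then have "ennreal s < (SUP n. a n)" using r(2) by simp
      then obtain n where "ennreal s < a n" by (auto simp: less_SUP_iff)
      then have "ennreal (f s) \<le> ext f (a n)" unfolding ext_def using s by (intro SUP_upper) auto
      also have "\<dots> \<le> (SUP n. ext f (a n))" by (rule SUP_upper) simp
      finally show ?thesis .
    qed
    show "ennreal (f r) \<le> (SUP n. ext f (a n))"
    proof (cases "r = 0")
      case True then show ?thesis using below[of 0] by simp
    next
      case False
      then have rp: "r > 0" using r by simp
      define s where "s = (\<lambda>m. r * (1 - 1 / real (Suc m)))"
      have s: "0 \<le> s m" "s m < r" for m using rp by (auto simp: s_def field_simps)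
      have "s \<longlonglongrightarrow> r * (1 - 0)" unfolding s_def
        by (intro tendsto_mult tendsto_diff tendsto_const LIMSEQ_inverse_real_of_nat[unfolded inverse_eq_divide])
      then have "s \<longlonglongrightarrow> r" by simp
      then have "(\<lambda>m. f (s m)) \<longlonglongrightarrow> f r"
        by (rule continuous_on_tendsto_compose[OF c]) (use r s in auto)
      then have "(\<lambda>m. ennreal (f (s m))) \<longlonglongrightarrow> ennreal (f r)" by (intro tendsto_ennrealI)
      then show ?thesis by (rule LIMSEQ_le_const2) (use below s in auto)
    qed
  qed
qed

lemma ext_growth:
  assumes K: "0 \<le> K" and p: "0 < p" and g: "\<And>s. 0 \<le> s \<Longrightarrow> f s \<le> K * (1 + s powr p)"
  shows "ext f x \<le> ennreal K + ennreal K * epow p x"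
  unfolding ext_def
proof (rule SUP_least)
  fix r assume "r \<in> {r. 0 \<le> r \<and> ennreal r \<le> x}"
  then have r: "0 \<le> r" "ennreal r \<le> x" by auto
  have "ennreal (f r) \<le> ennreal (K + K * r powr p)" using g[OF r(1)] by (intro ennreal_leI) (simp add: ring_distribs)
  also have "\<dots> = ennreal K + ennreal K * epow p (ennreal r)" using K r by (simp add: epow_ennreal ennreal_mult)
  also have "\<dots> \<le> ennreal K + ennreal K * epow p x"
    by (intro add_left_mono mult_left_mono epow_mono p r(2)) simp
  finally show "ennreal (f r) \<le> ennreal K + ennreal K * epow p x" .
qed

section \<open>Sufficiency of the growth condition\<close>

locale semilinear = dirichlet_system \<alpha> R lam \<phi>
  for \<alpha> R :: real and lam :: "nat \<Rightarrow> real" and \<phi> :: "nat \<Rightarrow> real^'n \<Rightarrow> real" +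
  fixes f :: "real \<Rightarrow> real" and q :: real
  assumes f_mono: "mono_on {0..} f" and f_cont: "continuous_on {0..} f" and f_nonneg: "\<forall>s\<ge>0. 0 \<le> f s"
    and q: "1 < q"
begin

text \<open>The critical exponent 1 + \<alpha>q/d.\<close>

definition p :: real where "p = 1 + q / \<sigma>"

lemma p_gt_1: "1 < p"
  using q \<sigma>_pos by (simp add: p_def)

lemma \<sigma>_eq: "\<sigma> = q / (p - 1)"
  using q \<sigma>_pos by (simp add: p_def)

lemma ext_f_measurable[measurable]: "ext f \<in> borel_measurable borel"
  by (rule ext_measurable[OF f_mono f_cont])

definition duhamel :: "(real^'n \<Rightarrow> real) \<Rightarrow> (real \<Rightarrow> real^'n \<Rightarrow> ennreal) \<Rightarrow> real \<Rightarrow> real^'n \<Rightarrow> ennreal" where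
  "duhamel u0 U t x = heat t (\<lambda>y. ennreal (u0 y)) x + (\<integral>\<^sup>+s\<in>{0<..<t}. heat (t - s) (\<lambda>y. ext f (U s y)) x \<partial>lborel)"

primrec picard :: "(real^'n \<Rightarrow> real) \<Rightarrow> nat \<Rightarrow> real \<Rightarrow> real^'n \<Rightarrow> ennreal" where
  "picard u0 0 = (\<lambda>_ _. 0)"
| "picard u0 (Suc n) = duhamel u0 (picard u0 n)"

section \<open>The Picard iterates and their limit\<close>

lemma source_measurable:
  assumes U: "case_prod U \<in> borel_measurable (borel \<Otimes>\<^sub>M borel)"
  shows "(\<lambda>(s, x). heat (t - s) (\<lambda>y. ext f (U s y)) x) \<in> borel_measurable (borel \<Otimes>\<^sub>M borel)"
    and "(\<lambda>((t, x), s). heat (t - s) (\<lambda>y. ext f (U s y)) x) \<in> borel_measurable ((borel \<Otimes>\<^sub>M borel) \<Otimes>\<^sub>M borel)"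
proof -
  have [measurable]: "(\<lambda>x. U (a x) (b x)) \<in> borel_measurable M"
    if "a \<in> borel_measurable M" "b \<in> borel_measurable M" for a b and M :: "'z measure"
    using measurable_compose[OF measurable_Pair[OF that] U] by simp
  show "(\<lambda>(s, x). heat (t - s) (\<lambda>y. ext f (U s y)) x) \<in> borel_measurable (borel \<Otimes>\<^sub>M borel)"
    unfolding heat_def case_prod_beta' by measurable
  show "(\<lambda>((t, x), s). heat (t - s) (\<lambda>y. ext f (U s y)) x) \<in> borel_measurable ((borel \<Otimes>\<^sub>M borel) \<Otimes>\<^sub>M borel)"
    unfolding heat_def case_prod_beta' by measurable
qed

lemma duhamel_measurable:
  assumes [measurable]: "u0 \<in> borel_measurable borel" and U: "case_prod U \<in> borel_measurable (borel \<Otimes>\<^sub>M borel)"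
  shows "case_prod (duhamel u0 U) \<in> borel_measurable (borel \<Otimes>\<^sub>M borel)"
proof -
  have [measurable]: "(\<lambda>w. heat (fst (fst w) - snd w) (\<lambda>y. ext f (U (snd w) y)) (snd (fst w))) \<in> borel_measurable ((borel \<Otimes>\<^sub>M borel) \<Otimes>\<^sub>M borel)"
    using source_measurable(2)[OF U] by (simp add: case_prod_beta')
  have 1: "(\<lambda>z. heat (fst z) (\<lambda>y. ennreal (u0 y)) (snd z)) \<in> borel_measurable (borel \<Otimes>\<^sub>M borel)"
    unfolding heat_def by measurable
  have ind: "indicator {0<..<a} s = (if 0 < s \<and> s < a then 1 else 0 :: ennreal)" for a s :: real
    by (auto simp: indicator_def)
  have "(\<lambda>w. heat (fst (fst w) - snd w) (\<lambda>y. ext f (U (snd w) y)) (snd (fst w)) * indicator {0<..<fst (fst w)} (snd w))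
      \<in> borel_measurable ((borel \<Otimes>\<^sub>M borel) \<Otimes>\<^sub>M borel)"
    unfolding ind by measurable
  then have "(\<lambda>(z, s). heat (fst z - s) (\<lambda>y. ext f (U s y)) (snd z) * indicator {0<..<fst z} s)
      \<in> borel_measurable ((borel \<Otimes>\<^sub>M borel) \<Otimes>\<^sub>M lborel)" by (simp add: case_prod_beta')
  from lborel.borel_measurable_nn_integral[OF this]
  have 2: "(\<lambda>z. \<integral>\<^sup>+s\<in>{0<..<fst z}. heat (fst z - s) (\<lambda>y. ext f (U s y)) (snd z) \<partial>lborel) \<in> borel_measurable (borel \<Otimes>\<^sub>M borel)" .
  show ?thesis
    unfolding duhamel_def[abs_def] case_prod_beta' by (rule borel_measurable_add[OF 1 2])
qed

lemma picard_measurable: "u0 \<in> borel_measurable borel \<Longrightarrow> case_prod (picard u0 n) \<in> borel_measurable (borel \<Otimes>\<^sub>M borel)"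
  by (induction n) (auto intro: duhamel_measurable)

lemma picard_slice_measurable:
  assumes "u0 \<in> borel_measurable borel"
  shows "picard u0 n t \<in> borel_measurable borel"
proof -
  have "(\<lambda>x. case_prod (picard u0 n) (t, x)) \<in> borel_measurable borel"
    by (rule measurable_compose[OF measurable_Pair1' picard_measurable[OF assms]]) simp
  then show ?thesis by simp
qed

lemma duhamel_mono: "(\<And>s x. U s x \<le> U' s x) \<Longrightarrow> duhamel u0 U t x \<le> duhamel u0 U' t x"
  unfolding duhamel_def
  by (intro add_left_mono nn_integral_mono mult_right_mono heat_mono_AE) (auto intro: ext_mono)

lemma picard_Suc_mono: "picard u0 n t x \<le> picard u0 (Suc n) t x"
proof (induction n arbitrary: t x)
  case (Suc n)
  then show ?case unfolding picard.simps(2) by (intro duhamel_mono) simp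
qed simp

lemma picard_incseq: "incseq (\<lambda>n. picard u0 n t x)"
  by (rule incseq_SucI) (rule picard_Suc_mono)

definition picard_limit :: "(real^'n \<Rightarrow> real) \<Rightarrow> real \<Rightarrow> real^'n \<Rightarrow> ennreal" where
  "picard_limit u0 t x = (SUP n. picard u0 n t x)"

lemma picard_limit_measurable:
  assumes "u0 \<in> borel_measurable borel"
  shows "case_prod (picard_limit u0) \<in> borel_measurable (borel \<Otimes>\<^sub>M borel)"
proof -
  have "(\<lambda>z. SUP n. case_prod (picard u0 n) z) \<in> borel_measurable (borel \<Otimes>\<^sub>M borel)"
    by (intro borel_measurable_SUP picard_measurable assms) simp
  then show ?thesis by (simp add: picard_limit_def case_prod_beta')
qed

text \<open>Monotone convergence passes the supremum through f, the kernel integral and the time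
  integral in turn. All values lie in [0,\<infinity>], so no finiteness enters.\<close>

lemma picard_limit_fixed_point:
  assumes u0: "u0 \<in> borel_measurable borel"
  shows "picard_limit u0 t x = duhamel u0 (picard_limit u0) t x"
proof -
  note pm[measurable] = picard_slice_measurable[OF u0]
  have heat_sup: "heat r (\<lambda>y. ext f (picard_limit u0 s y)) x = (SUP n. heat r (\<lambda>y. ext f (picard u0 n s y)) x)" for r s
  proof -
    have "heat r (\<lambda>y. ext f (picard_limit u0 s y)) x = (\<integral>\<^sup>+y. (SUP n. ennreal (pk r x y) * ext f (picard u0 n s y)) \<partial>lborel)"
      unfolding heat_def picard_limit_def ext_SUP[OF f_mono f_cont] by (simp add: SUP_mult_left_ennreal)
    also have "\<dots> = (SUP n. \<integral>\<^sup>+y. ennreal (pk r x y) * ext f (picard u0 n s y) \<partial>lborel)"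
    proof (rule nn_integral_monotone_convergence_SUP)
      show "incseq (\<lambda>n y. ennreal (pk r x y) * ext f (picard u0 n s y))"
        using picard_incseq[of u0 s] by (auto simp: incseq_def le_fun_def intro!: mult_left_mono ext_mono)
    qed measurable
    finally show ?thesis by (simp add: heat_def)
  qed
  have inc: "incseq (\<lambda>n. heat r (\<lambda>y. ext f (picard u0 n s y)) x)" for r s
    using picard_incseq[of u0 s] by (auto simp: incseq_def intro!: heat_mono_AE ext_mono)
  have "duhamel u0 (picard_limit u0) t x = heat t (\<lambda>y. ennreal (u0 y)) x
      + (\<integral>\<^sup>+s. (SUP n. heat (t - s) (\<lambda>y. ext f (picard u0 n s y)) x * indicator {0<..<t} s) \<partial>lborel)"
    unfolding duhamel_def heat_sup by (simp add: SUP_mult_right_ennreal)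
  also have "(\<integral>\<^sup>+s. (SUP n. heat (t - s) (\<lambda>y. ext f (picard u0 n s y)) x * indicator {0<..<t} s) \<partial>lborel)
      = (SUP n. \<integral>\<^sup>+s. heat (t - s) (\<lambda>y. ext f (picard u0 n s y)) x * indicator {0<..<t} s \<partial>lborel)"
  proof (rule nn_integral_monotone_convergence_SUP)
    show "incseq (\<lambda>n s. heat (t - s) (\<lambda>y. ext f (picard u0 n s y)) x * indicator {0<..<t} s)"
      using inc by (auto simp: incseq_def le_fun_def intro!: mult_right_mono)
    fix n
    have "(\<lambda>s. case_prod (\<lambda>s x. heat (t - s) (\<lambda>y. ext f (picard u0 n s y)) x) (s, x)) \<in> borel_measurable borel"
      by (rule measurable_compose[OF measurable_Pair2' source_measurable(1)[OF picard_measurable[OF u0]]]) simp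
    then have [measurable]: "(\<lambda>s. heat (t - s) (\<lambda>y. ext f (picard u0 n s y)) x) \<in> borel_measurable borel" by simp
    show "(\<lambda>s. heat (t - s) (\<lambda>y. ext f (picard u0 n s y)) x * indicator {0<..<t} s) \<in> borel_measurable lborel" by measurable
  qed
  also have "heat t (\<lambda>y. ennreal (u0 y)) x + \<dots> = (SUP n. duhamel u0 (picard u0 n) t x)"
    unfolding duhamel_def by (rule ennreal_SUP_add_right) simp
  also have "\<dots> = (SUP n. picard u0 (Suc n) t x)" by simp
  also have "\<dots> = (SUP n. picard u0 n t x)"
  proof (rule antisym)
    show "(SUP n. picard u0 (Suc n) t x) \<le> (SUP n. picard u0 n t x)"
      by (rule SUP_least) (rule SUP_upper, simp)
    show "(SUP n. picard u0 n t x) \<le> (SUP n. picard u0 (Suc n) t x)"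
      by (rule SUP_mono) (use picard_Suc_mono in blast)
  qed
  finally show ?thesis by (simp only: picard_limit_def[of u0 t x])
qed

text \<open>The gain of the heat flow from \<open>L^(r/p)\<close> to \<open>L^b\<close>, integrated in time.\<close>
lemma duhamel_source_Lb:
  fixes b r \<beta> \<delta> K T m0 :: real
  assumes r: "p < r" "r / p < b" and K: "0 \<le> K" and growth: "\<And>s. 0 \<le> s \<Longrightarrow> f s \<le> K * (1 + s powr p)"
    and T: "0 < T" and \<delta>: "0 \<le> \<delta>"
    and U: "case_prod U \<in> borel_measurable (borel \<Otimes>\<^sub>M borel)"
    and UL: "\<And>s. 0 < s \<Longrightarrow> s < T \<Longrightarrow> Lb r (U s) (\<delta> * s powr (- \<beta>))"
    and \<beta>: "0 \<le> \<beta>" "p * \<beta> < 1" and g: "\<sigma> * (p / r - 1 / b) < 1" and t: "0 < t" "t < T"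
  defines "\<gamma> \<equiv> \<sigma> * (p / r - 1 / b)"
    and "D \<equiv> 4 * K * (measure lborel (ball (0::real^'n) R) powr (p / r) * T powr (p * \<beta>) + \<delta> powr p)"
    and "B \<equiv> 2 powr (\<sigma> * (p / r - 1 / b)) / (1 - p * \<beta>) + 2 powr (p * \<beta>) / (1 - \<sigma> * (p / r - 1 / b))"
  shows "Lb b (\<lambda>x. \<integral>\<^sup>+s\<in>{0<..<t}. heat (t - s) (\<lambda>y. ext f (U s y)) x \<partial>lborel)
    (heat_const powr (p / r - 1 / b) * D * (B * t powr (1 - \<gamma> - p * \<beta>)))"
proof -
  have [measurable]: "ball (0::real^'n) R \<in> sets borel" by simp
  have "1 < r / p" using p_gt_1 r by simp
  then have pos: "0 < p" "0 < r" "1 < r / p" "1 < b" using p_gt_1 r by linarith+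
  have \<gamma>: "0 \<le> \<gamma>" "\<gamma> < 1"
  proof -
    have "1 / b \<le> p / r" using r pos by (simp add: field_simps)
    then show "0 \<le> \<gamma>" using \<sigma>_pos by (simp add: \<gamma>_def)
    show "\<gamma> < 1" using g by (simp add: \<gamma>_def)
  qed
  have \<kappa>: "0 \<le> p * \<beta>" "p * \<beta> < 1" using \<beta> pos by auto
  let ?b = "measure lborel (ball (0::real^'n) R) powr (p / r)"
  have D: "0 \<le> D" using K \<delta> by (simp add: D_def)
  have B: "0 < B" unfolding B_def \<gamma>_def[symmetric] using \<gamma> \<kappa> by (intro add_pos_pos divide_pos_pos) auto
  have U_slice[measurable]: "U s \<in> borel_measurable borel" for s
    using measurable_compose[OF measurable_Pair1' U, of s] by simp
  \<comment> \<open>The growth bound turns an L^r bound on U into an L^(r/p) bound on the source,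
    with the power s^(-p\<beta>). The constant part of the growth bound is given the same power at
    the price of T^(p\<beta>), as s < T.\<close>
  have wL: "Lb (r / p) (\<lambda>y. ennreal K * indicator (ball 0 R) y + ennreal K * epow p (U s y)) (D * s powr (- (p * \<beta>)))"
    if s: "0 < s" "s < T" for s
  proof (rule Lb_mono_AE)
    have 1: "Lb (r / p) (\<lambda>y. ennreal K * indicator (ball (0::real^'n) R) y) (K * ?b)"
      using Lb_const_ball[of "r / p" K R] pos K by simp
    have 2: "Lb (r / p) (\<lambda>y. ennreal K * epow p (U s y)) (K * (\<delta> * s powr (- \<beta>)) powr p)"
      using UL[OF s] \<delta> pos K by (intro Lb_scale Lb_epow) auto
    show "Lb (r / p) (\<lambda>y. ennreal K * indicator (ball 0 R) y + ennreal K * epow p (U s y)) (4 * (K * ?b + K * (\<delta> * s powr (- \<beta>)) powr p))"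
      by (rule Lb_add[OF _ 1 2]) (use pos K in auto)
    have "s powr (p * \<beta>) \<le> T powr (p * \<beta>)" using s \<kappa> by (intro powr_mono2) auto
    then have "s powr (p * \<beta>) * s powr (- (p * \<beta>)) \<le> T powr (p * \<beta>) * s powr (- (p * \<beta>))" by (rule mult_right_mono) simp
    moreover have "s powr (p * \<beta>) * s powr (- (p * \<beta>)) = 1" using s by (simp add: powr_add[symmetric])
    ultimately have "K * ?b * 1 \<le> K * ?b * (T powr (p * \<beta>) * s powr (- (p * \<beta>)))" using K by (intro mult_left_mono) auto
    moreover have "(\<delta> * s powr (- \<beta>)) powr p = \<delta> powr p * s powr (- (p * \<beta>))"
      by (simp add: powr_mult powr_powr mult.commute)
    ultimately show "4 * (K * ?b + K * (\<delta> * s powr (- \<beta>)) powr p) \<le> D * s powr (- (p * \<beta>))"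
      unfolding D_def by (simp add: algebra_simps)
  qed (use pos K in auto)
  have hL: "Lb b (heat (t - s) (\<lambda>y. ext f (U s y))) (heat_const powr (p / r - 1 / b) * D * ((t - s) powr (- \<gamma>) * s powr (- (p * \<beta>))))"
    if s: "0 < s" "s < t" for s
  proof (rule Lb_mono_AE)
    have "s < T" using s t by simp
    show "Lb b (heat (t - s) (\<lambda>y. ennreal K * indicator (ball 0 R) y + ennreal K * epow p (U s y)))
        (heat_const powr (1 / (r / p) - 1 / b) * (t - s) powr (- (\<sigma> * (1 / (r / p) - 1 / b))) * (D * s powr (- (p * \<beta>))))"
      by (rule Lb_heat'[OF _ _ r(2) _ wL[OF s(1) \<open>s < T\<close>]]) (use s pos D in auto)
    show "AE x in lborel. heat (t - s) (\<lambda>y. ext f (U s y)) x \<le> heat (t - s) (\<lambda>y. ennreal K * indicator (ball 0 R) y + ennreal K * epow p (U s y)) x"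
      using ext_growth[OF K pos(1) growth] by (intro AE_I2 heat_mono_AE) auto
    show "heat_const powr (1 / (r / p) - 1 / b) * (t - s) powr (- (\<sigma> * (1 / (r / p) - 1 / b))) * (D * s powr (- (p * \<beta>)))
      \<le> heat_const powr (p / r - 1 / b) * D * ((t - s) powr (- \<gamma>) * s powr (- (p * \<beta>)))"
      by (simp add: \<gamma>_def)
  qed (use pos D in auto)
  show ?thesis
  proof (rule Lb_time_integral[where \<omega> = "\<lambda>s. (t - s) powr (- \<gamma>) * s powr (- (p * \<beta>))"])
    show "(\<lambda>z. heat (t - fst z) (\<lambda>y. ext f (U (fst z) y)) (snd z)) \<in> borel_measurable (borel \<Otimes>\<^sub>M borel)"
      using source_measurable(1)[OF U, of t] by (simp add: case_prod_beta')
    show "(\<integral>\<^sup>+s\<in>{0<..<t}. ennreal ((t - s) powr (- \<gamma>) * s powr (- (p * \<beta>))) \<partial>lborel) \<le> ennreal (B * t powr (1 - \<gamma> - p * \<beta>))"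
      unfolding B_def \<gamma>_def[symmetric] by (rule beta_weight_integral[OF \<gamma> \<kappa> t(1)])
    show "0 < B * t powr (1 - \<gamma> - p * \<beta>)" using B t by simp
    show "0 \<le> heat_const powr (p / r - 1 / b) * D" using D by simp
  qed (use pos hL in auto)
qed

text \<open>The exponent r satisfies max(p,q) < r < pq. The lower bounds make r/p > 1 and both
  smoothing weights integrable in time; r < pq gives p\<beta> < 1 and r/p < q. The weighted L^r
  bound reproduces itself under the iteration, and inserting it once more into the source yields the
  L^q bound with power zero of t.\<close>

lemma picard_bounds:
  assumes K: "0 \<le> K" and growth: "\<And>s. 0 \<le> s \<Longrightarrow> f s \<le> K * (1 + s powr p)"
    and u0m[measurable]: "u0 \<in> borel_measurable borel" and u0: "\<And>x. 0 \<le> u0 x"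
    and fin: "(\<integral>\<^sup>+x\<in>ball 0 R. ennreal (u0 x powr q) \<partial>lborel) < \<infinity>"
  shows "\<exists>T>0. \<exists>A. \<forall>n t. 0 < t \<and> t < T \<longrightarrow> Lb q (picard u0 n t) A"
proof -
  have [measurable]: "ball (0::real^'n) R \<in> sets borel" by simp
  define r where "r = (max p q + p * q) / 2"
  have "p * 1 < p * q" "1 * q < p * q" using p_gt_1 q by (intro mult_strict_left_mono mult_strict_right_mono; simp)+
  then have m: "max p q < p * q" "p \<le> max p q" "q \<le> max p q" by auto
  have "a < (a + b) / 2 \<and> (a + b) / 2 < b" if "a < b" for a b :: real using that by simp
  from this[OF m(1)] have "max p q < r" "r < p * q" by (simp_all only: r_def)
  then have r: "p < r" "q < r" "r < p * q" using m by auto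
  have pos: "0 < p" "0 < q" "0 < r" "1 \<le> r" "1 \<le> q" using r p_gt_1 q by auto
  define \<beta> where "\<beta> = \<sigma> * (1 / q - 1 / r)"
  have \<beta>_eq: "\<beta> = (r - q) / ((p - 1) * r)"
    unfolding \<beta>_def \<sigma>_eq using pos p_gt_1 by (simp add: field_simps)
  have \<beta>: "0 < \<beta>" unfolding \<beta>_eq using r pos p_gt_1 by simp
  have \<kappa>: "0 < p * \<beta>" "p * \<beta> < 1"
  proof -
    show "0 < p * \<beta>" using \<beta> pos by simp
    have "p * (r - q) < (p - 1) * r" using r by (simp add: algebra_simps)
    then show "p * \<beta> < 1" unfolding \<beta>_eq using p_gt_1 pos by simp
  qed
  have \<gamma>r: "\<sigma> * (p / r - 1 / r) = q / r"
    unfolding \<sigma>_eq using p_gt_1 by (simp add: diff_divide_distrib[symmetric])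
  have \<gamma>q: "\<sigma> * (p / r - 1 / q) = (p * q - r) / ((p - 1) * r)"
    unfolding \<sigma>_eq using p_gt_1 pos by (simp add: field_simps)
  have \<gamma>r1: "\<sigma> * (p / r - 1 / r) < 1" unfolding \<gamma>r using r pos by simp
  have \<gamma>q1: "\<sigma> * (p / r - 1 / q) < 1"
  proof -
    have "p * q - r < (p - 1) * r" using mult_strict_left_mono[OF r(2) pos(1)] by (simp add: algebra_simps)
    then show ?thesis unfolding \<gamma>q using p_gt_1 pos by simp
  qed
  \<comment> \<open>Scale invariance: smoothing, source singularity and time integration combine to
    t^(-\<beta>) again. The analogous balance for L^q gives exponent 0.\<close>
  have er: "1 - \<sigma> * (p / r - 1 / r) - p * \<beta> = - \<beta>"
  proof -
    have "\<beta> * (p - 1) = (r - q) / r" unfolding \<beta>_eq using p_gt_1 pos by simp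
    then show ?thesis unfolding \<gamma>r using pos by (simp add: field_simps)
  qed
  have eq0: "1 - \<sigma> * (p / r - 1 / q) - p * \<beta> = 0"
  proof -
    have "\<sigma> * (p / r - 1 / q) + p * \<beta> = (p * q - r + p * (r - q)) / ((p - 1) * r)"
      unfolding \<gamma>q \<beta>_eq by (simp add: add_divide_distrib)
    also have "p * q - r + p * (r - q) = (p - 1) * r" by (simp add: algebra_simps)
    also have "\<dots> / ((p - 1) * r) = 1" using p_gt_1 pos by simp
    finally show ?thesis by simp
  qed
  have rr: "r / p < r"
    using divide_strict_left_mono[of 1 p r] p_gt_1 pos by simp
  let ?b = "measure lborel (ball (0::real^'n) R) powr (p / r)"
  define Br where "Br = 2 powr (\<sigma> * (p / r - 1 / r)) / (1 - p * \<beta>) + 2 powr (p * \<beta>) / (1 - \<sigma> * (p / r - 1 / r))"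
  define Bq where "Bq = 2 powr (\<sigma> * (p / r - 1 / q)) / (1 - p * \<beta>) + 2 powr (p * \<beta>) / (1 - \<sigma> * (p / r - 1 / q))"
  \<comment> \<open>The 16 collects the factor 4 of \<open>Lb_add\<close> and the factor 4 inside
    \<open>D\<close>.\<close>
  define Q where "Q = 16 * (heat_const powr (p / r - 1 / r) * K * Br)"
  have "0 \<le> Br" unfolding Br_def using \<kappa> \<gamma>r1 by (intro add_nonneg_nonneg divide_nonneg_nonneg) auto
  then have Q: "0 \<le> Q" using K by (simp add: Q_def)
  \<comment> \<open>The budget is split into thirds. This \<delta> makes the superlinear term Q
    \<delta>^p at most \<delta>/3, by p > 1; the linear part contributes 4 times \<delta>/12, and T
    makes the constant part of the growth bound at most \<delta>/3.\<close>
  define \<delta> where "\<delta> = (1 / (3 * (Q + 1))) powr (1 / (p - 1))"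
  have \<delta>: "0 < \<delta>" using Q by (simp add: \<delta>_def)
  have Q\<delta>: "Q * \<delta> powr p \<le> \<delta> / 3"
  proof -
    have "\<delta> powr (p - 1) = 1 / (3 * (Q + 1))" using Q p_gt_1 by (simp add: \<delta>_def powr_powr)
    moreover have "\<delta> powr p = \<delta> powr (p - 1) * \<delta>" using \<delta> by (simp add: powr_diff)
    ultimately have "Q * \<delta> powr p = Q / (Q + 1) * (\<delta> / 3)" by simp
    also have "\<dots> \<le> 1 * (\<delta> / 3)" using Q \<delta> by (intro mult_right_mono) auto
    finally show ?thesis by simp
  qed
  obtain T1 where T1: "0 < T1" "\<And>t. 0 < t \<Longrightarrow> t < T1 \<Longrightarrow> Lb r (heat t (\<lambda>y. ennreal (u0 y))) (\<delta> / 12 * t powr (- \<beta>))"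
    using heat_small[OF pos(5) r(2) u0m u0 fin, of "\<delta> / 12"] \<delta> unfolding \<beta>_def by auto
  define T where "T = min T1 ((\<delta> / (3 * (Q * ?b + 1))) powr (1 / (p * \<beta>)))"
  have T: "0 < T"
  proof -
    have "0 \<le> Q * ?b" using Q by simp
    then have "0 < 3 * (Q * ?b + 1)" by (intro mult_pos_pos add_nonneg_pos) auto
    then have "0 < \<delta> / (3 * (Q * ?b + 1))" using \<delta> by (intro divide_pos_pos)
    then have "0 < (\<delta> / (3 * (Q * ?b + 1))) powr (1 / (p * \<beta>))" by (simp only: powr_gt_zero less_imp_neq[symmetric] not_False_eq_True)
    then show ?thesis unfolding T_def using T1(1) by simp
  qed
  have QT: "Q * (?b * T powr (p * \<beta>)) \<le> \<delta> / 3"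
  proof -
    have "0 \<le> Q * ?b" using Q by simp
    have "T powr (p * \<beta>) \<le> ((\<delta> / (3 * (Q * ?b + 1))) powr (1 / (p * \<beta>))) powr (p * \<beta>)"
      using T \<kappa> by (intro powr_mono2) (auto simp: T_def)
    also have "\<dots> = \<delta> / (3 * (Q * ?b + 1))" using \<kappa> \<delta> \<open>0 \<le> Q * ?b\<close> pos \<beta> by (simp add: powr_powr)
    finally have "Q * ?b * T powr (p * \<beta>) \<le> Q * ?b * (\<delta> / (3 * (Q * ?b + 1)))" using \<open>0 \<le> Q * ?b\<close> by (rule mult_left_mono)
    also have "\<dots> = Q * ?b / (Q * ?b + 1) * (\<delta> / 3)" by simp
    also have "\<dots> \<le> 1 * (\<delta> / 3)" using \<open>0 \<le> Q * ?b\<close> \<delta> by (intro mult_right_mono) auto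
    finally show ?thesis by (simp add: mult.assoc)
  qed
  define D where "D = 4 * K * (?b * T powr (p * \<beta>) + \<delta> powr p)"
  have D: "0 \<le> D" using K by (simp add: D_def)
  have main: "Lb r (picard u0 n t) (\<delta> * t powr (- \<beta>))" if "0 < t" "t < T" for n t
    using that
  proof (induction n arbitrary: t)
    case 0
    show ?case by (simp add: Lb_def)
  next
    case (Suc n)
    have L1: "Lb r (heat t (\<lambda>y. ennreal (u0 y))) (\<delta> / 12 * t powr (- \<beta>))"
      using T1(2)[of t] Suc.prems by (simp add: T_def)
    have L2: "Lb r (\<lambda>x. \<integral>\<^sup>+s\<in>{0<..<t}. heat (t - s) (\<lambda>y. ext f (picard u0 n s y)) x \<partial>lborel)
        (heat_const powr (p / r - 1 / r) * D * (Br * t powr (- \<beta>)))"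
      unfolding D_def Br_def er[symmetric]
      by (rule duhamel_source_Lb[OF r(1) rr K growth T less_imp_le[OF \<delta>] picard_measurable[OF u0m] Suc.IH less_imp_le[OF \<beta>] \<kappa>(2) \<gamma>r1 Suc.prems])
    have Qn: "0 \<le> heat_const powr (p / r - 1 / r) * D * (Br * t powr (- \<beta>))"
      using D \<open>0 \<le> Br\<close> by simp
    have sm: "(\<lambda>x. \<integral>\<^sup>+s\<in>{0<..<t}. heat (t - s) (\<lambda>y. ext f (picard u0 n s y)) x \<partial>lborel) \<in> borel_measurable borel"
    proof -
      have [measurable]: "(\<lambda>(s, x). heat (t - s) (\<lambda>y. ext f (picard u0 n s y)) x) \<in> borel_measurable (borel \<Otimes>\<^sub>M borel)"
        by (rule source_measurable(1)[OF picard_measurable[OF u0m]])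
      show ?thesis by measurable
    qed
    have L3: "Lb r (picard u0 (Suc n) t) (4 * (\<delta> / 12 * t powr (- \<beta>) + heat_const powr (p / r - 1 / r) * D * (Br * t powr (- \<beta>))))"
      unfolding picard.simps(2) duhamel_def[abs_def]
      by (rule Lb_add[OF pos(4) L1 L2 _ Qn _ sm]) (use \<delta> in auto)
    show ?case
    proof (rule Lb_mono_AE[OF pos(3) L3])
      show "0 \<le> 4 * (\<delta> / 12 * t powr (- \<beta>) + heat_const powr (p / r - 1 / r) * D * (Br * t powr (- \<beta>)))"
        using \<delta> Qn by simp
      have "4 * (\<delta> / 12 * t powr (- \<beta>) + heat_const powr (p / r - 1 / r) * D * (Br * t powr (- \<beta>)))
        = (\<delta> / 3 + (Q * (?b * T powr (p * \<beta>)) + Q * \<delta> powr p)) * t powr (- \<beta>)"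
        unfolding D_def Q_def by (simp add: algebra_simps)
      also have "\<dots> \<le> \<delta> * t powr (- \<beta>)" using QT Q\<delta> by (intro mult_right_mono) auto
      finally show "4 * (\<delta> / 12 * t powr (- \<beta>) + heat_const powr (p / r - 1 / r) * D * (Br * t powr (- \<beta>))) \<le> \<delta> * t powr (- \<beta>)" .
    qed simp
  qed
  obtain A0 where A0: "0 \<le> A0" "Lb q (\<lambda>y. ennreal (u0 y) * indicator (ball 0 R) y) A0"
  proof -
    have "(\<integral>\<^sup>+y. epow q (ennreal (u0 y) * indicator (ball 0 R) y) \<partial>lborel) = (\<integral>\<^sup>+x\<in>ball 0 R. ennreal (u0 x powr q) \<partial>lborel)"
      using u0 by (intro nn_integral_cong) (auto simp: indicator_def epow_ennreal)
    moreover obtain a where a: "0 \<le> a" "(\<integral>\<^sup>+x\<in>ball 0 R. ennreal (u0 x powr q) \<partial>lborel) = ennreal a"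
      using fin by (cases "\<integral>\<^sup>+x\<in>ball 0 R. ennreal (u0 x powr q) \<partial>lborel") auto
    ultimately have "Lb q (\<lambda>y. ennreal (u0 y) * indicator (ball 0 R) y) (a powr (1 / q))"
      using pos by (simp add: Lb_def powr_powr)
    then show ?thesis using that[of "a powr (1 / q)"] by simp
  qed
  let ?A = "4 * (A0 + heat_const powr (p / r - 1 / q) * D * Bq)"
  have Bq: "0 \<le> Bq" unfolding Bq_def using \<kappa> \<gamma>q1 by (intro add_nonneg_nonneg divide_nonneg_nonneg) auto
  have "Lb q (picard u0 n t) ?A" if t: "0 < t" "t < T" for n t
  proof (cases n)
    case 0
    then show ?thesis by (simp add: Lb_def)
  next
    case (Suc m)
    have "Lb q (heat t (\<lambda>y. ennreal (u0 y) * indicator (ball 0 R) y)) A0"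
      by (rule Lb_heat_same[OF t(1) pos(5) _ A0(2)]) measurable
    moreover have "heat t (\<lambda>y. ennreal (u0 y) * indicator (ball 0 R) y) = heat t (\<lambda>y. ennreal (u0 y))"
      by (intro ext heat_cong_AE) auto
    ultimately have L1: "Lb q (heat t (\<lambda>y. ennreal (u0 y))) A0" by simp
    have rq: "r / p < q" using r pos by (simp add: field_simps)
    have "Lb q (\<lambda>x. \<integral>\<^sup>+s\<in>{0<..<t}. heat (t - s) (\<lambda>y. ext f (picard u0 m s y)) x \<partial>lborel)
        (heat_const powr (p / r - 1 / q) * D * (Bq * t powr (1 - \<sigma> * (p / r - 1 / q) - p * \<beta>)))"
      unfolding D_def Bq_def
      by (rule duhamel_source_Lb[OF r(1) rq K growth T less_imp_le[OF \<delta>] picard_measurable[OF u0m] main less_imp_le[OF \<beta>] \<kappa>(2) \<gamma>q1 t])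
    then have L2: "Lb q (\<lambda>x. \<integral>\<^sup>+s\<in>{0<..<t}. heat (t - s) (\<lambda>y. ext f (picard u0 m s y)) x \<partial>lborel)
        (heat_const powr (p / r - 1 / q) * D * Bq)"
      using t unfolding eq0 by (simp add: mult.assoc)
    have sm: "(\<lambda>x. \<integral>\<^sup>+s\<in>{0<..<t}. heat (t - s) (\<lambda>y. ext f (picard u0 m s y)) x \<partial>lborel) \<in> borel_measurable borel"
    proof -
      have [measurable]: "(\<lambda>(s, x). heat (t - s) (\<lambda>y. ext f (picard u0 m s y)) x) \<in> borel_measurable (borel \<Otimes>\<^sub>M borel)"
        by (rule source_measurable(1)[OF picard_measurable[OF u0m]])
      show ?thesis by measurable
    qed
    show ?thesis unfolding Suc picard.simps(2) duhamel_def[abs_def]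
      by (rule Lb_add[OF pos(5) L1 L2 A0(1) _ _ sm]) (use D Bq in auto)
  qed
  then show ?thesis using T by blast
qed

text \<open>The uniform L^q bound passes to the monotone limit and makes it finite almost everywhere
  in each time slice. Hence its real-valued version has the same source term under the semigroup and
  solves the same equation.\<close>

theorem existence:
  assumes K: "0 \<le> K" and growth: "\<And>s. 0 \<le> s \<Longrightarrow> f s \<le> K * (1 + s powr p)"
  shows "local_existence_Lq R lam \<phi> f q"
  unfolding local_existence_Lq_def
proof (intro allI impI)
  fix u0 :: "real^'n \<Rightarrow> real"
  assume u0m: "u0 \<in> borel_measurable lborel" and u0: "\<forall>x. 0 \<le> u0 x"
    and fin: "(\<integral>\<^sup>+x\<in>ball 0 R. ennreal (\<bar>u0 x\<bar> powr q) \<partial>lborel) < \<infinity>"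
  have u0m'[measurable]: "u0 \<in> borel_measurable borel" using u0m by simp
  have fin': "(\<integral>\<^sup>+x\<in>ball 0 R. ennreal (u0 x powr q) \<partial>lborel) < \<infinity>" using fin u0 by simp
  obtain T A where T: "0 < T" and A: "\<And>n t. 0 < t \<Longrightarrow> t < T \<Longrightarrow> Lb q (picard u0 n t) A"
    using picard_bounds[OF K growth u0m' u0[rule_format] fin'] by blast
  define U where "U = picard_limit u0"
  have Um: "case_prod U \<in> borel_measurable (borel \<Otimes>\<^sub>M borel)" unfolding U_def by (rule picard_limit_measurable[OF u0m'])
  have Ub[measurable]: "(\<lambda>x. U (a x) (b x)) \<in> borel_measurable M"
    if "a \<in> borel_measurable M" "b \<in> borel_measurable M" for a b and M :: "'z measure"
    using measurable_compose[OF measurable_Pair[OF that] Um] by simp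
  have UL: "Lb q (U t) A" if "0 < t" "t < T" for t
  proof -
    have "Lb q (\<lambda>x. SUP n. picard u0 n t x) A"
    proof (rule Lb_SUP[OF _ A[OF that]])
      show "incseq (\<lambda>n. picard u0 n t)" using picard_incseq[of u0 t] by (auto simp: incseq_def le_fun_def)
    qed (use q picard_slice_measurable[OF u0m'] in auto)
    then show ?thesis by (simp add: U_def picard_limit_def[abs_def])
  qed
  have Ufin: "AE x in lborel. U t x \<noteq> \<infinity>" if t: "0 < t" "t < T" for t
  proof -
    have "(\<integral>\<^sup>+x. epow q (U t x) \<partial>lborel) \<noteq> \<infinity>" using UL[OF t] by (auto simp: Lb_def top_unique)
    then have "AE x in lborel. epow q (U t x) \<noteq> \<infinity>" by (intro nn_integral_PInf_AE) measurable
    then show ?thesis by eventually_elim auto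
  qed
  define u where "u = (\<lambda>x t. enn2real (U t x))"
  have u_src: "heat r (\<lambda>y. ennreal (f (u y s))) x = heat r (\<lambda>y. ext f (U s y)) x" if s: "0 < s" "s < T" for r s x
  proof (rule heat_cong_AE, use Ufin[OF s] in eventually_elim)
    case (elim y)
    then have "ennreal (u y s) = U s y" by (simp add: u_def less_top)
    moreover have "ext f (ennreal (u y s)) = ennreal (f (u y s))" by (rule ext_ennreal[OF f_mono]) (simp add: u_def)
    ultimately show ?case by simp
  qed
  have "local_integral_solution R lam \<phi> f u0 T u"
    unfolding local_integral_solution_def
  proof (intro conjI allI)
    show "(\<lambda>z. u (fst z) (snd z)) \<in> borel_measurable (lborel \<Otimes>\<^sub>M lborel)" unfolding u_def by measurable
    show "0 \<le> u x t" for x t by (simp add: u_def)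
    \<comment> \<open>Finiteness is known slice by slice in time; measurability of the exceptional
      set allows the order to be exchanged and the statement to be put on the product, with x as
      first coordinate.\<close>
    have "AE t in lborel. AE x in lborel. 0 < t \<and> t < T \<longrightarrow> U t x \<noteq> \<infinity>"
    proof (rule AE_I2)
      fix t show "AE x in lborel. 0 < t \<and> t < T \<longrightarrow> U t x \<noteq> \<infinity>"
        using Ufin[of t] by (cases "0 < t \<and> t < T") auto
    qed
    moreover have Pm: "{z \<in> space (lborel \<Otimes>\<^sub>M lborel). 0 < snd z \<and> snd z < T \<longrightarrow> U (snd z) (fst z) \<noteq> \<infinity>} \<in> sets (lborel \<Otimes>\<^sub>M lborel)"
      by measurable
    ultimately have "AE x in lborel. AE t in lborel. 0 < t \<and> t < T \<longrightarrow> U t x \<noteq> \<infinity>"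
      using lborel_pair.AE_commute[of "\<lambda>x t. 0 < t \<and> t < T \<longrightarrow> U t x \<noteq> \<infinity>"] by blast
    then have "AE z in lborel \<Otimes>\<^sub>M lborel. 0 < snd z \<and> snd z < T \<longrightarrow> U (snd z) (fst z) \<noteq> \<infinity>"
      by (intro lborel_pair.AE_pair_measure[OF Pm]) simp
    then show "AE z in lborel \<Otimes>\<^sub>M lborel. fst z \<in> ball 0 R \<and> 0 < snd z \<and> snd z < T \<longrightarrow>
        ennreal (u (fst z) (snd z)) = dirichlet_semigroup R lam \<phi> (snd z) u0 (fst z) +
          (\<integral>\<^sup>+s\<in>{0<..<snd z}. dirichlet_semigroup R lam \<phi> (snd z - s) (\<lambda>y. f (u y s)) (fst z) \<partial>lborel)"
    proof eventually_elim
      case (elim z)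
      show ?case
      proof
        assume z: "fst z \<in> ball 0 R \<and> 0 < snd z \<and> snd z < T"
        then have "U (snd z) (fst z) \<noteq> \<infinity>" using elim by blast
        then have "ennreal (u (fst z) (snd z)) = U (snd z) (fst z)" by (simp add: u_def less_top)
        also have "\<dots> = duhamel u0 U (snd z) (fst z)" unfolding U_def by (rule picard_limit_fixed_point[OF u0m'])
        also have "\<dots> = heat (snd z) (\<lambda>y. ennreal (u0 y)) (fst z) +
          (\<integral>\<^sup>+s\<in>{0<..<snd z}. heat (snd z - s) (\<lambda>y. ennreal (f (u y s))) (fst z) \<partial>lborel)"
          unfolding duhamel_def
          by (intro arg_cong2[of _ _ _ _ "(+)"] nn_integral_cong refl) (use z in \<open>auto simp: indicator_def u_src\<close>)
        finally show "ennreal (u (fst z) (snd z)) = dirichlet_semigroup R lam \<phi> (snd z) u0 (fst z) +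
          (\<integral>\<^sup>+s\<in>{0<..<snd z}. dirichlet_semigroup R lam \<phi> (snd z - s) (\<lambda>y. f (u y s)) (fst z) \<partial>lborel)"
          unfolding dirichlet_semigroup_heat .
      qed
    qed
  qed
  moreover have "Linf_Lq R q T u"
    unfolding Linf_Lq_def
  proof (intro exI AE_I2 impI)
    fix t assume t: "0 < t \<and> t < T"
    have "(\<integral>\<^sup>+x\<in>ball 0 R. ennreal (\<bar>u x t\<bar> powr q) \<partial>lborel) \<le> (\<integral>\<^sup>+x. epow q (U t x) \<partial>lborel)"
    proof (rule nn_integral_mono)
      fix x show "ennreal (\<bar>u x t\<bar> powr q) * indicator (ball 0 R) x \<le> epow q (U t x)"
        by (cases "U t x") (auto simp: u_def indicator_def epow_ennreal)
    qed
    also have "\<dots> \<le> ennreal (A powr q)" using UL t by (simp add: Lb_def)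
    finally show "(\<integral>\<^sup>+x\<in>ball 0 R. ennreal (\<bar>u x t\<bar> powr q) \<partial>lborel) \<le> ennreal (A powr q)" .
  qed
  ultimately show "\<exists>T>0. \<exists>u. local_integral_solution R lam \<phi> f u0 T u \<and> Linf_Lq R q T u" using T by blast
qed

end

section \<open>Ground states\<close>

lemma ennreal_integral_le_nn_integral:
  fixes g :: "'a \<Rightarrow> real"
  assumes g: "integrable M g"
  shows "ennreal (\<integral>x. g x \<partial>M) \<le> (\<integral>\<^sup>+x. ennreal (g x) \<partial>M)"
proof -
  have i: "integrable M (\<lambda>x. max 0 (g x))" using g by simp
  have "ennreal (\<integral>x. g x \<partial>M) \<le> ennreal (\<integral>x. max 0 (g x) \<partial>M)"
    by (intro ennreal_leI integral_mono g i) auto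
  also have "\<dots> = (\<integral>\<^sup>+x. ennreal (max 0 (g x)) \<partial>M)" by (rule nn_integral_eq_integral[OF i, symmetric]) simp
  also have "\<dots> = (\<integral>\<^sup>+x. ennreal (g x) \<partial>M)" by (intro nn_integral_cong) (auto simp: max_def ennreal_neg)
  finally show ?thesis .
qed

context dirichlet_system
begin

lemma sg_nonneg:
  assumes v: "L2 v" and v0: "\<And>x. 0 \<le> v x" and t: "0 < t"
  shows "AE x in lborel. 0 \<le> sg t v x"
proof -
  have "AE x in lborel. AE y in lborel. 0 \<le> pk t x y \<and> pk t x y \<le> heat_bound t"
    using lborel_pair.AE_pair[OF pk_bounds[OF t]] by simp
  then show ?thesis using good_AE
  proof eventually_elim
    case (elim x)
    have "0 \<le> ip (pk t x) v" unfolding ip_def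
      by (rule integral_nonneg_AE) (use elim(1) v0 in \<open>auto elim!: eventually_mono\<close>)
    then show ?case unfolding pk_row(2)[OF elim(2) t v] .
  qed
qed

text \<open>Conversion to \<open>ennreal\<close> discards negative kernel values, which leaves an
  inequality valid at every good point.\<close>

lemma sg_le_heat:
  assumes v: "L2 v" and v0: "\<And>x. 0 \<le> v x" and t: "0 < t" and x: "good x"
  shows "ennreal (sg t v x) \<le> heat t (\<lambda>y. ennreal (v y)) x"
proof -
  have "ennreal (sg t v x) \<le> (\<integral>\<^sup>+y. ennreal (pk t x y * v y) \<partial>lborel)"
    unfolding pk_row(2)[OF x t v, symmetric] ip_def
    by (rule ennreal_integral_le_nn_integral[OF l2_ball_mult[OF pk_row(1)[OF x t] v]])
  also have "\<dots> = heat t (\<lambda>y. ennreal (v y)) x"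
    unfolding heat_def by (intro nn_integral_cong ennreal_mult'' v0)
  finally show ?thesis .
qed

lemma sg_phi:
  assumes t: "0 < t"
  shows "sg t (\<phi> k) x = exp (- lam k * t) * \<phi> k x"
proof -
  have "sg t (\<phi> k) x = (\<Sum>j\<in>{k}. exp (- lam j * t) * coef (\<phi> k) j * \<phi> j x)"
    unfolding sg_def by (rule suminf_finite) (auto simp: coef_phi)
  then show ?thesis by (simp add: coef_phi)
qed

text \<open>An eigenfunction is e^\<lambda> S(1) applied to itself, and the bounded kernel maps L^1
  into the bounded functions. The + 1 makes the bound positive.\<close>

lemma phi_bounded: "\<exists>M>0. AE x in lborel. \<bar>\<phi> k x\<bar> \<le> M"
proof -
  define I where "I = (\<integral>y. \<bar>\<phi> k y\<bar> \<partial>lborel)"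
  have I: "0 \<le> I" by (simp add: I_def)
  have i: "integrable lborel (\<lambda>y. heat_bound 1 * \<bar>\<phi> k y\<bar>)" using l2_ball_integrable[OF L2_phi, of k] by simp
  have "AE x in lborel. AE y in lborel. 0 \<le> pk 1 x y \<and> pk 1 x y \<le> heat_bound 1"
    using lborel_pair.AE_pair[OF pk_bounds[of 1]] by simp
  then have "AE x in lborel. \<bar>\<phi> k x\<bar> \<le> exp (lam k) * (heat_bound 1 * I) + 1" using good_AE
  proof eventually_elim
    case (elim x)
    have "\<bar>sg 1 (\<phi> k) x\<bar> = \<bar>\<integral>y. pk 1 x y * \<phi> k y \<partial>lborel\<bar>"
      using pk_row(2)[OF elim(2) _ L2_phi, of 1 k] by (simp add: ip_def)
    also have "\<dots> \<le> (\<integral>y. \<bar>pk 1 x y * \<phi> k y\<bar> \<partial>lborel)" by (rule integral_abs_bound)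
    also have "\<dots> \<le> (\<integral>y. heat_bound 1 * \<bar>\<phi> k y\<bar> \<partial>lborel)"
    proof (rule integral_mono_AE[OF _ i])
      show "integrable lborel (\<lambda>y. \<bar>pk 1 x y * \<phi> k y\<bar>)"
        using l2_ball_mult[OF pk_row(1)[OF elim(2)] L2_phi, of 1 k] by simp
      show "AE y in lborel. \<bar>pk 1 x y * \<phi> k y\<bar> \<le> heat_bound 1 * \<bar>\<phi> k y\<bar>"
        using elim(1) by eventually_elim (auto simp: abs_mult intro!: mult_right_mono)
    qed
    also have "\<dots> = heat_bound 1 * I" by (simp add: I_def)
    finally have "exp (lam k) * \<bar>exp (- lam k * 1) * \<phi> k x\<bar> \<le> exp (lam k) * (heat_bound 1 * I)"
      unfolding sg_phi[of 1, simplified, symmetric] by (intro mult_left_mono) (simp_all add: sg_phi)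
    moreover have "exp (lam k) * \<bar>exp (- lam k * 1) * \<phi> k x\<bar> = \<bar>\<phi> k x\<bar>"
      by (simp add: abs_mult mult.assoc[symmetric] exp_add[symmetric])
    ultimately show ?case by linarith
  qed
  moreover have "0 < exp (lam k) * (heat_bound 1 * I) + 1" using I heat_bound_nonneg[of 1] by (intro add_nonneg_pos) auto
  ultimately show ?thesis by blast
qed

text \<open>The eigenvalues are listed in no prescribed order, but summability of
  exp(-\<open>lam k\<close>) forces them to infinity, so only finitely many compete for the
  minimum.\<close>

lemma lam_has_min: "\<exists>j. \<forall>k. lam j \<le> lam k"
proof -
  have "(\<lambda>k. exp (- lam k * 1)) \<longlonglongrightarrow> 0" by (rule summable_LIMSEQ_zero[OF summable_exp_lam]) simp
  then have "\<forall>\<^sub>F k in sequentially. exp (- lam k * 1) < exp (- lam 0)" by (intro order_tendstoD(2)) auto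
  then obtain N where N: "\<And>k. k \<ge> N \<Longrightarrow> lam 0 < lam k" by (auto simp: eventually_sequentially)
  have fin: "finite (lam ` {..N})" "lam ` {..N} \<noteq> {}" by auto
  from Min_in[OF fin] obtain j where j: "j \<le> N" "lam j = Min (lam ` {..N})" by (metis atMost_iff imageE)
  have "lam j \<le> lam k" for k
  proof (cases "k \<le> N")
    case True then show ?thesis using j fin by auto
  next
    case False
    have "lam j \<le> lam 0" using j fin by auto
    then show ?thesis using N[of k] False by simp
  qed
  then show ?thesis by blast
qed

text \<open>The absolute value of a lowest eigenfunction also minimizes the Rayleigh quotient.\<close>
lemma ground_state:
  "\<exists>\<mu> M (w :: real^'n \<Rightarrow> real). 0 \<le> \<mu> \<and> 0 < M \<and> V w \<and> (\<forall>x. 0 \<le> w x \<and> w x \<le> M) \<and> ip w w = 1 \<and> (\<forall>v. V v \<longrightarrow> E w v = \<mu> * ip w v)"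
proof -
  obtain j where j: "\<And>k. lam j \<le> lam k" using lam_has_min by blast
  obtain M where M: "0 < M" "AE x in lborel. \<bar>\<phi> j x\<bar> \<le> M" using phi_bounded by blast
  \<comment> \<open>Truncating at M alters the absolute value only on a null set, yet yields a bound
    at every point; absolute value and truncation together form one normal contraction.\<close>
  define F where "F = (\<lambda>a::real. min \<bar>a\<bar> M)"
  have F: "normal_contraction F" using M(1) by (auto simp: normal_contraction_def F_def min_def abs_if)
  define w where "w = (\<lambda>x. F (\<phi> j x))"
  have w: "V w" "E w w \<le> E (\<phi> j) (\<phi> j)" unfolding w_def by (rule frac_form_contraction[OF V_phi F \<alpha>_pos \<alpha>(2)])+
  note lw = frac_domain_l2[OF w(1)]
  have ww: "ip w w = 1"
  proof -
    have "ip w w = ip (\<phi> j) (\<phi> j)"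
      unfolding ip_self
    proof (rule integral_cong_AE)
      show "AE x in lborel. (w x)\<^sup>2 = (\<phi> j x)\<^sup>2"
        using M(2) by eventually_elim (simp add: w_def F_def min_def)
    qed (use l2_ball_meas[OF lw] in auto)
    then show ?thesis by (simp add: ip_phi)
  qed
  have Ew: "E w w \<le> lam j" using w(2) E_phi[OF V_phi, of j j] by (simp add: coef_phi)
  have s: "(\<lambda>k. lam k * (coef w k)\<^sup>2 - lam j * (coef w k)\<^sup>2) sums (E w w - lam j * ip w w)"
    by (intro sums_diff sums_mult E_self_sums w(1) parseval lw)
  have nn: "0 \<le> lam k * (coef w k)\<^sup>2 - lam j * (coef w k)\<^sup>2" for k
    using j[of k] by (simp add: mult_right_mono)
  \<comment> \<open>A series of non-negative terms with sum at most zero: w has coefficients only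
    for eigenvalues equal to the lowest one.\<close>
  have z: "lam k * (coef w k)\<^sup>2 - lam j * (coef w k)\<^sup>2 = 0" for k
  proof -
    have "(\<Sum>k. lam k * (coef w k)\<^sup>2 - lam j * (coef w k)\<^sup>2) \<le> 0" using sums_unique[OF s] Ew ww by simp
    moreover have "(\<Sum>i\<in>{k}. lam i * (coef w i)\<^sup>2 - lam j * (coef w i)\<^sup>2) \<le> (\<Sum>k. lam k * (coef w k)\<^sup>2 - lam j * (coef w k)\<^sup>2)"
      by (rule sum_le_suminf[OF sums_summable[OF s]]) (use nn in auto)
    moreover have "(\<Sum>i\<in>{k}. lam i * (coef w i)\<^sup>2 - lam j * (coef w i)\<^sup>2) = lam k * (coef w k)\<^sup>2 - lam j * (coef w k)\<^sup>2" by simp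
    ultimately show ?thesis using nn[of k] by linarith
  qed
  have "E w v = lam j * ip w v" if v: "V v" for v
  proof (rule sums_unique2[OF E_sums[OF w(1) v]])
    have eq: "lam k * (coef w k * coef v k) = lam j * (coef w k * coef v k)" for k
      using z[of k] by (cases "coef w k = 0") (auto simp: algebra_simps)
    show "(\<lambda>k. lam k * (coef w k * coef v k)) sums (lam j * ip w v)"
      unfolding eq by (rule sums_mult[OF parseval_ip[OF lw frac_domain_l2[OF v]]])
  qed
  moreover have "0 \<le> w x \<and> w x \<le> M" for x using M(1) by (simp add: w_def F_def)
  ultimately have *: "0 \<le> lam j \<and> 0 < M \<and> V w \<and> (\<forall>x. 0 \<le> w x \<and> w x \<le> M) \<and> ip w w = 1 \<and> (\<forall>v. V v \<longrightarrow> E w v = lam j * ip w v)"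
    using lam_nonneg[of j] M(1) w(1) ww by simp
  show ?thesis by (rule exI[of _ "lam j"], rule exI[of _ M], rule exI[of _ w]) (rule *)
qed

text \<open>Expand E(|h|,|h|) \<le> E(h,h) with |h| = 2 max(0,h) - h.\<close>

lemma E_max_0_le:
  assumes h: "V h"
  shows "V (\<lambda>x. max 0 (h x))" "E (\<lambda>x. max 0 (h x)) (\<lambda>x. max 0 (h x)) \<le> E h (\<lambda>x. max 0 (h x))"
proof -
  let ?p = "\<lambda>x. max 0 (h x)"
  show p: "V ?p" by (rule frac_form_contraction(1)[OF h normal_contraction_max \<alpha>_pos \<alpha>(2)])
  have eq: "(\<lambda>x. \<bar>h x\<bar>) = (\<lambda>x. 2 * ?p x + (-1) * h x)" by (auto simp: max_def)
  have d: "V (\<lambda>x. 2 * ?p x + (-1) * h x)" by (rule frac_domain_lincomb[OF p h])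
  have "E (\<lambda>x. \<bar>h x\<bar>) (\<lambda>x. \<bar>h x\<bar>) \<le> E h h"
    by (rule frac_form_contraction(2)[OF h normal_contraction_abs \<alpha>_pos \<alpha>(2)])
  also have "E (\<lambda>x. \<bar>h x\<bar>) (\<lambda>x. \<bar>h x\<bar>) = 4 * E ?p ?p - 4 * E h ?p + E h h"
    unfolding eq frac_form_lincomb[OF p h d] frac_form_commute[of \<alpha> _ "\<lambda>x. 2 * ?p x + (-1) * h x"]
    unfolding frac_form_lincomb[OF p h p] frac_form_lincomb[OF p h h] frac_form_commute[of \<alpha> ?p h] by simp
  finally show "E ?p ?p \<le> E h ?p" by simp
qed

text \<open>Extension by zero of the ground state of a smaller ball is a subsolution: test with
  \<open>min v (N w)\<close>, supported in the smaller ball, and let \<open>N\<close> tend to infinity.\<close>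
lemma dilated_ground_state_subsolution:
  fixes w v :: "real^'n \<Rightarrow> real"
  assumes \<mu>: "0 \<le> \<mu>" and w: "V w" "\<And>x. 0 \<le> w x" and eig: "\<And>v. V v \<Longrightarrow> E w v = \<mu> * ip w v"
    and r: "0 < r" "r \<le> R" and v: "V v" "\<And>x. 0 \<le> v x"
  defines "wr \<equiv> \<lambda>x. w ((R / r) *\<^sub>R x)"
  shows "V wr" "E wr v \<le> \<mu> * (R / r) powr \<alpha> * ip wr v"
proof -
  define c where "c = R / r"
  have c: "0 < c" "R / c = r" using r R by (auto simp: c_def)
  have wm: "w \<in> borel_measurable borel" by (rule l2_ball_meas[OF frac_domain_l2[OF w(1)]])
  have wr': "frac_domain \<alpha> r wr" unfolding wr_def c_def[symmetric] using frac_domain_dilation[OF w(1) c(1)] c(2) by simp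
  show wr: "V wr" by (rule frac_domain_mono_radius[OF wr' r(2)])
  have wr0: "0 \<le> wr x" for x using w(2) by (simp add: wr_def)
  have wr_out: "wr x = 0" if "x \<notin> ball 0 r" for x using wr' that by (auto simp: frac_domain_def)
  define \<mu>' where "\<mu>' = \<mu> * c powr \<alpha>"
  \<comment> \<open>For test functions supported in the smaller ball the dilated eigenvalue equation
    holds exactly: dilating them back to the large ball gives admissible test functions for
    w.\<close>
  have inner: "E wr z = \<mu>' * ip wr z" if z: "V z" "\<And>x. x \<notin> ball 0 r \<Longrightarrow> z x = 0" for z
  proof -
    have z': "frac_domain \<alpha> r z" using z by (auto simp: frac_domain_def)
    define y where "y = (\<lambda>x. z ((1 / c) *\<^sub>R x))"
    have "r / (1 / c) = R" using c r by (simp add: c_def)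
    then have y: "V y" unfolding y_def using frac_domain_dilation[OF z', of "1 / c"] c by simp
    have ym: "y \<in> borel_measurable borel" by (rule l2_ball_meas[OF frac_domain_l2[OF y]])
    have zy: "z = (\<lambda>x. y (c *\<^sub>R x))" using c by (simp add: y_def)
    have "E wr z = c powr \<alpha> / c ^ CARD('n) * E w y"
      unfolding zy wr_def c_def[symmetric] using frac_form_dilation[OF wm ym c(1), of \<alpha>] .
    also have "\<dots> = \<mu>' * (ip w y / c ^ CARD('n))" unfolding eig[OF y] \<mu>'_def by simp
    also have "ip w y / c ^ CARD('n) = ip wr z"
      unfolding zy wr_def c_def[symmetric] by (rule ip_dilation[OF wm ym c(1), symmetric])
    finally show ?thesis .
  qed
  \<comment> \<open>Here v = m + g with m the minimum of v and N w_r, and g the positive part of h =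
    v - N w_r, for N = n+1. The form sees N E(w_r,g) = E(v,g) - E(h,g) \<le> E(v,g) - E(g,g), which
    is at most E(v,v)/4 whatever N is.\<close>
  have step: "E wr v \<le> \<mu>' * ip wr v + E v v / 4 * (1 / real (Suc n))" for n
  proof -
    let ?N = "real (Suc n)"
    define h where "h = (\<lambda>x. 1 * v x + (- ?N) * wr x)"
    define g where "g = (\<lambda>x. max 0 (h x))"
    define m where "m = (\<lambda>x. v x - g x)"
    have h: "V h" unfolding h_def by (rule frac_domain_lincomb[OF v(1) wr])
    have g: "V g" "E g g \<le> E h g" unfolding g_def by (rule E_max_0_le[OF h])+
    have m: "V m" unfolding m_def by (rule frac_domain_diff[OF v(1) g(1)])
    have m_out: "m x = 0" if "x \<notin> ball 0 r" for x
      using wr_out[OF that] v(2)[of x] by (simp add: m_def g_def h_def)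
    have "ip m wr \<le> ip v wr"
      by (rule ip_mono[OF frac_domain_l2[OF m] frac_domain_l2[OF v(1)] frac_domain_l2[OF wr]]) (auto simp: m_def g_def wr0)
    then have "ip wr m \<le> ip wr v" by (simp only: ip_commute[of wr])
    moreover have "E wr m = \<mu>' * ip wr m" by (rule inner[OF m]) (rule m_out)
    moreover have "0 \<le> \<mu>'" using \<mu> by (simp add: \<mu>'_def)
    ultimately have 1: "E wr m \<le> \<mu>' * ip wr v" by (simp add: mult_left_mono)
    have "E h g = E v g - ?N * E wr g" unfolding h_def frac_form_lincomb[OF v(1) wr g(1)]
      by (simp only: mult_1_left minus_mult_left[symmetric] add_uminus_conv_diff)
    then have 2: "?N * E wr g \<le> E v g - E g g" using g(2) by simp
    \<comment> \<open>Completing the square: E(g - v/2, g - v/2) \<ge> 0.\<close>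
    let ?d = "\<lambda>x. 1 * g x + (- (1 / 2)) * v x"
    have d: "V ?d" by (rule frac_domain_lincomb[OF g(1) v(1)])
    have "0 \<le> E ?d ?d" by (rule frac_form_nonneg)
    also have "E ?d ?d = E g g - E v g + E v v / 4"
      unfolding frac_form_lincomb[OF g(1) v(1) d] frac_form_commute[of \<alpha> _ ?d]
      unfolding frac_form_lincomb[OF g(1) v(1) g(1)] frac_form_lincomb[OF g(1) v(1) v(1)] frac_form_commute[of \<alpha> g v]
      by (simp add: field_simps)
    finally have le: "?N * E wr g \<le> E v v / 4" using 2 by linarith
    have "y \<le> x * (1 / a)" if "a * y \<le> x" "0 < a" for x y a :: real
      using that by (simp add: pos_le_divide_eq mult.commute)
    from this[OF le] have "E wr g \<le> E v v / 4 * (1 / ?N)" by simp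
    moreover have "E wr v = E wr m + E wr g"
    proof -
      have "v = (\<lambda>x. m x + g x)" by (simp add: m_def)
      then show ?thesis unfolding frac_form_commute[of \<alpha> wr] using frac_form_add[OF m g(1) wr] by metis
    qed
    ultimately show ?thesis using 1 by linarith
  qed
  have "(\<lambda>n. \<mu>' * ip wr v + E v v / 4 * (1 / real (Suc n))) \<longlonglongrightarrow> \<mu>' * ip wr v + E v v / 4 * 0"
    by (intro tendsto_add tendsto_mult tendsto_const LIMSEQ_inverse_real_of_nat[unfolded inverse_eq_divide])
  then have "E wr v \<le> \<mu>' * ip wr v + E v v / 4 * 0" by (rule LIMSEQ_le_const) (use step in auto)
  then show "E wr v \<le> \<mu> * (R / r) powr \<alpha> * ip wr v" by (simp add: \<mu>'_def c_def)
qed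

text \<open>The function G(t) of the proof, the inner product of S(t)v with w, has derivative -E(w,
  S(t)v) \<ge> -\<nu> G(t), so e^(\<nu>t) G(t) is non-decreasing. This is carried out with
  increments on [a,b], and then a tends to zero.\<close>

lemma subsolution_semigroup_ip:
  assumes w: "V w" "\<And>x. 0 \<le> w x" and \<nu>: "0 \<le> \<nu>" and sub: "\<And>v. V v \<Longrightarrow> (\<And>x. 0 \<le> v x) \<Longrightarrow> E w v \<le> \<nu> * ip w v"
    and v: "L2 v" "\<And>x. 0 \<le> v x" and b: "0 < b"
  shows "exp (- \<nu> * b) * ip w v \<le> ip w (sg b v)"
proof -
  note lw = frac_domain_l2[OF w(1)]
  define G where "G = (\<lambda>t. ip (sg t v) w)"
  have pos: "0 \<le> G t \<and> E (sg t v) w \<le> \<nu> * G t" if t: "0 < t" for t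
  proof -
    \<comment> \<open>The subsolution property asks for test functions non-negative at every point,
      whereas S(t)v is so only almost everywhere. Its positive part has the same coefficients, hence
      the same form values.\<close>
    let ?u = "sg t v" let ?u' = "\<lambda>x. max 0 (sg t v x)"
    have u: "V ?u" "V ?u'" using sg_V[OF v(1) t] E_max_0_le(1) by auto
    have ae: "AE x in lborel. ?u x = ?u' x" using sg_nonneg[OF v t] by eventually_elim simp
    have ip_eq: "ip ?u z = ip ?u' z" if z: "L2 z" for z
      unfolding ip_def
    proof (rule integral_cong_AE)
      show "AE x in lborel. ?u x * z x = ?u' x * z x" using ae by eventually_elim simp
    qed (use l2_ball_meas[OF z] l2_ball_meas[OF frac_domain_l2[OF u(1)]] in auto)
    have "E ?u w = E ?u' w"
    proof (rule sums_unique2[OF E_sums[OF u(1) w(1)]])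
      show "(\<lambda>k. lam k * (coef ?u k * coef w k)) sums E ?u' w"
        using E_sums[OF u(2) w(1)] unfolding coef_def ip_eq[OF L2_phi] .
    qed
    also have "\<dots> = E w ?u'" by (rule frac_form_commute)
    also have "\<dots> \<le> \<nu> * ip w ?u'" by (rule sub[OF u(2)]) simp
    also have "ip w ?u' = G t" unfolding G_def ip_eq[OF lw] by (rule ip_commute)
    finally have "E ?u w \<le> \<nu> * G t" .
    moreover have "0 \<le> G t" unfolding G_def ip_eq[OF lw] unfolding ip_def
      by (intro Bochner_Integration.integral_nonneg) (auto simp: w(2))
    ultimately show ?thesis by simp
  qed
  have inc: "G a \<le> exp (\<nu> * b) * G b" if a: "0 < a" "a < b" for a
  proof -
    let ?C = "(2 / a)\<^sup>2 * (ip v v + ip w w)"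
    have C: "0 \<le> ?C" using ip_nonneg[of v] ip_nonneg[of w] by simp
    have "- (exp (\<nu> * b) * G b) \<le> - (exp (\<nu> * a) * G a)"
    proof (rule quadratic_increment_decreasing[OF a(2)])
      fix s t assume st: "a \<le> s" "s < t" "t \<le> b"
      then have t0: "0 < t" "0 < s" using a by auto
      have "\<bar>G t - G s + (t - s) * E (sg t v) w\<bar> \<le> (2 / a)\<^sup>2 * (t - s)\<^sup>2 * (ip v v + ip w w)"
        unfolding G_def by (rule sg_increment[OF v(1) w(1) a(1) st(1,2)])
      moreover have "(t - s) * E (sg t v) w \<le> (t - s) * (\<nu> * G t)"
        using pos[OF t0(1)] st by (intro mult_left_mono) auto
      moreover have "(2 / a)\<^sup>2 * (t - s)\<^sup>2 * (ip v v + ip w w) = ?C * (t - s)\<^sup>2" by simp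
      ultimately have Gs: "G s \<le> G t + (t - s) * (\<nu> * G t) + ?C * (t - s)\<^sup>2" by linarith
      have "G t + (t - s) * (\<nu> * G t) = (1 + \<nu> * (t - s)) * G t" by (simp add: algebra_simps)
      also have "\<dots> \<le> exp (\<nu> * (t - s)) * G t"
        using pos[OF t0(1)] by (intro mult_right_mono exp_ge_add_one_self) auto
      finally have "G s \<le> exp (\<nu> * (t - s)) * G t + ?C * (t - s)\<^sup>2" using Gs by linarith
      then have "exp (\<nu> * s) * G s \<le> exp (\<nu> * s) * (exp (\<nu> * (t - s)) * G t + ?C * (t - s)\<^sup>2)" by (intro mult_left_mono) auto
      also have "\<dots> = exp (\<nu> * t) * G t + exp (\<nu> * s) * (?C * (t - s)\<^sup>2)"
        by (simp add: ring_distribs mult.assoc[symmetric] exp_add[symmetric])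
      also have "\<dots> \<le> exp (\<nu> * t) * G t + exp (\<nu> * b) * (?C * (t - s)\<^sup>2)"
        using st \<nu> C by (intro add_left_mono mult_right_mono) (auto intro!: mult_left_mono)
      finally show "- (exp (\<nu> * t) * G t) - - (exp (\<nu> * s) * G s) \<le> (exp (\<nu> * b) * ?C) * (t - s)\<^sup>2" by (simp add: mult.assoc)
    qed
    moreover have "1 * G a \<le> exp (\<nu> * a) * G a" using pos[OF a(1)] a \<nu> by (intro mult_right_mono) auto
    ultimately show ?thesis by linarith
  qed
  have "(\<lambda>m. G (1 / Suc m) - ip v w) \<longlonglongrightarrow> 0"
  proof (rule Lim_null_comparison[OF always_eventually])
    show "(\<lambda>m. sqrt (\<integral>x. (sg (1 / Suc m) v x - v x)\<^sup>2 \<partial>lborel) * sqrt (ip w w)) \<longlonglongrightarrow> 0"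
      using tendsto_mult[OF tendsto_real_sqrt[OF sg_limit[OF v(1)]] tendsto_const[of "sqrt (ip w w)"]] by simp
    show "\<forall>m. norm (G (1 / Suc m) - ip v w) \<le> sqrt (\<integral>x. (sg (1 / Suc m) v x - v x)\<^sup>2 \<partial>lborel) * sqrt (ip w w)"
    proof
      fix m
      have l: "L2 (sg (1 / Suc m) v)" by (rule sg_L2[OF v(1)]) simp
      have "G (1 / Suc m) - ip v w = ip (\<lambda>x. sg (1 / Suc m) v x - v x) w"
        unfolding G_def by (rule ip_diff[OF l v(1) lw, symmetric])
      then show "norm (G (1 / Suc m) - ip v w) \<le> sqrt (\<integral>x. (sg (1 / Suc m) v x - v x)\<^sup>2 \<partial>lborel) * sqrt (ip w w)"
        using ip_cs_abs[OF l2_ball_diff[OF l v(1)] lw] by (simp add: ip_self)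
    qed
  qed
  then have lim: "(\<lambda>m. G (1 / Suc m)) \<longlonglongrightarrow> ip v w" by (simp add: LIM_zero_iff)
  have "ip v w \<le> exp (\<nu> * b) * G b"
  proof (rule LIMSEQ_le_const2[OF lim])
    obtain N where N: "1 / real (Suc N) < b" using b nat_approx_posE by blast
    show "\<exists>N. \<forall>m\<ge>N. G (1 / Suc m) \<le> exp (\<nu> * b) * G b"
    proof (intro exI allI impI)
      fix m assume "m \<ge> N"
      then have "1 / real (Suc m) \<le> 1 / real (Suc N)" by (intro divide_left_mono) auto
      then show "G (1 / Suc m) \<le> exp (\<nu> * b) * G b" using N by (intro inc) auto
    qed
  qed
  then have "exp (- \<nu> * b) * ip v w \<le> exp (- \<nu> * b) * (exp (\<nu> * b) * G b)" by (intro mult_left_mono) auto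
  also have "\<dots> = G b" by (simp add: mult.assoc[symmetric] exp_add[symmetric])
  finally show ?thesis by (simp add: G_def ip_commute)
qed

text \<open>Let u = S(t)w - e^(-\<nu>t) w and v its negative part. Testing with v gives 0 \<le>
  ip(u,v) = -ip(v,v), so v = 0.\<close>

lemma subsolution_semigroup_AE:
  assumes w: "V w" "\<And>x. 0 \<le> w x" and \<nu>: "0 \<le> \<nu>" and sub: "\<And>v. V v \<Longrightarrow> (\<And>x. 0 \<le> v x) \<Longrightarrow> E w v \<le> \<nu> * ip w v"
    and t: "0 < t"
  shows "AE x in lborel. exp (- \<nu> * t) * w x \<le> sg t w x"
proof -
  note lw = frac_domain_l2[OF w(1)]
  define u where "u = (\<lambda>x. 1 * sg t w x + (- exp (- \<nu> * t)) * w x)"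
  have u: "L2 u" unfolding u_def by (rule l2_ball_lincomb[OF sg_L2[OF lw t] lw])
  define v where "v = (\<lambda>x. max 0 (- u x))"
  have [measurable]: "u \<in> borel_measurable borel" by (rule l2_ball_meas[OF u])
  have v: "L2 v" by (rule l2_ball_dominated[OF u]) (auto simp: v_def)
  have "exp (- \<nu> * t) * ip w v \<le> ip w (sg t v)"
    by (rule subsolution_semigroup_ip[OF w \<nu> sub v _ t]) (auto simp: v_def)
  then have "0 \<le> ip u v"
    unfolding u_def ip_lincomb[OF sg_L2[OF lw t] lw v] using ip_sg_commute[OF lw v t] by simp
  moreover have "ip u v = - ip v v"
    unfolding ip_def by (subst Bochner_Integration.integral_minus[symmetric], intro Bochner_Integration.integral_cong)
      (auto simp: v_def max_def)
  ultimately have "ip v v \<le> 0" by linarith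
  then have "(\<integral>x. (v x)\<^sup>2 \<partial>lborel) = 0" using ip_nonneg[of v] unfolding ip_self by linarith
  then have "AE x in lborel. (v x)\<^sup>2 = 0"
    using integral_nonneg_eq_0_iff_AE[OF l2_ball_sq[OF v]] by simp
  then show ?thesis by eventually_elim (auto simp: v_def u_def max_def split: if_splits)
qed

end

section \<open>Necessity of the growth condition\<close>

context dirichlet_system
begin

lemma heat_scale: "w \<in> borel_measurable borel \<Longrightarrow> heat t (\<lambda>y. c * w y) x = c * heat t w x"
  unfolding heat_def by (subst nn_integral_cmult[symmetric]) (auto simp: mult_ac)

text \<open>One ground state of the large ball is dilated to every radius r. Its eigenvalue times
  r^\<alpha> is always \<mu> R^\<alpha>, so up to time r^\<alpha> the decay factor is at least
  exp(-\<mu> R^\<alpha>), and \<kappa> is independent of r. The set A is where the dilated state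
  exceeds a fixed level. The second estimate is the dual one, for the semigroup started from the
  indicator of A and weighted by the normalized state.\<close>

lemma heat_lower_bound:
  "\<exists>\<kappa>>0. \<forall>r. 0 < r \<and> r \<le> R \<longrightarrow> (\<exists>(w :: real^'n \<Rightarrow> real) A. w \<in> borel_measurable borel \<and> A \<in> sets borel \<and> A \<subseteq> ball 0 r \<and>
     (\<forall>x. 0 \<le> w x \<and> w x \<le> indicator (ball 0 r) x) \<and>
     (\<forall>t. 0 < t \<and> t \<le> r powr \<alpha> \<longrightarrow>
        (AE x in lborel. x \<in> A \<longrightarrow> ennreal \<kappa> \<le> heat t (\<lambda>y. indicator (ball 0 r) y) x) \<and>
        ennreal (\<kappa> * r ^ CARD('n)) \<le> (\<integral>\<^sup>+x. ennreal (w x) * heat t (indicator A) x \<partial>lborel)))"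
proof -
  obtain \<mu> M and w :: "real^'n \<Rightarrow> real" where \<mu>: "0 \<le> \<mu>" and M: "0 < M" and w: "V w" "\<And>x. 0 \<le> w x" "\<And>x. w x \<le> M"
    and ww: "ip w w = 1" and eig: "\<And>v. V v \<Longrightarrow> E w v = \<mu> * ip w v"
    using ground_state by blast
  note lw = frac_domain_l2[OF w(1)]
  have wm[measurable]: "w \<in> borel_measurable borel" by (rule l2_ball_meas[OF lw])
  define B where "B = measure lborel (ball (0::real^'n) R)"
  have B: "0 \<le> B" by (simp add: B_def)
  \<comment> \<open>The level is so low that the part of w below it contributes at most M \<eta> B
    \<le> 1/2 to the squared norm 1; the other half must come from A.\<close>
  define \<eta> where "\<eta> = 1 / (2 * M * (B + 1))"
  have \<eta>: "0 < \<eta>" using M B by (simp add: \<eta>_def)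
  define A where "A = {x. \<eta> \<le> w x}"
  have Am[measurable]: "A \<in> sets borel" unfolding A_def by measurable
  have w_out: "w x = 0" if "x \<notin> ball 0 R" for x using lw that by (simp add: l2_ball_def)
  have AB: "A \<subseteq> ball 0 R"
  proof
    fix x assume "x \<in> A" then show "x \<in> ball 0 R" using w_out[of x] \<eta> by (cases "x \<in> ball 0 R") (auto simp: A_def)
  qed
  have lA: "L2 (indicator A)" by (rule l2_ball_indicator[OF Am AB])
  have lB: "L2 (indicator (ball 0 R))" by (rule l2_ball_indicator) auto
  define c1 where "c1 = 1 / (2 * M)"
  have c1: "0 < c1" using M by (simp add: c1_def)
  have c1_le: "c1 \<le> ip w (indicator A)"
  proof -
    have "1 \<le> M * ip w (indicator A) + M * (\<eta> * B)"
    proof -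
      have "ip w w \<le> (\<integral>x. M * (w x * indicator A x) + M * \<eta> * indicator (ball 0 R) x \<partial>lborel)"
        unfolding ip_def
      proof (rule integral_mono[OF l2_ball_mult[OF lw lw]])
        show "integrable lborel (\<lambda>x. M * (w x * indicator A x) + M * \<eta> * indicator (ball 0 R) x)"
          using l2_ball_mult[OF lw lA] l2_ball_integrable[OF lB] by auto
        fix x
        have "w x * w x \<le> M * w x" using w(2,3)[of x] by (intro mult_right_mono) auto
        moreover have "w x \<le> w x * indicator A x + \<eta> * indicator (ball 0 R) x"
          using w(2)[of x] w_out[of x] \<eta> by (auto simp: A_def indicator_def)
        then have "M * w x \<le> M * (w x * indicator A x + \<eta> * indicator (ball 0 R) x)" using M by (intro mult_left_mono) auto
        ultimately show "w x * w x \<le> M * (w x * indicator A x) + M * \<eta> * indicator (ball 0 R) x"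
          by (simp add: ring_distribs mult.assoc)
      qed
      also have "\<dots> = M * ip w (indicator A) + M * \<eta> * (\<integral>x. indicator (ball (0::real^'n) R) x \<partial>lborel)"
        using l2_ball_mult[OF lw lA] l2_ball_integrable[OF lB]
        by (subst Bochner_Integration.integral_add) (auto simp: ip_def)
      finally show ?thesis using ww by (simp add: B_def mult.assoc)
    qed
    moreover have "M * (\<eta> * B) \<le> 1 / 2"
    proof -
      have "M * (\<eta> * B) = B / (B + 1) * (1 / 2)" using M B by (simp add: \<eta>_def)
      also have "\<dots> \<le> 1 * (1 / 2)" using B by (intro mult_right_mono) auto
      finally show ?thesis by simp
    qed
    ultimately have "1 / 2 \<le> M * ip w (indicator A)" by linarith
    then show ?thesis using M by (simp add: c1_def field_simps)
  qed
  define \<nu> where "\<nu> = \<mu> * R powr \<alpha>"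
  \<comment> \<open>The first entry serves the pointwise bound on A, the second the weighted mean;
    the division by R^d there compensates the factor (R/r)^d from the dilation.\<close>
  define \<kappa> where "\<kappa> = min (exp (- \<nu>) * \<eta> / M) (exp (- \<nu>) * c1 / (M * R ^ CARD('n)))"
  have \<kappa>: "0 < \<kappa>" using \<eta> M c1 R by (simp add: \<kappa>_def)
  show ?thesis
  proof (rule exI[of _ \<kappa>], intro conjI allI impI \<kappa>)
    fix r assume r: "0 < r \<and> r \<le> R"
    define c where "c = R / r"
    have c: "0 < c" using r R by (simp add: c_def)
    define wr where "wr = (\<lambda>x. w (c *\<^sub>R x))"
    define Ar where "Ar = {x. c *\<^sub>R x \<in> A}"
    have Vwr: "V wr"
    proof -
      have "V (\<lambda>x. w ((R / r) *\<^sub>R x))"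
      proof (rule dilated_ground_state_subsolution(1)[OF \<mu> w(1,2) eig])
        show "V (\<lambda>_ :: real^'n. 0 :: real)" using frac_domain_scale[OF w(1), of 0] by simp
      qed (use r in auto)
      then show ?thesis by (simp add: wr_def c_def)
    qed
    note lwr = frac_domain_l2[OF Vwr]
    have wrm[measurable]: "wr \<in> borel_measurable borel" by (rule l2_ball_meas[OF lwr])
    have wr0: "0 \<le> wr x" "wr x \<le> M" for x using w by (auto simp: wr_def)
    have scale_ball: "c *\<^sub>R x \<in> ball 0 R \<longleftrightarrow> x \<in> ball 0 r" for x :: "real^'n"
      using r R by (auto simp: c_def field_simps)
    have wr_out: "wr x = 0" if "x \<notin> ball 0 r" for x using w_out[of "c *\<^sub>R x"] that scale_ball[of x] by (simp add: wr_def)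
    have Ar_eq: "Ar = {x. \<eta> \<le> wr x}" by (auto simp: Ar_def A_def wr_def)
    have Arm[measurable]: "Ar \<in> sets borel" unfolding Ar_eq by measurable
    have Arr: "Ar \<subseteq> ball 0 r" using AB scale_ball by (auto simp: Ar_def)
    have lAr: "L2 (indicator Ar)" by (rule l2_ball_indicator[OF Arm]) (use Arr r in auto)
    define \<mu>r where "\<mu>r = \<mu> * c powr \<alpha>"
    have \<mu>r: "0 \<le> \<mu>r" using \<mu> by (simp add: \<mu>r_def)
    have sub: "E wr v \<le> \<mu>r * ip wr v" if "V v" "\<And>x. 0 \<le> v x" for v
      using dilated_ground_state_subsolution(2)[OF \<mu> w(1,2) eig _ _ that] r by (simp add: wr_def \<mu>r_def c_def)
    have ip_Ar: "ip wr (indicator Ar) = ip w (indicator A) / c ^ CARD('n)"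
    proof -
      have "(indicator Ar :: real^'n \<Rightarrow> real) = (\<lambda>x. indicator A (c *\<^sub>R x))" by (auto simp: Ar_def indicator_def)
      then show ?thesis unfolding wr_def using ip_dilation[OF wm borel_measurable_indicator[OF Am] c] by simp
    qed
    have decay: "exp (- \<nu>) \<le> exp (- \<mu>r * t)" if t: "0 < t" "t \<le> r powr \<alpha>" for t
    proof -
      have "\<mu>r * t \<le> \<mu>r * r powr \<alpha>" using t \<mu>r by (intro mult_left_mono) auto
      also have "\<dots> = \<nu>" using r R by (simp add: \<mu>r_def \<nu>_def c_def powr_divide)
      finally show ?thesis by simp
    qed
    show "\<exists>(w :: real^'n \<Rightarrow> real) A. w \<in> borel_measurable borel \<and> A \<in> sets borel \<and> A \<subseteq> ball 0 r \<and>
     (\<forall>x. 0 \<le> w x \<and> w x \<le> indicator (ball 0 r) x) \<and>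
     (\<forall>t. 0 < t \<and> t \<le> r powr \<alpha> \<longrightarrow>
        (AE x in lborel. x \<in> A \<longrightarrow> ennreal \<kappa> \<le> heat t (\<lambda>y. indicator (ball 0 r) y) x) \<and>
        ennreal (\<kappa> * r ^ CARD('n)) \<le> (\<integral>\<^sup>+x. ennreal (w x) * heat t (indicator A) x \<partial>lborel))"
    proof (rule exI[of _ "\<lambda>x. wr x / M"], rule exI[of _ Ar], intro conjI allI impI)
      show "(\<lambda>x. wr x / M) \<in> borel_measurable borel" by measurable
      show "0 \<le> wr x / M" for x using wr0 M by simp
      show "wr x / M \<le> indicator (ball 0 r) x" for x
        using wr0[of x] wr_out[of x] M by (auto simp: indicator_def)
      fix t assume t: "0 < t \<and> t \<le> r powr \<alpha>"
      then have t0: "0 < t" "t \<le> r powr \<alpha>" by auto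
      have "AE x in lborel. exp (- \<mu>r * t) * wr x \<le> sg t wr x"
        by (rule subsolution_semigroup_AE[OF Vwr wr0(1) \<mu>r sub t0(1)])
      then show "AE x in lborel. x \<in> Ar \<longrightarrow> ennreal \<kappa> \<le> heat t (\<lambda>y. indicator (ball 0 r) y) x"
        using good_AE
      proof eventually_elim
        case (elim x)
        show ?case
        proof
          assume "x \<in> Ar"
          then have "exp (- \<nu>) * \<eta> \<le> exp (- \<mu>r * t) * wr x"
            using decay[OF t0] \<eta> by (intro mult_mono) (auto simp: Ar_eq)
          then have le: "exp (- \<nu>) * \<eta> \<le> sg t wr x" using elim by linarith
          have "ennreal (1 / M) * ennreal (exp (- \<nu>) * \<eta>) \<le> ennreal (1 / M) * heat t (\<lambda>y. ennreal (wr y)) x"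
            using order.trans[OF ennreal_leI[OF le] sg_le_heat[OF lwr wr0(1) t0(1) elim(2)]] by (intro mult_left_mono) auto
          also have "\<dots> = heat t (\<lambda>y. ennreal (1 / M) * ennreal (wr y)) x" by (rule heat_scale[symmetric]) measurable
          also have "\<dots> \<le> heat t (\<lambda>y. indicator (ball 0 r) y) x"
          proof (rule heat_mono_AE, rule AE_I2, rule impI)
            fix y
            have "1 / M * wr y \<le> indicator (ball 0 r) y"
              using wr0[of y] wr_out[of y] M by (auto simp: indicator_def)
            then have "ennreal (1 / M * wr y) \<le> ennreal (indicator (ball 0 r) y)" by (rule ennreal_leI)
            then show "ennreal (1 / M) * ennreal (wr y) \<le> indicator (ball 0 r) y"
              using M wr0(1)[of y] by (simp only: ennreal_indicator ennreal_mult'[of "1 / M"] zero_le_divide_1_iff less_imp_le)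
          qed
          also have "ennreal (1 / M) * ennreal (exp (- \<nu>) * \<eta>) = ennreal (exp (- \<nu>) * \<eta> / M)"
            using M \<eta> by (simp add: ennreal_mult[symmetric])
          finally have "ennreal (exp (- \<nu>) * \<eta> / M) \<le> heat t (\<lambda>y. indicator (ball 0 r) y) x" .
          then show "ennreal \<kappa> \<le> heat t (\<lambda>y. indicator (ball 0 r) y) x"
            by (rule order.trans[rotated]) (simp add: \<kappa>_def ennreal_leI)
        qed
      qed
      have sA: "L2 (sg t (indicator Ar))" by (rule sg_L2[OF lAr t0(1)])
      have "\<kappa> * r ^ CARD('n) \<le> exp (- \<nu>) * c1 / (M * R ^ CARD('n)) * r ^ CARD('n)"
        using r by (intro mult_right_mono) (auto simp: \<kappa>_def)
      also have "\<dots> = 1 / M * (exp (- \<nu>) * (c1 / c ^ CARD('n)))"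
        by (simp add: c_def power_divide)
      also have "\<dots> \<le> 1 / M * (exp (- \<mu>r * t) * ip wr (indicator Ar))"
        unfolding ip_Ar using decay[OF t0] c1_le c1 c M
        by (intro mult_left_mono mult_mono divide_right_mono) auto
      also have "\<dots> \<le> 1 / M * ip wr (sg t (indicator Ar))"
        using M subsolution_semigroup_ip[OF Vwr wr0(1) \<mu>r sub lAr _ t0(1)] by (intro mult_left_mono) auto
      finally have "ennreal (\<kappa> * r ^ CARD('n)) \<le> ennreal (1 / M * ip wr (sg t (indicator Ar)))" by (rule ennreal_leI)
      also have "1 / M * ip wr (sg t (indicator Ar)) = (\<integral>x. wr x / M * sg t (indicator Ar) x \<partial>lborel)"
        unfolding ip_def integral_mult_right_zero[symmetric] by simp
      also have "ennreal \<dots> \<le> (\<integral>\<^sup>+x. ennreal (wr x / M * sg t (indicator Ar) x) \<partial>lborel)"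
        by (rule ennreal_integral_le_nn_integral) (use l2_ball_mult[OF lwr sA] in auto)
      also have "\<dots> \<le> (\<integral>\<^sup>+x. ennreal (wr x / M) * heat t (indicator Ar) x \<partial>lborel)"
      proof (rule nn_integral_mono_AE, use good_AE in eventually_elim)
        case (elim x)
        have "ennreal (sg t (indicator Ar) x) \<le> heat t (\<lambda>y. ennreal (indicator Ar y)) x"
          by (rule sg_le_heat[OF lAr _ t0(1) elim]) simp
        moreover have "ennreal (wr x / M * sg t (indicator Ar) x) = ennreal (wr x / M) * ennreal (sg t (indicator Ar) x)"
          using wr0(1)[of x] M by (intro ennreal_mult') simp
        ultimately show ?case by (simp add: ennreal_indicator mult_left_mono)
      qed
      finally show "ennreal (\<kappa> * r ^ CARD('n)) \<le> (\<integral>\<^sup>+x. ennreal (wr x / M) * heat t (indicator Ar) x \<partial>lborel)" .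
    qed (use Arm Arr in auto)
  qed
qed

end

section \<open>Almost every time and almost every point\<close>

lemma AE_pair_swap:
  fixes P :: "'a::euclidean_space \<times> 'b::euclidean_space \<Rightarrow> bool"
  assumes "AE z in lborel \<Otimes>\<^sub>M lborel. P z"
  shows "AE y in lborel. AE x in lborel. P (x, y)"
proof -
  from assms obtain N where N: "{z \<in> space (lborel \<Otimes>\<^sub>M lborel). \<not> P z} \<subseteq> N" "N \<in> null_sets (lborel \<Otimes>\<^sub>M lborel)"
    by (auto simp: eventually_ae_filter)
  have Nm: "{z \<in> space (lborel \<Otimes>\<^sub>M lborel). (fst z, snd z) \<notin> N} \<in> sets (lborel \<Otimes>\<^sub>M lborel)"
  proof -
    have "{z \<in> space (lborel \<Otimes>\<^sub>M lborel). (fst z, snd z) \<notin> N} = space (lborel \<Otimes>\<^sub>M lborel) - N" by auto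
    then show ?thesis using sets.compl_sets[OF null_setsD2[OF N(2)]] by metis
  qed
  have "AE z in lborel \<Otimes>\<^sub>M lborel. z \<notin> N" by (rule AE_not_in[OF N(2)])
  then have "AE x in lborel. AE y in lborel. (x, y) \<notin> N" by (rule lborel_pair.AE_pair)
  then have "AE y in lborel. AE x in lborel. (x, y) \<notin> N" using lborel_pair.AE_commute[OF Nm] by blast
  moreover have "P z" if "z \<notin> N" for z using N(1) that by (auto simp: space_pair_measure)
  ultimately show ?thesis by (auto elim!: eventually_mono)
qed

lemma AE_ex_in_interval:
  fixes a b :: real
  assumes "AE t in lborel. P t" "a < b"
  shows "\<exists>t. a < t \<and> t < b \<and> P t"
proof (rule ccontr)
  assume "\<nexists>t. a < t \<and> t < b \<and> P t"
  then have "AE t in lborel. t \<notin> {a<..<b}" using assms(1) by (auto elim!: eventually_mono)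
  then have "emeasure lborel {a<..<b} = 0" by (subst (asm) AE_iff_measurable[of "{a<..<b}"]) auto
  then show False using assms(2) by simp
qed

context semilinear
begin

text \<open>The equation is used twice. Keeping only the linear part gives u \<ge> a \<kappa> on A.
  Keeping only the source, now at least f(a \<kappa>) on A by monotonicity, and pairing it with w
  gives the same lower bound for every s in (0,t), hence the factor t.\<close>

lemma solution_lower_bound:
  fixes u0 w :: "real^'n \<Rightarrow> real"
  assumes sol: "local_integral_solution R lam \<phi> f u0 T u" and r: "0 < r" "r \<le> R"
    and wm[measurable]: "w \<in> borel_measurable borel" and A[measurable]: "A \<in> sets borel" and Ar: "A \<subseteq> ball 0 r"
    and w: "\<And>x. 0 \<le> w x" "\<And>x. w x \<le> indicator (ball 0 r) x"
    and lb1: "\<And>t. 0 < t \<Longrightarrow> t \<le> r powr \<alpha> \<Longrightarrow> AE x in lborel. x \<in> A \<longrightarrow> ennreal \<kappa> \<le> heat t (\<lambda>y. indicator (ball 0 r) y) x"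
    and lb2: "\<And>t. 0 < t \<Longrightarrow> t \<le> r powr \<alpha> \<Longrightarrow> ennreal (\<kappa> * r ^ CARD('n)) \<le> (\<integral>\<^sup>+x. ennreal (w x) * heat t (indicator A) x \<partial>lborel)"
    and \<kappa>: "0 < \<kappa>" and a: "0 \<le> a" and u0: "AE y in lborel. y \<in> ball 0 r \<longrightarrow> a \<le> u0 y"
  shows "AE t in lborel. 0 < t \<and> t < T \<and> t \<le> r powr \<alpha> \<longrightarrow>
    ennreal (t * (f (a * \<kappa>) * (\<kappa> * r ^ CARD('n)))) \<le> (\<integral>\<^sup>+x. ennreal (w x) * ennreal (u x t) \<partial>lborel)"
proof -
  have [measurable]: "ball (0::real^'n) r \<in> sets borel" by simp
  have u_nn: "0 \<le> u x t" for x t using sol by (simp add: local_integral_solution_def)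
  have eq: "AE t in lborel. AE x in lborel. x \<in> ball 0 R \<and> 0 < t \<and> t < T \<longrightarrow>
      ennreal (u x t) = heat t (\<lambda>y. ennreal (u0 y)) x + (\<integral>\<^sup>+s\<in>{0<..<t}. heat (t - s) (\<lambda>y. ennreal (f (u y s))) x \<partial>lborel)"
    using AE_pair_swap[of "\<lambda>z. fst z \<in> ball 0 R \<and> 0 < snd z \<and> snd z < T \<longrightarrow> ennreal (u (fst z) (snd z)) =
          dirichlet_semigroup R lam \<phi> (snd z) u0 (fst z) +
          (\<integral>\<^sup>+s\<in>{0<..<snd z}. dirichlet_semigroup R lam \<phi> (snd z - s) (\<lambda>y. f (u y s)) (fst z) \<partial>lborel)"] sol
    unfolding local_integral_solution_def dirichlet_semigroup_heat by simp
  have s0: "0 \<le> a * \<kappa>" using a \<kappa> by simp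
  have fs: "0 \<le> f (a * \<kappa>)" using f_nonneg s0 by simp
  have low: "AE s in lborel. 0 < s \<and> s < T \<and> s \<le> r powr \<alpha> \<longrightarrow> (AE y in lborel. y \<in> A \<longrightarrow> a * \<kappa> \<le> u y s)"
    using eq
  proof eventually_elim
    case (elim s)
    show ?case
    proof
      assume s: "0 < s \<and> s < T \<and> s \<le> r powr \<alpha>"
      have "AE x in lborel. x \<in> A \<longrightarrow> ennreal \<kappa> \<le> heat s (\<lambda>y. indicator (ball 0 r) y) x" by (rule lb1) (use s in auto)
      then show "AE y in lborel. y \<in> A \<longrightarrow> a * \<kappa> \<le> u y s" using elim
      proof eventually_elim
        case (elim x)
        show ?case
        proof
          assume x: "x \<in> A"
          then have xR: "x \<in> ball 0 R" using Ar r by auto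
          have "ennreal (a * \<kappa>) = ennreal a * ennreal \<kappa>" using a \<kappa> by (simp add: ennreal_mult)
          also have "\<dots> \<le> ennreal a * heat s (\<lambda>y. indicator (ball 0 r) y) x" using elim(1) x by (intro mult_left_mono) auto
          also have "\<dots> = heat s (\<lambda>y. ennreal a * indicator (ball 0 r) y) x" by (rule heat_scale[symmetric]) measurable
          also have "\<dots> \<le> heat s (\<lambda>y. ennreal (u0 y)) x"
            by (rule heat_mono_AE) (use u0 in eventually_elim, auto simp: indicator_def ennreal_leI)
          also have "\<dots> \<le> ennreal (u x s)" using elim(2) xR s by auto
          finally show "a * \<kappa> \<le> u x s" using u_nn by (simp add: ennreal_le_iff)
        qed
      qed
    qed
  qed
  show ?thesis using eq
  proof eventually_elim
    case (elim t)
    show ?case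
    proof
      assume t: "0 < t \<and> t < T \<and> t \<le> r powr \<alpha>"
      let ?g = "\<lambda>x s. ennreal (f (a * \<kappa>)) * heat (t - s) (indicator A) x * indicator {0<..<t} s"
      have gm: "(\<lambda>(x, s). ennreal (w x) * ?g x s) \<in> borel_measurable (borel \<Otimes>\<^sub>M borel)"
        unfolding heat_def case_prod_beta' by measurable
      have gm': "(\<lambda>(x, s). ennreal (w x) * ?g x s) \<in> borel_measurable (lborel \<Otimes>\<^sub>M lborel)" using gm by simp
      have "ennreal (t * (f (a * \<kappa>) * (\<kappa> * r ^ CARD('n)))) = (\<integral>\<^sup>+s. ennreal (f (a * \<kappa>) * (\<kappa> * r ^ CARD('n))) * indicator {0<..<t} s \<partial>lborel)"
        using t fs \<kappa> r by (subst nn_integral_cmult_indicator) (auto simp: ennreal_mult[symmetric] mult.commute)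
      also have "\<dots> \<le> (\<integral>\<^sup>+s. (\<integral>\<^sup>+x. ennreal (w x) * ?g x s \<partial>lborel) \<partial>lborel)"
      proof (rule nn_integral_mono)
        fix s
        show "ennreal (f (a * \<kappa>) * (\<kappa> * r ^ CARD('n))) * indicator {0<..<t} s \<le> (\<integral>\<^sup>+x. ennreal (w x) * ?g x s \<partial>lborel)"
        proof (cases "0 < s \<and> s < t")
          case True
          have "ennreal (f (a * \<kappa>) * (\<kappa> * r ^ CARD('n))) = ennreal (f (a * \<kappa>)) * ennreal (\<kappa> * r ^ CARD('n))"
            using fs \<kappa> r by (intro ennreal_mult) auto
          also have "\<dots> \<le> ennreal (f (a * \<kappa>)) * (\<integral>\<^sup>+x. ennreal (w x) * heat (t - s) (indicator A) x \<partial>lborel)"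
            using True t by (intro mult_left_mono lb2) auto
          also have "\<dots> = (\<integral>\<^sup>+x. ennreal (f (a * \<kappa>)) * (ennreal (w x) * heat (t - s) (indicator A) x) \<partial>lborel)"
            by (rule nn_integral_cmult[symmetric]) measurable
          also have "\<dots> = (\<integral>\<^sup>+x. ennreal (w x) * ?g x s \<partial>lborel)"
            using True by (intro nn_integral_cong) (simp add: mult_ac)
          finally show ?thesis using True by simp
        qed auto
      qed
      also have "\<dots> = (\<integral>\<^sup>+x. (\<integral>\<^sup>+s. ennreal (w x) * ?g x s \<partial>lborel) \<partial>lborel)"
        by (rule lborel_pair.Fubini'[OF gm'])
      also have "\<dots> \<le> (\<integral>\<^sup>+x. ennreal (w x) * ennreal (u x t) \<partial>lborel)"
      proof (rule nn_integral_mono_AE, use elim in eventually_elim)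
        case (elim x)
        show ?case
        proof (cases "x \<in> ball 0 r")
          case False
          then have "w x = 0" using w[of x] by simp
          then show ?thesis by simp
        next
          case True
          then have xR: "x \<in> ball 0 R" using r by auto
          have [measurable]: "(\<lambda>s. ?g x s) \<in> borel_measurable borel" unfolding heat_def by measurable
          have "(\<integral>\<^sup>+s. ennreal (w x) * ?g x s \<partial>lborel) = ennreal (w x) * (\<integral>\<^sup>+s. ?g x s \<partial>lborel)"
            by (rule nn_integral_cmult) measurable
          also have "(\<integral>\<^sup>+s. ?g x s \<partial>lborel) \<le> (\<integral>\<^sup>+s\<in>{0<..<t}. heat (t - s) (\<lambda>y. ennreal (f (u y s))) x \<partial>lborel)"
          proof (rule nn_integral_mono_AE, use low in eventually_elim)
            case (elim s)
            show ?case
            proof (cases "0 < s \<and> s < t")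
              case s: True
              then have "AE y in lborel. y \<in> A \<longrightarrow> a * \<kappa> \<le> u y s" using elim t by auto
              then have "AE y in lborel. y \<in> ball 0 R \<longrightarrow> ennreal (f (a * \<kappa>)) * indicator A y \<le> ennreal (f (u y s))"
              proof eventually_elim
                case (elim y)
                then show ?case using s0 u_nn by (auto simp: indicator_def intro!: ennreal_leI mono_onD[OF f_mono])
              qed
              then have "heat (t - s) (\<lambda>y. ennreal (f (a * \<kappa>)) * indicator A y) x \<le> heat (t - s) (\<lambda>y. ennreal (f (u y s))) x"
                by (rule heat_mono_AE)
              moreover have "heat (t - s) (\<lambda>y. ennreal (f (a * \<kappa>)) * indicator A y) x = ennreal (f (a * \<kappa>)) * heat (t - s) (indicator A) x"
                by (rule heat_scale) measurable
              ultimately show ?thesis using s by simp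
            qed auto
          qed
          also have "ennreal (w x) * \<dots> \<le> ennreal (w x) * ennreal (u x t)"
            using elim xR t by (intro mult_left_mono) auto
          finally show ?thesis by (simp add: mult_left_mono)
        qed
      qed
      finally show "ennreal (t * (f (a * \<kappa>) * (\<kappa> * r ^ CARD('n)))) \<le> (\<integral>\<^sup>+x. ennreal (w x) * ennreal (u x t) \<partial>lborel)" .
    qed
  qed
qed

text \<open>A form of Hoelder's inequality on the ball of radius r, through y \<le> c + c^(1-q) y^q
  with c = r^(-d/q). This c gives both terms the same power of r.\<close>

lemma weighted_Lq_bound:
  assumes r: "0 < r" "r \<le> R" and w: "\<And>x. 0 \<le> w x" "\<And>x. w x \<le> indicator (ball (0::real^'n) r) x" and v: "\<And>x. 0 \<le> v x" "v \<in> borel_measurable borel"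
    and C: "0 \<le> C" "(\<integral>\<^sup>+x\<in>ball 0 R. ennreal (\<bar>v x\<bar> powr q) \<partial>lborel) \<le> ennreal C"
  shows "(\<integral>\<^sup>+x. ennreal (w x) * ennreal (v x) \<partial>lborel) \<le> ennreal ((unit_ball_vol (CARD('n)) + C) * r powr (CARD('n) - CARD('n) / q))"
proof -
  have [measurable]: "ball (0::real^'n) r \<in> sets borel" "ball (0::real^'n) R \<in> sets borel" by simp_all
  note [measurable] = v(2)
  define c0 where "c0 = r powr (- real CARD('n) / q)"
  have c0: "0 < c0" using r by (simp add: c0_def)
  have young: "y \<le> c0 + c0 powr (1 - q) * y powr q" if "0 \<le> y" for y
  proof (cases "y \<le> c0")
    case True then show ?thesis by (simp add: add_increasing2)
  next
    case False
    have "y = y powr (1 - q) * y powr q" using False c0 by (simp add: powr_add[symmetric])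
    also have "\<dots> \<le> c0 powr (1 - q) * y powr q"
      using False c0 q by (intro mult_right_mono powr_mono2') auto
    finally show ?thesis using c0 by simp
  qed
  have "(\<integral>\<^sup>+x. ennreal (w x) * ennreal (v x) \<partial>lborel)
     \<le> (\<integral>\<^sup>+x. ennreal c0 * indicator (ball (0::real^'n) r) x + ennreal (c0 powr (1 - q)) * (ennreal (\<bar>v x\<bar> powr q) * indicator (ball 0 R) x) \<partial>lborel)"
  proof (rule nn_integral_mono)
    fix x :: "real^'n"
    show "ennreal (w x) * ennreal (v x) \<le> ennreal c0 * indicator (ball 0 r) x + ennreal (c0 powr (1 - q)) * (ennreal (\<bar>v x\<bar> powr q) * indicator (ball 0 R) x)"
    proof (cases "x \<in> ball 0 r")
      case False
      then have "w x = 0" using w[of x] by simp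
      then show ?thesis by simp
    next
      case True
      then have xR: "x \<in> ball 0 R" using r by auto
      have "w x \<le> 1" using w(2)[of x] True by simp
      then have "ennreal (w x) * ennreal (v x) \<le> 1 * ennreal (v x)" by (intro mult_right_mono) auto
      also have "\<dots> \<le> ennreal (c0 + c0 powr (1 - q) * v x powr q)" using young[OF v(1)] by (simp add: ennreal_leI)
      also have "\<dots> = ennreal c0 + ennreal (c0 powr (1 - q)) * ennreal (v x powr q)" using c0 by (simp add: ennreal_mult)
      finally show ?thesis using True xR v(1)[of x] by simp
    qed
  qed
  also have "\<dots> = ennreal c0 * emeasure lborel (ball (0::real^'n) r) + ennreal (c0 powr (1 - q)) * (\<integral>\<^sup>+x\<in>ball 0 R. ennreal (\<bar>v x\<bar> powr q) \<partial>lborel)"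
    by (simp add: nn_integral_add nn_integral_cmult nn_integral_cmult_indicator)
  also have "\<dots> \<le> ennreal c0 * ennreal (unit_ball_vol (CARD('n)) * r ^ CARD('n)) + ennreal (c0 powr (1 - q)) * ennreal C"
    using r C(2) by (intro add_mono mult_left_mono) (auto simp: emeasure_ball)
  also have "\<dots> = ennreal (c0 * (unit_ball_vol (CARD('n)) * r ^ CARD('n)) + c0 powr (1 - q) * C)"
    using c0 r C by (simp add: ennreal_mult ennreal_plus)
  also have "c0 * (unit_ball_vol (CARD('n)) * r ^ CARD('n)) + c0 powr (1 - q) * C = (unit_ball_vol (CARD('n)) + C) * r powr (CARD('n) - CARD('n) / q)"
  proof -
    have "c0 * r ^ CARD('n) = r powr (CARD('n) - CARD('n) / q)"
      using r by (simp add: c0_def powr_realpow[symmetric] powr_add[symmetric])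
    moreover have "c0 powr (1 - q) = r powr (CARD('n) - CARD('n) / q)"
    proof -
      have "- real CARD('n) / q * (1 - q) = CARD('n) - CARD('n) / q" using q by (simp add: field_simps)
      then show ?thesis by (simp only: c0_def powr_powr)
    qed
    ultimately show ?thesis by (simp add: algebra_simps)
  qed
  finally show ?thesis .
qed

lemma p_eq: "p = 1 + \<alpha> * q / real CARD('n)"
  by (simp add: p_def \<sigma>_def mult.commute)

text \<open>Comparing the source at time of order r_k^\<alpha> with the L^q bound yields f(s_k)
  \<le> \<Lambda> 2^(k\<epsilon>) s_k^p. The factor 2^(k\<epsilon>) is the price of the 2^(-k) that
  puts u0 into L^q. An unbounded quotient lets s_k be chosen with f(s_k) > 2^(2k\<epsilon>) s_k^p,
  which contradicts this for large k.\<close>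

theorem nonexistence:
  assumes ex: "local_existence_Lq R lam \<phi> f q"
  shows "Limsup at_top (\<lambda>s. ereal (s powr (- p) * f s)) < \<infinity>"
proof (rule ccontr)
  assume "\<not> Limsup at_top (\<lambda>s. ereal (s powr (- p) * f s)) < \<infinity>"
  then have inf: "Limsup at_top (\<lambda>s. ereal (s powr (- p) * f s)) = \<infinity>" by simp
  have big: "\<exists>s\<ge>s0. K < s powr (- p) * f s" for K s0
  proof (rule ccontr)
    assume "\<not> (\<exists>s\<ge>s0. K < s powr (- p) * f s)"
    then have "\<forall>\<^sub>F s in at_top. ereal (s powr (- p) * f s) \<le> ereal K"
      unfolding eventually_at_top_linorder by (intro exI[of _ s0]) (auto simp: not_less)
    then have "Limsup at_top (\<lambda>s. ereal (s powr (- p) * f s)) \<le> ereal K" by (rule Limsup_bounded)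
    then show False using inf by simp
  qed
  let ?n = "real CARD('n)"
  have n: "0 < ?n" by simp
  have q0: "0 < q" using q by simp
  obtain \<kappa> where \<kappa>: "0 < \<kappa>" and hlb: "\<And>r. 0 < r \<and> r \<le> R \<Longrightarrow> (\<exists>(w :: real^'n \<Rightarrow> real) A. w \<in> borel_measurable borel \<and> A \<in> sets borel \<and> A \<subseteq> ball 0 r \<and>
     (\<forall>x. 0 \<le> w x \<and> w x \<le> indicator (ball 0 r) x) \<and>
     (\<forall>t. 0 < t \<and> t \<le> r powr \<alpha> \<longrightarrow>
        (AE x in lborel. x \<in> A \<longrightarrow> ennreal \<kappa> \<le> heat t (\<lambda>y. indicator (ball 0 r) y) x) \<and>
        ennreal (\<kappa> * r ^ CARD('n)) \<le> (\<integral>\<^sup>+x. ennreal (w x) * heat t (indicator A) x \<partial>lborel)))"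
    using heat_lower_bound by (elim exE conjE) (rule that, assumption, erule allE, erule mp, assumption)
  \<comment> \<open>Chosen so that r_k^(-\<alpha>-d/q) is z_k to the power -\<epsilon>; moreover q
    \<epsilon> = p, which is where the critical exponent appears.\<close>
  define \<epsilon> where "\<epsilon> = \<alpha> / ?n + 1 / q"
  have \<epsilon>: "0 < \<epsilon>" using \<alpha>_pos q0 by (simp add: \<epsilon>_def add_pos_pos)
  \<comment> \<open>The two lower bounds on s_k keep r_k below R and make r_k^\<alpha> decay
    geometrically.\<close>
  define s0 where "s0 = max 1 (R powr (- ?n / q))"
  have "\<forall>k::nat. \<exists>s\<ge>s0. 2 powr (2 * (k * \<epsilon>)) < s powr (- p) * f s" using big by blast
  then obtain S :: "nat \<Rightarrow> real" where S: "\<And>k. s0 \<le> S k" "\<And>k::nat. 2 powr (2 * (k * \<epsilon>)) < S k powr (- p) * f (S k)" by metis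
  have S1: "1 \<le> S k" "0 < S k" for k using S(1)[of k] by (auto simp: s0_def)
  define z where "z = (\<lambda>k. 2 powr (- real k) * S k powr (- q))"
  have z: "0 < z k" for k using S1[of k] by (simp add: z_def)
  define r where "r = (\<lambda>k. z k powr (1 / ?n))"
  have r0: "0 < r k" for k using z[of k] by (simp add: r_def)
  have rn: "r k ^ CARD('n) = z k" for k
    using z[of k] r0[of k] by (simp add: powr_realpow[symmetric]) (simp add: r_def powr_powr)
  have two: "2 powr (- real k) \<le> 1" for k by (simp add: powr_minus_divide ge_one_powr_ge_zero)
  have rR: "r k \<le> R" for k
  proof -
    have "S k powr (- q) \<le> (R powr (- ?n / q)) powr (- q)"
      using S(1)[of k] R q0 by (intro powr_mono2') (auto simp: s0_def)
    also have "\<dots> = R powr ?n" using q0 by (simp add: powr_powr)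
    finally have "z k \<le> 1 * R powr ?n" unfolding z_def using two by (intro mult_mono) auto
    then have "r k \<le> (R powr ?n) powr (1 / ?n)" unfolding r_def using z[of k] by (intro powr_mono2) auto
    also have "\<dots> = R" using R by (simp add: powr_powr)
    finally show ?thesis .
  qed
  have r\<alpha>: "r k powr \<alpha> \<le> (2 powr (- \<alpha> / ?n)) ^ k" for k
  proof -
    have "S k powr (- q) \<le> 1 powr (- q)" using S1[of k] q0 by (intro powr_mono2') auto
    then have "z k \<le> 2 powr (- real k) * 1" unfolding z_def by (intro mult_left_mono) auto
    then have "z k powr (\<alpha> / ?n) \<le> (2 powr (- real k)) powr (\<alpha> / ?n)" using z[of k] \<alpha>_pos by (intro powr_mono2) auto
    moreover have "r k powr \<alpha> = z k powr (\<alpha> / ?n)" by (simp add: r_def powr_powr)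
    moreover have "(2 powr (- real k)) powr (\<alpha> / ?n) = (2 powr (- \<alpha> / ?n)) ^ k"
      by (simp add: powr_powr powr_realpow[symmetric] mult.commute)
    ultimately show ?thesis by simp
  qed
  have r\<alpha>lim: "(\<lambda>k. (2 powr (- \<alpha> / ?n)) ^ k) \<longlonglongrightarrow> 0"
  proof (rule LIMSEQ_power_zero)
    have "2 powr (- \<alpha> / ?n) < 2 powr 0" using \<alpha>_pos by (intro powr_less_mono) auto
    then show "norm (2 powr (- \<alpha> / ?n)) < 1" by simp
  qed
  \<comment> \<open>The linear part loses a factor \<kappa>, so the data are larger by 1/\<kappa> in
    order that the solution reaches the level s_k.\<close>
  define a where "a = (\<lambda>k. S k / \<kappa>)"
  have a: "0 \<le> a k" "a k * \<kappa> = S k" for k using S1[of k] \<kappa> by (auto simp: a_def)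
  define u0E where "u0E = (\<lambda>x::real^'n. SUP k. ennreal (a k) * indicator (ball 0 (r k)) x)"
  have [measurable]: "ball (0::real^'n) \<rho> \<in> sets borel" for \<rho> by simp
  have u0Em[measurable]: "u0E \<in> borel_measurable borel" unfolding u0E_def by measurable
  \<comment> \<open>The q-th power of the supremum is at most the sum of the q-th powers, and the
    k-th term integrates to a constant times 2^(-k), since the volume z_k cancels s_k^q.\<close>
  have u0E_fin: "(\<integral>\<^sup>+x. epow q (u0E x) \<partial>lborel) < \<infinity>"
  proof -
    have "(\<integral>\<^sup>+x. epow q (u0E x) \<partial>lborel) \<le> (\<integral>\<^sup>+x. (\<Sum>k. ennreal (a k powr q) * indicator (ball (0::real^'n) (r k)) x) \<partial>lborel)"
    proof (rule nn_integral_mono)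
      fix x :: "real^'n"
      have e: "epow q (ennreal (a k) * indicator (ball 0 (r k)) x) = ennreal (a k powr q) * indicator (ball 0 (r k)) x" for k
        using a(1)[of k] by (auto simp: indicator_def epow_ennreal)
      have "epow q (u0E x) = (SUP k. ennreal (a k powr q) * indicator (ball 0 (r k)) x)"
        unfolding u0E_def epow_SUP[OF q0] e ..
      also have "\<dots> \<le> (\<Sum>k. ennreal (a k powr q) * indicator (ball 0 (r k)) x)"
      proof (rule SUP_least)
        fix k
        show "ennreal (a k powr q) * indicator (ball 0 (r k)) x \<le> (\<Sum>k. ennreal (a k powr q) * indicator (ball 0 (r k)) x)"
        proof -
          have "g k \<le> suminf g" for g :: "nat \<Rightarrow> ennreal" using sum_le_suminf[of g "{k}"] by simp
          then show ?thesis .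
        qed
      qed
      finally show "epow q (u0E x) \<le> (\<Sum>k. ennreal (a k powr q) * indicator (ball 0 (r k)) x)" .
    qed
    also have "\<dots> = (\<Sum>k. ennreal (a k powr q) * emeasure lborel (ball (0::real^'n) (r k)))"
      by (subst nn_integral_suminf) (auto simp: nn_integral_cmult_indicator)
    also have "\<dots> = (\<Sum>k. ennreal (unit_ball_vol (CARD('n)) / \<kappa> powr q * (1 / 2) ^ k))"
    proof (rule suminf_cong)
      fix k
      have "a k powr q * (unit_ball_vol (CARD('n)) * z k) = unit_ball_vol (CARD('n)) / \<kappa> powr q * (S k powr q * S k powr (- q)) * 2 powr (- real k)"
        using S1[of k] \<kappa> by (simp add: a_def z_def powr_divide)
      also have "S k powr q * S k powr (- q) = 1" using S1[of k] by (simp add: powr_add[symmetric])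
      also have "2 powr (- real k) = (1 / 2) ^ k" by (simp add: powr_minus_divide powr_realpow power_divide)
      finally have "a k powr q * (unit_ball_vol (CARD('n)) * z k) = unit_ball_vol (CARD('n)) / \<kappa> powr q * (1 / 2) ^ k" by simp
      then show "ennreal (a k powr q) * emeasure lborel (ball (0::real^'n) (r k)) = ennreal (unit_ball_vol (CARD('n)) / \<kappa> powr q * (1 / 2) ^ k)"
        using r0[of k] z[of k] by (simp add: emeasure_ball rn ennreal_mult[symmetric])
    qed
    also have "\<dots> < \<infinity>"
      unfolding infinity_ennreal_def less_top[symmetric]
      by (rule ennreal_suminf_neq_top) (auto intro!: summable_mult summable_geometric)
    finally show ?thesis .
  qed
  \<comment> \<open>The supremum may be infinite on a null set, where \<open>enn2real\<close> puts
    0; the lower bounds by a_k therefore hold almost everywhere only.\<close>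
  define u0 where "u0 = (\<lambda>x. enn2real (u0E x))"
  have u0m: "u0 \<in> borel_measurable lborel" unfolding u0_def by measurable
  have u0_nn: "\<forall>x. 0 \<le> u0 x" by (simp add: u0_def)
  have u0_fin: "(\<integral>\<^sup>+x\<in>ball 0 R. ennreal (\<bar>u0 x\<bar> powr q) \<partial>lborel) < \<infinity>"
  proof -
    have "(\<integral>\<^sup>+x\<in>ball 0 R. ennreal (\<bar>u0 x\<bar> powr q) \<partial>lborel) \<le> (\<integral>\<^sup>+x. epow q (u0E x) \<partial>lborel)"
    proof (rule nn_integral_mono)
      fix x show "ennreal (\<bar>u0 x\<bar> powr q) * indicator (ball 0 R) x \<le> epow q (u0E x)"
        by (cases "u0E x") (auto simp: u0_def indicator_def epow_ennreal)
    qed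
    then show ?thesis using u0E_fin by simp
  qed
  have u0_ge: "AE y in lborel. y \<in> ball 0 (r k) \<longrightarrow> a k \<le> u0 y" for k
  proof -
    have "AE y in lborel. epow q (u0E y) \<noteq> \<infinity>"
      using u0E_fin by (intro nn_integral_PInf_AE) auto
    then show ?thesis
    proof eventually_elim
      case (elim y)
      then obtain b where b: "0 \<le> b" "u0E y = ennreal b" by (cases "u0E y") auto
      show ?case
      proof
        assume y: "y \<in> ball 0 (r k)"
        have "ennreal (a k) * indicator (ball 0 (r k)) y \<le> u0E y" unfolding u0E_def by (rule SUP_upper) simp
        then show "a k \<le> u0 y" using y b a(1)[of k] by (simp add: u0_def)
      qed
    qed
  qed
  obtain T u where T: "0 < T" and sol: "local_integral_solution R lam \<phi> f u0 T u" and Linf: "Linf_Lq R q T u"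
    using ex u0m u0_nn u0_fin unfolding local_existence_Lq_def by blast
  from Linf obtain C' where C': "AE t in lborel. 0 < t \<and> t < T \<longrightarrow> (\<integral>\<^sup>+x\<in>ball 0 R. ennreal (\<bar>u x t\<bar> powr q) \<partial>lborel) \<le> ennreal C'"
    unfolding Linf_Lq_def by blast
  define C where "C = max 0 C'"
  have C: "0 \<le> C" "ennreal C' \<le> ennreal C" by (auto simp: C_def ennreal_leI)
  have u_nn: "0 \<le> u x t" for x t using sol by (simp add: local_integral_solution_def)
  have u_slice: "(\<lambda>x. u x t) \<in> borel_measurable borel" for t
  proof -
    have "(\<lambda>z. u (fst z) (snd z)) \<in> borel_measurable (lborel \<Otimes>\<^sub>M lborel)" using sol by (simp add: local_integral_solution_def)
    then have "(\<lambda>x. (\<lambda>z. u (fst z) (snd z)) (x, t)) \<in> borel_measurable lborel"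
      by (rule measurable_compose[OF measurable_Pair2', rotated]) simp
    then show ?thesis by simp
  qed
  define \<Lambda> where "\<Lambda> = 2 * (unit_ball_vol (CARD('n)) + C) / \<kappa>"
  have key: "2 powr (k * \<epsilon>) \<le> \<Lambda>" if k: "r k powr \<alpha> < T" for k
  proof -
    obtain w A where wA: "w \<in> borel_measurable borel" "A \<in> sets borel" "A \<subseteq> ball 0 (r k)" "\<And>x. 0 \<le> w x" "\<And>x. w x \<le> indicator (ball (0::real^'n) (r k)) x"
      "\<And>t. 0 < t \<Longrightarrow> t \<le> r k powr \<alpha> \<Longrightarrow> AE x in lborel. x \<in> A \<longrightarrow> ennreal \<kappa> \<le> heat t (\<lambda>y. indicator (ball 0 (r k)) y) x"
      "\<And>t. 0 < t \<Longrightarrow> t \<le> r k powr \<alpha> \<Longrightarrow> ennreal (\<kappa> * r k ^ CARD('n)) \<le> (\<integral>\<^sup>+x. ennreal (w x) * heat t (indicator A) x \<partial>lborel)"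
      using hlb[of "r k"] r0[of k] rR[of k] by blast
    have "AE t in lborel. 0 < t \<and> t < T \<and> t \<le> r k powr \<alpha> \<longrightarrow>
      ennreal (t * (f (a k * \<kappa>) * (\<kappa> * r k ^ CARD('n)))) \<le> (\<integral>\<^sup>+x. ennreal (w x) * ennreal (u x t) \<partial>lborel)"
      by (rule solution_lower_bound[OF sol r0 rR wA \<kappa> a(1) u0_ge])
    then have "AE t in lborel. (0 < t \<and> t < T \<and> t \<le> r k powr \<alpha> \<longrightarrow>
      ennreal (t * (f (S k) * (\<kappa> * r k ^ CARD('n)))) \<le> (\<integral>\<^sup>+x. ennreal (w x) * ennreal (u x t) \<partial>lborel)) \<and>
      (0 < t \<and> t < T \<longrightarrow> (\<integral>\<^sup>+x\<in>ball 0 R. ennreal (\<bar>u x t\<bar> powr q) \<partial>lborel) \<le> ennreal C')"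
      using C' unfolding a(2) by eventually_elim blast
    \<comment> \<open>The estimates hold for almost every time, so a time is picked from the
      interval (r_k^\<alpha>/2, r_k^\<alpha>) at the cost of a factor 2.\<close>
    moreover have "r k powr \<alpha> / 2 < r k powr \<alpha>" using r0[of k] by simp
    ultimately obtain t where t: "r k powr \<alpha> / 2 < t" "t < r k powr \<alpha>" and
      low: "0 < t \<and> t < T \<and> t \<le> r k powr \<alpha> \<longrightarrow> ennreal (t * (f (S k) * (\<kappa> * r k ^ CARD('n)))) \<le> (\<integral>\<^sup>+x. ennreal (w x) * ennreal (u x t) \<partial>lborel)"
      and up: "0 < t \<and> t < T \<longrightarrow> (\<integral>\<^sup>+x\<in>ball 0 R. ennreal (\<bar>u x t\<bar> powr q) \<partial>lborel) \<le> ennreal C'"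
      by (blast dest!: AE_ex_in_interval)
    have t0: "0 < t" using t(1) powr_ge_zero[of "r k" \<alpha>] by linarith
    have tT: "t < T" using t(2) k by simp
    have "ennreal (t * (f (S k) * (\<kappa> * r k ^ CARD('n)))) \<le> (\<integral>\<^sup>+x. ennreal (w x) * ennreal (u x t) \<partial>lborel)"
      using low t0 tT t by simp
    also have "\<dots> \<le> ennreal ((unit_ball_vol (CARD('n)) + C) * r k powr (?n - ?n / q))"
      by (rule weighted_Lq_bound[OF r0 rR wA(4,5) u_nn u_slice C(1)]) (use up t0 tT C(2) in \<open>auto intro: order.trans\<close>)
    finally have le1: "t * (f (S k) * (\<kappa> * r k ^ CARD('n))) \<le> (unit_ball_vol (CARD('n)) + C) * r k powr (?n - ?n / q)"
      using C(1) by (subst (asm) ennreal_le_iff) auto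
    have fS: "0 \<le> f (S k)" using f_nonneg S1[of k] by simp
    have "r k powr \<alpha> / 2 * (f (S k) * (\<kappa> * r k ^ CARD('n))) \<le> t * (f (S k) * (\<kappa> * r k ^ CARD('n)))"
      using t(1) fS \<kappa> r0[of k] by (intro mult_right_mono) auto
    then have le2: "r k powr \<alpha> / 2 * (f (S k) * (\<kappa> * r k ^ CARD('n))) \<le> (unit_ball_vol (CARD('n)) + C) * r k powr (?n - ?n / q)"
      using le1 by linarith
    define \<rho> where "\<rho> = r k powr (- \<alpha> - ?n)"
    have \<rho>: "0 \<le> \<rho>" by (simp add: \<rho>_def)
    have e1: "\<rho> * (r k powr \<alpha> * r k ^ CARD('n)) = 1"
      using r0[of k] by (simp add: \<rho>_def powr_realpow[symmetric] powr_add[symmetric])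
    have e2: "\<rho> * r k powr (?n - ?n / q) = 2 powr (k * \<epsilon>) * S k powr p"
    proof -
      have "\<rho> * r k powr (?n - ?n / q) = r k powr (- \<alpha> - ?n / q)"
        by (simp add: \<rho>_def powr_add[symmetric])
      also have "\<dots> = z k powr (1 / ?n * (- \<alpha> - ?n / q))" by (simp add: r_def powr_powr)
      also have "1 / ?n * (- \<alpha> - ?n / q) = - \<epsilon>" using n q0 by (simp add: \<epsilon>_def field_simps)
      also have "z k powr (- \<epsilon>) = 2 powr (- real k * - \<epsilon>) * S k powr (- q * - \<epsilon>)"
        by (simp only: z_def powr_mult powr_powr)
      also have "- q * - \<epsilon> = p" using q0 by (simp add: p_eq \<epsilon>_def field_simps)
      finally show ?thesis by simp
    qed
    have "\<rho> * (r k powr \<alpha> / 2 * (f (S k) * (\<kappa> * r k ^ CARD('n)))) \<le> \<rho> * ((unit_ball_vol (CARD('n)) + C) * r k powr (?n - ?n / q))"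
      by (rule mult_left_mono[OF le2 \<rho>])
    also have "\<rho> * (r k powr \<alpha> / 2 * (f (S k) * (\<kappa> * r k ^ CARD('n)))) = (\<rho> * (r k powr \<alpha> * r k ^ CARD('n))) * (f (S k) * \<kappa> / 2)"
      by simp
    also have "\<dots> = f (S k) * \<kappa> / 2" unfolding e1 by simp
    also have "\<rho> * ((unit_ball_vol (CARD('n)) + C) * r k powr (?n - ?n / q)) = (unit_ball_vol (CARD('n)) + C) * (\<rho> * r k powr (?n - ?n / q))"
      by simp
    also have "\<dots> = (unit_ball_vol (CARD('n)) + C) * (2 powr (k * \<epsilon>) * S k powr p)" unfolding e2 ..
    finally have fle: "f (S k) \<le> \<Lambda> * (2 powr (k * \<epsilon>) * S k powr p)"
      using \<kappa> by (simp add: \<Lambda>_def field_simps)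
    have "2 powr (2 * (k * \<epsilon>)) * S k powr p \<le> (S k powr (- p) * f (S k)) * S k powr p"
      using S(2)[of k] by (intro mult_right_mono) auto
    also have "\<dots> = f (S k) * (S k powr (- p) * S k powr p)" by simp
    also have "S k powr (- p) * S k powr p = 1" using S1[of k] by (simp add: powr_add[symmetric])
    finally have "2 powr (2 * (k * \<epsilon>)) * S k powr p \<le> \<Lambda> * (2 powr (k * \<epsilon>) * S k powr p)" using fle by simp
    moreover have "(2::real) powr (2 * (k * \<epsilon>)) = 2 powr (k * \<epsilon>) * 2 powr (k * \<epsilon>)"
      by (simp add: powr_add[symmetric] mult.commute)
    ultimately have "2 powr (k * \<epsilon>) * (2 powr (k * \<epsilon>) * S k powr p) \<le> \<Lambda> * (2 powr (k * \<epsilon>) * S k powr p)"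
      by (simp add: mult.assoc)
    moreover have "0 < 2 powr (k * \<epsilon>) * S k powr p" using S1[of k] by simp
    ultimately show ?thesis by (rule mult_right_le_imp_le)
  qed
  have "\<forall>\<^sub>F k in sequentially. (2 powr (- \<alpha> / ?n)) ^ k < T" using order_tendstoD(2)[OF r\<alpha>lim T] .
  moreover have "\<forall>\<^sub>F k in sequentially. \<Lambda> < 2 powr (real k * \<epsilon>)"
  proof -
    have "2 powr 0 < (2::real) powr \<epsilon>" using \<epsilon> by (intro powr_less_mono) auto
    then have gt: "1 < (2::real) powr \<epsilon>" by simp
    obtain N where N: "\<Lambda> < (2 powr \<epsilon>) ^ N" using real_arch_pow[OF gt] by blast
    have "\<Lambda> < 2 powr (real k * \<epsilon>)" if "N \<le> k" for k
    proof -
      have "(2 powr \<epsilon>) ^ N \<le> (2 powr \<epsilon>) ^ k" using gt that by (intro power_increasing) auto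
      also have "\<dots> = 2 powr (real k * \<epsilon>)" by (simp add: powr_realpow[symmetric] powr_powr mult.commute)
      finally show ?thesis using N by linarith
    qed
    then show ?thesis by (auto simp: eventually_sequentially)
  qed
  ultimately have "\<forall>\<^sub>F k in sequentially. False"
  proof eventually_elim
    case (elim k)
    then show ?case using key[of k] r\<alpha>[of k] by linarith
  qed
  then show False by simp
qed

text \<open>For large s the finite upper limit gives the bound; on the remaining bounded range
  monotonicity bounds f by its value at the right end.\<close>

lemma growth_of_Limsup:
  assumes "Limsup at_top (\<lambda>s. ereal (s powr (- p) * f s)) < \<infinity>"
  shows "\<exists>K\<ge>0. \<forall>s\<ge>0. f s \<le> K * (1 + s powr p)"
proof -
  obtain c :: nat where "Limsup at_top (\<lambda>s. ereal (s powr (- p) * f s)) < ereal c"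
    using assms less_PInf_Ex_of_nat by auto
  then have "\<forall>\<^sub>F s in at_top. ereal (s powr (- p) * f s) < ereal c" by (rule Limsup_lessD)
  then obtain s0 where s0: "\<And>s. s0 \<le> s \<Longrightarrow> s powr (- p) * f s < c" by (auto simp: eventually_at_top_linorder)
  define s1 where "s1 = max 1 s0"
  have fs1: "0 \<le> f s1" using f_nonneg by (simp add: s1_def)
  show ?thesis
  proof (intro exI[of _ "c + f s1"] conjI allI impI)
    show "0 \<le> c + f s1" using fs1 by simp
    fix s :: real assume s: "0 \<le> s"
    show "f s \<le> (c + f s1) * (1 + s powr p)"
    proof (cases "s \<le> s1")
      case True
      have "f s \<le> f s1" using True s by (intro mono_onD[OF f_mono]) auto
      also have "\<dots> \<le> (c + f s1) * 1" by simp
      also have "\<dots> \<le> (c + f s1) * (1 + s powr p)" using fs1 by (intro mult_left_mono) auto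
      finally show ?thesis .
    next
      case False
      then have sp: "0 < s" "s0 \<le> s" by (auto simp: s1_def)
      have "s powr p * (s powr (- p) * f s) \<le> s powr p * c" using s0[OF sp(2)] by (intro mult_left_mono) auto
      moreover have "s powr p * (s powr (- p) * f s) = f s" using sp by (simp add: mult.assoc[symmetric] powr_add[symmetric])
      ultimately have "f s \<le> c * s powr p" by (simp only: mult.commute)
      also have "\<dots> \<le> (c + f s1) * (1 + s powr p)" using fs1 by (intro mult_mono) auto
      finally show ?thesis .
    qed
  qed
qed

end

theorem theorem3p5:
  fixes f :: "real \<Rightarrow> real" and q \<alpha> R :: real
    and lam :: "nat \<Rightarrow> real" and \<phi> :: "nat \<Rightarrow> real^'n \<Rightarrow> real"
  assumes "mono_on {0..} f" and "continuous_on {0..} f" and "\<forall>s\<ge>0. 0 \<le> f s"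
    and "1 < q" and "1 < \<alpha>" and "\<alpha> \<le> 2" and "0 < R"
    and "dirichlet_eigensystem \<alpha> R lam \<phi>"
  shows "local_existence_Lq R lam \<phi> f q \<longleftrightarrow>
         Limsup at_top (\<lambda>s. ereal (s powr (- (1 + \<alpha> * q / real CARD('n))) * f s)) < \<infinity>"
proof -
  interpret semilinear \<alpha> R lam \<phi> f q
    by unfold_locales (use assms in auto)
  show ?thesis
    using nonexistence growth_of_Limsup existence unfolding p_eq[symmetric] by blast
qed

end
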